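(* Let $k$ be a field, $\Sigma$ a rational pointed fan in $\mathbb{R}^d$ (where $d\ge 1$), $\mathcal{M}=(M_C)_{C\in\Sigma}$ a seminormal monoidal complex supported on $\Sigma$, and $R=k[\mathcal{M}]$ its toric face ring with graded maximal ideal $\mathfrak{m}$. Assume that $H^i_{\mathfrak{m}}(R)_a\neq 0$ for some $a\in\mathbb{Z}^d$. Then $a\in-\overline{M_C}$ for a cone $C\in\Sigma$ of dimension $\le i$. In particular, $$H^i_{\mathfrak{m}}(R)_a=0\quad\text{if}\quad a\notin-|\overline{\mathcal{M}}|=\bigcup_{C\in\Sigma}(-\overline{M_C}).$$
   Context: Cones: a cone in $\mathbb{R}^d$ is a finite intersection of closed half-spaces bounded by hyperplanes through the origin; its dimension is that of its linear span. It is rational if the hyperplanes can be defined by homogeneous linear equations with integer coefficients. A face of a cone $C$ is $C$ itself or the intersection of $C$ with a supporting hyperplane through the origin. $C$ is pointed if $\{0\}$ is a face of $C$. All cones are rational and pointed. Monoids: an affine monoid is a finitely generated submonoid $M$ of some $\mathbb{Z}^d$; $\mathbb{Z}M$ is the subgroup it generates and $\mathbb{R}_+M$ the cone of nonnegative real combinations of its elements. The normalization is $\overline{M}=\{x\in\mathbb{Z}M: px\in M\text{ for some integer }p>0\}$. $M$ is seminormal if every $x\in\mathbb{Z}M$ with $2x,3x\in M$ lies in $M$. Fans and monoidal complexes: a rational pointed fan $\Sigma$ in $\mathbb{R}^d$ is a finite nonempty set of rational pointed cones such that faces of members are members, and the intersection of two members is a common face of both. A monoidal complex $\mathcal{M}$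 supported on $\Sigma$ is a family of affine monoids $(M_C)_{C\in\Sigma}$ with $M_C\subseteq C\cap\mathbb{Z}^d$, $\mathbb{R}_+M_C=C$, and $M_D=M_C\cap D$ whenever $D$ is a face of $C$. It is seminormal if all $M_C$ are seminormal. Put $|\mathcal{M}|=\bigcup_{C\in\Sigma}M_C$ and $|\overline{\mathcal{M}}|=\bigcup_{C\in\Sigma}\overline{M_C}$. Toric face ring: $R=k[\mathcal{M}]=\bigoplus_{a\in|\mathcal{M}|}k\,X^a$ as a $k$-vector space, with $X^a\cdot X^b=X^{a+b}$ if $a,b\in M_C$ for some $C\in\Sigma$, and $X^aX^b=0$ otherwise. It is $\mathbb{Z}^d$-graded with $\deg X^a=a$; $\mathfrak{m}$ is the ideal spanned by the $X^a$ with $a\ne 0$. The local cohomology modules $H^i_{\mathfrak{m}}(R)$ are $\mathbb{Z}^d$-graded, and $H^i_{\mathfrak m}(R)_a$ is the component of degree $a$. *)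

theory Defs
  imports
    "HOL-Analysis.Analysis"
    "HOL-Library.Poly_Mapping"
    "HOL-Algebra.Ideal_Product"
    "HOL-Algebra.Module"
begin

section \<open>Cones and fans\<close>

definition real_vec :: "int ^ 'd \<Rightarrow> real ^ 'd" where
  "real_vec a = (\<chi> i. real_of_int (a $ i))"

text \<open>The set \<open>N\<close> consists of integral normal vectors of the bounding hyperplanes; the empty
  intersection is the whole space.\<close>

definition rational_cone :: "(real ^ 'd) set \<Rightarrow> bool" where
  "rational_cone C \<longleftrightarrow>
     (\<exists>N. finite N \<and> 0 \<notin> N \<and> C = (\<Inter>n\<in>N. {x. 0 \<le> real_vec n \<bullet> x}))"

definition cone_face :: "(real ^ 'd) set \<Rightarrow> (real ^ 'd) set \<Rightarrow> bool" where
  "cone_face F C \<longleftrightarrow>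
     F = C \<or> (\<exists>u. u \<noteq> 0 \<and> C \<subseteq> {x. 0 \<le> u \<bullet> x} \<and> F = C \<inter> {x. u \<bullet> x = 0})"

definition pointed :: "(real ^ 'd) set \<Rightarrow> bool" where
  "pointed C \<longleftrightarrow> cone_face {0} C"

definition rational_pointed_fan :: "(real ^ 'd) set set \<Rightarrow> bool" where
  "rational_pointed_fan \<Sigma> \<longleftrightarrow>
     finite \<Sigma> \<and> \<Sigma> \<noteq> {} \<and>
     (\<forall>C\<in>\<Sigma>. rational_cone C \<and> pointed C) \<and>
     (\<forall>C\<in>\<Sigma>. \<forall>F. cone_face F C \<longrightarrow> F \<in> \<Sigma>) \<and>
     (\<forall>C\<in>\<Sigma>. \<forall>D\<in>\<Sigma>. cone_face (C \<inter> D) C \<and> cone_face (C \<inter> D) D)"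

section \<open>Affine monoids and monoidal complexes\<close>

definition add_submonoid :: "(int ^ 'd) set \<Rightarrow> bool" where
  "add_submonoid S \<longleftrightarrow> 0 \<in> S \<and> (\<forall>x\<in>S. \<forall>y\<in>S. x + y \<in> S)"

definition add_subgroup :: "(int ^ 'd) set \<Rightarrow> bool" where
  "add_subgroup S \<longleftrightarrow> 0 \<in> S \<and> (\<forall>x\<in>S. \<forall>y\<in>S. x - y \<in> S)"

definition affine_monoid :: "(int ^ 'd) set \<Rightarrow> bool" where
  "affine_monoid M \<longleftrightarrow> (\<exists>G. finite G \<and> M = add_submonoid hull G)"

definition normalization :: "(int ^ 'd) set \<Rightarrow> (int ^ 'd) set" where
  "normalization M = {x \<in> add_subgroup hull M. \<exists>p>0. p *s x \<in> M}"

definition seminormal :: "(int ^ 'd) set \<Rightarrow> bool" where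
  "seminormal M \<longleftrightarrow> (\<forall>x \<in> add_subgroup hull M. 2 *s x \<in> M \<and> 3 *s x \<in> M \<longrightarrow> x \<in> M)"

definition monoidal_complex ::
    "(real ^ 'd) set set \<Rightarrow> ((real ^ 'd) set \<Rightarrow> (int ^ 'd) set) \<Rightarrow> bool" where
  "monoidal_complex \<Sigma> M \<longleftrightarrow>
     (\<forall>C\<in>\<Sigma>. affine_monoid (M C) \<and> real_vec ` M C \<subseteq> C \<and>
              convex_cone hull (real_vec ` M C) = C \<and>
              (\<forall>D. cone_face D C \<longrightarrow> M D = {a \<in> M C. real_vec a \<in> D}))"

definition seminormal_complex ::
    "(real ^ 'd) set set \<Rightarrow> ((real ^ 'd) set \<Rightarrow> (int ^ 'd) set) \<Rightarrow> bool" where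
  "seminormal_complex \<Sigma> M \<longleftrightarrow> (\<forall>C\<in>\<Sigma>. seminormal (M C))"

definition support ::
    "(real ^ 'd) set set \<Rightarrow> ((real ^ 'd) set \<Rightarrow> (int ^ 'd) set) \<Rightarrow> (int ^ 'd) set" where
  "support \<Sigma> M = (\<Union>C\<in>\<Sigma>. M C)"

definition normalization_complex ::
    "((real ^ 'd) set \<Rightarrow> (int ^ 'd) set) \<Rightarrow> (real ^ 'd) set \<Rightarrow> (int ^ 'd) set" where
  "normalization_complex M C = normalization (M C)"

section \<open>Graded modules\<close>

text \<open>
  The component of degree \<open>b\<close> of a graded module \<open>N\<close> is \<open>grade N b\<close>. The (inherited) multiplication
  and unit fields of a module record carry no meaning. Throughout, \<open>A b\<close> denotes the component of
  degree \<open>b\<close> of the graded base ring \<open>R\<close>.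
\<close>

record ('a, 'b, 'g) graded_module = "('a, 'b) module" +
  grade :: "'g \<Rightarrow> 'b set"

definition is_graded_module ::
    "'a ring \<Rightarrow> ('g::ab_group_add \<Rightarrow> 'a set) \<Rightarrow> ('a, 'b, 'g) graded_module \<Rightarrow> bool" where
  "is_graded_module R A N \<longleftrightarrow>
     Module.module R N \<and>
     (\<forall>b. additive_subgroup (grade N b) N) \<and>
     (\<forall>x\<in>carrier N. \<exists>!c. (\<forall>b. c b \<in> grade N b) \<and> finite {b. c b \<noteq> \<zero>\<^bsub>N\<^esub>} \<and>
        x = (\<Oplus>\<^bsub>N\<^esub>b\<in>{b. c b \<noteq> \<zero>\<^bsub>N\<^esub>}. c b)) \<and>
     (\<forall>b b'. \<forall>r\<in>A b. \<forall>x\<in>grade N b'. r \<odot>\<^bsub>N\<^esub> x \<in> grade N (b + b'))"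

definition graded_hom ::
    "'a ring \<Rightarrow> ('a, 'b, 'g) graded_module \<Rightarrow> ('a, 'c, 'g) graded_module \<Rightarrow> ('b \<Rightarrow> 'c) \<Rightarrow> bool" where
  "graded_hom R N P f \<longleftrightarrow>
     f \<in> carrier N \<rightarrow> carrier P \<and>
     (\<forall>x\<in>carrier N. \<forall>y\<in>carrier N. f (x \<oplus>\<^bsub>N\<^esub> y) = f x \<oplus>\<^bsub>P\<^esub> f y) \<and>
     (\<forall>r\<in>carrier R. \<forall>x\<in>carrier N. f (r \<odot>\<^bsub>N\<^esub> x) = r \<odot>\<^bsub>P\<^esub> f x) \<and>
     (\<forall>b. f ` grade N b \<subseteq> grade P b)"

text \<open>
  Injective objects of the category of graded \<open>R\<close>-modules and homomorphisms of degree \<open>0\<close>.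
  A predicate cannot quantify over types, so the test modules \<open>N\<close>, \<open>P\<close> have carriers in the same
  type as \<open>E\<close>, which serves as the universe. This loses nothing as soon as \<open>R\<close> embeds into that
  type, since then all graded ideals of \<open>R\<close> (with shifted gradings) have copies in it and Baer's
  criterion applies; this is the case whenever \<open>R\<close> has a resolution with carriers in that type.
\<close>

definition graded_injective ::
    "'a ring \<Rightarrow> ('g::ab_group_add \<Rightarrow> 'a set) \<Rightarrow> ('a, 'b, 'g) graded_module \<Rightarrow> bool" where
  "graded_injective R A E \<longleftrightarrow>
     is_graded_module R A E \<and>
     (\<forall>(N :: ('a, 'b, 'g) graded_module) (P :: ('a, 'b, 'g) graded_module) f h.
        is_graded_module R A N \<and> is_graded_module R A P \<and>
        graded_hom R N P f \<and> inj_on f (carrier N) \<and> graded_hom R N E h \<longrightarrow>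
        (\<exists>h'. graded_hom R P E h' \<and> (\<forall>x\<in>carrier N. h' (f x) = h x)))"

text \<open>\<open>0 \<rightarrow> N \<rightarrow> E 0 \<rightarrow> E 1 \<rightarrow> \<dots>\<close> is exact, with augmentation \<open>\<epsilon>\<close> and differentials \<open>\<delta> i\<close>.\<close>

definition graded_injective_resolution ::
    "'a ring \<Rightarrow> ('g::ab_group_add \<Rightarrow> 'a set) \<Rightarrow> ('a, 'b, 'g) graded_module \<Rightarrow>
     (nat \<Rightarrow> ('a, 'c, 'g) graded_module) \<Rightarrow> ('b \<Rightarrow> 'c) \<Rightarrow> (nat \<Rightarrow> 'c \<Rightarrow> 'c) \<Rightarrow> bool" where
  "graded_injective_resolution R A N E \<epsilon> \<delta> \<longleftrightarrow>
     is_graded_module R A N \<and>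
     (\<forall>i. graded_injective R A (E i)) \<and>
     graded_hom R N (E 0) \<epsilon> \<and> inj_on \<epsilon> (carrier N) \<and>
     (\<forall>i. graded_hom R (E i) (E (Suc i)) (\<delta> i)) \<and>
     \<epsilon> ` carrier N = {x \<in> carrier (E 0). \<delta> 0 x = \<zero>\<^bsub>E 1\<^esub>} \<and>
     (\<forall>i. \<delta> i ` carrier (E i) =
            {x \<in> carrier (E (Suc i)). \<delta> (Suc i) x = \<zero>\<^bsub>E (Suc (Suc i))\<^esub>})"

section \<open>Local cohomology\<close>

primrec ideal_pow :: "'a ring \<Rightarrow> 'a set \<Rightarrow> nat \<Rightarrow> 'a set" where
  "ideal_pow R J 0 = carrier R"
| "ideal_pow R J (Suc n) = ideal_prod R J (ideal_pow R J n)"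

definition torsion :: "'a ring \<Rightarrow> 'a set \<Rightarrow> ('a, 'b, 'g) graded_module \<Rightarrow> 'b set" where
  "torsion R J N = {x \<in> carrier N. \<exists>n. \<forall>r \<in> ideal_pow R J n. r \<odot>\<^bsub>N\<^esub> x = \<zero>\<^bsub>N\<^esub>}"

text \<open>
  Local cohomology is the right derived functor of the \<open>J\<close>-torsion functor, taken in the category
  of graded modules: given a graded injective resolution \<open>(E, \<delta>)\<close> of a module, it is the cohomology
  of \<open>torsion R J (E 0) \<rightarrow> torsion R J (E 1) \<rightarrow> \<dots>\<close>. Up to isomorphism of graded modules it does not
  depend on the resolution. The component of degree \<open>a\<close> consists of the classes of the cocycles that
  are homogeneous of degree \<open>a\<close>.
\<close>

definition cocycles ::
    "'a ring \<Rightarrow> 'a set \<Rightarrow> (nat \<Rightarrow> ('a, 'b, 'g) graded_module) \<Rightarrow> (nat \<Rightarrow> 'b \<Rightarrow> 'b) \<Rightarrow> nat \<Rightarrow> 'b set" where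
  "cocycles R J E \<delta> i = {x \<in> torsion R J (E i). \<delta> i x = \<zero>\<^bsub>E (Suc i)\<^esub>}"

definition coboundaries ::
    "'a ring \<Rightarrow> 'a set \<Rightarrow> (nat \<Rightarrow> ('a, 'b, 'g) graded_module) \<Rightarrow> (nat \<Rightarrow> 'b \<Rightarrow> 'b) \<Rightarrow> nat \<Rightarrow> 'b set" where
  "coboundaries R J E \<delta> i =
     (case i of 0 \<Rightarrow> {\<zero>\<^bsub>E 0\<^esub>} | Suc j \<Rightarrow> \<delta> j ` torsion R J (E j))"

definition local_cohomology ::
    "'a ring \<Rightarrow> 'a set \<Rightarrow> (nat \<Rightarrow> ('a, 'b, 'g) graded_module) \<Rightarrow> (nat \<Rightarrow> 'b \<Rightarrow> 'b) \<Rightarrow> nat \<Rightarrow>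
     'b set monoid" where
  "local_cohomology R J E \<delta> i =
     \<lparr>carrier = cocycles R J E \<delta> i, monoid.mult = add (E i), one = \<zero>\<^bsub>E i\<^esub>\<rparr> Mod
       coboundaries R J E \<delta> i"

definition local_cohomology_component ::
    "'a ring \<Rightarrow> 'a set \<Rightarrow> (nat \<Rightarrow> ('a, 'b, 'g) graded_module) \<Rightarrow> (nat \<Rightarrow> 'b \<Rightarrow> 'b) \<Rightarrow> nat \<Rightarrow> 'g \<Rightarrow>
     'b set set" where
  "local_cohomology_component R J E \<delta> i a =
     {coboundaries R J E \<delta> i +>\<^bsub>E i\<^esub> z |z. z \<in> cocycles R J E \<delta> i \<inter> grade (E i) a}"

definition local_cohomology_vanishes ::
    "'a ring \<Rightarrow> 'a set \<Rightarrow> (nat \<Rightarrow> ('a, 'b, 'g) graded_module) \<Rightarrow> (nat \<Rightarrow> 'b \<Rightarrow> 'b) \<Rightarrow> nat \<Rightarrow> 'g \<Rightarrow>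
     bool" where
  "local_cohomology_vanishes R J E \<delta> i a \<longleftrightarrow>
     local_cohomology_component R J E \<delta> i a = {\<one>\<^bsub>local_cohomology R J E \<delta> i\<^esub>}"

section \<open>Toric face rings\<close>

definition toric_mult ::
    "(real ^ 'd) set set \<Rightarrow> ((real ^ 'd) set \<Rightarrow> (int ^ 'd) set) \<Rightarrow>
     (int ^ 'd \<Rightarrow>\<^sub>0 'k::field) \<Rightarrow> (int ^ 'd \<Rightarrow>\<^sub>0 'k) \<Rightarrow> (int ^ 'd \<Rightarrow>\<^sub>0 'k)" where
  "toric_mult \<Sigma> M f g =
     (\<Sum>a\<in>Poly_Mapping.keys f. \<Sum>b\<in>Poly_Mapping.keys g.
        if \<exists>C\<in>\<Sigma>. a \<in> M C \<and> b \<in> M C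
        then Poly_Mapping.single (a + b) (Poly_Mapping.lookup f a * Poly_Mapping.lookup g b) else 0)"

text \<open>The monomial \<open>X\<^sup>a\<close> is \<open>Poly_Mapping.single a 1\<close>.\<close>

definition toric_face_ring ::
    "(real ^ 'd) set set \<Rightarrow> ((real ^ 'd) set \<Rightarrow> (int ^ 'd) set) \<Rightarrow> (int ^ 'd \<Rightarrow>\<^sub>0 'k::field) ring" where
  "toric_face_ring \<Sigma> M =
     \<lparr>carrier = {f. Poly_Mapping.keys f \<subseteq> support \<Sigma> M}, monoid.mult = toric_mult \<Sigma> M,
      one = Poly_Mapping.single 0 1, zero = 0, add = (+)\<rparr>"

definition toric_grade ::
    "(real ^ 'd) set set \<Rightarrow> ((real ^ 'd) set \<Rightarrow> (int ^ 'd) set) \<Rightarrow> int ^ 'd \<Rightarrow>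
     (int ^ 'd \<Rightarrow>\<^sub>0 'k::field) set" where
  "toric_grade \<Sigma> M a = {f \<in> carrier (toric_face_ring \<Sigma> M). Poly_Mapping.keys f \<subseteq> {a}}"

definition toric_max_ideal ::
    "(real ^ 'd) set set \<Rightarrow> ((real ^ 'd) set \<Rightarrow> (int ^ 'd) set) \<Rightarrow> (int ^ 'd \<Rightarrow>\<^sub>0 'k::field) set" where
  "toric_max_ideal \<Sigma> M = {f. Poly_Mapping.keys f \<subseteq> support \<Sigma> M - {0}}"

definition toric_self_module ::
    "(real ^ 'd) set set \<Rightarrow> ((real ^ 'd) set \<Rightarrow> (int ^ 'd) set) \<Rightarrow>
     (int ^ 'd \<Rightarrow>\<^sub>0 'k::field, int ^ 'd \<Rightarrow>\<^sub>0 'k, int ^ 'd) graded_module" where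
  "toric_self_module \<Sigma> M =
     \<lparr>carrier = {f. Poly_Mapping.keys f \<subseteq> support \<Sigma> M}, monoid.mult = toric_mult \<Sigma> M,
      one = Poly_Mapping.single 0 1, zero = 0, add = (+),
      smult = toric_mult \<Sigma> M, grade = toric_grade \<Sigma> M\<rparr>"

end

theory Submission
  imports Defs "HOL-Library.Function_Algebras"
begin

text \<open>
  Let \<open>v\<^sub>1, \<dots>, v\<^sub>r\<close> be nonzero lattice vectors such that each \<open>M\<^sub>C\<close> is generated by the \<open>v\<^sub>j\<close> in it.
  A high power of the maximal ideal is spanned by monomials that are divisible by a high power of
  some \<open>X\<close> to the \<open>v\<^sub>j\<close>, so an element of a module is torsion as soon as it is killed by a power of each
  of these \<open>r\<close> monomials (\<open>torsion_iff\<close>). This suggests to compare the torsion of the injective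
  resolution with the Cech complex of \<open>R\<close> for the \<open>r\<close> monomials, in the fixed degree \<open>a\<close>.

  \<^emph>\<open>The Cech complex.\<close> For \<open>J \<subseteq> {1, \<dots>, r}\<close> put \<open>v\<^sub>J = (\<Sum>j\<in>J. v\<^sub>j)\<close>. The localization of \<open>R\<close> at the
  variables in \<open>J\<close> is one-dimensional in degree \<open>a\<close> if, for large \<open>n\<close>, the point \<open>a + n v\<^sub>J\<close> belongs to
  \<open>M\<^sub>C\<close> for a cone \<open>C\<close> that contains the \<open>v\<^sub>j\<close>, \<open>j \<in> J\<close>; otherwise it is zero. In the first case let \<open>D\<close> be
  the cone that has \<open>a + n v\<^sub>J\<close> in its interior for large \<open>n\<close>. This label \<open>D\<close> can only grow with \<open>J\<close>, so
  the complex is filtered by the labels, and it suffices to treat the sets \<open>J\<close> with one label \<open>D\<close>.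
  Here seminormality enters: all elements of the group \<open>\<int>M\<^sub>D\<close> in the interior of \<open>D\<close> belong to \<open>M\<^sub>D\<close>
  (\<open>interior_lattice_point\<close>). Hence, if \<open>a \<in> \<int>M\<^sub>D\<close>, the sets with label \<open>D\<close> depend only on the position
  of the point \<open>a\<close> relative to the real cone \<open>D\<close>, and otherwise there are none.

  The cochain complex on these sets is exact if \<open>-a \<notin> D\<close> (\<open>exact_at_open_family\<close>): sweep \<open>a\<close> into the
  interior of \<open>D\<close>, where all sets occur; whenever the sweep crosses bounding hyperplanes of \<open>D\<close>, the
  change is governed by proper faces of \<open>D\<close>. If \<open>-a \<in> D\<close>, it is still exact below \<open>dim D\<close>
  (\<open>exact_at_open_family_below_dim\<close>). So the Cech complex is exact in degree \<open>a\<close> at the place \<open>i\<close> unless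
  \<open>a \<in> \<int>M\<^sub>D\<close> and \<open>-a \<in> D\<close> for a cone \<open>D\<close> of dimension at most \<open>i\<close>. By rational approximation, such an
  \<open>-a\<close> has a positive multiple in \<open>M\<^sub>D\<close>, so it belongs to the normalization (\<open>exact_at_degree\<close>).

  \<^emph>\<open>The comparison.\<close> In the double complex of the Cech complexes of the resolution, the rows compute
  the Cech complex of \<open>R\<close>. For the columns one needs that the Cech complex of a graded injective module
  \<open>E\<close> is a resolution of the torsion of \<open>E\<close>. This is done one variable at a time: if \<open>e\<close> is torsion with
  respect to the first variables, then the fraction of \<open>e\<close> by a power of the next variable is
  again represented by such a torsion element (\<open>torsion_lift\<close>). That element comes from the graded
  Baer criterion for a monomial ideal (\<open>monomial_baer\<close>), and an Artin--Rees lemma for monomials makes it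
  torsion (\<open>artin_rees\<close>). The outcome is \<open>torsion_cohomology_vanishes\<close>: exactness of the Cech complex of
  \<open>R\<close> at the place \<open>i\<close> makes the cohomology of the torsion complex vanish there.
\<close>

section \<open>Cochains on families of finite sets\<close>

text \<open>The usual sign of the simplicial coboundary, given by the position of \<open>j\<close> in \<open>J\<close>.\<close>

definition inc_sign :: "nat \<Rightarrow> nat set \<Rightarrow> 'a::comm_ring_1" where
  "inc_sign j J = (-1) ^ card {i \<in> J. i < j}"

lemma inc_sign_square [simp]: "inc_sign j J * (inc_sign j J * x) = (x::'a::comm_ring_1)"
  by (simp add: inc_sign_def mult.assoc [symmetric] power_add [symmetric])

lemma inc_sign_swap_less:
  assumes "finite J" "j \<in> J" "l \<in> J" "j < l"
  shows "inc_sign j J * inc_sign l (J - {j}) = - (inc_sign l J * inc_sign j (J - {l}) :: 'a::comm_ring_1)"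
proof -
  have 1: "{i \<in> J - {l}. i < j} = {i \<in> J. i < j}"
    using assms by auto
  have 2: "{i \<in> J. i < l} = insert j {i \<in> J - {j}. i < l}" "j \<notin> {i \<in> J - {j}. i < l}"
    using assms by auto
  have 3: "card {i \<in> J. i < l} = Suc (card {i \<in> J - {j}. i < l})"
    unfolding 2(1) using 2(2) assms(1) by (subst card_insert_disjoint) auto
  show ?thesis
    by (simp only: inc_sign_def 1 3) simp
qed

lemma inc_sign_swap:
  assumes "finite J" "j \<in> J" "l \<in> J" "j \<noteq> l"
  shows "inc_sign j J * inc_sign l (J - {j}) = - (inc_sign l J * inc_sign j (J - {l}) :: 'a::comm_ring_1)"
proof (cases "j < l")
  case True then show ?thesis using inc_sign_swap_less assms by blast
next
  case False
  then have "l < j" using assms by auto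
  from inc_sign_swap_less [OF assms(1,3,2) this] show ?thesis by (metis minus_minus)
qed

text \<open>
  The terms of \<open>(j, l)\<close> and \<open>(l, j)\<close> cancel. Every differential in this development squares to
  zero by this computation.
\<close>

lemma double_coboundary_sum_zero:
  fixes F :: "nat \<Rightarrow> nat \<Rightarrow> 'a::comm_ring_1"
  assumes J: "finite J" and sym: "\<And>j l. j \<in> J \<Longrightarrow> l \<in> J \<Longrightarrow> j \<noteq> l \<Longrightarrow> F j l = F l j"
  shows "(\<Sum>j\<in>J. inc_sign j J * (\<Sum>l\<in>J - {j}. inc_sign l (J - {j}) * F j l)) = 0"
proof -
  define G where "G = (\<lambda>j l. inc_sign j J * inc_sign l (J - {j}) * F j l)"
  have "(\<Sum>j\<in>J. inc_sign j J * (\<Sum>l\<in>J - {j}. inc_sign l (J - {j}) * F j l)) =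
        (\<Sum>j\<in>J. \<Sum>l\<in>J - {j}. G j l)"
    by (simp add: G_def sum_distrib_left mult.assoc)
  also have "\<dots> = (\<Sum>j\<in>J. (\<Sum>l\<in>{l\<in>J. l < j}. G j l) + (\<Sum>l\<in>{l\<in>J. j < l}. G j l))"
  proof (rule sum.cong [OF refl])
    fix j assume "j \<in> J"
    have "J - {j} = {l\<in>J. l < j} \<union> {l\<in>J. j < l}" by auto
    moreover have "{l\<in>J. l < j} \<inter> {l\<in>J. j < l} = {}" by auto
    ultimately show "(\<Sum>l\<in>J - {j}. G j l) = (\<Sum>l\<in>{l\<in>J. l < j}. G j l) + (\<Sum>l\<in>{l\<in>J. j < l}. G j l)"
      using J by (simp add: sum.union_disjoint)
  qed
  also have "\<dots> = (\<Sum>j\<in>J. \<Sum>l\<in>{l\<in>J. l < j}. G j l) + (\<Sum>j\<in>J. \<Sum>l\<in>{l\<in>J. j < l}. G j l)"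
    by (rule sum.distrib)
  also have "(\<Sum>j\<in>J. \<Sum>l\<in>{l\<in>J. j < l}. G j l) = (\<Sum>l\<in>J. \<Sum>j\<in>{j\<in>J. j < l}. G j l)"
    using J by (rule sum.swap_restrict) (rule J)
  also have "\<dots> = (\<Sum>l\<in>J. \<Sum>j\<in>{j\<in>J. j < l}. - G l j)"
  proof (intro sum.cong refl)
    fix l j assume "l \<in> J" "j \<in> {j \<in> J. j < l}"
    then have "inc_sign j J * inc_sign l (J - {j}) = - (inc_sign l J * inc_sign j (J - {l}) :: 'a)" "F j l = F l j"
      using inc_sign_swap [of J j l] sym [of j l] J by auto
    then show "G j l = - G l j"
      by (simp only: G_def) simp
  qed
  finally show ?thesis
    by (simp add: sum_negf)
qed

text \<open>
  The families \<open>P\<close> need not be closed under subsets, and the predicate \<open>W\<close> selects the removals of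
  an element that count: in the Cech complex of a toric face ring, the maps between two nonzero
  components can vanish because the monomials involved lie in no common cone.
\<close>

definition cobd ::
    "nat set set \<Rightarrow> (nat set \<Rightarrow> nat set \<Rightarrow> bool) \<Rightarrow> (nat set \<Rightarrow> 'k::comm_ring_1) \<Rightarrow> nat set \<Rightarrow> 'k" where
  "cobd P W f J = (\<Sum>j\<in>J. if J - {j} \<in> P \<and> W (J - {j}) J then inc_sign j J * f (J - {j}) else 0)"

definition exact_at ::
    "'k::comm_ring_1 itself \<Rightarrow> nat set set \<Rightarrow> (nat set \<Rightarrow> nat set \<Rightarrow> bool) \<Rightarrow> nat \<Rightarrow> bool" where
  "exact_at T P W i \<longleftrightarrow>
     (\<forall>f :: nat set \<Rightarrow> 'k. (\<forall>J\<in>P. card J = Suc i \<longrightarrow> cobd P W f J = 0) \<longrightarrow>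
        (\<exists>g. \<forall>J\<in>P. card J = i \<longrightarrow> f J = cobd P W g J))"

text \<open>
  The condition under which the coboundary squares to zero: the two ways of removing \<open>j\<close> and \<open>l\<close>
  count simultaneously.
\<close>

definition cobd_compatible :: "nat set set \<Rightarrow> (nat set \<Rightarrow> nat set \<Rightarrow> bool) \<Rightarrow> bool" where
  "cobd_compatible P W \<longleftrightarrow>
     (\<forall>J\<in>P. finite J \<and>
       (\<forall>j\<in>J. \<forall>l\<in>J. j \<noteq> l \<longrightarrow> J - {j} \<in> P \<longrightarrow> W (J - {j}) J \<longrightarrow>
          J - {j} - {l} \<in> P \<longrightarrow> W (J - {j} - {l}) (J - {j}) \<longrightarrow>
          J - {l} \<in> P \<and> W (J - {l}) J \<and> W (J - {j} - {l}) (J - {l})))"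

text \<open>The cochains supported on \<open>Q\<close> form a subcomplex.\<close>

definition upper_part :: "nat set set \<Rightarrow> (nat set \<Rightarrow> nat set \<Rightarrow> bool) \<Rightarrow> nat set set \<Rightarrow> bool" where
  "upper_part P W Q \<longleftrightarrow>
     Q \<subseteq> P \<and> (\<forall>J\<in>P. \<forall>j\<in>J. J - {j} \<in> Q \<longrightarrow> W (J - {j}) J \<longrightarrow> J \<in> Q)"

lemma cobd_cong:
  assumes "\<And>j. j \<in> J \<Longrightarrow> J - {j} \<in> P \<Longrightarrow> W (J - {j}) J \<Longrightarrow> f (J - {j}) = g (J - {j})"
  shows "cobd P W f J = cobd P W g J"
  unfolding cobd_def using assms by (intro sum.cong) auto

lemma cobd_add: "cobd P W (\<lambda>J. f J + g J) J = cobd P W f J + cobd P W g J"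
  unfolding cobd_def sum.distrib [symmetric] by (intro sum.cong) (auto simp: algebra_simps)

lemma cobd_diff: "cobd P W (\<lambda>J. f J - g J) J = cobd P W f J - cobd P W g J"
  unfolding cobd_def sum_subtractf [symmetric] by (intro sum.cong) (auto simp: algebra_simps)

lemma cobd_eq_0:
  assumes "\<And>j. j \<in> J \<Longrightarrow> J - {j} \<in> P \<Longrightarrow> W (J - {j}) J \<Longrightarrow> f (J - {j}) = 0"
  shows "cobd P W f J = 0"
  unfolding cobd_def using assms by (intro sum.neutral) auto

lemma cobd_cobd:
  assumes "cobd_compatible P W" "J \<in> P"
  shows "cobd P W (cobd P W f) J = 0"
proof -
  have J: "finite J"
    using assms unfolding cobd_compatible_def by blast
  define F where "F = (\<lambda>j l. if J - {j} \<in> P \<and> W (J - {j}) J \<and>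
      J - {j} - {l} \<in> P \<and> W (J - {j} - {l}) (J - {j}) then f (J - {j} - {l}) else 0)"
  have eq: "J - {l} - {j} = J - {j} - {l}" for j l by auto
  have "cobd P W (cobd P W f) J =
        (\<Sum>j\<in>J. inc_sign j J * (\<Sum>l\<in>J - {j}. inc_sign l (J - {j}) * F j l))"
    unfolding cobd_def F_def
  proof (intro sum.cong refl)
    fix j
    show "(if J - {j} \<in> P \<and> W (J - {j}) J
        then inc_sign j J * (\<Sum>l\<in>J - {j}. if J - {j} - {l} \<in> P \<and> W (J - {j} - {l}) (J - {j})
          then inc_sign l (J - {j}) * f (J - {j} - {l}) else 0) else 0) =
      inc_sign j J * (\<Sum>l\<in>J - {j}. inc_sign l (J - {j}) *
        (if J - {j} \<in> P \<and> W (J - {j}) J \<and> J - {j} - {l} \<in> P \<and> W (J - {j} - {l}) (J - {j})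
         then f (J - {j} - {l}) else 0))"
    proof (cases "J - {j} \<in> P \<and> W (J - {j}) J")
      case True
      then show ?thesis
        by (simp only: if_True simp_thms) (intro arg_cong2 [of _ _ _ _ "(*)"] sum.cong refl, simp)
    qed auto
  qed
  also have "\<dots> = 0"
  proof (rule double_coboundary_sum_zero [OF J])
    fix j l assume jl: "j \<in> J" "l \<in> J" "j \<noteq> l"
    have A: "\<And>j l. j\<in>J \<Longrightarrow> l\<in>J \<Longrightarrow> j \<noteq> l \<Longrightarrow> J - {j} \<in> P \<Longrightarrow> W (J - {j}) J \<Longrightarrow>
          J - {j} - {l} \<in> P \<Longrightarrow> W (J - {j} - {l}) (J - {j}) \<Longrightarrow>
          J - {l} \<in> P \<and> W (J - {l}) J \<and> W (J - {j} - {l}) (J - {l})"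
      using assms unfolding cobd_compatible_def by blast
    show "F j l = F l j"
      using A [of j l] A [of l j] jl unfolding F_def eq [of l j] by auto
  qed
  finally show ?thesis .
qed

lemma cobd_compatible_Diff:
  assumes "cobd_compatible P W" "upper_part P W Q"
  shows "cobd_compatible (P - Q) W"
  unfolding cobd_compatible_def
proof (intro ballI conjI impI)
  fix J assume J: "J \<in> P - Q"
  then show "finite J" using assms(1) unfolding cobd_compatible_def by blast
  fix j l assume jl: "j \<in> J" "l \<in> J" "j \<noteq> l" "J - {j} \<in> P - Q" "W (J - {j}) J"
    "J - {j} - {l} \<in> P - Q" "W (J - {j} - {l}) (J - {j})"
  have *: "J - {l} \<in> P \<and> W (J - {l}) J \<and> W (J - {j} - {l}) (J - {l})"
    using assms(1) J jl unfolding cobd_compatible_def by blast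
  then show "W (J - {l}) J" "W (J - {j} - {l}) (J - {l})" by auto
  show "J - {l} \<in> P - Q"
    using * J jl assms(2) unfolding upper_part_def by blast
qed

text \<open>
  A family \<open>P\<close> with an upper part \<open>Q\<close> gives a short exact sequence of cochain complexes, with the
  cochains supported on \<open>Q\<close> as the subcomplex and the cochains on \<open>P - Q\<close> as the quotient. The
  next two lemmas are the pieces of its long exact cohomology sequence that are needed below.
\<close>

lemma exact_at_extension:
  assumes comp: "cobd_compatible P W" and up: "upper_part P W Q"
    and ex1: "exact_at TYPE('k::comm_ring_1) Q W i" and ex2: "exact_at TYPE('k) (P - Q) W i"
  shows "exact_at TYPE('k) P W i"
  unfolding exact_at_def
proof (intro allI impI)
  fix f :: "nat set \<Rightarrow> 'k"
  assume f: "\<forall>J\<in>P. card J = Suc i \<longrightarrow> cobd P W f J = 0"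
  have low: "cobd (P - Q) W h J = cobd P W h J" if "J \<in> P - Q" for h :: "nat set \<Rightarrow> 'k" and J
    unfolding cobd_def using that up unfolding upper_part_def by (intro sum.cong) auto
  have high: "cobd Q W h J = cobd P W h J" if "J \<in> Q" "\<And>J. J \<in> P - Q \<Longrightarrow> h J = 0"
    for h :: "nat set \<Rightarrow> 'k" and J
    unfolding cobd_def using that up unfolding upper_part_def by (intro sum.cong) auto
  have "\<forall>J\<in>P - Q. card J = Suc i \<longrightarrow> cobd (P - Q) W f J = 0"
    using f low by auto
  then obtain g where g: "\<forall>J\<in>P - Q. card J = i \<longrightarrow> f J = cobd (P - Q) W g J"
    using ex2 unfolding exact_at_def by blast
  \<comment> \<open>After subtracting a coboundary, the cocycle is supported on \<open>Q\<close>.\<close>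
  define f' where "f' = (\<lambda>J. if J \<in> P - Q \<and> card J = i then 0 else f J - cobd P W g J)"
  have f'P: "f' J = f J - cobd P W g J" if "J \<in> P" "card J = i" for J
    using that g low unfolding f'_def by auto
  have "cobd Q W (\<lambda>J. if J \<in> P - Q then 0 else f' J) J = 0" if J: "J \<in> Q" "card J = Suc i" for J
  proof -
    have JP: "J \<in> P" using J up unfolding upper_part_def by auto
    have finJ: "finite J" using J(2) card.infinite by fastforce
    have c: "card (J - {j}) = i" if "j \<in> J" for j using that J finJ by simp
    have "cobd Q W (\<lambda>J. if J \<in> P - Q then 0 else f' J) J = cobd P W (\<lambda>J. if J \<in> P - Q then 0 else f' J) J"
      using J by (intro high) auto
    also have "\<dots> = cobd P W (\<lambda>J. f J - cobd P W g J) J"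
    proof (rule cobd_cong)
      fix j assume j: "j \<in> J" "J - {j} \<in> P"
      show "(if J - {j} \<in> P - Q then 0 else f' (J - {j})) = f (J - {j}) - cobd P W g (J - {j})"
        using f'P [OF j(2) c [OF j(1)]] c [OF j(1)] unfolding f'_def by metis
    qed
    also have "\<dots> = 0"
      using cobd_cobd [OF comp JP, of g] f J JP by (simp add: cobd_diff)
    finally show ?thesis .
  qed
  then obtain h where h: "\<forall>J\<in>Q. card J = i \<longrightarrow> (if J \<in> P - Q then 0 else f' J) = cobd Q W h J"
    using ex1 unfolding exact_at_def by blast
  define h' where "h' = (\<lambda>J. if J \<in> Q then h J else 0)"
  have "f J = cobd P W (\<lambda>J. g J + h' J) J" if J: "J \<in> P" "card J = i" for J
  proof (cases "J \<in> Q")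
    case True
    have "cobd P W h' J = cobd Q W h' J"
      using True by (intro high [symmetric]) (auto simp: h'_def)
    also have "\<dots> = cobd Q W h J"
      by (rule cobd_cong) (auto simp: h'_def)
    also have "\<dots> = f' J" using h True J by auto
    finally show ?thesis using f'P J by (simp add: cobd_add)
  next
    case False
    have "cobd P W h' J = 0"
      using up False J unfolding upper_part_def by (intro cobd_eq_0) (auto simp: h'_def)
    then show ?thesis
      using f'P [OF J] False J by (auto simp: cobd_add f'_def)
  qed
  then show "\<exists>g. \<forall>J\<in>P. card J = i \<longrightarrow> f J = cobd P W g J" by blast
qed

lemma exact_at_upper_part:
  assumes comp: "cobd_compatible P W" and up: "upper_part P W Q"
    and ex1: "exact_at TYPE('k::comm_ring_1) P W i"
    and ex2: "\<And>i'. i = Suc i' \<Longrightarrow> exact_at TYPE('k) (P - Q) W i'"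
  shows "exact_at TYPE('k) Q W i"
  unfolding exact_at_def
proof (intro allI impI)
  fix f :: "nat set \<Rightarrow> 'k"
  assume f: "\<forall>J\<in>Q. card J = Suc i \<longrightarrow> cobd Q W f J = 0"
  have QP: "Q \<subseteq> P" using up unfolding upper_part_def by auto
  have low: "cobd (P - Q) W h J = cobd P W h J" if "J \<in> P - Q" for h :: "nat set \<Rightarrow> 'k" and J
    unfolding cobd_def using that up unfolding upper_part_def by (intro sum.cong) auto
  define f' where "f' = (\<lambda>J. if J \<in> Q then f J else 0)"
  have f': "cobd P W f' J = (if J \<in> Q then cobd Q W f J else 0)" if "J \<in> P" for J
    using that up QP unfolding cobd_def f'_def upper_part_def
    by (auto intro!: sum.cong sum.neutral)
  have "\<forall>J\<in>P. card J = Suc i \<longrightarrow> cobd P W f' J = 0"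
    using f f' by auto
  then obtain g where g: "\<And>J. J \<in> P \<Longrightarrow> card J = i \<Longrightarrow> f' J = cobd P W g J"
    using ex1 unfolding exact_at_def by blast
  show "\<exists>g. \<forall>J\<in>Q. card J = i \<longrightarrow> f J = cobd Q W g J"
  proof (cases i)
    case 0
    have "f J = cobd Q W g J" if J: "J \<in> Q" "card J = i" for J
    proof -
      have "J \<in> P" using J QP by auto
      then have "finite J" using comp unfolding cobd_compatible_def by blast
      then have "J = {}" using J 0 by simp
      then show ?thesis using g [of J] J QP by (auto simp: f'_def cobd_def)
    qed
    then show ?thesis by blast
  next
    case (Suc i')
    have "\<forall>J\<in>P - Q. card J = Suc i' \<longrightarrow> cobd (P - Q) W g J = 0"
      using g Suc by (auto simp: low f'_def simp flip: g)
    then obtain h where h: "\<And>J. J \<in> P - Q \<Longrightarrow> card J = i' \<Longrightarrow> g J = cobd (P - Q) W h J"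
      using ex2 [OF Suc] unfolding exact_at_def by blast
    have "f J = cobd Q W (\<lambda>J. g J - cobd P W h J) J" if J: "J \<in> Q" "card J = i" for J
    proof -
      have JP: "J \<in> P" using J QP by auto
      have finJ: "finite J" using JP comp unfolding cobd_compatible_def by blast
      have c: "card (J - {j}) = i'" if "j \<in> J" for j using that J finJ Suc by simp
      have "f J = cobd P W (\<lambda>J. g J - cobd P W h J) J"
        using g [OF JP] J cobd_cobd [OF comp JP, of h] by (simp add: f'_def cobd_diff)
      also have "\<dots> = cobd Q W (\<lambda>J. g J - cobd P W h J) J"
        unfolding cobd_def [of P W "\<lambda>J. g J - cobd P W h J"] cobd_def [of Q W]
      proof (rule sum.cong [OF refl])
        fix j assume "j \<in> J"
        then show "(if J - {j} \<in> P \<and> W (J - {j}) J then inc_sign j J * (g (J - {j}) - cobd P W h (J - {j})) else 0) =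
          (if J - {j} \<in> Q \<and> W (J - {j}) J then inc_sign j J * (g (J - {j}) - cobd P W h (J - {j})) else 0)"
          using h [of "J - {j}"] c [of j] QP low [of "J - {j}" h] by auto
      qed
      finally show ?thesis .
    qed
    then show ?thesis by blast
  qed
qed

lemma exact_at_empty: "exact_at T {} W i"
  by (simp add: exact_at_def)

text \<open>
  For the full power set of a nonempty set, adding or removing the least element is a contracting
  homotopy; choosing the least element makes the sign of this operation trivial.
\<close>

lemma exact_at_Pow:
  assumes "finite I" "I \<noteq> {}" and W: "\<And>J J'. W J J'"
  shows "exact_at TYPE('k::comm_ring_1) (Pow I) W i"
  unfolding exact_at_def
proof (intro allI impI)
  fix f :: "nat set \<Rightarrow> 'k"
  assume f: "\<forall>J\<in>Pow I. card J = Suc i \<longrightarrow> cobd (Pow I) W f J = 0"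
  define m where "m = Min I"
  have m: "m \<in> I" "\<And>j. j \<in> I \<Longrightarrow> m \<le> j"
    using assms by (auto simp: m_def)
  define g where "g = (\<lambda>J. if m \<in> J then 0 else f (insert m J))"
  have cob: "cobd (Pow I) W h J = (\<Sum>j\<in>J. inc_sign j J * h (J - {j}))" if "J \<subseteq> I"
    for h :: "nat set \<Rightarrow> 'k" and J
    unfolding cobd_def using that W by (intro sum.cong) auto
  have sgm: "inc_sign m J = (1::'k)" if "J \<subseteq> I" for J
  proof -
    have "{i \<in> J. i < m} = {}" using that m by (auto simp: leD)
    then show ?thesis by (simp only: inc_sign_def card.empty power_0)
  qed
  have "f J = cobd (Pow I) W g J" if J: "J \<in> Pow I" "card J = i" for J
  proof (cases "m \<in> J")
    case True
    have finJ: "finite J" using J(1) assms(1) by (meson PowD finite_subset)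
    have "cobd (Pow I) W g J = (\<Sum>j\<in>J. inc_sign j J * g (J - {j}))"
      using J by (intro cob) auto
    also have "\<dots> = inc_sign m J * g (J - {m}) + (\<Sum>j\<in>J - {m}. inc_sign j J * g (J - {j}))"
      using True finJ by (rule sum.remove [rotated])
    also have "(\<Sum>j\<in>J - {m}. inc_sign j J * g (J - {j})) = 0"
      using True by (intro sum.neutral) (auto simp: g_def)
    finally show ?thesis
      using True J sgm by (simp add: g_def insert_absorb)
  next
    case False
    have finJ: "finite J" using J(1) assms(1) by (meson PowD finite_subset)
    define K where "K = insert m J"
    have K: "K \<subseteq> I" "card K = Suc i" "K - {m} = J"
      using J m False finJ by (auto simp: K_def)
    have "0 = cobd (Pow I) W f K" using f K by auto
    also have "\<dots> = (\<Sum>j\<in>K. inc_sign j K * f (K - {j}))" using K cob by auto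
    also have "\<dots> = inc_sign m K * f J + (\<Sum>j\<in>J. inc_sign j K * f (K - {j}))"
      using finJ False K(3) by (simp add: K_def)
    also have "(\<Sum>j\<in>J. inc_sign j K * f (K - {j})) = (\<Sum>j\<in>J. - (inc_sign j J * g (J - {j})))"
    proof (rule sum.cong [OF refl])
      fix j assume j: "j \<in> J"
      have "m < j" using j False m J by (metis PowD le_neq_implies_less subsetD)
      have "{i \<in> K. i < j} = insert m {i \<in> J. i < j}" "m \<notin> {i \<in> J. i < j}"
        using \<open>m < j\<close> False by (auto simp: K_def)
      then have "card {i \<in> K. i < j} = Suc (card {i \<in> J. i < j})"
        using finJ by simp
      moreover have "K - {j} = insert m (J - {j})" using \<open>m < j\<close> by (auto simp: K_def)
      ultimately show "inc_sign j K * f (K - {j}) = - (inc_sign j J * g (J - {j}))"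
        using False by (simp add: inc_sign_def g_def)
    qed
    finally show ?thesis
      using sgm [OF K(1)] cob [of J g] J by (simp add: sum_negf)
  qed
  then show "\<exists>g. \<forall>J\<in>Pow I. card J = i \<longrightarrow> f J = cobd (Pow I) W g J" by blast
qed

text \<open>
  A family that is cut into pieces along a finite partially ordered set of labels, such that the
  label can only grow along incidences, is exact as soon as all pieces are: the pieces are the
  graded pieces of a filtration.
\<close>

lemma exact_at_Union:
  fixes Q :: "'c::order \<Rightarrow> nat set set"
  assumes "finite L" and "cobd_compatible (\<Union>F\<in>L. Q F) W"
    and "\<And>F F' J j. F \<in> L \<Longrightarrow> F' \<in> L \<Longrightarrow> J \<in> Q F \<Longrightarrow> j \<in> J \<Longrightarrow> J - {j} \<in> Q F' \<Longrightarrow> W (J - {j}) J \<Longrightarrow> F' \<le> F"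
    and "\<And>F F' J. F \<in> L \<Longrightarrow> F' \<in> L \<Longrightarrow> J \<in> Q F \<Longrightarrow> J \<in> Q F' \<Longrightarrow> F = F'"
    and "\<And>F. F \<in> L \<Longrightarrow> exact_at TYPE('k::comm_ring_1) (Q F) W i"
  shows "exact_at TYPE('k) (\<Union>F\<in>L. Q F) W i"
  using assms
proof (induction "card L" arbitrary: L)
  case 0
  then show ?case by (simp add: exact_at_empty)
next
  case (Suc n)
  then obtain m where m: "m \<in> L" "\<And>F. F \<in> L \<Longrightarrow> m \<le> F \<Longrightarrow> F = m"
    using finite_has_maximal [of L] by (metis card.empty nat.distinct(1))
  have eq: "(\<Union>F\<in>L. Q F) - Q m = (\<Union>F\<in>L - {m}. Q F)"
    using Suc.prems(4) m(1) by blast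
  have up: "upper_part (\<Union>F\<in>L. Q F) W (Q m)"
    unfolding upper_part_def
  proof (intro conjI ballI impI)
    show "Q m \<subseteq> (\<Union>F\<in>L. Q F)" using m by auto
    fix J j assume J: "J \<in> (\<Union>F\<in>L. Q F)" "j \<in> J" "J - {j} \<in> Q m" "W (J - {j}) J"
    then obtain F where F: "F \<in> L" "J \<in> Q F" by auto
    then have "m \<le> F" using Suc.prems(3) [OF F(1) m(1) F(2)] J by auto
    then show "J \<in> Q m" using m(2) [OF F(1)] F by auto
  qed
  have "exact_at TYPE('k) (\<Union>F\<in>L - {m}. Q F) W i"
  proof (rule Suc.hyps(1))
    show "cobd_compatible (\<Union>F\<in>L - {m}. Q F) W"
      unfolding eq [symmetric] by (rule cobd_compatible_Diff [OF Suc.prems(2) up])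
  qed (use Suc m in \<open>auto simp: \<open>Suc n = card L\<close> [symmetric]\<close>)
  then show ?case
    using exact_at_extension [OF Suc.prems(2) up Suc.prems(5) [OF m(1)]] eq by simp
qed

section \<open>Faces of rational pointed cones\<close>

text \<open>
  For a convex cone this is the relative interior. In this form it can be used without topology:
  from \<open>x\<close> one can go a bit in the direction opposite to any point of the cone.
\<close>

definition cone_interior :: "'a::real_vector set \<Rightarrow> 'a set" where
  "cone_interior C = {x \<in> C. \<forall>z\<in>C. \<exists>\<epsilon>>0. x - \<epsilon> *\<^sub>R z \<in> C}"

lemma cone_interior_subset: "cone_interior C \<subseteq> C"
  by (auto simp: cone_interior_def)

lemma rational_cone_properties:
  assumes "rational_cone C"
  shows "0 \<in> C" "x \<in> C \<Longrightarrow> y \<in> C \<Longrightarrow> x + y \<in> C" "x \<in> C \<Longrightarrow> 0 \<le> c \<Longrightarrow> c *\<^sub>R x \<in> C"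
  using assms unfolding rational_cone_def by (auto simp: inner_add_right inner_scaleR_right)

lemma rational_cone_sum:
  assumes "rational_cone C" "\<And>i. i \<in> A \<Longrightarrow> f i \<in> C"
  shows "sum f A \<in> C"
  using assms(2) by (induction A rule: infinite_finite_induct)
    (auto intro: rational_cone_properties [OF assms(1)])

lemma cone_interior_add:
  assumes C: "rational_cone C" and x: "x \<in> cone_interior C" and y: "y \<in> C"
  shows "x + y \<in> cone_interior C"
proof -
  note cp = rational_cone_properties [OF C]
  have "\<exists>\<epsilon>>0. x + y - \<epsilon> *\<^sub>R z \<in> C" if z: "z \<in> C" for z
  proof -
    obtain \<epsilon> where "\<epsilon> > 0" "x - \<epsilon> *\<^sub>R z \<in> C"
      using x z unfolding cone_interior_def by auto
    then show ?thesis using cp(2) [OF _ y, of "x - \<epsilon> *\<^sub>R z"] by (auto simp: algebra_simps)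
  qed
  then show ?thesis
    using x y cp(2) unfolding cone_interior_def by auto
qed

lemma cone_interior_scale:
  assumes C: "rational_cone C" and x: "x \<in> cone_interior C" and c: "c > 0"
  shows "c *\<^sub>R x \<in> cone_interior C"
proof -
  note cp = rational_cone_properties [OF C]
  have "\<exists>\<epsilon>>0. c *\<^sub>R x - \<epsilon> *\<^sub>R z \<in> C" if z: "z \<in> C" for z
  proof -
    obtain \<epsilon> where \<epsilon>: "\<epsilon> > 0" "x - \<epsilon> *\<^sub>R z \<in> C"
      using x z unfolding cone_interior_def by auto
    then have "c *\<^sub>R (x - \<epsilon> *\<^sub>R z) \<in> C" using c cp(3) by simp
    then show ?thesis using c \<epsilon> by (intro exI [of _ "c * \<epsilon>"]) (auto simp: algebra_simps)
  qed
  then show ?thesis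
    using x c cp(3) unfolding cone_interior_def by auto
qed

lemma cone_interior_diff:
  assumes C: "rational_cone C" and x: "x \<in> cone_interior C" and y: "y \<in> C"
  obtains c where "c > 0" "c *\<^sub>R x - y \<in> cone_interior C"
proof -
  obtain \<epsilon> where \<epsilon>: "\<epsilon> > 0" "x - \<epsilon> *\<^sub>R y \<in> C"
    using x y unfolding cone_interior_def by auto
  have "x + (x - \<epsilon> *\<^sub>R y) \<in> cone_interior C"
    using C x \<epsilon> by (intro cone_interior_add)
  then have "(1 / \<epsilon>) *\<^sub>R (x + (x - \<epsilon> *\<^sub>R y)) \<in> cone_interior C"
    using C \<epsilon> by (intro cone_interior_scale) auto
  moreover have "(1 / \<epsilon>) *\<^sub>R (x + (x - \<epsilon> *\<^sub>R y)) = (2 / \<epsilon>) *\<^sub>R x - y"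
    using \<epsilon> by (simp add: algebra_simps scaleR_2 [symmetric])
  ultimately show ?thesis using \<epsilon> by (intro that [of "2 / \<epsilon>"]) auto
qed

text \<open>
  The inequalities in \<open>L0\<close> are equalities on the cone, those in \<open>L1\<close> are essential. Each essential
  one is strict at some point of the cone; the sum of such points is interior.
\<close>

lemma rational_cone_inequalities:
  fixes C :: "(real ^ 'd) set"
  assumes C: "rational_cone C"
  obtains L0 L1 where "finite L0" "finite L1" "L0 \<union> L1 \<subseteq> range real_vec"
    "\<And>x. x \<in> C \<longleftrightarrow> (\<forall>l\<in>L0. 0 \<le> l \<bullet> x) \<and> (\<forall>l\<in>L1. 0 \<le> l \<bullet> x)"
    "\<And>l x. l \<in> L0 \<Longrightarrow> x \<in> C \<Longrightarrow> l \<bullet> x = 0"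
    "\<And>x. x \<in> cone_interior C \<longleftrightarrow> (\<forall>l\<in>L0. 0 \<le> l \<bullet> x) \<and> (\<forall>l\<in>L1. 0 < l \<bullet> x)"
    "cone_interior C \<noteq> {}"
proof -
  obtain N where N: "finite N" "C = (\<Inter>n\<in>N. {x. 0 \<le> real_vec n \<bullet> x})"
    using C unfolding rational_cone_def by auto
  note cp = rational_cone_properties [OF C]
  define L where "L = real_vec ` N"
  have L: "finite L" "\<And>x. x \<in> C \<longleftrightarrow> (\<forall>l\<in>L. 0 \<le> l \<bullet> x)"
    using N by (auto simp: L_def)
  define L0 where "L0 = {l \<in> L. \<forall>z\<in>C. l \<bullet> z = 0}"
  define L1 where "L1 = {l \<in> L. \<exists>z\<in>C. 0 < l \<bullet> z}"
  have fin: "finite L0" "finite L1" using L by (auto simp: L0_def L1_def)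
  have ex: "\<exists>z\<in>C. 0 < l \<bullet> z" if "l \<in> L1" for l
    using that by (auto simp: L1_def)
  have LU: "L = L0 \<union> L1"
  proof
    show "L \<subseteq> L0 \<union> L1"
    proof
      fix l assume l: "l \<in> L"
      show "l \<in> L0 \<union> L1"
      proof (cases "\<exists>z\<in>C. 0 < l \<bullet> z")
        case False
        then have "l \<bullet> z = 0" if "z \<in> C" for z
          using that l L(2) [of z] by (meson linorder_not_less order_antisym)
        then show ?thesis using l by (auto simp: L0_def)
      qed (use l in \<open>auto simp: L1_def\<close>)
    qed
  qed (auto simp: L0_def L1_def)
  have int: "x \<in> cone_interior C \<longleftrightarrow> (\<forall>l\<in>L0. 0 \<le> l \<bullet> x) \<and> (\<forall>l\<in>L1. 0 < l \<bullet> x)" for x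
  proof
    assume x: "x \<in> cone_interior C"
    have "0 < l \<bullet> x" if l: "l \<in> L1" for l
    proof -
      obtain z where z: "z \<in> C" "0 < l \<bullet> z" using ex [OF l] by auto
      obtain \<epsilon> where \<epsilon>: "\<epsilon> > 0" "x - \<epsilon> *\<^sub>R z \<in> C"
        using x z unfolding cone_interior_def by auto
      have "0 \<le> l \<bullet> x - \<epsilon> * (l \<bullet> z)"
        using \<epsilon> l L(2) LU by (auto simp: inner_diff_right inner_scaleR_right)
      moreover have "\<epsilon> * (l \<bullet> z) > 0" using \<epsilon> z by simp
      ultimately show ?thesis by linarith
    qed
    then show "(\<forall>l\<in>L0. 0 \<le> l \<bullet> x) \<and> (\<forall>l\<in>L1. 0 < l \<bullet> x)"
      using x L(2) [of x] cone_interior_subset [of C] LU by auto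
  next
    assume x: "(\<forall>l\<in>L0. 0 \<le> l \<bullet> x) \<and> (\<forall>l\<in>L1. 0 < l \<bullet> x)"
    then have xC: "x \<in> C" using L LU by (auto intro: less_imp_le)
    have "\<exists>\<epsilon>>0. x - \<epsilon> *\<^sub>R z \<in> C" if z: "z \<in> C" for z
    proof -
      have "\<forall>l\<in>L. \<forall>\<^sub>F \<epsilon> in at_right 0. 0 \<le> l \<bullet> (x - \<epsilon> *\<^sub>R z)"
      proof
        fix l assume l: "l \<in> L"
        show "\<forall>\<^sub>F \<epsilon> in at_right 0. 0 \<le> l \<bullet> (x - \<epsilon> *\<^sub>R z)"
        proof (cases "l \<in> L0")
          case True
          then have "l \<bullet> z = 0" using z by (auto simp: L0_def)
          then show ?thesis using xC l L by (simp add: inner_diff_right)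
        next
          case False
          then have "l \<in> L1" using l LU by auto
          then have pos: "0 < l \<bullet> (x - 0 *\<^sub>R z)" using x by simp
          have "((\<lambda>\<epsilon>. l \<bullet> (x - \<epsilon> *\<^sub>R z)) \<longlongrightarrow> l \<bullet> (x - 0 *\<^sub>R z)) (at_right 0)"
            by (intro tendsto_intros)
          from order_tendstoD(1) [OF this pos] show ?thesis
            by (rule eventually_mono) auto
        qed
      qed
      then have "\<forall>\<^sub>F \<epsilon> in at_right 0. \<forall>l\<in>L. 0 \<le> l \<bullet> (x - \<epsilon> *\<^sub>R z)"
        using L(1) by (intro eventually_ball_finite)
      then have "\<forall>\<^sub>F \<epsilon> in at_right (0::real). \<epsilon> > 0 \<and> x - \<epsilon> *\<^sub>R z \<in> C"
        using eventually_at_right_less [of "0::real"] by eventually_elim (auto simp: L(2))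
      then show ?thesis
        using eventually_happens trivial_limit_at_right_real by blast
    qed
    then show "x \<in> cone_interior C" using xC by (auto simp: cone_interior_def)
  qed
  obtain Z where Z: "\<And>l. l \<in> L1 \<Longrightarrow> Z l \<in> C \<and> 0 < l \<bullet> Z l"
    using ex by metis
  have ZC: "(\<Sum>l\<in>L1. Z l) \<in> C" using Z by (intro rational_cone_sum [OF C]) auto
  have "0 < l \<bullet> (\<Sum>l\<in>L1. Z l)" if l: "l \<in> L1" for l
  proof -
    have "0 < l \<bullet> Z l" using Z l by auto
    also have "\<dots> \<le> (\<Sum>m\<in>L1. l \<bullet> Z m)"
      using l Z L(2) LU fin by (intro member_le_sum) auto
    finally show ?thesis by (simp add: inner_sum_right)
  qed
  then have "(\<Sum>l\<in>L1. Z l) \<in> cone_interior C"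
    using ZC L(2) LU by (auto simp: int)
  then have ne: "cone_interior C \<noteq> {}" by auto
  have mem: "x \<in> C \<longleftrightarrow> (\<forall>l\<in>L0. 0 \<le> l \<bullet> x) \<and> (\<forall>l\<in>L1. 0 \<le> l \<bullet> x)" for x
    unfolding L(2) LU by blast
  have range: "L0 \<union> L1 \<subseteq> range real_vec"
    unfolding LU [symmetric] L_def by blast
  show ?thesis
    by (rule that [OF fin range mem _ int ne]) (auto simp: L0_def)
qed

lemma cone_face_subset: "cone_face F C \<Longrightarrow> F \<subseteq> C"
  by (auto simp: cone_face_def)

lemma cone_face_summands:
  assumes "cone_face F C" "x \<in> C" "y \<in> C" "x + y \<in> F"
  shows "x \<in> F" "y \<in> F"
proof -
  have "x \<in> F \<and> y \<in> F"
  proof (cases "F = C")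
    case False
    then obtain u where u: "C \<subseteq> {x. 0 \<le> u \<bullet> x}" "F = C \<inter> {x. u \<bullet> x = 0}"
      using assms unfolding cone_face_def by auto
    then have "u \<bullet> x \<ge> 0" "u \<bullet> y \<ge> 0" "u \<bullet> x + u \<bullet> y = 0"
      using assms by (auto simp: inner_add_right)
    then show ?thesis using u assms by auto
  qed (use assms in auto)
  then show "x \<in> F" "y \<in> F" by auto
qed

lemma cone_face_interior:
  assumes F: "cone_face F C" and x: "x \<in> cone_interior C" "x \<in> F"
  shows "F = C"
proof (rule ccontr)
  assume "F \<noteq> C"
  then obtain u where u: "C \<subseteq> {x. 0 \<le> u \<bullet> x}" "F = C \<inter> {x. u \<bullet> x = 0}"
    using F unfolding cone_face_def by auto
  have "z \<in> F" if z: "z \<in> C" for z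
  proof -
    obtain \<epsilon> where \<epsilon>: "\<epsilon> > 0" "x - \<epsilon> *\<^sub>R z \<in> C"
      using x z unfolding cone_interior_def by auto
    then have "0 \<le> u \<bullet> x - \<epsilon> * (u \<bullet> z)" using u by (auto simp: inner_diff_right)
    then have "u \<bullet> z \<le> 0" using u x \<epsilon> by (auto simp: mult_le_0_iff)
    then show ?thesis using u z by force
  qed
  then show False using \<open>F \<noteq> C\<close> cone_face_subset [OF F] by auto
qed

text \<open>The face containing \<open>x\<close> in its interior is cut out by the sum of the inequalities that are
  equalities at \<open>x\<close>.\<close>

lemma cone_face_of_point:
  fixes C :: "(real ^ 'd) set"
  assumes C: "rational_cone C" and x: "x \<in> C"
  obtains F where "cone_face F C" "x \<in> cone_interior F"
proof -
  obtain N where N: "finite N" "C = (\<Inter>n\<in>N. {x. 0 \<le> real_vec n \<bullet> x})"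
    using C unfolding rational_cone_def by auto
  define L where "L = real_vec ` N"
  have L: "finite L" "\<And>x. x \<in> C \<longleftrightarrow> (\<forall>l\<in>L. 0 \<le> l \<bullet> x)"
    using N by (auto simp: L_def)
  define T where "T = {l \<in> L. l \<bullet> x = 0}"
  define u where "u = (\<Sum>l\<in>T. l)"
  define F where "F = C \<inter> {y. u \<bullet> y = 0}"
  have uy: "u \<bullet> y = (\<Sum>l\<in>T. l \<bullet> y)" for y by (simp add: u_def inner_sum_left)
  have u0: "0 \<le> u \<bullet> y" if "y \<in> C" for y
    unfolding uy using that L by (intro sum_nonneg) (auto simp: T_def)
  have T0: "l \<bullet> y = 0" if "y \<in> F" "l \<in> T" for l y
  proof -
    have "(\<Sum>l\<in>T. l \<bullet> y) = 0" using that uy by (auto simp: F_def)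
    moreover have "finite T" "\<And>l. l \<in> T \<Longrightarrow> 0 \<le> l \<bullet> y"
      using that L by (auto simp: T_def F_def)
    ultimately show ?thesis using that(2) by (simp add: sum_nonneg_eq_0_iff)
  qed
  have "cone_face F C"
  proof (cases "u = 0")
    case True then show ?thesis by (simp add: F_def cone_face_def)
  next
    case False then show ?thesis using u0 by (auto simp: F_def cone_face_def)
  qed
  moreover have "x \<in> cone_interior F"
    unfolding cone_interior_def
  proof (intro CollectI conjI ballI)
    show xF: "x \<in> F" using x by (auto simp: F_def uy T_def)
    fix z assume z: "z \<in> F"
    have "\<forall>l\<in>L. \<forall>\<^sub>F \<epsilon> in at_right 0. 0 \<le> l \<bullet> (x - \<epsilon> *\<^sub>R z)"
    proof
      fix l assume l: "l \<in> L"
      show "\<forall>\<^sub>F \<epsilon> in at_right 0. 0 \<le> l \<bullet> (x - \<epsilon> *\<^sub>R z)"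
      proof (cases "l \<in> T")
        case True
        then have "l \<bullet> z = 0" "l \<bullet> x = 0" using T0 z by (auto simp: T_def)
        then show ?thesis by (simp add: inner_diff_right)
      next
        case False
        then have pos: "0 < l \<bullet> (x - 0 *\<^sub>R z)" using l x L(2) [of x] by (auto simp: T_def order_less_le)
        have "((\<lambda>\<epsilon>. l \<bullet> (x - \<epsilon> *\<^sub>R z)) \<longlongrightarrow> l \<bullet> (x - 0 *\<^sub>R z)) (at_right 0)"
          by (intro tendsto_intros)
        from order_tendstoD(1) [OF this pos] show ?thesis
          by (rule eventually_mono) auto
      qed
    qed
    then have "\<forall>\<^sub>F \<epsilon> in at_right 0. \<forall>l\<in>L. 0 \<le> l \<bullet> (x - \<epsilon> *\<^sub>R z)"
      using L(1) by (intro eventually_ball_finite)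
    then have "\<forall>\<^sub>F \<epsilon> in at_right (0::real). \<epsilon> > 0 \<and> x - \<epsilon> *\<^sub>R z \<in> F"
      using eventually_at_right_less [of "0::real"]
    proof eventually_elim
      case (elim \<epsilon>)
      then have "x - \<epsilon> *\<^sub>R z \<in> C" by (auto simp: L(2))
      moreover have "u \<bullet> (x - \<epsilon> *\<^sub>R z) = 0"
        using xF z by (simp add: F_def inner_diff_right)
      ultimately show ?case using elim by (auto simp: F_def)
    qed
    then show "\<exists>\<epsilon>>0. x - \<epsilon> *\<^sub>R z \<in> F"
      using eventually_happens trivial_limit_at_right_real by blast
  qed
  ultimately show ?thesis by (rule that)
qed

lemma rational_cone_polyhedron:
  fixes C :: "(real ^ 'd) set"
  assumes "rational_cone C"
  shows "polyhedron C" "convex C"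
proof -
  obtain N where N: "finite N" "C = (\<Inter>n\<in>N. {x. 0 \<le> real_vec n \<bullet> x})"
    using assms unfolding rational_cone_def by auto
  show "polyhedron C"
    unfolding N(2) using N(1) by (intro polyhedron_Inter) (auto intro: polyhedron_halfspace_ge)
  then show "convex C" by (rule polyhedron_imp_convex)
qed

text \<open>
  The apex of a nonzero pointed cone is not in its relative interior, so it lies on a facet.
\<close>

lemma cone_facet_exists:
  fixes C :: "(real ^ 'd) set"
  assumes C: "rational_cone C" and p: "pointed C" and "C \<noteq> {0}"
  obtains F where "cone_face F C" "F \<noteq> C" "dim C = Suc (dim F)"
proof -
  note cp = rational_cone_properties [OF C]
  have poly: "polyhedron C" "convex C" using rational_cone_polyhedron [OF C] by auto
  have "0 \<notin> rel_interior C"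
  proof
    assume 0: "0 \<in> rel_interior C"
    obtain u where u: "C \<subseteq> {x. 0 \<le> u \<bullet> x}" "{0} = C \<inter> {x. u \<bullet> x = 0}"
      using p \<open>C \<noteq> {0}\<close> unfolding pointed_def cone_face_def by auto
    obtain z where z: "z \<in> C" "z \<noteq> 0" using \<open>C \<noteq> {0}\<close> cp(1) by auto
    obtain e where "e > 1" "(1 - e) *\<^sub>R z + e *\<^sub>R 0 \<in> C"
      using 0 z convex_rel_interior_iff [OF poly(2), of 0] by blast
    then have "0 \<le> (1 - e) * (u \<bullet> z)" using u by auto
    then have "u \<bullet> z \<le> 0" using \<open>e > 1\<close> by (simp add: zero_le_mult_iff)
    then have "z \<in> {0}" using u z by force
    then show False using z by simp
  qed
  then obtain F where F: "F facet_of C" "0 \<in> F"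
    using rel_boundary_of_polyhedron [OF poly(1)] cp(1) by blast
  have "F exposed_face_of C"
    using F exposed_face_of_polyhedron [OF poly(1)] facet_of_imp_face_of by blast
  moreover have "F \<noteq> C" using F by auto
  ultimately obtain a b where ab: "C \<subseteq> {x. a \<bullet> x \<le> b}" "F = C \<inter> {x. a \<bullet> x = b}" "a \<noteq> 0"
    unfolding exposed_face_of using F(2) by auto
  have b: "b = 0" using ab F(2) by auto
  have "cone_face F C"
    unfolding cone_face_def using ab b by (intro disjI2 exI [of _ "- a"]) auto
  moreover have "dim C = Suc (dim F)"
  proof -
    have "aff_dim F = aff_dim C - 1" using F by (simp add: facet_of_def)
    moreover have "aff_dim F = int (dim F)" "aff_dim C = int (dim C)"
      using F cp(1) by (auto intro!: aff_dim_zero hull_inc)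
    ultimately show ?thesis by simp
  qed
  ultimately show ?thesis using \<open>F \<noteq> C\<close> that by blast
qed

lemma cone_face_dim_less:
  fixes C :: "(real ^ 'd) set"
  assumes F: "cone_face F C" and "F \<noteq> C"
  shows "dim F < dim C"
proof -
  obtain u where u: "C \<subseteq> {x. 0 \<le> u \<bullet> x}" "F = C \<inter> {x. u \<bullet> x = 0}"
    using F \<open>F \<noteq> C\<close> unfolding cone_face_def by auto
  have "span F \<subseteq> {x. u \<bullet> x = 0}"
    by (rule span_minimal) (use u in \<open>auto simp: subspace_hyperplane\<close>)
  moreover obtain z where "z \<in> C" "z \<notin> F" using assms cone_face_subset by blast
  ultimately have "span F \<noteq> span C" using u span_superset by blast
  then have "span F \<subset> span C" using span_mono [OF cone_face_subset [OF F]] by auto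
  then show ?thesis by (simp add: dim_psubset)
qed

section \<open>Families of index sets attached to a point\<close>

text \<open>
  Faces of cones of the fan are cones of the fan as well, so the last assumption applies to the
  rays, and the cones are generated by the vectors in them.
\<close>

locale generated_fan =
  fixes \<Sigma> :: "(real ^ 'd) set set" and I :: "nat set" and v :: "nat \<Rightarrow> real ^ 'd"
  assumes fan: "rational_pointed_fan \<Sigma>"
    and finite_I: "finite I"
    and generated: "\<And>C. C \<in> \<Sigma> \<Longrightarrow> C \<noteq> {0} \<Longrightarrow> \<exists>j\<in>I. v j \<in> C"
begin

definition idx :: "(real ^ 'd) set \<Rightarrow> nat set" where
  "idx C = {j \<in> I. v j \<in> C}"

definition vsum :: "nat set \<Rightarrow> real ^ 'd" where
  "vsum J = (\<Sum>j\<in>J. v j)"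

text \<open>
  The ray from \<open>a\<close> in direction \<open>v\<^sub>J\<close> ends up in the interior of \<open>C\<close>. In the ring spanned by all
  lattice points of \<open>C\<close>, this describes the degree \<open>a\<close> part of the Cech complex of the ideal of
  the interior points; the closed family does the same for the ring itself.
\<close>

definition open_family :: "(real ^ 'd) set \<Rightarrow> real ^ 'd \<Rightarrow> nat set set" where
  "open_family C a = {J. J \<subseteq> idx C \<and> (\<exists>t\<ge>0. a + t *\<^sub>R vsum J \<in> cone_interior C)}"

definition closed_family :: "(real ^ 'd) set \<Rightarrow> real ^ 'd \<Rightarrow> nat set set" where
  "closed_family C a = {J. J \<subseteq> idx C \<and> (\<exists>t\<ge>0. a + t *\<^sub>R vsum J \<in> C)}"

lemma rational: "C \<in> \<Sigma> \<Longrightarrow> rational_cone C"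
  and pointed: "C \<in> \<Sigma> \<Longrightarrow> pointed C"
  and face_mem: "C \<in> \<Sigma> \<Longrightarrow> cone_face F C \<Longrightarrow> F \<in> \<Sigma>"
  and inter_face: "C \<in> \<Sigma> \<Longrightarrow> D \<in> \<Sigma> \<Longrightarrow> cone_face (C \<inter> D) C"
  and inter_face': "C \<in> \<Sigma> \<Longrightarrow> D \<in> \<Sigma> \<Longrightarrow> cone_face (C \<inter> D) D"
  and finite_fan: "finite \<Sigma>"
  using fan unfolding rational_pointed_fan_def by blast+

lemma interior_point_le:
  assumes "F \<in> \<Sigma>" "D \<in> \<Sigma>" "x \<in> cone_interior F" "x \<in> D"
  shows "F \<subseteq> D"
  using cone_face_interior [OF inter_face [OF assms(1,2)] assms(3)] assms cone_interior_subset by blast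

lemma interior_point_eq:
  assumes "F \<in> \<Sigma>" "D \<in> \<Sigma>" "x \<in> cone_interior F" "x \<in> cone_interior D"
  shows "F = D"
  using interior_point_le assms cone_interior_subset by (metis subset_antisym subsetD)

lemma subset_cone_face:
  assumes "C \<in> \<Sigma>" "D \<in> \<Sigma>" "C \<subseteq> D"
  shows "cone_face C D"
  using inter_face' [OF assms(1,2)] assms(3) by (simp add: Int_absorb2)

lemma interior_point:
  assumes "C \<in> \<Sigma>"
  obtains b where "b \<in> cone_interior C"
  by (rule rational_cone_inequalities [OF rational [OF assms]]) (use that in blast)

lemma finite_idx: "finite (idx C)"
  using finite_I by (simp add: idx_def)

lemma idx_mono: "C \<subseteq> D \<Longrightarrow> idx C \<subseteq> idx D"
  by (auto simp: idx_def)

lemma vsum_mem: "C \<in> \<Sigma> \<Longrightarrow> J \<subseteq> idx C \<Longrightarrow> vsum J \<in> C"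
  unfolding vsum_def by (intro rational_cone_sum rational) (auto simp: idx_def)

lemma vsum_face:
  assumes "C \<in> \<Sigma>" "cone_face F C" "J \<subseteq> idx C" "vsum J \<in> F"
  shows "J \<subseteq> idx F"
proof
  fix j assume j: "j \<in> J"
  have fin: "finite J" using assms(3) finite_idx finite_subset by blast
  have "vsum J = v j + vsum (J - {j})"
    unfolding vsum_def using fin j by (rule sum.remove)
  moreover have "v j \<in> C" "vsum (J - {j}) \<in> C"
    using assms j by (auto simp: idx_def intro!: vsum_mem)
  ultimately have "v j \<in> F" using cone_face_summands [OF assms(2)] assms(4) by metis
  then show "j \<in> idx F" using assms j by (auto simp: idx_def)
qed

lemma vsum_diff:
  assumes "finite J" "J' \<subseteq> J"
  shows "vsum J = vsum J' + vsum (J - J')"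
  unfolding vsum_def using assms by (metis add.commute sum.subset_diff)

lemma cone_mem_mono:
  assumes "C \<in> \<Sigma>" "a + t *\<^sub>R w \<in> C" "w \<in> C" "t \<le> t'"
  shows "a + t' *\<^sub>R w \<in> C"
proof -
  note cp = rational_cone_properties [OF rational [OF assms(1)]]
  have "(a + t *\<^sub>R w) + (t' - t) *\<^sub>R w \<in> C" using cp(2) [OF assms(2) cp(3) [OF assms(3), of "t' - t"]] assms(4) by simp
  then show ?thesis by (simp add: algebra_simps)
qed

lemma interior_mem_mono:
  assumes "C \<in> \<Sigma>" "a + t *\<^sub>R w \<in> cone_interior C" "w \<in> C" "t \<le> t'"
  shows "a + t' *\<^sub>R w \<in> cone_interior C"
proof -
  note cp = rational_cone_properties [OF rational [OF assms(1)]]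
  have "(a + t *\<^sub>R w) + (t' - t) *\<^sub>R w \<in> cone_interior C"
    using assms cone_interior_add [OF rational assms(2) cp(3) [OF assms(3), of "t' - t"]] by simp
  then show ?thesis by (simp add: algebra_simps)
qed

lemma open_family_upclosed:
  assumes C: "C \<in> \<Sigma>" and "J' \<in> open_family C a" "J' \<subseteq> J" "J \<subseteq> idx C"
  shows "J \<in> open_family C a"
proof -
  obtain t where t: "t \<ge> 0" "a + t *\<^sub>R vsum J' \<in> cone_interior C"
    using assms unfolding open_family_def by auto
  have fin: "finite J" using assms finite_idx finite_subset by blast
  have "vsum (J - J') \<in> C" using assms by (intro vsum_mem) auto
  then have "(a + t *\<^sub>R vsum J') + t *\<^sub>R vsum (J - J') \<in> cone_interior C"
    by (rule cone_interior_add [OF rational [OF C] t(2) rational_cone_properties(3) [OF rational [OF C] _ t(1)]])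
  then show ?thesis
    using assms t vsum_diff [OF fin assms(3)] unfolding open_family_def
    by (auto simp: algebra_simps)
qed

lemma closed_family_upclosed:
  assumes C: "C \<in> \<Sigma>" and "J' \<in> closed_family C a" "J' \<subseteq> J" "J \<subseteq> idx C"
  shows "J \<in> closed_family C a"
proof -
  note cp = rational_cone_properties [OF rational [OF C]]
  obtain t where t: "t \<ge> 0" "a + t *\<^sub>R vsum J' \<in> C"
    using assms unfolding closed_family_def by auto
  have fin: "finite J" using assms finite_idx finite_subset by blast
  have "vsum (J - J') \<in> C" using assms by (intro vsum_mem) auto
  then have "(a + t *\<^sub>R vsum J') + t *\<^sub>R vsum (J - J') \<in> C"
    by (rule cp(2) [OF t(2) cp(3) [OF _ t(1)]])
  then show ?thesis
    using assms t vsum_diff [OF fin assms(3)] unfolding closed_family_def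
    by (auto simp: algebra_simps)
qed

text \<open>
  A set \<open>J'\<close> with label \<open>F'\<close> is enlarged to a set \<open>J\<close> with label \<open>F\<close>. Far out on the rays, the
  point for \<open>J'\<close> is a summand of the point for \<open>J\<close>, hence lies in the face \<open>F\<close>; being interior to
  \<open>F'\<close>, it forces \<open>F' \<subseteq> F\<close>.
\<close>

lemma open_family_label_mono:
  assumes "C \<in> \<Sigma>" "F \<in> \<Sigma>" "F' \<in> \<Sigma>" "F \<subseteq> C" "F' \<subseteq> C"
    and "J \<in> open_family F a" "J' \<in> open_family F' a" "J' \<subseteq> J"
  shows "F' \<subseteq> F"
proof -
  obtain t t' where t: "t \<ge> 0" "a + t *\<^sub>R vsum J \<in> cone_interior F"
    "t' \<ge> 0" "a + t' *\<^sub>R vsum J' \<in> cone_interior F'"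
    using assms unfolding open_family_def by auto
  define s where "s = max t t'"
  have JJ: "J \<subseteq> idx F" "J' \<subseteq> idx F'" using assms unfolding open_family_def by auto
  then have fin: "finite J" using finite_idx finite_subset by blast
  have 1: "a + s *\<^sub>R vsum J \<in> cone_interior F"
    using interior_mem_mono [OF assms(2) t(2) vsum_mem [OF assms(2) JJ(1)]] by (simp add: s_def)
  have 2: "a + s *\<^sub>R vsum J' \<in> cone_interior F'"
    using interior_mem_mono [OF assms(3) t(4) vsum_mem [OF assms(3) JJ(2)]] by (simp add: s_def)
  have "vsum (J - J') \<in> F" using JJ by (intro vsum_mem assms) auto
  then have 3: "s *\<^sub>R vsum (J - J') \<in> F"
    using t rational_cone_properties(3) [OF rational [OF assms(2)]] by (auto simp: s_def)
  have "(a + s *\<^sub>R vsum J') + s *\<^sub>R vsum (J - J') \<in> F"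
    using 1 cone_interior_subset vsum_diff [OF fin assms(8)] by (auto simp: algebra_simps)
  then have "a + s *\<^sub>R vsum J' \<in> F"
    using cone_face_summands(1) [OF subset_cone_face [OF assms(2,1,4)]] 2 3 cone_interior_subset assms(4,5)
    by blast
  then show ?thesis using interior_point_le [OF assms(3,2) 2] by auto
qed

lemma open_family_disjoint:
  assumes "F \<in> \<Sigma>" "F' \<in> \<Sigma>" "J \<in> open_family F a" "J \<in> open_family F' a"
  shows "F = F'"
proof -
  obtain t t' where t: "t \<ge> 0" "a + t *\<^sub>R vsum J \<in> cone_interior F"
    "t' \<ge> 0" "a + t' *\<^sub>R vsum J \<in> cone_interior F'"
    using assms unfolding open_family_def by auto
  have JJ: "J \<subseteq> idx F" "J \<subseteq> idx F'" using assms unfolding open_family_def by auto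
  have "a + max t t' *\<^sub>R vsum J \<in> cone_interior F" "a + max t t' *\<^sub>R vsum J \<in> cone_interior F'"
    using interior_mem_mono [OF assms(1) t(2) vsum_mem [OF assms(1) JJ(1)], of "max t t'"]
      interior_mem_mono [OF assms(2) t(4) vsum_mem [OF assms(2) JJ(2)], of "max t t'"] by auto
  then show ?thesis using interior_point_eq assms by blast
qed

text \<open>
  Every point of a cone lies in the interior of exactly one face. This is applied to a point on
  the ray beyond the first one in \<open>C\<close>, so that \<open>v\<^sub>J\<close> belongs to the face as well.
\<close>

lemma closed_family_eq:
  assumes C: "C \<in> \<Sigma>"
  shows "closed_family C a = (\<Union>F\<in>{F \<in> \<Sigma>. F \<subseteq> C}. open_family F a)"
proof
  show "(\<Union>F\<in>{F \<in> \<Sigma>. F \<subseteq> C}. open_family F a) \<subseteq> closed_family C a"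
  proof
    fix J assume "J \<in> (\<Union>F\<in>{F \<in> \<Sigma>. F \<subseteq> C}. open_family F a)"
    then obtain F t where F: "F \<subseteq> C" "J \<subseteq> idx F" "t \<ge> 0" "a + t *\<^sub>R vsum J \<in> cone_interior F"
      unfolding open_family_def by auto
    have "J \<subseteq> idx C" using idx_mono [OF F(1)] F(2) by (rule order_trans [rotated])
    moreover have "a + t *\<^sub>R vsum J \<in> C" using F(1,4) cone_interior_subset [of F] by auto
    ultimately show "J \<in> closed_family C a" using F(3) unfolding closed_family_def by auto
  qed
  show "closed_family C a \<subseteq> (\<Union>F\<in>{F \<in> \<Sigma>. F \<subseteq> C}. open_family F a)"
  proof
    fix J assume "J \<in> closed_family C a"
    then obtain t where t: "J \<subseteq> idx C" "t \<ge> 0" "a + t *\<^sub>R vsum J \<in> C"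
      unfolding closed_family_def by auto
    have s: "vsum J \<in> C" using vsum_mem C t by auto
    have "a + (t + 1) *\<^sub>R vsum J \<in> C" using cone_mem_mono [OF C t(3) s] by auto
    then obtain F where F: "cone_face F C" "a + (t + 1) *\<^sub>R vsum J \<in> cone_interior F"
      using cone_face_of_point [OF rational [OF C]] by metis
    have "(a + t *\<^sub>R vsum J) + vsum J \<in> F"
      using F(2) cone_interior_subset [of F] by (auto simp: algebra_simps)
    then have "vsum J \<in> F" using cone_face_summands(2) [OF F(1) t(3) s] by auto
    then have "J \<subseteq> idx F" by (rule vsum_face [OF C F(1) t(1)])
    then have "J \<in> open_family F a"
      using F t unfolding open_family_def by (auto intro!: exI [of _ "t + 1"])
    then show "J \<in> (\<Union>F\<in>{F \<in> \<Sigma>. F \<subseteq> C}. open_family F a)"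
      using face_mem [OF C F(1)] cone_face_subset [OF F(1)] by auto
  qed
qed

lemma compatible_closed_family:
  assumes C: "C \<in> \<Sigma>"
  shows "cobd_compatible (closed_family C a) (\<lambda>_ _. True)"
  unfolding cobd_compatible_def
proof (intro ballI conjI impI)
  fix J assume J: "J \<in> closed_family C a"
  then show "finite J" using finite_idx finite_subset unfolding closed_family_def by blast
  fix j l assume "J - {j} - {l} \<in> closed_family C a"
  then show "J - {l} \<in> closed_family C a"
    using J by (rule_tac closed_family_upclosed [OF C]) (auto simp: closed_family_def)
qed (rule TrueI)+

lemma upper_part_closed_family:
  assumes C: "C \<in> \<Sigma>"
  shows "upper_part (closed_family C a) (\<lambda>_ _. True) (open_family C a)"
  unfolding upper_part_def
proof (intro conjI ballI impI)
  show "open_family C a \<subseteq> closed_family C a"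
    using C unfolding closed_family_eq [OF C] by auto
  fix J j assume "J \<in> closed_family C a" "J - {j} \<in> open_family C a"
  then show "J \<in> open_family C a"
    by (rule_tac open_family_upclosed [OF C]) (auto simp: closed_family_def)
qed

text \<open>The sets in the closed but not in the open family are labelled by the proper faces.\<close>

lemma exact_at_boundary:
  assumes C: "C \<in> \<Sigma>"
    and ex: "\<And>F. F \<in> \<Sigma> \<Longrightarrow> F \<subset> C \<Longrightarrow> exact_at TYPE('k::comm_ring_1) (open_family F a) (\<lambda>_ _. True) i"
  shows "exact_at TYPE('k) (closed_family C a - open_family C a) (\<lambda>_ _. True) i"
proof -
  have eq: "closed_family C a - open_family C a = (\<Union>F\<in>{F \<in> \<Sigma>. F \<subset> C}. open_family F a)"
  proof (intro equalityI subsetI)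
    fix J assume "J \<in> closed_family C a - open_family C a"
    then have J: "J \<in> (\<Union>F\<in>{F \<in> \<Sigma>. F \<subseteq> C}. open_family F a)" "J \<notin> open_family C a"
      unfolding closed_family_eq [OF C] by auto
    then obtain F where F: "F \<in> \<Sigma>" "F \<subseteq> C" "J \<in> open_family F a" by auto
    moreover have "F \<noteq> C" using F(3) J(2) by auto
    ultimately show "J \<in> (\<Union>F\<in>{F \<in> \<Sigma>. F \<subset> C}. open_family F a)" by auto
  next
    fix J assume "J \<in> (\<Union>F\<in>{F \<in> \<Sigma>. F \<subset> C}. open_family F a)"
    then obtain F where F: "F \<in> \<Sigma>" "F \<subset> C" "J \<in> open_family F a" by auto
    then have "J \<notin> open_family C a" using open_family_disjoint [OF F(1) C F(3)] by blast
    then show "J \<in> closed_family C a - open_family C a"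
      unfolding closed_family_eq [OF C] using F by auto
  qed
  show ?thesis
    unfolding eq
  proof (rule exact_at_Union)
    show "cobd_compatible (\<Union>F\<in>{F \<in> \<Sigma>. F \<subset> C}. open_family F a) (\<lambda>_ _. True)"
      unfolding eq [symmetric]
      by (rule cobd_compatible_Diff [OF compatible_closed_family [OF C] upper_part_closed_family [OF C]])
    show "F' \<le> F" if "F \<in> {F \<in> \<Sigma>. F \<subset> C}" "F' \<in> {F \<in> \<Sigma>. F \<subset> C}" "J \<in> open_family F a"
      "J - {j} \<in> open_family F' a" for F F' J j
      using open_family_label_mono [OF C, of F F' J a "J - {j}"] that by blast
    show "F = F'" if "F \<in> {F \<in> \<Sigma>. F \<subset> C}" "F' \<in> {F \<in> \<Sigma>. F \<subset> C}" "J \<in> open_family F a"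
      "J \<in> open_family F' a" for F F' J
      using open_family_disjoint [of F F' J a] that by blast
    show "finite {F \<in> \<Sigma>. F \<subset> C}" using finite_fan by simp
    show "exact_at TYPE('k) (open_family F a) (\<lambda>_ _. True) i" if "F \<in> {F \<in> \<Sigma>. F \<subset> C}" for F
      using ex that by blast
  qed
qed

lemma open_family_from_closed:
  assumes C: "C \<in> \<Sigma>"
    and cl: "exact_at TYPE('k::comm_ring_1) (closed_family C a) (\<lambda>_ _. True) i"
    and ex: "\<And>F i'. F \<in> \<Sigma> \<Longrightarrow> F \<subset> C \<Longrightarrow> i = Suc i' \<Longrightarrow>
       exact_at TYPE('k::comm_ring_1) (open_family F a) (\<lambda>_ _. True) i'"
  shows "exact_at TYPE('k) (open_family C a) (\<lambda>_ _. True) i"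
  by (rule exact_at_upper_part [OF compatible_closed_family [OF C] upper_part_closed_family [OF C] cl])
    (intro exact_at_boundary [OF C] ex)

text \<open>
  Moving slightly from \<open>a\<close> into the cone turns the closed family into an open one: an essential
  inequality that is negative at \<open>a\<close> stays negative, and one that vanishes becomes positive.
\<close>

lemma closed_family_perturb:
  assumes C: "C \<in> \<Sigma>" and b: "b \<in> cone_interior C"
  obtains e where "e > 0" "\<And>\<epsilon>. 0 < \<epsilon> \<Longrightarrow> \<epsilon> \<le> e \<Longrightarrow> closed_family C a = open_family C (a + \<epsilon> *\<^sub>R b)"
proof -
  note cp = rational_cone_properties [OF rational [OF C]]
  obtain L0 L1 where L: "finite L0" "finite L1" "L0 \<union> L1 \<subseteq> range real_vec"
    "\<And>x. x \<in> C \<longleftrightarrow> (\<forall>l\<in>L0. 0 \<le> l \<bullet> x) \<and> (\<forall>l\<in>L1. 0 \<le> l \<bullet> x)"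
    "\<And>l x. l \<in> L0 \<Longrightarrow> x \<in> C \<Longrightarrow> l \<bullet> x = 0"
    "\<And>x. x \<in> cone_interior C \<longleftrightarrow> (\<forall>l\<in>L0. 0 \<le> l \<bullet> x) \<and> (\<forall>l\<in>L1. 0 < l \<bullet> x)"
    "cone_interior C \<noteq> {}"
    by (rule rational_cone_inequalities [OF rational [OF C]]) (rule that)
  have "\<forall>l\<in>L1. \<forall>\<^sub>F \<epsilon> in at_right 0. l \<bullet> a < 0 \<longrightarrow> l \<bullet> (a + \<epsilon> *\<^sub>R b) < 0"
  proof
    fix l
    have "((\<lambda>\<epsilon>. l \<bullet> (a + \<epsilon> *\<^sub>R b)) \<longlongrightarrow> l \<bullet> (a + 0 *\<^sub>R b)) (at_right 0)"
      by (intro tendsto_intros)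
    then show "\<forall>\<^sub>F \<epsilon> in at_right 0. l \<bullet> a < 0 \<longrightarrow> l \<bullet> (a + \<epsilon> *\<^sub>R b) < 0"
      by (cases "l \<bullet> a < 0") (auto dest: order_tendstoD(2))
  qed
  then have "\<forall>\<^sub>F \<epsilon> in at_right 0. \<forall>l\<in>L1. l \<bullet> a < 0 \<longrightarrow> l \<bullet> (a + \<epsilon> *\<^sub>R b) < 0"
    using L(2) by (intro eventually_ball_finite)
  then obtain e0 where e0: "e0 > 0"
    "\<And>\<epsilon>. 0 < \<epsilon> \<Longrightarrow> \<epsilon> < e0 \<Longrightarrow> \<forall>l\<in>L1. l \<bullet> a < 0 \<longrightarrow> l \<bullet> (a + \<epsilon> *\<^sub>R b) < 0"
    unfolding eventually_at_right_field by auto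
  show ?thesis
  proof (rule that [of "e0 / 2"])
    fix \<epsilon> :: real assume \<epsilon>: "0 < \<epsilon>" "\<epsilon> \<le> e0 / 2"
    have neg: "l \<bullet> (a + \<epsilon> *\<^sub>R b) < 0" if "l \<in> L1" "l \<bullet> a < 0" for l
      using e0 \<epsilon> that by auto
    have bC: "b \<in> C" using b cone_interior_subset by auto
    show "closed_family C a = open_family C (a + \<epsilon> *\<^sub>R b)"
    proof (intro equalityI subsetI)
      fix J assume "J \<in> closed_family C a"
      then obtain t where t: "J \<subseteq> idx C" "t \<ge> 0" "a + t *\<^sub>R vsum J \<in> C"
        unfolding closed_family_def by auto
      have "\<epsilon> *\<^sub>R b + (a + t *\<^sub>R vsum J) \<in> cone_interior C"
        using t b \<epsilon> by (intro cone_interior_add cone_interior_scale rational C)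
      then show "J \<in> open_family C (a + \<epsilon> *\<^sub>R b)"
        using t unfolding open_family_def by (auto simp: algebra_simps)
    next
      fix J assume "J \<in> open_family C (a + \<epsilon> *\<^sub>R b)"
      then obtain t where t: "J \<subseteq> idx C" "t \<ge> 0" "a + \<epsilon> *\<^sub>R b + t *\<^sub>R vsum J \<in> cone_interior C"
        unfolding open_family_def by auto
      have s: "vsum J \<in> C" using t vsum_mem C by auto
      have "\<forall>l\<in>L1. \<forall>\<^sub>F t in at_top. 0 \<le> l \<bullet> (a + t *\<^sub>R vsum J)"
      proof
        fix l assume l: "l \<in> L1"
        show "\<forall>\<^sub>F t in at_top. 0 \<le> l \<bullet> (a + t *\<^sub>R vsum J)"
        proof (cases "l \<bullet> vsum J = 0")
          case True
          have "0 < l \<bullet> (a + \<epsilon> *\<^sub>R b + t *\<^sub>R vsum J)" using t(3) l L(6) by auto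
          then have "\<not> l \<bullet> a < 0" using neg [OF l] True by (auto simp: inner_add_right)
          then show ?thesis using True by (simp add: inner_add_right)
        next
          case False
          then have pos: "l \<bullet> vsum J > 0" using s l L(4) [of "vsum J"] by (auto simp: order_less_le)
          show ?thesis
          proof (rule eventually_at_top_linorderI [of "- (l \<bullet> a) / (l \<bullet> vsum J)"])
            fix t assume "- (l \<bullet> a) / (l \<bullet> vsum J) \<le> t"
            then have "- (l \<bullet> a) \<le> t * (l \<bullet> vsum J)" using pos by (simp only: pos_divide_le_eq)
            then show "0 \<le> l \<bullet> (a + t *\<^sub>R vsum J)" by (simp add: inner_add_right)
          qed
        qed
      qed
      then have "\<forall>\<^sub>F t in at_top. \<forall>l\<in>L1. 0 \<le> l \<bullet> (a + t *\<^sub>R vsum J)"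
        using L(2) by (intro eventually_ball_finite)
      then have "\<forall>\<^sub>F t in at_top. t \<ge> 0 \<and> (\<forall>l\<in>L1. 0 \<le> l \<bullet> (a + t *\<^sub>R vsum J))"
        using eventually_ge_at_top [of "0::real"] by eventually_elim auto
      then have "\<exists>t. t \<ge> 0 \<and> (\<forall>l\<in>L1. 0 \<le> l \<bullet> (a + t *\<^sub>R vsum J))"
        by (rule eventually_happens' [rotated]) simp
      then obtain t' where t': "t' \<ge> 0" "\<And>l. l \<in> L1 \<Longrightarrow> 0 \<le> l \<bullet> (a + t' *\<^sub>R vsum J)"
        by blast
      have "0 \<le> l \<bullet> (a + t' *\<^sub>R vsum J)" if l: "l \<in> L0" for l
      proof -
        have "0 \<le> l \<bullet> (a + \<epsilon> *\<^sub>R b + t *\<^sub>R vsum J)" using t(3) l L(6) by blast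
        then show ?thesis using L(5) [OF l bC] L(5) [OF l s] by (simp add: inner_add_right)
      qed
      then have "a + t' *\<^sub>R vsum J \<in> C" using t' L(4) by auto
      then show "J \<in> closed_family C a" using t t' unfolding closed_family_def by auto
    qed
  qed (use e0 in auto)
qed

text \<open>
  Sweep \<open>a\<close> along a direction \<open>b\<close> in the interior of \<open>C\<close> until, at a point \<open>p\<close>, one of the
  essential inequalities that are not positive at \<open>a\<close> becomes an equality. The open family has not
  changed up to \<open>p\<close>, and slightly behind \<open>p\<close> it is the closed family of \<open>p\<close>, which is exact by
  induction on the number of nonpositive inequalities. The two families of \<open>p\<close> differ by the open
  families of the proper faces, which are exact by induction on the dimension. At the end of the
  sweep the point is interior to \<open>C\<close>, and the open family is a full power set. Along the way and
  on the faces, \<open>- a \<notin> C\<close> remains true; at the end it excludes the cone \<open>{0}\<close>, where the power set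
  would have cohomology.
\<close>

lemma exact_at_open_family:
  assumes "C \<in> \<Sigma>" "- a \<notin> C"
  shows "exact_at TYPE('k::comm_ring_1) (open_family C a) (\<lambda>_ _. True) i"
  using assms
proof (induction "dim C" arbitrary: C a i rule: less_induct)
  case (less C a i)
  note C = \<open>C \<in> \<Sigma>\<close> and outer = less.hyps
  note cp = rational_cone_properties [OF rational [OF C]]
  obtain L0 L1 where L: "finite L0" "finite L1" "L0 \<union> L1 \<subseteq> range real_vec"
    "\<And>x. x \<in> C \<longleftrightarrow> (\<forall>l\<in>L0. 0 \<le> l \<bullet> x) \<and> (\<forall>l\<in>L1. 0 \<le> l \<bullet> x)"
    "\<And>l x. l \<in> L0 \<Longrightarrow> x \<in> C \<Longrightarrow> l \<bullet> x = 0"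
    "\<And>x. x \<in> cone_interior C \<longleftrightarrow> (\<forall>l\<in>L0. 0 \<le> l \<bullet> x) \<and> (\<forall>l\<in>L1. 0 < l \<bullet> x)"
    "cone_interior C \<noteq> {}"
    by (rule rational_cone_inequalities [OF rational [OF C]]) (rule that)
  obtain b where b: "b \<in> cone_interior C" using L(7) by auto
  then have bC: "b \<in> C" using cone_interior_subset by auto
  have b1: "0 < l \<bullet> b" if "l \<in> L1" for l using b L(6) that by auto
  have b0: "l \<bullet> b = 0" if "l \<in> L0" for l using bC L(5) that by auto
  show ?case
    using less.prems(2)
  proof (induction "card {l \<in> L1. l \<bullet> a \<le> 0}" arbitrary: a i rule: less_induct)
    case (less a i)
    show ?case
    proof (cases "\<exists>l\<in>L0. l \<bullet> a < 0")
      case True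
      then obtain l where l: "l \<in> L0" "l \<bullet> a < 0" by auto
      have "open_family C a = {}"
      proof (rule ccontr)
        assume "open_family C a \<noteq> {}"
        then obtain J t where t: "J \<subseteq> idx C" "a + t *\<^sub>R vsum J \<in> cone_interior C"
          unfolding open_family_def by auto
        then have "0 \<le> l \<bullet> (a + t *\<^sub>R vsum J)" using l L(6) by blast
        then show False using l L(5) [OF l(1) vsum_mem [OF C t(1)]] by (simp add: inner_add_right)
      qed
      then show ?thesis by (simp add: exact_at_empty)
    next
      case False
      then have a0: "0 \<le> l \<bullet> a" if "l \<in> L0" for l using that by (meson not_less)
      define A where "A = {l \<in> L1. l \<bullet> a \<le> 0}"
      have finA: "finite A" using L(2) by (simp add: A_def)
      show ?thesis
      proof (cases "A = {}")
        case True
        then have aC: "a \<in> cone_interior C" using a0 L(6) by (force simp: A_def)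
        have "C \<noteq> {0}"
        proof
          assume "C = {0}"
          then have "a = 0" using aC cone_interior_subset by auto
          then show False using less.prems \<open>C = {0}\<close> by simp
        qed
        then have ne: "idx C \<noteq> {}" using generated [OF C] by (auto simp: idx_def)
        have "open_family C a = Pow (idx C)"
          using aC unfolding open_family_def by (auto intro!: exI [of _ "0::real"])
        then show ?thesis using exact_at_Pow [OF finite_idx ne, of "\<lambda>_ _. True"] by simp
      next
        case False
        \<comment> \<open>The time at which the sweep meets the first of the hyperplanes that it has to cross.\<close>
        define t0 where "t0 = Min ((\<lambda>l. - (l \<bullet> a) / (l \<bullet> b)) ` A)"
        have "t0 \<in> (\<lambda>l. - (l \<bullet> a) / (l \<bullet> b)) ` A"
          unfolding t0_def using False finA by (intro Min_in) auto
        then obtain m where m: "m \<in> A" "t0 = - (m \<bullet> a) / (m \<bullet> b)" by auto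
        have t0_le: "t0 \<le> - (l \<bullet> a) / (l \<bullet> b)" if "l \<in> A" for l
          unfolding t0_def using that finA by (intro Min_le) auto
        have t0: "t0 \<ge> 0" unfolding m(2) using m(1) b1 by (auto simp: A_def divide_nonneg_pos intro: divide_nonpos_pos)
        define p where "p = a + t0 *\<^sub>R b"
        have pA: "l \<bullet> p \<le> 0" if "l \<in> A" for l
        proof -
          have "0 < l \<bullet> b" using that b1 by (auto simp: A_def)
          then have "t0 * (l \<bullet> b) \<le> - (l \<bullet> a)" using t0_le [OF that] by (simp only: pos_le_divide_eq)
          then show ?thesis by (simp add: p_def inner_add_right)
        qed
        have pB: "l \<bullet> p > 0" if "l \<in> L1" "l \<notin> A" for l
          using that b1 [of l] t0 by (auto simp: p_def A_def inner_add_right intro: add_pos_nonneg)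
        have p0: "l \<bullet> p = l \<bullet> a" if "l \<in> L0" for l
          using b0 [OF that] by (simp add: p_def inner_add_right)
        have mp: "m \<bullet> p = 0"
          using m b1 [of m] by (auto simp: p_def A_def inner_add_right inner_diff_right)
        have neg_p: "- p \<notin> C"
        proof
          assume "- p \<in> C"
          then have "- p + t0 *\<^sub>R b \<in> C" using cp(2) [OF _ cp(3) [OF bC t0]] by blast
          then show False using less.prems by (simp add: p_def)
        qed
        \<comment> \<open>Membership only depends on which essential inequalities are positive at \<open>x\<close>.\<close>
        have char: "J \<in> open_family C x \<longleftrightarrow> J \<subseteq> idx C \<and> (\<forall>l\<in>L1. 0 < l \<bullet> x \<or> 0 < l \<bullet> vsum J)"
          if x0: "\<And>l. l \<in> L0 \<Longrightarrow> 0 \<le> l \<bullet> x" for x J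
        proof (cases "J \<subseteq> idx C")
          case True
          then have s: "vsum J \<in> C" using vsum_mem C by auto
          have s0: "0 \<le> l \<bullet> vsum J" if "l \<in> L1" for l using L(4) s that by blast
          have "(\<exists>t\<ge>0. x + t *\<^sub>R vsum J \<in> cone_interior C) \<longleftrightarrow> (\<forall>l\<in>L1. 0 < l \<bullet> x \<or> 0 < l \<bullet> vsum J)"
          proof
            assume "\<exists>t\<ge>0. x + t *\<^sub>R vsum J \<in> cone_interior C"
            then obtain t where t: "t \<ge> 0" "\<And>l. l \<in> L1 \<Longrightarrow> 0 < l \<bullet> (x + t *\<^sub>R vsum J)"
              using L(6) by blast
            show "\<forall>l\<in>L1. 0 < l \<bullet> x \<or> 0 < l \<bullet> vsum J"
            proof
              fix l assume l: "l \<in> L1"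
              have "0 < l \<bullet> x + t * (l \<bullet> vsum J)" using t(2) [OF l] by (simp add: inner_add_right)
              then show "0 < l \<bullet> x \<or> 0 < l \<bullet> vsum J" using s0 [OF l] by (cases "l \<bullet> vsum J = 0") auto
            qed
          next
            assume *: "\<forall>l\<in>L1. 0 < l \<bullet> x \<or> 0 < l \<bullet> vsum J"
            have "\<forall>l\<in>L1. \<forall>\<^sub>F t in at_top. 0 < l \<bullet> (x + t *\<^sub>R vsum J)"
            proof
              fix l assume l: "l \<in> L1"
              show "\<forall>\<^sub>F t in at_top. 0 < l \<bullet> (x + t *\<^sub>R vsum J)"
              proof (cases "l \<bullet> vsum J = 0")
                case True
                then show ?thesis using * l by (auto simp: inner_add_right)
              next
                case False
                then have pos: "l \<bullet> vsum J > 0" using s0 [OF l] by auto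
                show ?thesis
                  using eventually_gt_at_top [of "- (l \<bullet> x) / (l \<bullet> vsum J)"]
                proof eventually_elim
                  case (elim t)
                  then have "- (l \<bullet> x) < t * (l \<bullet> vsum J)" using pos by (simp only: pos_divide_less_eq)
                  then show ?case by (simp add: inner_add_right)
                qed
              qed
            qed
            then have "\<forall>\<^sub>F t in at_top. \<forall>l\<in>L1. 0 < l \<bullet> (x + t *\<^sub>R vsum J)"
              using L(2) by (intro eventually_ball_finite)
            then have "\<forall>\<^sub>F t in at_top. t \<ge> 0 \<and> (\<forall>l\<in>L1. 0 < l \<bullet> (x + t *\<^sub>R vsum J))"
              using eventually_ge_at_top [of "0::real"] by eventually_elim auto
            then have "\<exists>t. t \<ge> 0 \<and> (\<forall>l\<in>L1. 0 < l \<bullet> (x + t *\<^sub>R vsum J))"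
              by (rule eventually_happens' [rotated]) simp
            then obtain t where t: "t \<ge> 0" "\<forall>l\<in>L1. 0 < l \<bullet> (x + t *\<^sub>R vsum J)"
              by blast
            have "0 \<le> l \<bullet> (x + t *\<^sub>R vsum J)" if "l \<in> L0" for l
              using x0 [OF that] L(5) [OF that s] by (simp add: inner_add_right)
            then show "\<exists>t\<ge>0. x + t *\<^sub>R vsum J \<in> cone_interior C" using t L(6) by blast
          qed
          then show ?thesis using True by (simp add: open_family_def)
        qed (simp add: open_family_def)
        have same: "open_family C p = open_family C a"
        proof -
          have "0 < l \<bullet> p \<longleftrightarrow> 0 < l \<bullet> a" if "l \<in> L1" for l
            using pA [of l] pB [of l] that by (cases "l \<in> A") (auto simp: A_def)
          then have "J \<in> open_family C p \<longleftrightarrow> J \<in> open_family C a" for J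
            using char [of p J] char [of a J] a0 p0 by (smt (verit, best))
          then show ?thesis by blast
        qed
        obtain e where e: "e > 0" "\<And>\<epsilon>. 0 < \<epsilon> \<Longrightarrow> \<epsilon> \<le> e \<Longrightarrow> closed_family C p = open_family C (p + \<epsilon> *\<^sub>R b)"
          by (rule closed_family_perturb [OF C b]) (rule that)
        define q where "q = p + e *\<^sub>R b"
        have neg_q: "- q \<notin> C"
        proof
          assume "- q \<in> C"
          then have "- q + e *\<^sub>R b \<in> C" using cp(2) [OF _ cp(3) [OF bC less_imp_le [OF e(1)]]] by blast
          moreover have "- q + e *\<^sub>R b = - p" by (simp add: q_def)
          ultimately show False using neg_p by metis
        qed
        \<comment> \<open>Behind \<open>p\<close>, the inequality \<open>m\<close> has become positive.\<close>
        have "{l \<in> L1. l \<bullet> q \<le> 0} \<subset> {l \<in> L1. l \<bullet> a \<le> 0}"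
        proof
          have qp: "l \<bullet> p < l \<bullet> q" if "l \<in> L1" for l
            using b1 [OF that] e by (simp add: q_def inner_add_right)
          show "{l \<in> L1. l \<bullet> q \<le> 0} \<subseteq> {l \<in> L1. l \<bullet> a \<le> 0}"
          proof safe
            fix l assume l: "l \<in> L1" "l \<bullet> q \<le> 0"
            then have "l \<in> A" using qp [of l] pB [of l] by force
            then show "l \<bullet> a \<le> 0" by (simp add: A_def)
          qed
          have "m \<in> {l \<in> L1. l \<bullet> a \<le> 0}" "m \<notin> {l \<in> L1. l \<bullet> q \<le> 0}"
            using m mp qp [of m] by (auto simp: A_def)
          then show "{l \<in> L1. l \<bullet> q \<le> 0} \<noteq> {l \<in> L1. l \<bullet> a \<le> 0}" by blast
        qed
        then have "card {l \<in> L1. l \<bullet> q \<le> 0} < card {l \<in> L1. l \<bullet> a \<le> 0}"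
          using L(2) by (intro psubset_card_mono) auto
        then have "exact_at TYPE('k) (open_family C q) (\<lambda>_ _. True) i"
          using neg_q by (rule less.hyps)
        then have cl: "exact_at TYPE('k) (closed_family C p) (\<lambda>_ _. True) i"
          using e by (simp add: q_def)
        have "exact_at TYPE('k) (open_family C p) (\<lambda>_ _. True) i"
        proof (rule open_family_from_closed [OF C cl])
          fix F i' assume F: "F \<in> \<Sigma>" "F \<subset> C"
          have "dim F < dim C" 
            using F C subset_cone_face [of F C] by (intro cone_face_dim_less) auto
          moreover have "- p \<notin> F" using F neg_p by auto
          ultimately show "exact_at TYPE('k) (open_family F p) (\<lambda>_ _. True) i'"
            by (intro outer F(1))
        qed
        then show ?thesis using same by simp
      qed
    qed
  qed
qed

text \<open>
  For \<open>- a \<in> C\<close>, the ray in direction \<open>v\<^sub>J\<close> reaches the interior from \<open>a\<close> only if \<open>v\<^sub>J\<close> itself is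
  interior, and then it does so from everywhere. Thus the family does not depend on \<open>a\<close>.
\<close>

lemma open_family_neg:
  assumes C: "C \<in> \<Sigma>" and a: "- a \<in> C" "- p \<in> C"
  shows "open_family C a \<subseteq> open_family C p"
proof
  fix J assume "J \<in> open_family C a"
  then obtain t where t: "J \<subseteq> idx C" "t \<ge> 0" "a + t *\<^sub>R vsum J \<in> cone_interior C"
    unfolding open_family_def by auto
  have "(a + t *\<^sub>R vsum J) + - a \<in> cone_interior C"
    by (rule cone_interior_add [OF rational [OF C] t(3) a(1)])
  then have ts: "t *\<^sub>R vsum J \<in> cone_interior C" by simp
  obtain c where c: "c > 0" "c *\<^sub>R (t *\<^sub>R vsum J) - (- p) \<in> cone_interior C"
    by (rule cone_interior_diff [OF rational [OF C] ts a(2)])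
  then have "p + (c * t) *\<^sub>R vsum J \<in> cone_interior C" by (simp add: add.commute)
  moreover have "c * t \<ge> 0" using c t by simp
  ultimately show "J \<in> open_family C p"
    using t(1) unfolding open_family_def by (intro CollectI conjI exI [of _ "c * t"])
qed

text \<open>
  Since the choice of \<open>- a \<in> C\<close> does not matter, \<open>- a\<close> may be taken in the interior of a facet
  \<open>F\<^sub>0\<close> of \<open>C\<close>. Slightly further inside, \<open>exact_at_open_family\<close> applies, so the closed family is
  exact. In the boundary, all faces other than \<open>F\<^sub>0\<close> are covered by that lemma too, and \<open>F\<^sub>0\<close> is
  exact below \<open>dim C - 1\<close> by induction, which is enough since the connecting homomorphism raises
  the degree by one.
\<close>

lemma exact_at_open_family_below_dim:
  assumes "C \<in> \<Sigma>" "- a \<in> C" "i < dim C"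
  shows "exact_at TYPE('k::comm_ring_1) (open_family C a) (\<lambda>_ _. True) i"
  using assms
proof (induction "dim C" arbitrary: C a i rule: less_induct)
  case (less C a i)
  note C = \<open>C \<in> \<Sigma>\<close> and outer = less.hyps
  note cp = rational_cone_properties [OF rational [OF C]]
  have "C \<noteq> {0}" using less.prems by auto
  then obtain F0 where F0: "cone_face F0 C" "F0 \<noteq> C" "dim C = Suc (dim F0)"
    by (rule cone_facet_exists [OF rational [OF C] pointed [OF C]])
  have F0S: "F0 \<in> \<Sigma>" using F0 face_mem C by auto
  obtain p where p: "- p \<in> cone_interior F0"
  proof (rule interior_point [OF F0S])
    fix b assume "b \<in> cone_interior F0"
    then show thesis using that [of "- b"] by simp
  qed
  have pF0: "- p \<in> F0" using p cone_interior_subset by blast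
  then have pC: "- p \<in> C" using cone_face_subset [OF F0(1)] by auto
  have same: "open_family C a = open_family C p"
    using open_family_neg [OF C less.prems(2) pC] open_family_neg [OF C pC less.prems(2)]
    by (rule subset_antisym)
  obtain b where b: "b \<in> cone_interior C"
    by (rule interior_point [OF C])
  obtain e where e: "e > 0" "\<And>\<epsilon>. 0 < \<epsilon> \<Longrightarrow> \<epsilon> \<le> e \<Longrightarrow> closed_family C p = open_family C (p + \<epsilon> *\<^sub>R b)"
    by (rule closed_family_perturb [OF C b]) (rule that)
  have neg: "- (p + e *\<^sub>R b) \<notin> C"
  proof
    assume "- (p + e *\<^sub>R b) \<in> C"
    moreover have "e *\<^sub>R b \<in> cone_interior C" by (rule cone_interior_scale [OF rational [OF C] b e(1)])
    ultimately have "e *\<^sub>R b + - (p + e *\<^sub>R b) \<in> cone_interior C"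
      by (intro cone_interior_add rational C)
    then have "- p \<in> cone_interior C" by simp
    then show False using cone_face_interior [OF F0(1)] pF0 F0(2) by auto
  qed
  then have cl: "exact_at TYPE('k) (closed_family C p) (\<lambda>_ _. True) i"
    using e(2) [of e] e(1) exact_at_open_family [OF C neg] by simp
  have "exact_at TYPE('k) (open_family C p) (\<lambda>_ _. True) i"
  proof (rule open_family_from_closed [OF C cl])
    fix F i' assume F: "F \<in> \<Sigma>" "F \<subset> C" and i: "i = Suc i'"
    show "exact_at TYPE('k) (open_family F p) (\<lambda>_ _. True) i'"
    proof (cases "- p \<in> F")
      case False
      then show ?thesis using exact_at_open_family F by blast
    next
      case True
      have "F0 \<subseteq> F" using interior_point_le [OF F0S F(1) p True] .
      moreover have "dim F < dim C"
        using F C subset_cone_face [of F C] by (intro cone_face_dim_less) auto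
      ultimately have "F0 = F"
        using cone_face_dim_less [OF subset_cone_face [OF F0S F(1)]] F0(3) by fastforce
      then show ?thesis using less.hyps [of F0 p i'] pF0 F0S F0(3) less.prems(3) i by auto
    qed
  qed
  then show ?case using same by simp
qed

end

section \<open>Affine monoids and their cones\<close>

lemma real_vec_simps [simp]:
  "real_vec 0 = 0" "real_vec (x + y) = real_vec x + real_vec y" "real_vec (- x) = - real_vec x"
  "real_vec (x - y) = real_vec x - real_vec y" "real_vec (c *s x) = of_int c *\<^sub>R real_vec x"
  by (simp_all add: real_vec_def vec_eq_iff)

lemma real_vec_sum: "real_vec (sum f A) = (\<Sum>x\<in>A. real_vec (f x))"
  by (induction A rule: infinite_finite_induct) auto

lemma real_vec_eq_iff [simp]: "real_vec x = real_vec y \<longleftrightarrow> x = y"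
  by (simp add: real_vec_def vec_eq_iff)

lemma add_submonoid_hull: "add_submonoid (add_submonoid hull S)"
  by (rule hull_in) (auto simp: add_submonoid_def)

lemma affine_monoid_submonoid: "affine_monoid M \<Longrightarrow> add_submonoid M"
  using add_submonoid_hull by (auto simp: affine_monoid_def)

lemma submonoid_sum:
  assumes "add_submonoid M" "\<And>i. i \<in> A \<Longrightarrow> f i \<in> M"
  shows "sum f A \<in> M"
  using assms(2) by (induction A rule: infinite_finite_induct) (use assms(1) in \<open>auto simp: add_submonoid_def\<close>)

lemma submonoid_nat_scale:
  assumes "add_submonoid M" "x \<in> M"
  shows "int n *s x \<in> M"
proof (induction n)
  case (Suc n)
  have "int (Suc n) *s x = x + int n *s x" by (simp add: vec_eq_iff algebra_simps)
  then show ?case using Suc assms unfolding add_submonoid_def by metis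
qed (use assms in \<open>simp add: add_submonoid_def\<close>)

lemma submonoid_scale:
  assumes "add_submonoid M" "x \<in> M" "c \<ge> 0"
  shows "c *s x \<in> M"
  using submonoid_nat_scale [OF assms(1,2), of "nat c"] assms(3) by simp

lemma subgroup_hull_of_submonoid:
  assumes M: "add_submonoid M"
  shows "add_subgroup hull M = {u - w |u w. u \<in> M \<and> w \<in> M}"
proof
  show "add_subgroup hull M \<subseteq> {u - w |u w. u \<in> M \<and> w \<in> M}"
  proof (rule hull_minimal)
    show "M \<subseteq> {u - w |u w. u \<in> M \<and> w \<in> M}"
    proof
      fix x assume "x \<in> M"
      moreover have "x = x - 0" by simp
      ultimately show "x \<in> {u - w |u w. u \<in> M \<and> w \<in> M}"
        using M unfolding add_submonoid_def by blast
    qed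
    show "add_subgroup {u - w |u w. u \<in> M \<and> w \<in> M}"
      unfolding add_subgroup_def
    proof (intro conjI ballI)
      have "0 = (0::int^'a) - 0" by simp
      then show "0 \<in> {u - w |u w. u \<in> M \<and> w \<in> M}"
        using M unfolding add_submonoid_def by blast
      fix x y assume "x \<in> {u - w |u w. u \<in> M \<and> w \<in> M}" "y \<in> {u - w |u w. u \<in> M \<and> w \<in> M}"
      then obtain u w u' w' where uw: "x = u - w" "y = u' - w'" "u \<in> M" "w \<in> M" "u' \<in> M" "w' \<in> M"
        by auto
      have "x - y = (u + w') - (w + u')" by (simp add: uw)
      moreover have "u + w' \<in> M" "w + u' \<in> M" using uw M unfolding add_submonoid_def by auto
      ultimately show "x - y \<in> {u - w |u w. u \<in> M \<and> w \<in> M}" by blast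
    qed
  qed
  have sub: "add_subgroup (add_subgroup hull M)"
    by (rule hull_in) (auto simp: add_subgroup_def)
  then show "{u - w |u w. u \<in> M \<and> w \<in> M} \<subseteq> add_subgroup hull M"
    using hull_subset [of M add_subgroup] unfolding add_subgroup_def by blast
qed

lemma subgroup_hull_closed:
  assumes "x \<in> add_subgroup hull M" "y \<in> add_subgroup hull M"
  shows "x + y \<in> add_subgroup hull M" "x - y \<in> add_subgroup hull M" "- x \<in> add_subgroup hull M"
proof -
  have sub: "add_subgroup (add_subgroup hull M)"
    by (rule hull_in) (auto simp: add_subgroup_def)
  then have d: "a - b \<in> add_subgroup hull M" if "a \<in> add_subgroup hull M" "b \<in> add_subgroup hull M" for a b
    using that unfolding add_subgroup_def by auto
  have z: "0 \<in> add_subgroup hull M" using sub unfolding add_subgroup_def by auto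
  show "x - y \<in> add_subgroup hull M" using d assms by auto
  show m: "- x \<in> add_subgroup hull M" using d [OF z assms(1)] by simp
  show "x + y \<in> add_subgroup hull M" using d [OF assms(1) d [OF z assms(2)]] by simp
qed

lemma subgroup_hull_scale:
  assumes "x \<in> add_subgroup hull M"
  shows "c *s x \<in> add_subgroup hull M"
proof -
  have z: "0 \<in> add_subgroup hull M" using subgroup_hull_closed(2) [OF assms assms] by simp
  have n: "int n *s x \<in> add_subgroup hull M" for n
  proof (induction n)
    case (Suc n)
    have "int (Suc n) *s x = x + int n *s x" by (simp add: vec_eq_iff algebra_simps)
    then show ?case using subgroup_hull_closed(1) [OF assms Suc] by metis
  qed (use z in simp)
  show ?thesis
  proof (cases "c \<ge> 0")
    case True then show ?thesis using n [of "nat c"] by simp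
  next
    case False
    then have "c *s x = - (int (nat (- c)) *s x)" by (simp add: vec_eq_iff)
    then show ?thesis using subgroup_hull_closed(3) [OF n n] by metis
  qed
qed

lemma convex_cone_hull_combination:
  assumes "x \<in> convex_cone hull S"
  obtains T c where "finite T" "T \<subseteq> S" "\<And>s. 0 \<le> c s" "x = (\<Sum>s\<in>T. c s *\<^sub>R s)"
proof -
  define K where "K = {x. \<exists>T c. finite T \<and> T \<subseteq> S \<and> (\<forall>s. 0 \<le> (c s :: real)) \<and> x = (\<Sum>s\<in>T. c s *\<^sub>R s)}"
  have "convex_cone hull S \<subseteq> K"
  proof (rule hull_minimal)
    show "S \<subseteq> K"
    proof
      fix s assume "s \<in> S"
      then show "s \<in> K"
        unfolding K_def by (intro CollectI exI [of _ "{s}"] exI [of _ "\<lambda>_. 1"]) auto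
    qed
    show "convex_cone K"
      unfolding convex_cone_iff
    proof (intro conjI ballI allI impI)
      show "0 \<in> K"
        unfolding K_def by (intro CollectI exI [of _ "{}"] exI [of _ "\<lambda>_. 1"]) auto
      fix x assume "x \<in> K"
      then obtain T c where x: "finite T" "T \<subseteq> S" "\<And>s. 0 \<le> (c s :: real)" "x = (\<Sum>s\<in>T. c s *\<^sub>R s)"
        unfolding K_def by auto
      show "r *\<^sub>R x \<in> K" if "r \<ge> 0" for r
        unfolding K_def using x that
        by (intro CollectI exI [of _ T] exI [of _ "\<lambda>s. r * c s"]) (auto simp: scaleR_sum_right)
      fix y assume "y \<in> K"
      then obtain T' c' where y: "finite T'" "T' \<subseteq> S" "\<And>s. 0 \<le> (c' s :: real)" "y = (\<Sum>s\<in>T'. c' s *\<^sub>R s)"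
        unfolding K_def by auto
      define d where "d = (\<lambda>s. (if s \<in> T then c s else 0) + (if s \<in> T' then c' s else 0))"
      have "(\<Sum>s\<in>T \<union> T'. d s *\<^sub>R s) =
          (\<Sum>s\<in>T \<union> T'. (if s \<in> T then c s else 0) *\<^sub>R s) + (\<Sum>s\<in>T \<union> T'. (if s \<in> T' then c' s else 0) *\<^sub>R s)"
        by (simp add: d_def scaleR_add_left sum.distrib)
      also have "(\<Sum>s\<in>T \<union> T'. (if s \<in> T then c s else 0) *\<^sub>R s) = x"
        unfolding x(4) using x(1) y(1) by (intro sum.mono_neutral_cong_right) auto
      also have "(\<Sum>s\<in>T \<union> T'. (if s \<in> T' then c' s else 0) *\<^sub>R s) = y"
        unfolding y(4) using x(1) y(1) by (intro sum.mono_neutral_cong_right) auto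
      finally show "x + y \<in> K"
        unfolding K_def using x y
        by (intro CollectI exI [of _ "T \<union> T'"] exI [of _ d]) (auto simp: d_def)
    qed
  qed
  then show ?thesis using assms that unfolding K_def by blast
qed

text \<open>
  By simultaneous Diophantine approximation some multiple \<open>p y\<close> of a nonnegative real combination
  of lattice points differs by less than one from an integral combination, hence not at all.
\<close>

lemma multiple_in_monoid:
  fixes y :: "int ^ 'd"
  assumes M: "add_submonoid M" and y: "real_vec y \<in> convex_cone hull (real_vec ` M)"
  obtains p where "p > 0" "p *s y \<in> M"
proof -
  obtain T0 c0 where T0: "finite T0" "T0 \<subseteq> real_vec ` M" "\<And>s. 0 \<le> c0 s" "real_vec y = (\<Sum>s\<in>T0. c0 s *\<^sub>R s)"
    by (rule convex_cone_hull_combination [OF y]) (rule that)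
  obtain T where T: "T \<subseteq> M" "finite T" "T0 = real_vec ` T"
    using finite_subset_image [OF T0(1,2)] by blast
  have inj: "inj_on real_vec T" by (auto simp: inj_on_def)
  define c where "c = (\<lambda>s. c0 (real_vec s))"
  have c0: "c s \<ge> 0" for s using T0 by (simp add: c_def)
  have yc: "real_vec y = (\<Sum>s\<in>T. c s *\<^sub>R real_vec s)"
    unfolding T0(4) T(3) c_def by (simp add: sum.reindex [OF inj])
  obtain h n where h: "bij_betw h {..<n::nat} T"
    using ex_bij_betw_nat_finite [OF T(2)] by (auto simp: lessThan_atLeast0)
  \<comment> \<open>An approximation with errors below \<open>1 / B\<close> changes each coordinate by less than one.\<close>
  define B where "B = (\<Sum>s\<in>T. \<Sum>i\<in>UNIV. \<bar>real_of_int (s $ i)\<bar>)"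
  obtain N :: nat where N: "N > 0" "B < N"
    using reals_Archimedean2 [of "max B 0"] by (metis max_less_iff_conj of_nat_0_less_iff)
  obtain q p where q: "0 < q" "\<And>i. i < n \<Longrightarrow> \<bar>of_int q * c (h i) - of_int (p i)\<bar> < 1 / N"
    using Dirichlet_approx_simult [OF N(1), of n "\<lambda>i. c (h i)"] by metis
  define m where "m = (\<lambda>s. p (inv_into {..<n} h s))"
  have m: "\<bar>of_int q * c s - of_int (m s)\<bar> < 1 / N" if "s \<in> T" for s
    using q(2) [of "inv_into {..<n} h s"] that h
    by (metis bij_betw_inv_into_right bij_betw_apply bij_betw_inv_into lessThan_iff m_def)
  have m0: "m s \<ge> 0" if "s \<in> T" for s
  proof -
    have "0 \<le> of_int q * c s" using q c0 by simp
    moreover have "1 / real N \<le> 1" using N by simp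
    ultimately have "real_of_int (m s) > -1" using m [OF that] by linarith
    then show ?thesis by linarith
  qed
  define z where "z = q *s y - (\<Sum>s\<in>T. m s *s s)"
  have "z $ i = 0" for i
  proof -
    have "real_vec z = (\<Sum>s\<in>T. (of_int q * c s - of_int (m s)) *\<^sub>R real_vec s)"
      by (simp add: z_def yc real_vec_sum scaleR_sum_right scaleR_diff_left sum_subtractf)
    then have "real_of_int (z $ i) = (\<Sum>s\<in>T. (of_int q * c s - of_int (m s)) * real_of_int (s $ i))"
      by (simp add: real_vec_def vec_eq_iff)
    then have "\<bar>real_of_int (z $ i)\<bar> \<le> (\<Sum>s\<in>T. \<bar>(of_int q * c s - of_int (m s)) * real_of_int (s $ i)\<bar>)"
      by simp
    also have "\<dots> \<le> (\<Sum>s\<in>T. (1 / N) * (\<Sum>i\<in>UNIV. \<bar>real_of_int (s $ i)\<bar>))"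
    proof (rule sum_mono)
      fix s assume s: "s \<in> T"
      have "\<bar>real_of_int (s $ i)\<bar> \<le> (\<Sum>i\<in>UNIV. \<bar>real_of_int (s $ i)\<bar>)"
        by (rule member_le_sum) auto
      then show "\<bar>(of_int q * c s - of_int (m s)) * real_of_int (s $ i)\<bar> \<le> (1 / N) * (\<Sum>i\<in>UNIV. \<bar>real_of_int (s $ i)\<bar>)"
        unfolding abs_mult using m [OF s] by (intro mult_mono) auto
    qed
    also have "\<dots> = B / N" by (simp add: B_def sum_divide_distrib)
    also have "\<dots> < 1" using N by simp
    finally show ?thesis by simp
  qed
  then have "z = 0" by (simp add: vec_eq_iff)
  then have qy: "q *s y = (\<Sum>s\<in>T. m s *s s)" unfolding z_def by simp
  have "(\<Sum>s\<in>T. m s *s s) \<in> M"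
  proof (rule submonoid_sum [OF M])
    fix s assume "s \<in> T"
    then show "m s *s s \<in> M" using submonoid_scale [OF M] T(1) m0 by auto
  qed
  then show ?thesis by (intro that [OF q(1)]) (simp only: qy)
qed

text \<open>
  Write \<open>y\<close> as a difference \<open>u - w\<close> of elements of the monoid. As \<open>y\<close> is interior, a large
  multiple of \<open>y\<close> minus \<open>w\<close> is still in the cone, so a multiple of it is in the monoid; with this,
  all large multiples of \<open>y\<close> are in the monoid. Then seminormality descends from the multiples
  \<open>n y\<close> with \<open>n > j\<close> to \<open>j y\<close>, because \<open>2 j > j\<close> and \<open>3 j > j\<close>.
\<close>

lemma interior_lattice_point:
  fixes y :: "int ^ 'd"
  assumes M: "add_submonoid M" and sn: "seminormal M"
    and C: "rational_cone C" "convex_cone hull (real_vec ` M) = C"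
    and y: "y \<in> add_subgroup hull M" "real_vec y \<in> cone_interior C"
  shows "y \<in> M"
proof -
  obtain u w where uw: "y = u - w" "u \<in> M" "w \<in> M"
    using y(1) subgroup_hull_of_submonoid [OF M] by auto
  have wC: "real_vec w \<in> C" using uw C(2) by (metis hull_inc imageI)
  obtain c where c: "c > 0" "c *\<^sub>R real_vec y - real_vec w \<in> cone_interior C"
    by (rule cone_interior_diff [OF C(1) y(2) wC])
  define q where "q = \<lceil>c\<rceil>"
  have q: "c \<le> of_int q" "q > 0" using c(1) by (auto simp: q_def)
  have "(c *\<^sub>R real_vec y - real_vec w) + (of_int q - c) *\<^sub>R real_vec y \<in> C"
  proof (rule rational_cone_properties(2) [OF C(1)])
    show "c *\<^sub>R real_vec y - real_vec w \<in> C" using c(2) cone_interior_subset by blast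
    have "real_vec y \<in> C" using y(2) cone_interior_subset by blast
    then show "(of_int q - c) *\<^sub>R real_vec y \<in> C"
      by (rule rational_cone_properties(3) [OF C(1)]) (use q in simp)
  qed
  moreover have "(c *\<^sub>R real_vec y - real_vec w) + (of_int q - c) *\<^sub>R real_vec y = real_vec (q *s y - w)"
    by (simp add: scaleR_diff_left)
  ultimately have "real_vec (q *s y - w) \<in> convex_cone hull (real_vec ` M)"
    unfolding C(2) by (simp only:)
  then obtain m where m: "m > 0" "m *s (q *s y - w) \<in> M"
    by (rule multiple_in_monoid [OF M])
  define s where "s = m *s (q *s y - w)"
  define Q where "Q = m * q"
  have Q: "Q > 0" using m q by (simp add: Q_def)
  have large: "n *s y \<in> M" if n: "n \<ge> Q * Q" for n
  proof -
    define k where "k = n div Q"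
    define \<rho> where "\<rho> = n mod Q"
    have nk: "n = k * Q + \<rho>" "0 \<le> \<rho>" "\<rho> < Q" using Q by (auto simp: k_def \<rho>_def)
    have "Q * Q div Q \<le> k" unfolding k_def using n Q by (intro zdiv_mono1)
    then have "Q \<le> k" using Q by simp
    moreover have "k \<le> k * m" using calculation m Q mult_left_mono [of 1 m k] by simp
    ultimately have k: "\<rho> \<le> k * m" "k \<ge> 0" using nk Q by linarith+
    \<comment> \<open>The three coefficients are nonnegative because \<open>\<rho> < Q \<le> k\<close>.\<close>
    have "n *s y = \<rho> *s u + (k * m - \<rho>) *s w + k *s s"
      unfolding nk(1) s_def Q_def uw(1) by (simp add: vec_eq_iff algebra_simps)
    moreover have "\<rho> *s u \<in> M" "(k * m - \<rho>) *s w \<in> M" "k *s s \<in> M"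
      using submonoid_scale [OF M uw(2) nk(2)] submonoid_scale [OF M uw(3), of "k * m - \<rho>"]
        submonoid_scale [OF M m(2) k(2)] k(1) by (simp_all only: s_def diff_ge_0_iff_ge)
    moreover have add: "\<And>x y. x \<in> M \<Longrightarrow> y \<in> M \<Longrightarrow> x + y \<in> M"
      using M unfolding add_submonoid_def by blast
    ultimately show ?thesis by (simp only: add)
  qed
  have desc: "\<forall>n\<ge>int (Suc 0). n *s y \<in> M" if "\<forall>n\<ge>int (Suc j). n *s y \<in> M" for j
    using that
  proof (induction j)
    case (Suc j)
    have "2 *s (int (Suc j) *s y) \<in> M" "3 *s (int (Suc j) *s y) \<in> M"
      unfolding vector_smult_assoc by (rule Suc.prems [rule_format], simp)+
    then have "int (Suc j) *s y \<in> M"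
      using sn subgroup_hull_scale [OF y(1)] unfolding seminormal_def by blast
    then have "n *s y \<in> M" if "n \<ge> int (Suc j)" for n
      using Suc.prems that by (cases "n = int (Suc j)") auto
    then show ?case using Suc.IH by blast
  qed auto
  have "\<forall>n\<ge>int (Suc (nat (Q * Q))). n *s y \<in> M" using large Q by auto
  from desc [OF this] have "\<forall>n\<ge>1. n *s y \<in> M" by simp
  then have "1 *s y \<in> M" by blast
  then show ?thesis by simp
qed

section \<open>Seminormal monoidal complexes\<close>

lemma exact_at_cong:
  assumes "\<And>J J'. J \<in> P \<Longrightarrow> J' \<in> P \<Longrightarrow> W J' J = W' J' J"
  shows "exact_at T P W i \<longleftrightarrow> exact_at T P W' i"
proof -
  have "cobd P W f J = cobd P W' f J" if "J \<in> P" for f :: "nat set \<Rightarrow> 'a" and J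
    unfolding cobd_def using assms that by (intro sum.cong) auto
  then show ?thesis unfolding exact_at_def by (metis (no_types, lifting))
qed

locale seminormal_toric =
  fixes \<Sigma> :: "(real ^ 'd) set set" and M :: "(real ^ 'd) set \<Rightarrow> (int ^ 'd) set"
  assumes fan: "rational_pointed_fan \<Sigma>"
    and complex: "monoidal_complex \<Sigma> M"
    and seminormal: "seminormal_complex \<Sigma> M"
begin

lemma rational: "C \<in> \<Sigma> \<Longrightarrow> rational_cone C"
  and face_mem: "C \<in> \<Sigma> \<Longrightarrow> cone_face F C \<Longrightarrow> F \<in> \<Sigma>"
  and inter_face: "C \<in> \<Sigma> \<Longrightarrow> D \<in> \<Sigma> \<Longrightarrow> cone_face (C \<inter> D) C"
  and inter_face': "C \<in> \<Sigma> \<Longrightarrow> D \<in> \<Sigma> \<Longrightarrow> cone_face (C \<inter> D) D"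
  and finite_fan: "finite \<Sigma>" and fan_nonempty: "\<Sigma> \<noteq> {}"
  using fan unfolding rational_pointed_fan_def by blast+

lemma affine: "C \<in> \<Sigma> \<Longrightarrow> affine_monoid (M C)"
  and real_vec_in: "C \<in> \<Sigma> \<Longrightarrow> a \<in> M C \<Longrightarrow> real_vec a \<in> C"
  and cone_hull: "C \<in> \<Sigma> \<Longrightarrow> convex_cone hull (real_vec ` M C) = C"
  and face_monoid: "C \<in> \<Sigma> \<Longrightarrow> cone_face D C \<Longrightarrow> M D = {a \<in> M C. real_vec a \<in> D}"
  using complex unfolding monoidal_complex_def by blast+

lemma submonoid: "C \<in> \<Sigma> \<Longrightarrow> add_submonoid (M C)"
  using affine affine_monoid_submonoid by blast

lemma zero_mem: "C \<in> \<Sigma> \<Longrightarrow> 0 \<in> M C"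
  and add_mem: "C \<in> \<Sigma> \<Longrightarrow> a \<in> M C \<Longrightarrow> b \<in> M C \<Longrightarrow> a + b \<in> M C"
  using submonoid unfolding add_submonoid_def by blast+

lemma scale_mem: "C \<in> \<Sigma> \<Longrightarrow> a \<in> M C \<Longrightarrow> 0 \<le> n \<Longrightarrow> n *s a \<in> M C"
  using submonoid submonoid_scale by blast

lemma mem_other_cone:
  assumes "C \<in> \<Sigma>" "D \<in> \<Sigma>" "a \<in> M C" "real_vec a \<in> D"
  shows "a \<in> M D"
proof -
  have "a \<in> M (C \<inter> D)"
    using face_monoid [OF assms(1) inter_face [OF assms(1,2)]] real_vec_in assms by auto
  then show ?thesis
    using face_monoid [OF assms(2) inter_face' [OF assms(1,2)]] by auto
qed

lemma mem_mono:
  assumes "C \<in> \<Sigma>" "D \<in> \<Sigma>" "C \<subseteq> D" "a \<in> M C"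
  shows "a \<in> M D"
  using mem_other_cone [OF assms(1,2,4)] real_vec_in [OF assms(1,4)] assms(3) by blast

text \<open>
  If a product of two monomials is nonzero and belongs to the ring of \<open>D\<close>, then so do its factors,
  because \<open>C \<inter> D\<close> is a face of \<open>C\<close>.
\<close>

lemma summands_mem:
  assumes C: "C \<in> \<Sigma>" and D: "D \<in> \<Sigma>" and ab: "a \<in> M C" "b \<in> M C" and "real_vec (a + b) \<in> D"
  shows "a \<in> M D" "b \<in> M D"
proof -
  have "real_vec a \<in> C" "real_vec b \<in> C" "real_vec a + real_vec b \<in> C \<inter> D"
    using assms add_mem [OF C ab] real_vec_in [OF C] by force+
  then have "real_vec a \<in> C \<inter> D" "real_vec b \<in> C \<inter> D"
    using cone_face_summands [OF inter_face [OF C D]] by blast+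
  then show "a \<in> M D" "b \<in> M D" using mem_other_cone [OF C D] ab by auto
qed

lemma interior_le:
  assumes "C \<in> \<Sigma>" "D \<in> \<Sigma>" "x \<in> cone_interior D" "x \<in> C"
  shows "D \<subseteq> C"
  using cone_face_interior [OF inter_face [OF assms(2,1)] assms(3)] assms cone_interior_subset by blast

lemma interior_cone:
  assumes C: "C \<in> \<Sigma>" and a: "a \<in> M C"
  obtains D where "D \<in> \<Sigma>" "D \<subseteq> C" "a \<in> M D" "real_vec a \<in> cone_interior D"
proof -
  obtain D where D: "cone_face D C" "real_vec a \<in> cone_interior D"
    by (rule cone_face_of_point [OF rational [OF C] real_vec_in [OF C a]])
  have "D \<in> \<Sigma>" using face_mem [OF C D(1)] .
  moreover have "a \<in> M D"
    using face_monoid [OF C D(1)] a D(2) cone_interior_subset by blast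
  ultimately show ?thesis using that cone_face_subset [OF D(1)] D(2) by blast
qed

lemma interior_mem:
  assumes D: "D \<in> \<Sigma>" and "y \<in> add_subgroup hull (M D)" "real_vec y \<in> cone_interior D"
  shows "y \<in> M D"
  using interior_lattice_point [OF submonoid [OF D] _ rational [OF D] cone_hull [OF D] assms(2,3)]
    seminormal D unfolding seminormal_complex_def by blast

lemma root_mem:
  assumes D: "D \<in> \<Sigma>" and z: "z \<in> support \<Sigma> M" "int k *s z \<in> M D" "k > 0"
  shows "z \<in> M D"
proof -
  obtain E where E: "E \<in> \<Sigma>" "z \<in> M E" using z(1) unfolding support_def by blast
  have "(1 / real k) *\<^sub>R real_vec (int k *s z) \<in> D"
    using rational_cone_properties(3) [OF rational [OF D] real_vec_in [OF D z(2)], of "1 / real k"] by simp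
  then have "real_vec z \<in> D" using z(3) by simp
  then show ?thesis by (rule mem_other_cone [OF E(1) D E(2)])
qed

text \<open>
  In the toric face ring this says that the product of the monomials of degrees \<open>a\<close> and \<open>b\<close> is not
  zero.
\<close>

definition compat :: "int ^ 'd \<Rightarrow> int ^ 'd \<Rightarrow> bool" where
  "compat a b \<longleftrightarrow> (\<exists>C\<in>\<Sigma>. a \<in> M C \<and> b \<in> M C)"

lemma compat_sym: "compat a b \<longleftrightarrow> compat b a"
  unfolding compat_def by blast

lemma compat_zero: "a \<in> support \<Sigma> M \<Longrightarrow> compat 0 a"
  unfolding compat_def support_def using zero_mem by blast

lemma compat_support: "compat a b \<Longrightarrow> a \<in> support \<Sigma> M \<and> b \<in> support \<Sigma> M \<and> a + b \<in> support \<Sigma> M"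
  unfolding compat_def support_def using add_mem by blast

lemma compat_assoc: "compat a b \<and> compat (a + b) c \<longleftrightarrow> (\<exists>C\<in>\<Sigma>. a \<in> M C \<and> b \<in> M C \<and> c \<in> M C)"
proof
  assume *: "compat a b \<and> compat (a + b) c"
  then obtain C D where CD: "C \<in> \<Sigma>" "a \<in> M C" "b \<in> M C" "D \<in> \<Sigma>" "a + b \<in> M D" "c \<in> M D"
    unfolding compat_def by blast
  then have "a \<in> M D" "b \<in> M D"
    using summands_mem [OF CD(1,4,2,3) real_vec_in [OF CD(4,5)]] by auto
  then show "\<exists>C\<in>\<Sigma>. a \<in> M C \<and> b \<in> M C \<and> c \<in> M C" using CD by blast
next
  assume "\<exists>C\<in>\<Sigma>. a \<in> M C \<and> b \<in> M C \<and> c \<in> M C"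
  then show "compat a b \<and> compat (a + b) c"
    unfolding compat_def using add_mem by blast
qed

text \<open>
  A form of the Artin--Rees lemma: if the monomial of degree \<open>(n + 1) y + c\<close> is divisible by a
  high power of \<open>X\<close> to the \<open>x\<close>, then the one of degree \<open>y + c\<close> is divisible by its \<open>p\<close>-th power.
  Both degrees lie in the interior of one cone \<open>D\<close>, on which \<open>y + c - p x\<close> has to satisfy the
  essential inequalities strictly. For an inequality that vanishes at \<open>x\<close> this is inherited from
  \<open>(n + 1) y + c\<close>; for one that is positive at \<open>x\<close> it follows from the divisibility by a high
  power. In the interior of \<open>D\<close>, seminormality turns membership in the group into membership in
  the monoid.
\<close>

lemma artin_rees:
  fixes n p :: nat
  assumes x: "x \<in> support \<Sigma> M" and y: "y \<in> support \<Sigma> M"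
  shows "\<forall>\<^sub>F p' in sequentially. \<forall>c s. compat (int (Suc n) *s y) c \<longrightarrow> compat (int p' *s x) s \<longrightarrow>
    int (Suc n) *s y + c = int p' *s x + s \<longrightarrow>
    (\<exists>D\<in>\<Sigma>. \<exists>u\<in>M D. y \<in> M D \<and> c \<in> M D \<and> x \<in> M D \<and> y + c = int p *s x + u)"
proof -
  define good where "good = (\<lambda>D p'. \<forall>c. y \<in> M D \<longrightarrow> c \<in> M D \<longrightarrow> x \<in> M D \<longrightarrow>
      real_vec (int (Suc n) *s y + c) \<in> cone_interior D \<longrightarrow>
      real_vec (int (Suc n) *s y + c) - real p' *\<^sub>R real_vec x \<in> D \<longrightarrow>
      real_vec (y + c - int p *s x) \<in> cone_interior D)"
  have "\<forall>\<^sub>F p' in sequentially. good D p'" if D: "D \<in> \<Sigma>" for D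
  proof -
    obtain L0 L1 where L: "finite L0" "finite L1" "L0 \<union> L1 \<subseteq> range real_vec"
      "\<And>x. x \<in> D \<longleftrightarrow> (\<forall>l\<in>L0. 0 \<le> l \<bullet> x) \<and> (\<forall>l\<in>L1. 0 \<le> l \<bullet> x)"
      "\<And>l x. l \<in> L0 \<Longrightarrow> x \<in> D \<Longrightarrow> l \<bullet> x = 0"
      "\<And>x. x \<in> cone_interior D \<longleftrightarrow> (\<forall>l\<in>L0. 0 \<le> l \<bullet> x) \<and> (\<forall>l\<in>L1. 0 < l \<bullet> x)"
      "cone_interior D \<noteq> {}"
      by (rule rational_cone_inequalities [OF rational [OF D]]) (rule that)
    have "\<forall>l\<in>L1. \<forall>\<^sub>F p' in sequentially. 0 < l \<bullet> real_vec x \<longrightarrow>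
        real n * (l \<bullet> real_vec y) + real p * (l \<bullet> real_vec x) < real p' * (l \<bullet> real_vec x)"
    proof
      fix l
      show "\<forall>\<^sub>F p' in sequentially. 0 < l \<bullet> real_vec x \<longrightarrow>
        real n * (l \<bullet> real_vec y) + real p * (l \<bullet> real_vec x) < real p' * (l \<bullet> real_vec x)"
      proof (cases "0 < l \<bullet> real_vec x")
        case True
        obtain N where N: "(real n * (l \<bullet> real_vec y) + real p * (l \<bullet> real_vec x)) / (l \<bullet> real_vec x) < real N"
          using reals_Archimedean2 by blast
        show ?thesis
        proof (rule eventually_sequentiallyI [of N], intro impI)
          fix p' assume "N \<le> p'"
          then have "(real n * (l \<bullet> real_vec y) + real p * (l \<bullet> real_vec x)) / (l \<bullet> real_vec x) < real p'"
            using N by simp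
          then show "real n * (l \<bullet> real_vec y) + real p * (l \<bullet> real_vec x) < real p' * (l \<bullet> real_vec x)"
            using True by (simp only: pos_divide_less_eq)
        qed
      qed simp
    qed
    then have "\<forall>\<^sub>F p' in sequentially. \<forall>l\<in>L1. 0 < l \<bullet> real_vec x \<longrightarrow>
        real n * (l \<bullet> real_vec y) + real p * (l \<bullet> real_vec x) < real p' * (l \<bullet> real_vec x)"
      using L(2) by (intro eventually_ball_finite)
    then show ?thesis
    proof (rule eventually_mono)
      fix p' assume p': "\<forall>l\<in>L1. 0 < l \<bullet> real_vec x \<longrightarrow>
        real n * (l \<bullet> real_vec y) + real p * (l \<bullet> real_vec x) < real p' * (l \<bullet> real_vec x)"
      show "good D p'"
        unfolding good_def
      proof (intro allI impI)
        fix c assume mem: "y \<in> M D" "c \<in> M D" "x \<in> M D"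
          and int: "real_vec (int (Suc n) *s y + c) \<in> cone_interior D"
          and div: "real_vec (int (Suc n) *s y + c) - real p' *\<^sub>R real_vec x \<in> D"
        have nn: "0 \<le> l \<bullet> real_vec y" "0 \<le> l \<bullet> real_vec c" "0 \<le> l \<bullet> real_vec x" if "l \<in> L1" for l
          using mem real_vec_in [OF D] L(4) that by blast+
        have zz: "l \<bullet> real_vec y = 0" "l \<bullet> real_vec c = 0" "l \<bullet> real_vec x = 0" if "l \<in> L0" for l
          using mem real_vec_in [OF D] L(5) that by blast+
        have pos: "0 < l \<bullet> real_vec (y + c - int p *s x)" if l: "l \<in> L1" for l
        proof (cases "0 < l \<bullet> real_vec x")
          case True
          have "0 \<le> l \<bullet> (real_vec (int (Suc n) *s y + c) - real p' *\<^sub>R real_vec x)"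
            using div L(4) l by blast
          then have "0 \<le> (1 + real n) * (l \<bullet> real_vec y) + l \<bullet> real_vec c - real p' * (l \<bullet> real_vec x)"
            by (simp add: inner_add_right inner_diff_right algebra_simps)
          moreover have "real n * (l \<bullet> real_vec y) + real p * (l \<bullet> real_vec x) < real p' * (l \<bullet> real_vec x)"
            using p' l True by blast
          ultimately show ?thesis by (simp add: inner_add_right inner_diff_right algebra_simps)
        next
          case False
          then have x0: "l \<bullet> real_vec x = 0" using nn [OF l] by linarith
          have "0 < l \<bullet> real_vec (int (Suc n) *s y + c)" using int L(6) l by blast
          then have "0 < (1 + real n) * (l \<bullet> real_vec y) + l \<bullet> real_vec c"
            by (simp add: inner_add_right algebra_simps)
          then have "0 < l \<bullet> real_vec y \<or> 0 < l \<bullet> real_vec c"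
            using nn [OF l] by (cases "l \<bullet> real_vec y = 0") auto
          then show ?thesis using nn [OF l] x0 by (auto simp: inner_add_right inner_diff_right)
        qed
        have "0 \<le> l \<bullet> real_vec (y + c - int p *s x)" if "l \<in> L0" for l
          using zz [OF that] by (simp add: inner_add_right inner_diff_right)
        then show "real_vec (y + c - int p *s x) \<in> cone_interior D" using pos L(6) by blast
      qed
    qed
  qed
  then have "\<forall>\<^sub>F p' in sequentially. \<forall>D\<in>\<Sigma>. good D p'"
    using finite_fan by (intro eventually_ball_finite) auto
  moreover have "\<forall>\<^sub>F p' in sequentially. p' \<ge> (1::nat)" by (rule eventually_ge_at_top)
  ultimately show ?thesis
  proof eventually_elim
    case (elim p')
    show ?case
    proof (intro allI impI)
      fix c s assume cy: "compat (int (Suc n) *s y) c" and xs: "compat (int p' *s x) s"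
        and eq: "int (Suc n) *s y + c = int p' *s x + s"
      obtain C where C: "C \<in> \<Sigma>" "int (Suc n) *s y \<in> M C" "c \<in> M C"
        using cy unfolding compat_def by blast
      obtain C' where C': "C' \<in> \<Sigma>" "int p' *s x \<in> M C'" "s \<in> M C'"
        using xs unfolding compat_def by blast
      obtain D where D: "D \<in> \<Sigma>" "int (Suc n) *s y + c \<in> M D"
        "real_vec (int (Suc n) *s y + c) \<in> cone_interior D"
        using interior_cone [OF C(1) add_mem [OF C]] by metis
      have inD: "int (Suc n) *s y \<in> M D" "c \<in> M D" "int p' *s x \<in> M D" "s \<in> M D"
      proof -
        have "real_vec (int p' *s x + s) \<in> D"
          unfolding eq [symmetric] by (rule real_vec_in [OF D(1,2)])
        then show "int p' *s x \<in> M D" "s \<in> M D"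
          by (rule summands_mem [OF C'(1) D(1) C'(2,3)])+
        show "int (Suc n) *s y \<in> M D" "c \<in> M D"
          by (rule summands_mem [OF C(1) D(1) C(2,3) real_vec_in [OF D(1,2)]])+
      qed
      show "\<exists>D\<in>\<Sigma>. \<exists>u\<in>M D. y \<in> M D \<and> c \<in> M D \<and> x \<in> M D \<and> y + c = int p *s x + u"
      proof -
        have xyD: "y \<in> M D" "x \<in> M D"
          using root_mem [OF D(1) y inD(1)] root_mem [OF D(1) x inD(3)] elim(2) by auto
        have "real_vec (int (Suc n) *s y + c) - real p' *\<^sub>R real_vec x = real_vec s"
          unfolding eq by simp
        then have "real_vec (int (Suc n) *s y + c) - real p' *\<^sub>R real_vec x \<in> D"
          using real_vec_in [OF D(1) inD(4)] by simp
        then have "real_vec (y + c - int p *s x) \<in> cone_interior D"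
          using elim(1) D(1,3) xyD inD(2) unfolding good_def by blast
        moreover have "y + c - int p *s x \<in> add_subgroup hull (M D)"
          using xyD inD(2) by (intro subgroup_hull_closed subgroup_hull_scale hull_inc)
        ultimately have u: "y + c - int p *s x \<in> M D" by (intro interior_mem D(1))
        have "y + c = int p *s x + (y + c - int p *s x)" by simp
        then show ?thesis using D(1) u xyD inD(2) by blast
      qed
    qed
  qed
qed

lemma generators_exist:
  obtains r :: nat and v :: "nat \<Rightarrow> int ^ 'd" where
    "\<And>j. j < r \<Longrightarrow> v j \<in> support \<Sigma> M" "\<And>j. j < r \<Longrightarrow> v j \<noteq> 0"
    "\<And>C c. C \<in> \<Sigma> \<Longrightarrow> c \<in> M C \<Longrightarrow>
       \<exists>\<alpha>::nat \<Rightarrow> nat. (\<forall>j<r. \<alpha> j > 0 \<longrightarrow> v j \<in> M C) \<and> c = (\<Sum>j<r. int (\<alpha> j) *s v j)"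
proof -
  have "\<forall>C\<in>\<Sigma>. \<exists>G. finite G \<and> M C = add_submonoid hull G"
    using affine unfolding affine_monoid_def by blast
  then obtain G where G: "\<And>C. C \<in> \<Sigma> \<Longrightarrow> finite (G C)" "\<And>C. C \<in> \<Sigma> \<Longrightarrow> M C = add_submonoid hull (G C)"
    by metis
  define V where "V = (\<Union>C\<in>\<Sigma>. G C) - {0}"
  have "finite V" using G finite_fan by (simp add: V_def)
  then obtain h and r :: nat where h: "bij_betw h {..<r} V"
    using ex_bij_betw_nat_finite [of V] by (auto simp: lessThan_atLeast0)
  have GM: "G C \<subseteq> M C" if "C \<in> \<Sigma>" for C 
    unfolding G(2) [OF that] by (rule hull_subset)
  show ?thesis
  proof (rule that [of r h])
    fix j assume "j < r"
    then have "h j \<in> V" using h by (auto simp: bij_betw_def)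
    then show "h j \<in> support \<Sigma> M" "h j \<noteq> 0"
      using GM unfolding V_def support_def by auto
  next
    fix C c assume C: "C \<in> \<Sigma>" and c: "c \<in> M C"
    define K where "K = {c. \<exists>\<alpha>::nat \<Rightarrow> nat. (\<forall>j<r. \<alpha> j > 0 \<longrightarrow> h j \<in> M C) \<and> c = (\<Sum>j<r. int (\<alpha> j) *s h j)}"
    have "add_submonoid hull (G C) \<subseteq> K"
    proof (rule hull_minimal)
      have K0: "0 \<in> K"
        unfolding K_def by (intro CollectI exI [of _ "\<lambda>_. 0"]) simp
      show "add_submonoid K"
        unfolding add_submonoid_def
      proof (intro conjI ballI K0)
        fix x y assume "x \<in> K" "y \<in> K"
        then obtain \<alpha> \<beta> :: "nat \<Rightarrow> nat" where ab: "\<forall>j<r. \<alpha> j > 0 \<longrightarrow> h j \<in> M C" "x = (\<Sum>j<r. int (\<alpha> j) *s h j)"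
            "\<forall>j<r. \<beta> j > 0 \<longrightarrow> h j \<in> M C" "y = (\<Sum>j<r. int (\<beta> j) *s h j)"
          unfolding K_def by auto
        show "x + y \<in> K"
          unfolding K_def
        proof (intro CollectI exI [of _ "\<lambda>j. \<alpha> j + \<beta> j"] conjI)
          show "\<forall>j<r. 0 < \<alpha> j + \<beta> j \<longrightarrow> h j \<in> M C" using ab by auto
          show "x + y = (\<Sum>j<r. int (\<alpha> j + \<beta> j) *s h j)"
            by (simp add: ab sum.distrib [symmetric] vector_sadd_rdistrib)
        qed
      qed
      show "G C \<subseteq> K"
      proof
        fix g assume g: "g \<in> G C"
        show "g \<in> K"
        proof (cases "g = 0")
          case False
          then have "g \<in> V" using g C by (auto simp: V_def)
          then obtain j where j: "j < r" "h j = g" using h by (auto simp: bij_betw_def)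
          show ?thesis
            unfolding K_def
          proof (intro CollectI exI [of _ "\<lambda>l. if l = j then 1 else 0"] conjI)
            show "\<forall>l<r. 0 < (if l = j then 1 else 0 :: nat) \<longrightarrow> h l \<in> M C"
              using g j GM [OF C] by auto
            have "(\<Sum>l<r. int (if l = j then 1 else 0) *s h l) = (\<Sum>l<r. if l = j then h l else 0)"
              by (intro sum.cong) auto
            then show "g = (\<Sum>l<r. int (if l = j then 1 else 0) *s h l)" using j by simp
          qed
        qed (use K0 in simp)
      qed
    qed
    then show "\<exists>\<alpha>::nat \<Rightarrow> nat. (\<forall>j<r. \<alpha> j > 0 \<longrightarrow> h j \<in> M C) \<and> c = (\<Sum>j<r. int (\<alpha> j) *s h j)"
      using c G(2) [OF C] unfolding K_def by blast
  qed
qed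

end

locale toric_generators = seminormal_toric \<Sigma> M
  for \<Sigma> :: "(real ^ 'd) set set" and M :: "(real ^ 'd) set \<Rightarrow> (int ^ 'd) set" +
  fixes r :: nat and v :: "nat \<Rightarrow> int ^ 'd"
  assumes gen_support: "j < r \<Longrightarrow> v j \<in> support \<Sigma> M"
    and gen_nonzero: "j < r \<Longrightarrow> v j \<noteq> 0"
    and gen_combination: "C \<in> \<Sigma> \<Longrightarrow> c \<in> M C \<Longrightarrow>
       \<exists>\<alpha>::nat \<Rightarrow> nat. (\<forall>j<r. \<alpha> j > 0 \<longrightarrow> v j \<in> M C) \<and> c = (\<Sum>j<r. int (\<alpha> j) *s v j)"
begin

lemma gen_mem_iff: "j < r \<Longrightarrow> C \<in> \<Sigma> \<Longrightarrow> real_vec (v j) \<in> C \<longleftrightarrow> v j \<in> M C"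
  using gen_support [of j] mem_other_cone [of _ C "v j"] real_vec_in unfolding support_def by blast

sublocale G: generated_fan \<Sigma> "{..<r}" "\<lambda>j. real_vec (v j)"
proof
  show "rational_pointed_fan \<Sigma>" by (rule fan)
  show "finite {..<r}" by simp
  fix C assume C: "C \<in> \<Sigma>" "C \<noteq> {0}"
  show "\<exists>j\<in>{..<r}. real_vec (v j) \<in> C"
  proof (rule ccontr)
    assume no: "\<not> ?thesis"
    have "c = 0" if c: "c \<in> M C" for c
    proof -
      obtain \<alpha> :: "nat \<Rightarrow> nat" where \<alpha>: "\<forall>j<r. \<alpha> j > 0 \<longrightarrow> v j \<in> M C" "c = (\<Sum>j<r. int (\<alpha> j) *s v j)"
        using gen_combination [OF C(1) c] by blast
      then have "\<alpha> j = 0" if "j < r" for j using no that real_vec_in [OF C(1)] by blast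
      then show ?thesis using \<alpha>(2) by simp
    qed
    then have "real_vec ` M C \<subseteq> {0}" by (metis image_subsetI insertI1 real_vec_simps(1))
    then have "convex_cone hull (real_vec ` M C) \<subseteq> {0}"
      by (rule hull_minimal) (simp add: convex_cone_iff)
    then show False using C cone_hull [OF C(1)] rational_cone_properties(1) [OF rational [OF C(1)]] by auto
  qed
qed

definition vsum :: "nat set \<Rightarrow> int ^ 'd" where
  "vsum J = (\<Sum>j\<in>J. v j)"

lemma real_vsum: "real_vec (vsum J) = G.vsum J"
  by (simp add: vsum_def G.vsum_def real_vec_sum)

lemma idx_iff: "C \<in> \<Sigma> \<Longrightarrow> J \<subseteq> G.idx C \<longleftrightarrow> J \<subseteq> {..<r} \<and> (\<forall>j\<in>J. v j \<in> M C)"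
  using gen_mem_iff by (auto simp: G.idx_def)

lemma vsum_mem: "C \<in> \<Sigma> \<Longrightarrow> J \<subseteq> G.idx C \<Longrightarrow> vsum J \<in> M C"
  unfolding vsum_def by (intro submonoid_sum submonoid) (auto simp: idx_iff)

definition degree_family :: "int ^ 'd \<Rightarrow> (real ^ 'd) set \<Rightarrow> nat set set" where
  "degree_family a D = (if a \<in> add_subgroup hull (M D) then G.open_family D (real_vec a) else {})"

text \<open>
  By seminormality, the degrees \<open>a + n v\<^sub>J\<close> in the interior of \<open>D\<close> belong to \<open>M\<^sub>D\<close> as soon as they
  belong to the group that it generates.
\<close>

lemma degree_family_iff:
  assumes D: "D \<in> \<Sigma>"
  shows "J \<in> degree_family a D \<longleftrightarrow> J \<subseteq> G.idx D \<and>
    (\<forall>\<^sub>F n in sequentially. a + int n *s vsum J \<in> M D \<and> real_vec (a + int n *s vsum J) \<in> cone_interior D)"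
proof
  assume "J \<in> degree_family a D"
  then obtain t where t: "a \<in> add_subgroup hull (M D)" "J \<subseteq> G.idx D" "t \<ge> 0"
      "real_vec a + t *\<^sub>R G.vsum J \<in> cone_interior D"
    unfolding degree_family_def G.open_family_def by (auto split: if_splits)
  obtain N where N: "t \<le> real N" using real_arch_simple by blast
  have "a + int n *s vsum J \<in> M D \<and> real_vec (a + int n *s vsum J) \<in> cone_interior D" if n: "n \<ge> N" for n
  proof -
    have "real_vec a + real n *\<^sub>R G.vsum J \<in> cone_interior D"
      using n N by (intro G.interior_mem_mono [OF D t(4) G.vsum_mem [OF D t(2)]]) auto
    then have int: "real_vec (a + int n *s vsum J) \<in> cone_interior D" by (simp add: real_vsum)
    have "a + int n *s vsum J \<in> add_subgroup hull (M D)"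
      by (rule subgroup_hull_closed(1) [OF t(1) subgroup_hull_scale [OF hull_inc [OF vsum_mem [OF D t(2)]]]])
    then show ?thesis using int interior_mem [OF D] by blast
  qed
  then show "J \<subseteq> G.idx D \<and>
    (\<forall>\<^sub>F n in sequentially. a + int n *s vsum J \<in> M D \<and> real_vec (a + int n *s vsum J) \<in> cone_interior D)"
    using t(2) eventually_sequentially by blast
next
  assume *: "J \<subseteq> G.idx D \<and>
    (\<forall>\<^sub>F n in sequentially. a + int n *s vsum J \<in> M D \<and> real_vec (a + int n *s vsum J) \<in> cone_interior D)"
  have "\<exists>n. a + int n *s vsum J \<in> M D \<and> real_vec (a + int n *s vsum J) \<in> cone_interior D"
    by (rule eventually_happens' [OF sequentially_bot conjunct2 [OF *]])
  then obtain n where n: "a + int n *s vsum J \<in> M D" "real_vec (a + int n *s vsum J) \<in> cone_interior D"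
    by auto
  have "(a + int n *s vsum J) - int n *s vsum J \<in> add_subgroup hull (M D)"
    using * by (intro subgroup_hull_closed(2) [OF hull_inc [OF n(1)] subgroup_hull_scale [OF hull_inc [OF vsum_mem [OF D]]]]) blast
  then have "a \<in> add_subgroup hull (M D)" by simp
  then show "J \<in> degree_family a D"
    using n(2) * unfolding degree_family_def G.open_family_def
    by (auto simp: real_vsum intro!: exI [of _ "real n"])
qed

lemma degree_family_disjoint:
  "D \<in> \<Sigma> \<Longrightarrow> D' \<in> \<Sigma> \<Longrightarrow> J \<in> degree_family a D \<Longrightarrow> J \<in> degree_family a D' \<Longrightarrow> D = D'"
  using G.open_family_disjoint unfolding degree_family_def by (meson empty_iff)

text \<open>
  If the family is not exact then \<open>a\<close> is in the group of \<open>M\<^sub>D\<close> and \<open>- a\<close> is in the cone \<open>D\<close>, so a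
  positive multiple of \<open>- a\<close> is in \<open>M\<^sub>D\<close>.
\<close>

lemma exact_at_degree_family:
  assumes D: "D \<in> \<Sigma>" and "dim D \<le> i \<Longrightarrow> a \<notin> uminus ` normalization (M D)"
  shows "exact_at TYPE('k::comm_ring_1) (degree_family a D) (\<lambda>_ _. True) i"
proof (cases "a \<in> add_subgroup hull (M D)")
  case True
  show ?thesis
  proof (cases "- real_vec a \<in> D")
    case neg: True
    then have "real_vec (- a) \<in> convex_cone hull (real_vec ` M D)" using cone_hull [OF D] by simp
    then obtain p where "p > 0" "p *s (- a) \<in> M D"
      by (rule multiple_in_monoid [OF submonoid [OF D]])
    then have "- a \<in> normalization (M D)"
      unfolding normalization_def using subgroup_hull_closed(3) [OF True True] by blast
    then have "a \<in> uminus ` normalization (M D)" by (metis imageI minus_minus)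
    then have "i < dim D" using assms(2) by (meson not_le)
    then show ?thesis
      using True G.exact_at_open_family_below_dim [OF D neg] by (simp add: degree_family_def)
  next
    case False
    then show ?thesis
      using True G.exact_at_open_family [OF D False] by (simp add: degree_family_def)
  qed
qed (simp add: degree_family_def exact_at_empty)

text \<open>
  Between members of the families, multiplication by a variable is nonzero exactly if the cones of
  the two members are comparable.
\<close>

definition degree_inc :: "int ^ 'd \<Rightarrow> nat set \<Rightarrow> nat set \<Rightarrow> bool" where
  "degree_inc a J' J \<longleftrightarrow>
     (\<exists>D\<in>\<Sigma>. \<exists>D'\<in>\<Sigma>. J \<in> degree_family a D \<and> J' \<in> degree_family a D' \<and> D' \<subseteq> D)"

text \<open>The cone of a set between \<open>J'\<close> and \<open>J\<close> is found among the faces of the cone of \<open>J\<close>.\<close>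

lemma degree_inc_interpolate:
  assumes "D \<in> \<Sigma>" "D' \<in> \<Sigma>" "D' \<subseteq> D" "J \<in> degree_family a D" "J' \<in> degree_family a D'"
    and "J' \<subseteq> K" "K \<subseteq> J"
  obtains E where "E \<in> \<Sigma>" "D' \<subseteq> E" "E \<subseteq> D" "K \<in> degree_family a E"
proof -
  have JD: "J \<subseteq> G.idx D" "J' \<subseteq> G.idx D'" using assms(4,5) degree_family_iff assms(1,2) by auto
  then have KD: "K \<subseteq> G.idx D" using assms(7) by auto
  have "J' \<in> G.open_family D' (real_vec a)"
    using assms(5) unfolding degree_family_def by (auto split: if_splits)
  then have "J' \<in> G.closed_family D (real_vec a)"
    using assms(2,3) G.closed_family_eq [OF assms(1)] by auto
  then have "K \<in> G.closed_family D (real_vec a)"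
    by (rule G.closed_family_upclosed [OF assms(1) _ assms(6) KD])
  then obtain E where E: "E \<in> \<Sigma>" "E \<subseteq> D" "K \<in> G.open_family E (real_vec a)"
    using G.closed_family_eq [OF assms(1)] by auto
  have D'E: "D' \<subseteq> E"
    by (rule G.open_family_label_mono [OF assms(1) E(1) assms(2) E(2) assms(3) E(3)])
      (use \<open>J' \<in> G.open_family D' (real_vec a)\<close> assms(6) in auto)
  have "a \<in> add_subgroup hull (M D')"
    using assms(5) unfolding degree_family_def by (auto split: if_splits)
  then have "a \<in> add_subgroup hull (M E)"
    using hull_mono [of "M D'" "M E" add_subgroup] mem_mono [OF assms(2) E(1) D'E] by blast
  then have "K \<in> degree_family a E" using E unfolding degree_family_def by simp
  then show ?thesis using E D'E that by blast
qed

text \<open>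
  The complex is filtered by the cones that label its members, with the families of the single
  cones as graded pieces.
\<close>

lemma exact_at_degree:
  assumes "\<And>D. D \<in> \<Sigma> \<Longrightarrow> dim D \<le> i \<Longrightarrow> a \<notin> uminus ` normalization (M D)"
  shows "exact_at TYPE('k::comm_ring_1) (\<Union>D\<in>\<Sigma>. degree_family a D) (degree_inc a) i"
proof (rule exact_at_Union [OF finite_fan])
  show "cobd_compatible (\<Union>D\<in>\<Sigma>. degree_family a D) (degree_inc a)"
    unfolding cobd_compatible_def
  proof (intro ballI conjI impI)
    fix J assume J: "J \<in> (\<Union>D\<in>\<Sigma>. degree_family a D)"
    then obtain D where D: "D \<in> \<Sigma>" "J \<in> degree_family a D" by auto
    then show "finite J" using degree_family_iff G.finite_idx finite_subset by metis
    fix j l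
    assume "degree_inc a (J - {j}) J" "degree_inc a (J - {j} - {l}) (J - {j})"
    then obtain D1 D2 where D12: "D1 \<in> \<Sigma>" "J - {j} \<in> degree_family a D1" "D1 \<subseteq> D"
        "D2 \<in> \<Sigma>" "J - {j} - {l} \<in> degree_family a D2" "D2 \<subseteq> D1"
      unfolding degree_inc_def using D degree_family_disjoint by metis
    obtain E where E: "E \<in> \<Sigma>" "D2 \<subseteq> E" "E \<subseteq> D" "J - {l} \<in> degree_family a E"
      by (rule degree_inc_interpolate [OF D(1) D12(4) _ D(2) D12(5), of "J - {l}"]) (use D12 in auto)
    show "J - {l} \<in> (\<Union>D\<in>\<Sigma>. degree_family a D)" using E by auto
    show "degree_inc a (J - {l}) J" "degree_inc a (J - {j} - {l}) (J - {l})"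
      unfolding degree_inc_def using D E D12 by blast+
  qed
next
  fix D D' J j
  assume "D \<in> \<Sigma>" "D' \<in> \<Sigma>" "J \<in> degree_family a D" "J - {j} \<in> degree_family a D'"
    "degree_inc a (J - {j}) J"
  then show "D' \<le> D" unfolding degree_inc_def using degree_family_disjoint by metis
next
  fix D D' J
  assume "D \<in> \<Sigma>" "D' \<in> \<Sigma>" "J \<in> degree_family a D" "J \<in> degree_family a D'"
  then show "D = D'" by (rule degree_family_disjoint)
next
  fix D assume D: "D \<in> \<Sigma>"
  have "exact_at TYPE('k) (degree_family a D) (\<lambda>_ _. True) i"
    using assms D by (intro exact_at_degree_family)
  moreover have "degree_inc a J' J" if "J \<in> degree_family a D" "J' \<in> degree_family a D" for J J'
    unfolding degree_inc_def using D that by blast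
  ultimately show "exact_at TYPE('k) (degree_family a D) (degree_inc a) i"
    by (simp add: exact_at_cong [of _ "degree_inc a" "\<lambda>_ _. True"])
qed

end

section \<open>Germs along the Cech complex\<close>

text \<open>The exponent vector of the \<open>n\<close>-th power of the product of the variables in \<open>J\<close>.\<close>

definition pw :: "nat \<Rightarrow> nat set \<Rightarrow> nat \<Rightarrow> nat" where
  "pw n J = (\<lambda>j. if j \<in> J then n else 0)"

lemma additive_minus:
  fixes f :: "'a::ab_group_add \<Rightarrow> 'b::ab_group_add"
  assumes "\<And>x y. f (x + y) = f x + f y"
  shows "f 0 = 0" "f (- x) = - f x" "f (x - y) = f x - f y"
proof -
  interpret additive f by unfold_locales (rule assms)
  show "f 0 = 0" "f (- x) = - f x" "f (x - y) = f x - f y" by (simp_all add: zero minus diff)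
qed

text \<open>
  The comparison of torsion and Cech cohomology in abstract form. There are \<open>r\<close> variables; \<open>act \<alpha>\<close>
  is the multiplication by the monomial with exponent vector \<open>\<alpha>\<close>, of degree \<open>deg \<alpha>\<close>. The
  resolution is \<open>0 \<rightarrow> F 0 \<rightarrow> F 1 \<rightarrow> \<dots>\<close>, where \<open>F 0\<close> is the resolved module, \<open>F q g\<close> is the component
  of degree \<open>g\<close>, and \<open>d\<close> is the differential. All components are subsets of one ring, so that
  elements of different modules can be added in a total complex; the multiplication of that ring
  provides the signs. The degree in which cohomology is computed is \<open>a\<close>.

  The last assumption is the only one about injectivity, and concerns all terms except the
  resolved module: if \<open>x\<close> is torsion with respect to the first \<open>k\<close> variables, then its fraction by
  the \<open>n\<close>-th power of the variable \<open>k\<close> is, in the localization at that variable, the image of an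
  element \<open>y\<close> that is torsion in the same sense.
\<close>

locale germ_resolution =
  fixes r :: nat
    and deg :: "(nat \<Rightarrow> nat) \<Rightarrow> 'g::ab_group_add"
    and act :: "(nat \<Rightarrow> nat) \<Rightarrow> 't::comm_ring_1 \<Rightarrow> 't"
    and d :: "'t \<Rightarrow> 't"
    and F :: "nat \<Rightarrow> 'g \<Rightarrow> 't set"
    and a :: 'g
  assumes F_zero: "0 \<in> F q g"
    and F_diff: "x \<in> F q g \<Longrightarrow> y \<in> F q g \<Longrightarrow> x - y \<in> F q g"
    and act_add: "act \<alpha> (x + y) = act \<alpha> x + act \<alpha> y"
    and d_add: "d (x + y) = d x + d y"
    and act_F: "x \<in> F q g \<Longrightarrow> act \<alpha> x \<in> F q (g + deg \<alpha>)"
    and d_F: "x \<in> F q g \<Longrightarrow> d x \<in> F (Suc q) g"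
    and act_act: "x \<in> F q g \<Longrightarrow> act \<alpha> (act \<beta> x) = act (\<lambda>j. \<alpha> j + \<beta> j) x"
    and act_0: "x \<in> F q g \<Longrightarrow> act (\<lambda>_. 0) x = x"
    and d_act: "x \<in> F q g \<Longrightarrow> d (act \<alpha> x) = act \<alpha> (d x)"
    and d_d: "x \<in> F q g \<Longrightarrow> d (d x) = 0"
    and exact_0: "x \<in> F 0 g \<Longrightarrow> d x = 0 \<Longrightarrow> x = 0"
    and exact_Suc: "x \<in> F (Suc q) g \<Longrightarrow> d x = 0 \<Longrightarrow> \<exists>y\<in>F q g. d y = x"
    and deg_add: "deg (\<lambda>j. \<alpha> j + \<beta> j) = deg \<alpha> + deg \<beta>"
    and lift: "k < r \<Longrightarrow> x \<in> F (Suc q) (g + deg (pw n {k})) \<Longrightarrow> (\<And>j. j < k \<Longrightarrow> \<exists>m. act (pw m {j}) x = 0) \<Longrightarrow>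
      \<exists>y m. y \<in> F (Suc q) g \<and> (\<forall>j<k. \<exists>m. act (pw m {j}) y = 0) \<and> act (pw (n + m) {k}) y = act (pw m {k}) x"
begin

lemma act_simps [simp]: "act \<alpha> 0 = 0" "act \<alpha> (- x) = - act \<alpha> x" "act \<alpha> (x - y) = act \<alpha> x - act \<alpha> y"
  using additive_minus [of "act \<alpha>", OF act_add] by blast+

lemma d_simps [simp]: "d 0 = 0" "d (- x) = - d x" "d (x - y) = d x - d y"
  using additive_minus [of d, OF d_add] by blast+

lemma act_sum: "act \<alpha> (sum f A) = (\<Sum>x\<in>A. act \<alpha> (f x))"
  by (induction A rule: infinite_finite_induct) (auto simp: act_add)

lemma d_sum: "d (sum f A) = (\<Sum>x\<in>A. d (f x))"
  by (induction A rule: infinite_finite_induct) (auto simp: d_add)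

lemma act_power: "act \<alpha> ((-1) ^ n * x) = (-1) ^ n * act \<alpha> x"
  and d_power: "d ((-1) ^ n * x) = (-1) ^ n * d x"
  by (induction n) auto

lemma act_sign: "act \<alpha> (inc_sign j J * x) = inc_sign j J * act \<alpha> x"
  and d_sign: "d (inc_sign j J * x) = inc_sign j J * d x"
  unfolding inc_sign_def by (rule act_power d_power)+

lemma deg_0: "deg (\<lambda>_. 0) = 0"
  using deg_add [of "\<lambda>_. 0" "\<lambda>_. 0"] by simp

lemma deg_pw_insert: "j \<in> J \<Longrightarrow> deg (pw n (J - {j})) + deg (pw n {j}) = deg (pw n J)"
proof -
  assume "j \<in> J"
  then have "(\<lambda>i. pw n (J - {j}) i + pw n {j} i) = pw n J" by (auto simp: pw_def fun_eq_iff)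
  then show ?thesis using deg_add by metis
qed

text \<open>Torsion with respect to the first \<open>k\<close> variables.\<close>

definition Gam :: "nat \<Rightarrow> nat \<Rightarrow> 'g \<Rightarrow> 't set" where
  "Gam k q g = {x \<in> F q g. \<forall>j<k. \<exists>n. act (pw n {j}) x = 0}"

lemma act_pw_mono:
  assumes "x \<in> F q g" "act (pw n J) x = 0" "n \<le> m"
  shows "act (pw m J) x = 0"
proof -
  have "pw m J = (\<lambda>j. pw (m - n) J j + pw n J j)" using assms(3) by (auto simp: pw_def fun_eq_iff)
  then show ?thesis using act_act [OF assms(1), of "pw (m - n) J" "pw n J"] assms(2) by simp
qed

lemma act_commute:
  assumes "x \<in> F q g"
  shows "act \<alpha> (act \<beta> x) = act \<beta> (act \<alpha> x)"
  using act_act [OF assms] by (simp add: add.commute)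

lemma Gam_zero: "0 \<in> Gam k q g"
  using F_zero by (auto simp: Gam_def)

lemma Gam_diff:
  assumes "x \<in> Gam k q g" "y \<in> Gam k q g"
  shows "x - y \<in> Gam k q g"
  unfolding Gam_def
proof (intro CollectI conjI allI impI)
  show "x - y \<in> F q g" using assms F_diff by (auto simp: Gam_def)
  fix j assume "j < k"
  then obtain n m where "act (pw n {j}) x = 0" "act (pw m {j}) y = 0"
    using assms unfolding Gam_def by blast
  then have "act (pw (max n m) {j}) x = 0" "act (pw (max n m) {j}) y = 0"
    using assms act_pw_mono unfolding Gam_def by (auto intro: act_pw_mono)
  then show "\<exists>n. act (pw n {j}) (x - y) = 0" by (intro exI [of _ "max n m"]) simp
qed

lemma Gam_uminus: "x \<in> Gam k q g \<Longrightarrow> - x \<in> Gam k q g"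
  using Gam_diff [OF Gam_zero] by fastforce

lemma Gam_add: "x \<in> Gam k q g \<Longrightarrow> y \<in> Gam k q g \<Longrightarrow> x + y \<in> Gam k q g"
  using Gam_diff [OF _ Gam_uminus] by fastforce

lemma Gam_power: "x \<in> Gam k q g \<Longrightarrow> (-1) ^ n * x \<in> Gam k q g"
  by (induction n) (auto intro: Gam_uminus)

lemma Gam_act: "x \<in> Gam k q g \<Longrightarrow> act \<alpha> x \<in> Gam k q (g + deg \<alpha>)"
  unfolding Gam_def using act_F act_commute act_simps(1) by (auto, metis)

lemma Gam_d: "x \<in> Gam k q g \<Longrightarrow> d x \<in> Gam k (Suc q) g"
  unfolding Gam_def using d_F d_act d_simps(1) by (auto, metis)

lemma Gam_F: "x \<in> Gam k q g \<Longrightarrow> x \<in> F q g"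
  by (simp add: Gam_def)

text \<open>
  An element of degree \<open>a\<close> of the localization at the variables in \<open>J\<close> is represented by a
  sequence: \<open>c n\<close> is the numerator of the fraction with the \<open>n\<close>-th power of the variables in \<open>J\<close>
  as denominator. Two sequences represent the same element if they agree eventually.
\<close>

definition germ :: "nat \<Rightarrow> nat \<Rightarrow> nat set \<Rightarrow> (nat \<Rightarrow> 't) \<Rightarrow> bool" where
  "germ k q J c \<longleftrightarrow>
     (\<forall>\<^sub>F n in sequentially. c n \<in> Gam k q (a + deg (pw n J)) \<and> c (Suc n) = act (pw 1 J) (c n))"

lemma germ_zero: "germ k q J (\<lambda>_. 0)"
  by (simp add: germ_def Gam_zero)

lemma germ_diff: "germ k q J b \<Longrightarrow> germ k q J c \<Longrightarrow> germ k q J (\<lambda>n. b n - c n)"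
  unfolding germ_def by (erule (1) eventually_elim2) (auto intro: Gam_diff)

lemma germ_add: "germ k q J b \<Longrightarrow> germ k q J c \<Longrightarrow> germ k q J (\<lambda>n. b n + c n)"
  unfolding germ_def by (erule (1) eventually_elim2) (auto intro: Gam_add simp: act_add)

lemma germ_sum: "(\<And>i. i \<in> A \<Longrightarrow> germ k q J (c i)) \<Longrightarrow> germ k q J (\<lambda>n. \<Sum>i\<in>A. c i n)"
  by (induction A rule: infinite_finite_induct) (auto intro: germ_add germ_zero)

lemma germ_power: "germ k q J c \<Longrightarrow> germ k q J (\<lambda>n. (-1) ^ m * c n)"
  unfolding germ_def by (erule eventually_mono) (auto intro: Gam_power simp: act_power)

lemma germ_sign: "germ k q J c \<Longrightarrow> germ k q J (\<lambda>n. inc_sign j K * c n)"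
  unfolding inc_sign_def by (rule germ_power)

lemma germ_cong:
  assumes "germ k q J c" "\<forall>\<^sub>F n in sequentially. c n = b n"
  shows "germ k q J b"
proof -
  have "\<forall>\<^sub>F n in sequentially. c (Suc n) = b (Suc n)"
    using assms(2) by (subst eventually_sequentially_Suc [of "\<lambda>n. c n = b n"])
  then show ?thesis
    using assms unfolding germ_def by eventually_elim auto
qed

lemma germ_d: "germ k q J c \<Longrightarrow> germ k (Suc q) J (\<lambda>n. d (c n))"
  unfolding germ_def by (erule eventually_mono) (auto intro: Gam_d dest: Gam_F simp: d_act)

lemma germ_act:
  assumes c: "germ k q (J - {j}) c" and j: "j \<in> J"
  shows "germ k q J (\<lambda>n. act (pw n {j}) (c n))"
  using c unfolding germ_def
proof (rule eventually_mono)
  fix n assume *: "c n \<in> Gam k q (a + deg (pw n (J - {j}))) \<and> c (Suc n) = act (pw 1 (J - {j})) (c n)"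
  then have "act (pw n {j}) (c n) \<in> Gam k q (a + deg (pw n (J - {j})) + deg (pw n {j}))"
    by (intro Gam_act) simp
  moreover have "(\<lambda>i. pw (Suc n) {j} i + pw 1 (J - {j}) i) = (\<lambda>i. pw 1 J i + pw n {j} i)"
    using j by (auto simp: pw_def fun_eq_iff)
  ultimately show "act (pw n {j}) (c n) \<in> Gam k q (a + deg (pw n J)) \<and>
      act (pw (Suc n) {j}) (c (Suc n)) = act (pw 1 J) (act (pw n {j}) (c n))"
    using * act_act [OF Gam_F [OF conjunct1 [OF *]], of "pw (Suc n) {j}" "pw 1 (J - {j})"]
      act_act [OF Gam_F [OF conjunct1 [OF *]], of "pw 1 J" "pw n {j}"] deg_pw_insert [OF j]
    by (simp only: add.assoc simp_thms)
qed

lemma germ_iterate: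
  assumes "germ k q J c"
  obtains N where "\<And>n. n \<ge> N \<Longrightarrow> c n \<in> Gam k q (a + deg (pw n J))"
    "\<And>n0 n. N \<le> n0 \<Longrightarrow> n0 \<le> n \<Longrightarrow> c n = act (pw (n - n0) J) (c n0)"
proof -
  obtain N where N: "\<And>n. n \<ge> N \<Longrightarrow> c n \<in> Gam k q (a + deg (pw n J))"
      "\<And>n. n \<ge> N \<Longrightarrow> c (Suc n) = act (pw 1 J) (c n)"
    using assms unfolding germ_def eventually_sequentially by blast
  have "c n = act (pw (n - n0) J) (c n0)" if n0: "N \<le> n0" "n0 \<le> n" for n0 n
    using n0(2)
  proof (induction n rule: dec_induct)
    case base
    have "pw 0 J = (\<lambda>_. 0)" by (auto simp: pw_def fun_eq_iff)
    then show ?case using act_0 [OF Gam_F [OF N(1) [OF n0(1)]]] by simp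
  next
    case (step n)
    have "(\<lambda>i. pw 1 J i + pw (n - n0) J i) = pw (Suc n - n0) J"
      using step.hyps by (auto simp: pw_def fun_eq_iff)
    then show ?case
      using N(2) [of n] step n0(1) act_act [OF Gam_F [OF N(1) [OF n0(1)]], of "pw 1 J" "pw (n - n0) J"] by simp
  qed
  then show ?thesis using N(1) that by blast
qed

text \<open>The fraction with numerator \<open>x\<close> and the \<open>n0\<close>-th power of the variables as denominator.\<close>

definition spread :: "nat set \<Rightarrow> nat \<Rightarrow> 't \<Rightarrow> nat \<Rightarrow> 't" where
  "spread J n0 x n = (if n0 \<le> n then act (pw (n - n0) J) x else 0)"

lemma germ_spread:
  assumes "x \<in> Gam k q (a + deg (pw n0 J))"
  shows "germ k q J (spread J n0 x)"
  unfolding germ_def eventually_sequentially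
proof (intro exI [of _ n0] allI impI)
  fix n assume n: "n0 \<le> n"
  have "(\<lambda>i. pw n0 J i + pw (n - n0) J i) = pw n J" using n by (auto simp: pw_def fun_eq_iff)
  then have deg: "deg (pw n0 J) + deg (pw (n - n0) J) = deg (pw n J)" using deg_add by metis
  have "(\<lambda>i. pw 1 J i + pw (n - n0) J i) = pw (Suc n - n0) J" using n by (auto simp: pw_def fun_eq_iff)
  then show "spread J n0 x n \<in> Gam k q (a + deg (pw n J)) \<and> spread J n0 x (Suc n) = act (pw 1 J) (spread J n0 x n)"
    using n Gam_act [OF assms, of "pw (n - n0) J"] deg act_act [OF Gam_F [OF assms], of "pw 1 J" "pw (n - n0) J"]
    by (simp add: spread_def add.assoc)
qed

text \<open>
  A cochain of total degree \<open>N\<close> has components of resolution degree \<open>N - card J\<close>; for \<open>m = 1\<close>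
  the components in resolution degree \<open>0\<close> are required to vanish.
\<close>

definition chain :: "nat \<Rightarrow> nat \<Rightarrow> nat \<Rightarrow> (nat set \<Rightarrow> nat \<Rightarrow> 't) \<Rightarrow> bool" where
  "chain m k N c \<longleftrightarrow> (\<forall>J\<subseteq>{k..<r}.
     if card J + m \<le> N then germ k (N - card J) J (c J) else (\<forall>\<^sub>F n in sequentially. c J n = 0))"

definition hdiff :: "(nat set \<Rightarrow> nat \<Rightarrow> 't) \<Rightarrow> nat set \<Rightarrow> nat \<Rightarrow> 't" where
  "hdiff c J n = (\<Sum>j\<in>J. inc_sign j J * act (pw n {j}) (c (J - {j}) n))"

text \<open>The sign makes the two differentials of the double complex anticommute.\<close>

definition tdiff :: "(nat set \<Rightarrow> nat \<Rightarrow> 't) \<Rightarrow> nat set \<Rightarrow> nat \<Rightarrow> 't" where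
  "tdiff c J n = (-1) ^ card J * d (c J n) + hdiff c J n"

lemma finite_J: "J \<subseteq> {k..<r} \<Longrightarrow> finite J"
  using finite_subset by blast

lemma hdiff_diff: "hdiff (\<lambda>J n. b J n - c J n) J n = hdiff b J n - hdiff c J n"
  by (simp add: hdiff_def sum_subtractf algebra_simps)

lemma tdiff_diff: "tdiff (\<lambda>J n. b J n - c J n) J n = tdiff b J n - tdiff c J n"
  by (simp add: tdiff_def hdiff_diff algebra_simps)

lemma tdiff_add: "tdiff (\<lambda>J n. b J n + c J n) J n = tdiff b J n + tdiff c J n"
  by (simp add: tdiff_def hdiff_def d_add act_add sum.distrib algebra_simps)

lemma chain_germ: "chain m k N c \<Longrightarrow> J \<subseteq> {k..<r} \<Longrightarrow> card J + m \<le> N \<Longrightarrow> germ k (N - card J) J (c J)"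
  unfolding chain_def by meson

lemma chain_zero:
  "chain m k N c \<Longrightarrow> J \<subseteq> {k..<r} \<Longrightarrow> \<not> card J + m \<le> N \<Longrightarrow> \<forall>\<^sub>F n in sequentially. c J n = 0"
  unfolding chain_def by meson

lemma germ_of_zero:
  assumes "\<forall>\<^sub>F n in sequentially. c n = 0"
  shows "germ k q J c"
proof (rule germ_cong [OF germ_zero])
  show "\<forall>\<^sub>F n in sequentially. 0 = c n" using assms by eventually_elim simp
qed

lemma chain_diff:
  assumes "chain m k N b" "chain m k N c"
  shows "chain m k N (\<lambda>J n. b J n - c J n)"
  unfolding chain_def
proof (intro allI impI)
  fix J assume J: "J \<subseteq> {k..<r}"
  show "if card J + m \<le> N then germ k (N - card J) J (\<lambda>n. b J n - c J n) else \<forall>\<^sub>F n in sequentially. b J n - c J n = 0"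
  proof (cases "card J + m \<le> N")
    case True
    show ?thesis
      using germ_diff [OF chain_germ [OF assms(1) J True] chain_germ [OF assms(2) J True]] True by simp
  next
    case False
    then have "\<forall>\<^sub>F n in sequentially. b J n = 0" "\<forall>\<^sub>F n in sequentially. c J n = 0"
      using assms J unfolding chain_def by auto
    then have "\<forall>\<^sub>F n in sequentially. b J n - c J n = 0" by eventually_elim simp
    then show ?thesis using False by simp
  qed
qed

lemma chain_add:
  assumes "chain m k N b" "chain m k N c"
  shows "chain m k N (\<lambda>J n. b J n + c J n)"
proof -
  have z: "chain m k N (\<lambda>J n. 0)" by (simp add: chain_def germ_zero)
  show ?thesis using chain_diff [OF assms(1) chain_diff [OF z assms(2)]] by simp
qed

lemma chain_F:
  assumes "chain m k N c" "J \<subseteq> {k..<r}"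
  shows "\<forall>\<^sub>F n in sequentially. c J n \<in> F (N - card J) (a + deg (pw n J))"
proof (cases "card J + m \<le> N")
  case True
  then have "germ k (N - card J) J (c J)" using assms unfolding chain_def by auto
  then show ?thesis unfolding germ_def by (rule eventually_mono) (auto dest: Gam_F)
next
  case False
  then have "\<forall>\<^sub>F n in sequentially. c J n = 0" using assms unfolding chain_def by auto
  then show ?thesis by (rule eventually_mono) (auto simp: F_zero)
qed

lemma chain_F_all:
  assumes "chain m k N c"
  shows "\<forall>\<^sub>F n in sequentially. \<forall>J\<in>Pow {k..<r}. c J n \<in> F (N - card J) (a + deg (pw n J))"
  using chain_F [OF assms] by (intro eventually_ball_finite) auto

lemma chain_tdiff:
  assumes c: "chain m k N c" and m: "m \<le> 1"
  shows "chain m k (Suc N) (tdiff c)"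
  unfolding chain_def
proof (intro allI impI)
  fix J assume J: "J \<subseteq> {k..<r}"
  have fin: "finite J" using finite_J [OF J] .
  show "if card J + m \<le> Suc N then germ k (Suc N - card J) J (tdiff c J) else \<forall>\<^sub>F n in sequentially. tdiff c J n = 0"
  proof (cases "card J + m \<le> Suc N")
    case True
    have 1: "germ k (Suc N - card J) J (\<lambda>n. (-1) ^ card J * d (c J n))"
    proof (cases "card J + m \<le> N")
      case True
      then have "germ k (N - card J) J (c J)" using c J unfolding chain_def by auto
      then have "germ k (Suc (N - card J)) J (\<lambda>n. (-1) ^ card J * d (c J n))"
        by (intro germ_power germ_d)
      then show ?thesis using True by (simp add: Suc_diff_le)
    next
      case False
      then have "\<forall>\<^sub>F n in sequentially. c J n = 0" using c J unfolding chain_def by auto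
      then have "\<forall>\<^sub>F n in sequentially. 0 = (-1) ^ card J * d (c J n)" by eventually_elim simp
      then show ?thesis by (rule germ_cong [OF germ_zero])
    qed
    have 2: "germ k (Suc N - card J) J (hdiff c J)"
      unfolding hdiff_def
    proof (intro germ_sum germ_sign germ_act)
      fix j assume j: "j \<in> J"
      have cj: "Suc (card (J - {j})) = card J" by (rule card_Suc_Diff1 [OF fin j])
      have "J - {j} \<subseteq> {k..<r}" using J by auto
      then have "germ k (N - card (J - {j})) (J - {j}) (c (J - {j}))"
        using chain_germ [OF c] cj True by simp
      then show "germ k (Suc N - card J) (J - {j}) (c (J - {j}))"
        using cj by (metis diff_Suc_Suc)
    qed
    show ?thesis using True germ_add [OF 1 2] by (simp add: tdiff_def [abs_def])
  next
    case False
    have "\<forall>\<^sub>F n in sequentially. c J n = 0" using c J False unfolding chain_def by auto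
    moreover have "\<forall>\<^sub>F n in sequentially. \<forall>j\<in>J. c (J - {j}) n = 0"
    proof (intro eventually_ball_finite fin ballI)
      fix j assume j: "j \<in> J"
      have cj: "Suc (card (J - {j})) = card J" by (rule card_Suc_Diff1 [OF fin j])
      have "J - {j} \<subseteq> {k..<r}" using J by auto
      then show "\<forall>\<^sub>F n in sequentially. c (J - {j}) n = 0"
        using chain_zero [OF c] cj False by simp
    qed
    ultimately have "\<forall>\<^sub>F n in sequentially. tdiff c J n = 0"
      by eventually_elim (simp add: tdiff_def hdiff_def)
    then show ?thesis using False by simp
  qed
qed

lemma tdiff_tdiff:
  assumes c: "chain m k N c" and J: "J \<subseteq> {k..<r}"
  shows "\<forall>\<^sub>F n in sequentially. tdiff (tdiff c) J n = 0"
  using chain_F_all [OF c]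
proof (rule eventually_mono)
  fix n assume F: "\<forall>J\<in>Pow {k..<r}. c J n \<in> F (N - card J) (a + deg (pw n J))"
  have fin: "finite J" using finite_J [OF J] .
  have sub: "J - {j} \<in> Pow {k..<r}" "J - {j} - {l} \<in> Pow {k..<r}" "J \<in> Pow {k..<r}" for j l
    using J by auto
  have dd: "d (d (c J n)) = 0" using d_d F sub by blast
  have h2: "hdiff (hdiff c) J n = 0"
  proof -
    have "hdiff (hdiff c) J n = (\<Sum>j\<in>J. inc_sign j J * (\<Sum>l\<in>J - {j}. inc_sign l (J - {j}) *
        act (pw n {j}) (act (pw n {l}) (c (J - {j} - {l}) n))))"
      by (simp add: hdiff_def act_sum act_sign)
    also have "\<dots> = 0"
    proof (rule double_coboundary_sum_zero [OF fin])
      fix j l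
      have eq: "J - {l} - {j} = J - {j} - {l}" by auto
      have mem: "c (J - {j} - {l}) n \<in> F (N - card (J - {j} - {l})) (a + deg (pw n (J - {j} - {l})))"
        using F sub(2) by blast
      show "act (pw n {j}) (act (pw n {l}) (c (J - {j} - {l}) n)) =
          act (pw n {l}) (act (pw n {j}) (c (J - {l} - {j}) n))"
        unfolding eq by (rule act_commute [OF mem])
    qed
    finally show ?thesis .
  qed
  have "hdiff (\<lambda>K n. (-1) ^ card K * d (c K n)) J n = - ((-1) ^ card J * d (hdiff c J n))"
    unfolding hdiff_def d_sum sum_distrib_left sum_negf [symmetric]
  proof (rule sum.cong [OF refl])
    fix j assume j: "j \<in> J"
    have cj: "card J = Suc (card (J - {j}))" by (rule card_Suc_Diff1 [OF fin j, symmetric])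
    have "d (act (pw n {j}) (c (J - {j}) n)) = act (pw n {j}) (d (c (J - {j}) n))"
      by (rule d_act [OF bspec [OF F sub(1)]])
    then show "inc_sign j J * act (pw n {j}) ((-1) ^ card (J - {j}) * d (c (J - {j}) n)) =
        - ((-1) ^ card J * d (inc_sign j J * act (pw n {j}) (c (J - {j}) n)))"
      unfolding cj act_power d_sign by (simp add: mult.left_commute)
  qed
  moreover have "hdiff (tdiff c) J n = hdiff (\<lambda>K n. (-1) ^ card K * d (c K n)) J n + hdiff (hdiff c) J n"
    by (simp add: hdiff_def [of "tdiff c"] hdiff_def [of "hdiff c"] tdiff_def act_add sum.distrib distrib_left
        hdiff_def [of "\<lambda>K n. (-1) ^ card K * d (c K n)"])
  moreover have "d (tdiff c J n) = d (hdiff c J n)"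
    by (simp add: tdiff_def d_add d_power dd)
  ultimately show "tdiff (tdiff c) J n = 0"
    using h2 unfolding tdiff_def [of "tdiff c"] by simp
qed

text \<open>
  The resolution stays exact under localization, hence the total complex is exact: cocycles are
  corrected on the sets of size \<open>m\<close>, for increasing \<open>m\<close>. Beyond \<open>m = r\<close> nothing is left.
\<close>

lemma total_exact_from_column:
  assumes "chain 0 0 (Suc N) c"
    and "\<And>J. J \<subseteq> {0..<r} \<Longrightarrow> \<forall>\<^sub>F n in sequentially. tdiff c J n = 0"
    and "\<And>J. J \<subseteq> {0..<r} \<Longrightarrow> card J < m \<Longrightarrow> \<forall>\<^sub>F n in sequentially. c J n = 0"
  shows "\<exists>b. chain 0 0 N b \<and> (\<forall>J\<subseteq>{0..<r}. \<forall>\<^sub>F n in sequentially. tdiff b J n = c J n)"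
  using assms
proof (induction "Suc r - m" arbitrary: m c)
  case 0
  have "\<forall>\<^sub>F n in sequentially. tdiff (\<lambda>_ _. 0) J n = c J n" if J: "J \<subseteq> {0..<r}" for J
  proof -
    have "card J \<le> r" using card_mono [OF _ J] by simp
    then have "\<forall>\<^sub>F n in sequentially. c J n = 0" using 0 J by simp
    then show ?thesis by eventually_elim (simp add: tdiff_def hdiff_def)
  qed
  then show ?case by (intro exI [of _ "\<lambda>_ _. 0"]) (auto simp: chain_def germ_zero)
next
  case (Suc s)
  note c = Suc.prems
  have "\<exists>b. (if m \<le> N then germ 0 (N - m) J b else b = (\<lambda>_. 0)) \<and>
      (\<forall>\<^sub>F n in sequentially. (-1) ^ m * d (b n) = c J n)" if J: "J \<subseteq> {0..<r}" "card J = m" for J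
  proof -
    have fin: "finite J" using finite_J [OF J(1)] .
    have "\<forall>\<^sub>F n in sequentially. \<forall>j\<in>J. c (J - {j}) n = 0"
    proof (intro eventually_ball_finite fin ballI)
      fix j assume j: "j \<in> J"
      have "card (J - {j}) < m" using card_Suc_Diff1 [OF fin j] J(2) by linarith
      then show "\<forall>\<^sub>F n in sequentially. c (J - {j}) n = 0"
        using J(1) by (intro c(3)) auto
    qed
    then have dc: "\<forall>\<^sub>F n in sequentially. d (c J n) = 0"
      using c(2) [OF J(1)]
    proof eventually_elim
      case (elim n)
      then have "(-1) ^ m * d (c J n) = 0" by (simp add: tdiff_def hdiff_def J(2))
      then have "(-1) ^ m * ((-1) ^ m * d (c J n)) = 0" by simp
      then show ?case by (simp add: mult.assoc [symmetric] power_add [symmetric])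
    qed
    show ?thesis
    proof (cases "m \<le> Suc N")
      case True
      then have gc: "germ 0 (Suc N - m) J (c J)" using c(1) J unfolding chain_def by auto
      show ?thesis
      proof (cases "m \<le> N")
        case True
        obtain N0 where N0: "\<And>n. n \<ge> N0 \<Longrightarrow> c J n \<in> Gam 0 (Suc N - m) (a + deg (pw n J))"
            "\<And>n0 n. N0 \<le> n0 \<Longrightarrow> n0 \<le> n \<Longrightarrow> c J n = act (pw (n - n0) J) (c J n0)"
          by (rule germ_iterate [OF gc]) (rule that)
        obtain N1 where N1: "\<And>n. n \<ge> N1 \<Longrightarrow> d (c J n) = 0"
          using dc unfolding eventually_sequentially by blast
        define n0 where "n0 = max N0 N1"
        have "c J n0 \<in> F (Suc (N - m)) (a + deg (pw n0 J))"
          using N0(1) [of n0] True by (auto simp: n0_def Gam_def Suc_diff_le)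
        moreover have "d (c J n0) = 0" using N1 by (simp add: n0_def)
        ultimately obtain y where y: "y \<in> F (N - m) (a + deg (pw n0 J))" "d y = c J n0"
          using exact_Suc by blast
        define b where "b = (\<lambda>n. (-1) ^ m * spread J n0 y n)"
        have "germ 0 (N - m) J b"
          unfolding b_def using y(1) by (intro germ_power germ_spread) (simp add: Gam_def)
        moreover have "\<forall>\<^sub>F n in sequentially. (-1) ^ m * d (b n) = c J n"
          unfolding eventually_sequentially
        proof (intro exI [of _ n0] allI impI)
          fix n assume n: "n0 \<le> n"
          have "(-1) ^ m * d (b n) = d (spread J n0 y n)"
            by (simp add: b_def d_power mult.assoc [symmetric] power_add [symmetric])
          also have "\<dots> = act (pw (n - n0) J) (d y)"
            using n d_act [OF y(1)] by (simp add: spread_def)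
          also have "\<dots> = c J n" using N0(2) [of n0 n] n y(2) by (simp add: n0_def)
          finally show "(-1) ^ m * d (b n) = c J n" .
        qed
        ultimately show ?thesis using True by auto
      next
        case False
        then have "m = Suc N" using \<open>m \<le> Suc N\<close> by simp
        then have "germ 0 0 J (c J)" using gc by simp
        then have "\<forall>\<^sub>F n in sequentially. c J n = 0"
          using dc unfolding germ_def
          by eventually_elim (auto dest: Gam_F intro: exact_0)
        then have "\<forall>\<^sub>F n in sequentially. (-1) ^ m * d 0 = c J n" by eventually_elim simp
        then show ?thesis using False by (intro exI [of _ "\<lambda>_. 0"]) auto
      qed
    next
      case False
      then have "\<forall>\<^sub>F n in sequentially. c J n = 0" using c(1) J unfolding chain_def by auto
      then have "\<forall>\<^sub>F n in sequentially. (-1) ^ m * d 0 = c J n" by eventually_elim simp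
      then show ?thesis using False by (intro exI [of _ "\<lambda>_. 0"]) auto
    qed
  qed
  then obtain B where B: "\<And>J. J \<subseteq> {0..<r} \<Longrightarrow> card J = m \<Longrightarrow> (if m \<le> N then germ 0 (N - m) J (B J) else B J = (\<lambda>_. 0))"
      "\<And>J. J \<subseteq> {0..<r} \<Longrightarrow> card J = m \<Longrightarrow> \<forall>\<^sub>F n in sequentially. (-1) ^ m * d (B J n) = c J n"
    by metis
  define b where "b = (\<lambda>J. if card J = m then B J else (\<lambda>_. 0))"
  have chb: "chain 0 0 N b"
    unfolding chain_def
  proof (intro allI impI)
    fix J assume J: "J \<subseteq> {0..<r}"
    show "if card J + 0 \<le> N then germ 0 (N - card J) J (b J) else \<forall>\<^sub>F n in sequentially. b J n = 0"
      using B(1) [OF J] by (auto simp: b_def germ_zero)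
  qed
  define c' where "c' = (\<lambda>J n. c J n - tdiff b J n)"
  have "\<exists>b'. chain 0 0 N b' \<and> (\<forall>J\<subseteq>{0..<r}. \<forall>\<^sub>F n in sequentially. tdiff b' J n = c' J n)"
  proof (rule Suc.hyps(1) [of "Suc m"])
    show "s = Suc r - Suc m" using Suc.hyps(2) by simp
    show "chain 0 0 (Suc N) c'"
      unfolding c'_def by (rule chain_diff [OF c(1) chain_tdiff [OF chb]]) simp
    fix J assume J: "J \<subseteq> {0..<r}"
    have "\<forall>\<^sub>F n in sequentially. tdiff (tdiff b) J n = 0" by (rule tdiff_tdiff [OF chb J])
    then show "\<forall>\<^sub>F n in sequentially. tdiff c' J n = 0"
      using c(2) [OF J] unfolding c'_def tdiff_diff by eventually_elim simp
    assume cardJ: "card J < Suc m"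
    have fin: "finite J" using finite_J [OF J] .
    have h: "hdiff b J n = 0" for n
      unfolding hdiff_def
    proof (rule sum.neutral, rule ballI)
      fix j assume "j \<in> J"
      then have "card (J - {j}) \<noteq> m" using card_Suc_Diff1 [OF fin] cardJ by fastforce
      then show "inc_sign j J * act (pw n {j}) (b (J - {j}) n) = 0" by (simp add: b_def)
    qed
    show "\<forall>\<^sub>F n in sequentially. c' J n = 0"
    proof (cases "card J = m")
      case True
      have bJ: "b J n = B J n" for n by (simp add: b_def True)
      show ?thesis
        using B(2) [OF J True] by eventually_elim (simp add: c'_def tdiff_def h bJ True)
    next
      case False
      have bJ: "b J n = 0" for n by (simp add: b_def False)
      have "\<forall>\<^sub>F n in sequentially. c J n = 0" using c(3) [OF J] cardJ False by simp
      then show ?thesis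
        by eventually_elim (simp add: c'_def tdiff_def h bJ)
    qed
  qed
  then obtain b' where b': "chain 0 0 N b'" "\<And>J. J \<subseteq> {0..<r} \<Longrightarrow> \<forall>\<^sub>F n in sequentially. tdiff b' J n = c' J n"
    by blast
  have "\<forall>\<^sub>F n in sequentially. tdiff (\<lambda>J n. b J n + b' J n) J n = c J n" if "J \<subseteq> {0..<r}" for J
    using b'(2) [OF that] by eventually_elim (simp add: tdiff_add c'_def)
  then show ?case using chain_add [OF chb b'(1)] by blast
qed

definition cech_exact :: "nat \<Rightarrow> bool" where
  "cech_exact N \<longleftrightarrow>
     (\<forall>c. (\<forall>J\<subseteq>{0..<r}. card J = N \<longrightarrow> germ 0 0 J (c J)) \<longrightarrow>
          (\<forall>J\<subseteq>{0..<r}. card J = Suc N \<longrightarrow> (\<forall>\<^sub>F n in sequentially. hdiff c J n = 0)) \<longrightarrow>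
          (\<exists>b. (\<forall>J\<subseteq>{0..<r}. Suc (card J) = N \<longrightarrow> germ 0 0 J (b J)) \<and>
               (\<forall>J\<subseteq>{0..<r}. card J = N \<longrightarrow> (\<forall>\<^sub>F n in sequentially. c J n = hdiff b J n))))"

text \<open>
  Exactness in total degree \<open>N + 1\<close> of the double complex of the modules \<open>F 1, F 2, \<dots>\<close>, after
  taking torsion with respect to the variables before \<open>k\<close> and the Cech complex with respect to the
  others. The index \<open>k\<close> interpolates between the Cech complex of the whole resolution (\<open>k = 0\<close>)
  and the torsion complex (\<open>k = r\<close>).
\<close>

definition vanishing :: "nat \<Rightarrow> nat \<Rightarrow> bool" where
  "vanishing k N \<longleftrightarrow>
     (\<forall>c. chain 1 k (Suc N) c \<longrightarrow>
          (\<forall>J\<subseteq>{k..<r}. \<forall>\<^sub>F n in sequentially. tdiff c J n = 0) \<longrightarrow>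
          (\<exists>b. chain 1 k N b \<and> (\<forall>J\<subseteq>{k..<r}. \<forall>\<^sub>F n in sequentially. tdiff b J n = c J n)))"

text \<open>
  With the resolved module included, the total complex is exact. The component of a primitive in
  the resolved module is a Cech cocycle there; if it is a coboundary, it can be removed from the
  primitive.
\<close>

lemma vanishing_0:
  assumes "cech_exact N"
  shows "vanishing 0 N"
  unfolding vanishing_def
proof (intro allI impI)
  fix c assume c1: "chain 1 0 (Suc N) c"
    and dc: "\<forall>J\<subseteq>{0..<r}. \<forall>\<^sub>F n in sequentially. tdiff c J n = 0"
  have c0: "chain 0 0 (Suc N) c"
    unfolding chain_def
  proof (intro allI impI)
    fix J assume J: "J \<subseteq> {0..<r}"
    show "if card J + 0 \<le> Suc N then germ 0 (Suc N - card J) J (c J) else \<forall>\<^sub>F n in sequentially. c J n = 0"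
    proof (cases "card J + 1 \<le> Suc N")
      case True
      then show ?thesis using chain_germ [OF c1 J True] by simp
    next
      case False
      have z: "\<forall>\<^sub>F n in sequentially. c J n = 0" by (rule chain_zero [OF c1 J False])
      show ?thesis using germ_of_zero [OF z] z by simp
    qed
  qed
  obtain b where b: "chain 0 0 N b" "\<And>J. J \<subseteq> {0..<r} \<Longrightarrow> \<forall>\<^sub>F n in sequentially. tdiff b J n = c J n"
    using total_exact_from_column [OF c0, of 0] dc by auto
  have bg: "\<forall>J\<subseteq>{0..<r}. card J = N \<longrightarrow> germ 0 0 J (b J)"
    using chain_germ [OF b(1)] by (metis add_0_right diff_self_eq_0 order_refl)
  have bh: "\<forall>J\<subseteq>{0..<r}. card J = Suc N \<longrightarrow> (\<forall>\<^sub>F n in sequentially. hdiff b J n = 0)"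
  proof (intro allI impI)
    fix J assume J: "J \<subseteq> {0..<r}" "card J = Suc N"
    have "\<forall>\<^sub>F n in sequentially. b J n = 0" "\<forall>\<^sub>F n in sequentially. c J n = 0"
      using b(1) c1 J unfolding chain_def by auto
    then show "\<forall>\<^sub>F n in sequentially. hdiff b J n = 0"
      using b(2) [OF J(1)] by eventually_elim (simp add: tdiff_def)
  qed
  obtain e where e0: "\<forall>J\<subseteq>{0..<r}. Suc (card J) = N \<longrightarrow> germ 0 0 J (e J)"
      "\<forall>J\<subseteq>{0..<r}. card J = N \<longrightarrow> (\<forall>\<^sub>F n in sequentially. b J n = hdiff e J n)"
    using assms [unfolded cech_exact_def, THEN spec, THEN mp, THEN mp, OF bg bh] by (elim exE conjE)
  have e: "\<And>J. J \<subseteq> {0..<r} \<Longrightarrow> Suc (card J) = N \<Longrightarrow> germ 0 0 J (e J)"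
      "\<And>J. J \<subseteq> {0..<r} \<Longrightarrow> card J = N \<Longrightarrow> \<forall>\<^sub>F n in sequentially. b J n = hdiff e J n"
    using e0 by simp_all
  \<comment> \<open>Subtracting the total coboundary of \<open>e'\<close> removes the component in the resolved module.\<close>
  define e' where "e' = (\<lambda>J. if Suc (card J) = N then e J else (\<lambda>_. 0))"
  define b' where "b' = (\<lambda>J n. b J n - tdiff e' J n)"
  have che: "chain 0 0 (N - 1) e'" 
    unfolding chain_def
  proof (intro allI impI)
    fix J assume J: "J \<subseteq> {0..<r}"
    show "if card J + 0 \<le> N - 1 then germ 0 (N - 1 - card J) J (e' J) else \<forall>\<^sub>F n in sequentially. e' J n = 0"
      using e(1) [OF J] by (auto simp: e'_def germ_zero)
  qed
  have he: "hdiff e' J n = hdiff e J n" if "J \<subseteq> {0..<r}" "card J = N" for J n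
    unfolding hdiff_def
  proof (rule sum.cong [OF refl])
    fix j assume "j \<in> J"
    then have "Suc (card (J - {j})) = N" using card_Suc_Diff1 [OF finite_J [OF that(1)]] that(2) by simp
    then show "inc_sign j J * act (pw n {j}) (e' (J - {j}) n) = inc_sign j J * act (pw n {j}) (e (J - {j}) n)"
      by (simp add: e'_def)
  qed
  have b'0: "\<forall>\<^sub>F n in sequentially. b' J n = 0" if J: "J \<subseteq> {0..<r}" "card J = N" for J
  proof -
    have z: "e' J n = 0" for n using J(2) by (simp add: e'_def)
    show ?thesis
      using e(2) [OF J] by eventually_elim (simp add: b'_def tdiff_def he [OF J] z)
  qed
  have "chain 0 0 N b'"
  proof (cases N)
    case 0
    have "tdiff e' J n = 0" for J n
      using 0 by (simp add: tdiff_def hdiff_def e'_def)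
    then show ?thesis using b(1) by (simp add: b'_def)
  next
    case (Suc N')
    then have "chain 0 0 N (tdiff e')" using chain_tdiff [OF che] by simp
    then show ?thesis unfolding b'_def by (rule chain_diff [OF b(1)])
  qed
  then have chb': "chain 0 0 N b'" .
  have "chain 1 0 N b'"
    unfolding chain_def
  proof (intro allI impI)
    fix J assume J: "J \<subseteq> {0..<r}"
    consider "card J + 1 \<le> N" | "card J = N" | "N < card J" by linarith
    then show "if card J + 1 \<le> N then germ 0 (N - card J) J (b' J) else \<forall>\<^sub>F n in sequentially. b' J n = 0"
    proof cases
      case 1
      then show ?thesis using chain_germ [OF chb' J] by simp
    next
      case 2
      then show ?thesis using b'0 [OF J] by simp
    next
      case 3
      then show ?thesis using chain_zero [OF chb' J] by simp
    qed
  qed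
  moreover have "\<forall>\<^sub>F n in sequentially. tdiff b' J n = c J n" if J: "J \<subseteq> {0..<r}" for J
    using b(2) [OF J] tdiff_tdiff [OF che J] unfolding b'_def tdiff_diff
    by eventually_elim simp
  ultimately show "\<exists>b. chain 1 0 N b \<and> (\<forall>J\<subseteq>{0..<r}. \<forall>\<^sub>F n in sequentially. tdiff b J n = c J n)"
    by blast
qed

text \<open>
  The localization at one more variable is surjective on torsion elements: one value of the germ
  is lifted, and the fraction represented by the lift is a preimage of the germ.
\<close>

lemma germ_lift:
  assumes k: "k < r" "k \<notin> J" and c: "germ k (Suc q) (insert k J) c"
  obtains b where "germ k (Suc q) J b" "\<forall>\<^sub>F n in sequentially. act (pw n {k}) (b n) = c n"
proof -
  define K where "K = insert k J"
  have KJ: "K - {k} = J" "k \<in> K" using k by (auto simp: K_def)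
  obtain N where N: "\<And>n. n \<ge> N \<Longrightarrow> c n \<in> Gam k (Suc q) (a + deg (pw n K))"
      "\<And>n0 n. N \<le> n0 \<Longrightarrow> n0 \<le> n \<Longrightarrow> c n = act (pw (n - n0) K) (c n0)"
    using c unfolding K_def [symmetric] by (rule germ_iterate) (rule that)
  have "c N \<in> Gam k (Suc q) ((a + deg (pw N J)) + deg (pw N {k}))"
    using N(1) [of N] deg_pw_insert [OF KJ(2), of N] KJ by (simp add: add.assoc)
  then obtain y m where y: "y \<in> F (Suc q) (a + deg (pw N J))" "\<forall>j<k. \<exists>m. act (pw m {j}) y = 0"
      "act (pw (N + m) {k}) y = act (pw m {k}) (c N)"
    using lift [OF k(1), of "c N" q "a + deg (pw N J)" N] unfolding Gam_def by blast
  have yG: "y \<in> Gam k (Suc q) (a + deg (pw N J))" using y by (simp add: Gam_def)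
  have cF: "c N \<in> F (Suc q) (a + deg (pw N K))" using N(1) [of N] Gam_F by blast
  show ?thesis
  proof (rule that [of "spread J N y"])
    show "germ k (Suc q) J (spread J N y)" by (rule germ_spread [OF yG])
    show "\<forall>\<^sub>F n in sequentially. act (pw n {k}) (spread J N y n) = c n"
      unfolding eventually_sequentially
    proof (intro exI [of _ "N + m"] allI impI)
      fix n assume n: "N + m \<le> n"
      have e1: "(\<lambda>j. pw n {k} j + pw (n - N) J j) = (\<lambda>j. (pw (n - N - m) {k} j + pw (n - N) J j) + pw (N + m) {k} j)"
        using n k(2) by (auto simp: pw_def fun_eq_iff)
      have e2: "(\<lambda>j. (pw (n - N - m) {k} j + pw (n - N) J j) + pw m {k} j) = pw (n - N) K"
        using n k(2) by (auto simp: pw_def fun_eq_iff K_def)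
      have "act (pw n {k}) (spread J N y n) = act (pw n {k}) (act (pw (n - N) J) y)"
        using n by (simp add: spread_def)
      also have "\<dots> = act (\<lambda>j. pw (n - N - m) {k} j + pw (n - N) J j) (act (pw (N + m) {k}) y)"
        unfolding act_act [OF y(1)] e1 ..
      also have "\<dots> = act (pw (n - N) K) (c N)"
        unfolding y(3) act_act [OF cF] e2 ..
      also have "\<dots> = c n" using N(2) [of N n] n by simp
      finally show "act (pw n {k}) (spread J N y n) = c n" .
    qed
  qed
qed

lemma germ_torsion:
  assumes "germ (Suc k) q J c"
  shows "\<forall>\<^sub>F n in sequentially. act (pw n {k}) (c n) = 0"
proof -
  obtain N where N: "\<And>n. n \<ge> N \<Longrightarrow> c n \<in> Gam (Suc k) q (a + deg (pw n J))"
      "\<And>n0 n. N \<le> n0 \<Longrightarrow> n0 \<le> n \<Longrightarrow> c n = act (pw (n - n0) J) (c n0)"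
    by (rule germ_iterate [OF assms]) (rule that)
  have cN: "c N \<in> F q (a + deg (pw N J))" using N(1) [of N] Gam_F by blast
  obtain m where m: "act (pw m {k}) (c N) = 0" using N(1) [of N] unfolding Gam_def by blast
  show ?thesis
    unfolding eventually_sequentially
  proof (intro exI [of _ "max N m"] allI impI)
    fix n assume n: "max N m \<le> n"
    have "act (pw n {k}) (c n) = act (pw n {k}) (act (pw (n - N) J) (c N))"
      using N(2) [of N n] n by simp
    also have "\<dots> = act (pw (n - N) J) (act (pw n {k}) (c N))" by (rule act_commute [OF cN])
    also have "act (pw n {k}) (c N) = 0" by (rule act_pw_mono [OF cN m]) (use n in simp)
    finally show "act (pw n {k}) (c n) = 0" by simp
  qed
qed

lemma germ_torsion_intro:
  assumes c: "germ k q J c" and t: "\<forall>\<^sub>F n in sequentially. act (pw n {k}) (c n) = 0"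
  shows "germ (Suc k) q J c"
  using c t unfolding germ_def by eventually_elim (auto simp: Gam_def less_Suc_eq)

text \<open>
  Passing from \<open>k\<close> to \<open>Suc k\<close> replaces the two-term complex of a module and its localization at
  the variable \<open>k\<close> by its kernel, the torsion; this is harmless since the map is surjective.
  Concretely, a cocycle is extended by zero to the sets that contain \<open>k\<close>, and the primitive
  obtained for \<open>k\<close> is changed by a coboundary such that it vanishes on these sets.
\<close>

lemma vanishing_Suc:
  assumes k: "k < r" and van: "vanishing k N"
  shows "vanishing (Suc k) N"
  unfolding vanishing_def
proof (intro allI impI)
  fix c assume c: "chain 1 (Suc k) (Suc N) c"
    and dc: "\<forall>J\<subseteq>{Suc k..<r}. \<forall>\<^sub>F n in sequentially. tdiff c J n = 0"
  \<comment> \<open>The extended cocycle is a cocycle because the values of \<open>c\<close> are torsion with respect to the variable \<open>k\<close>.\<close>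
  define c' where "c' = (\<lambda>J. if k \<in> J then (\<lambda>_. 0) else c J)"
  have sub: "J \<subseteq> {Suc k..<r}" if "J \<subseteq> {k..<r}" "k \<notin> J" for J
    using that by (metis Suc_leI atLeastLessThan_iff le_neq_implies_less subset_eq)
  have weaken: "germ k q J b" if "germ (Suc k) q J b" for q J b
    using that unfolding germ_def by (rule eventually_mono) (auto simp: Gam_def)
  have chc': "chain 1 k (Suc N) c'"
    unfolding chain_def
  proof (intro allI impI)
    fix J assume J: "J \<subseteq> {k..<r}"
    show "if card J + 1 \<le> Suc N then germ k (Suc N - card J) J (c' J) else \<forall>\<^sub>F n in sequentially. c' J n = 0"
    proof (cases "k \<in> J")
      case False
      then show ?thesis using c sub [OF J] weaken unfolding chain_def c'_def by auto
    qed (simp add: c'_def germ_zero)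
  qed
  have dc': "\<forall>J\<subseteq>{k..<r}. \<forall>\<^sub>F n in sequentially. tdiff c' J n = 0"
  proof (intro allI impI)
    fix J assume J: "J \<subseteq> {k..<r}"
    have fin: "finite J" using finite_J [OF J] .
    show "\<forall>\<^sub>F n in sequentially. tdiff c' J n = 0"
    proof (cases "k \<in> J")
      case False
      have "tdiff c' J n = tdiff c J n" for n
        using False by (auto simp: tdiff_def hdiff_def c'_def intro!: sum.cong)
      then show ?thesis using dc sub [OF J False] by auto
    next
      case True
      have Jk: "J - {k} \<subseteq> {Suc k..<r}" using J sub [of "J - {k}"] by auto
      have "\<forall>\<^sub>F n in sequentially. act (pw n {k}) (c (J - {k}) n) = 0"
      proof (cases "card (J - {k}) + 1 \<le> Suc N")
        case True
        show ?thesis by (rule germ_torsion [OF chain_germ [OF c Jk True]])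
      next
        case False
        show ?thesis using chain_zero [OF c Jk False] by eventually_elim simp
      qed
      then show ?thesis
      proof eventually_elim
        case (elim n)
        have "inc_sign j J * act (pw n {j}) (c' (J - {j}) n) = 0" if "j \<in> J" for j
          using True elim that by (cases "j = k") (auto simp: c'_def)
        then show ?case using True by (simp add: tdiff_def hdiff_def c'_def)
      qed
    qed
  qed
  obtain b where b: "chain 1 k N b" "\<And>J. J \<subseteq> {k..<r} \<Longrightarrow> \<forall>\<^sub>F n in sequentially. tdiff b J n = c' J n"
    using van chc' dc' unfolding vanishing_def by blast
  have "\<exists>e. (if card J + 2 \<le> N then germ k (N - 1 - card J) J e else e = (\<lambda>_. 0)) \<and>
      (\<forall>\<^sub>F n in sequentially. inc_sign k (insert k J) * act (pw n {k}) (e n) = b (insert k J) n)"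
    if J: "J \<subseteq> {Suc k..<r}" for J
  proof -
    have kJ: "k \<notin> J" "insert k J \<subseteq> {k..<r}" using J k by auto
    have cardk: "card (insert k J) = Suc (card J)" using kJ finite_J [OF J] by simp
    show ?thesis
    proof (cases "card J + 2 \<le> N")
      case True
      define q where "q = N - card J - 2"
      have q: "N - card (insert k J) = Suc q" "N - 1 - card J = Suc q"
        using True cardk by (auto simp: q_def)
      have "germ k (Suc q) (insert k J) (b (insert k J))"
        using chain_germ [OF b(1) kJ(2)] True q(1) cardk by simp
      then have "germ k (Suc q) (insert k J) (\<lambda>n. inc_sign k (insert k J) * b (insert k J) n)"
        by (rule germ_sign)
      then obtain e where e: "germ k (Suc q) J e"
          "\<forall>\<^sub>F n in sequentially. act (pw n {k}) (e n) = inc_sign k (insert k J) * b (insert k J) n"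
        by (rule germ_lift [OF k kJ(1)])
      have "\<forall>\<^sub>F n in sequentially. inc_sign k (insert k J) * act (pw n {k}) (e n) = b (insert k J) n"
        using e(2) by eventually_elim simp
      then show ?thesis using e(1) True q(2) by auto
    next
      case False
      then have "\<forall>\<^sub>F n in sequentially. b (insert k J) n = 0"
        using chain_zero [OF b(1) kJ(2)] cardk by simp
      then have "\<forall>\<^sub>F n in sequentially. inc_sign k (insert k J) * act (pw n {k}) 0 = b (insert k J) n"
        by eventually_elim simp
      then show ?thesis using False by (intro exI [of _ "\<lambda>_. 0"]) auto
    qed
  qed
  then have "\<forall>J. \<exists>e. J \<subseteq> {Suc k..<r} \<longrightarrow> (if card J + 2 \<le> N then germ k (N - 1 - card J) J e else e = (\<lambda>_. 0)) \<and>
      (\<forall>\<^sub>F n in sequentially. inc_sign k (insert k J) * act (pw n {k}) (e n) = b (insert k J) n)"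
    by blast
  from choice [OF this] obtain E where E0: "\<forall>J. J \<subseteq> {Suc k..<r} \<longrightarrow>
      (if card J + 2 \<le> N then germ k (N - 1 - card J) J (E J) else E J = (\<lambda>_. 0)) \<and>
      (\<forall>\<^sub>F n in sequentially. inc_sign k (insert k J) * act (pw n {k}) (E J n) = b (insert k J) n)"
    by (elim exE)
  have E: "\<And>J. J \<subseteq> {Suc k..<r} \<Longrightarrow> (if card J + 2 \<le> N then germ k (N - 1 - card J) J (E J) else E J = (\<lambda>_. 0))"
      "\<And>J. J \<subseteq> {Suc k..<r} \<Longrightarrow>
         \<forall>\<^sub>F n in sequentially. inc_sign k (insert k J) * act (pw n {k}) (E J n) = b (insert k J) n"
    using E0 by blast+
  \<comment> \<open>The coboundary of \<open>e\<close> agrees with \<open>b\<close> on the sets that contain \<open>k\<close>.\<close>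
  define e where "e = (\<lambda>J. if k \<in> J then (\<lambda>_. 0) else E J)"
  have che: "chain 1 k (N - 1) e"
    unfolding chain_def
  proof (intro allI impI)
    fix J assume J: "J \<subseteq> {k..<r}"
    show "if card J + 1 \<le> N - 1 then germ k (N - 1 - card J) J (e J) else \<forall>\<^sub>F n in sequentially. e J n = 0"
    proof (cases "k \<in> J")
      case False
      have eJ: "e J = E J" using False by (simp add: e_def)
      show ?thesis
      proof (cases "card J + 2 \<le> N")
        case True
        then have "card J + 1 \<le> N - 1" by simp
        then show ?thesis
          using E(1) [OF sub [OF J False]] True unfolding eJ by (simp only: if_True)
      next
        case F2: False
        then have "\<not> card J + 1 \<le> N - 1" by simp
        then show ?thesis
          using E(1) [OF sub [OF J False]] F2 unfolding eJ by simp
      qed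
    qed (simp add: e_def germ_zero)
  qed
  have chde: "chain 1 k N (tdiff e)"
  proof (cases N)
    case 0
    have zero: "e J n = 0" if "J \<subseteq> {k..<r}" for J n
      using E(1) [OF sub [OF that]] 0 by (auto simp: e_def)
    have "tdiff e J n = 0" if J: "J \<subseteq> {k..<r}" for J n
    proof -
      have "e (J - {j}) n = 0" "e J n = 0" for j using J by (auto intro!: zero)
      then show ?thesis by (simp add: tdiff_def hdiff_def)
    qed
    then show ?thesis using 0 by (auto simp: chain_def)
  next
    case (Suc N')
    then show ?thesis using chain_tdiff [OF che] by simp
  qed
  define b' where "b' = (\<lambda>J n. b J n - tdiff e J n)"
  have chb': "chain 1 k N b'" unfolding b'_def by (rule chain_diff [OF b(1) chde])
  have db': "\<forall>\<^sub>F n in sequentially. tdiff b' J n = c' J n" if J: "J \<subseteq> {k..<r}" for J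
    using b(2) [OF J] tdiff_tdiff [OF che J] unfolding b'_def tdiff_diff by eventually_elim simp
  have b'k: "\<forall>\<^sub>F n in sequentially. b' (insert k J) n = 0" if J: "J \<subseteq> {Suc k..<r}" for J
    using E(2) [OF J]
  proof eventually_elim
    case (elim n)
    have kJ: "k \<notin> J" "finite J" using J finite_J by auto
    have "hdiff e (insert k J) n = inc_sign k (insert k J) * act (pw n {k}) (e J n) +
        (\<Sum>j\<in>J. inc_sign j (insert k J) * act (pw n {j}) (e (insert k J - {j}) n))"
      using kJ by (simp add: hdiff_def)
    also have "(\<Sum>j\<in>J. inc_sign j (insert k J) * act (pw n {j}) (e (insert k J - {j}) n)) = 0"
      using kJ by (intro sum.neutral) (auto simp: e_def)
    finally show ?case using elim kJ by (simp add: b'_def tdiff_def e_def)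
  qed
  have "chain 1 (Suc k) N b'"
    unfolding chain_def
  proof (intro allI impI)
    fix J assume J: "J \<subseteq> {Suc k..<r}"
    then have Jk: "J \<subseteq> {k..<r}" by auto
    have kJ: "k \<notin> J" "finite J" "insert k J \<subseteq> {k..<r}" using J finite_J k by auto
    show "if card J + 1 \<le> N then germ (Suc k) (N - card J) J (b' J) else \<forall>\<^sub>F n in sequentially. b' J n = 0"
    proof (cases "card J + 1 \<le> N")
      case True
      then have g: "germ k (N - card J) J (b' J)" using chb' Jk unfolding chain_def by auto
      have "\<forall>\<^sub>F n in sequentially. \<forall>j\<in>J. b' (insert k (J - {j})) n = 0"
        using kJ(2) J by (intro eventually_ball_finite ballI b'k) auto
      then have "\<forall>\<^sub>F n in sequentially. act (pw n {k}) (b' J n) = 0"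
        using b'k [OF J] db' [OF kJ(3)]
      proof eventually_elim
        case (elim n)
        have "hdiff b' (insert k J) n = inc_sign k (insert k J) * act (pw n {k}) (b' J n) +
            (\<Sum>j\<in>J. inc_sign j (insert k J) * act (pw n {j}) (b' (insert k J - {j}) n))"
          using kJ by (simp add: hdiff_def)
        also have "(\<Sum>j\<in>J. inc_sign j (insert k J) * act (pw n {j}) (b' (insert k J - {j}) n)) = 0"
        proof (intro sum.neutral ballI)
          fix j assume j: "j \<in> J"
          then have "insert k J - {j} = insert k (J - {j})" using kJ by auto
          then show "inc_sign j (insert k J) * act (pw n {j}) (b' (insert k J - {j}) n) = 0"
            using elim(1) j by simp
        qed
        finally have "inc_sign k (insert k J) * act (pw n {k}) (b' J n) = 0"
          using elim(2,3) by (simp add: tdiff_def c'_def)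
        then have "inc_sign k (insert k J) * (inc_sign k (insert k J) * act (pw n {k}) (b' J n)) = 0"
          by simp
        then show ?case by (simp only: inc_sign_square)
      qed
      then show ?thesis using True germ_torsion_intro [OF g] by simp
    next
      case False
      then show ?thesis using chb' Jk unfolding chain_def by auto
    qed
  qed
  moreover have "\<forall>\<^sub>F n in sequentially. tdiff b' J n = c J n" if J: "J \<subseteq> {Suc k..<r}" for J
  proof -
    have "J \<subseteq> {k..<r}" "k \<notin> J" using J by auto
    then show ?thesis using db' [of J] by (simp add: c'_def)
  qed
  ultimately show "\<exists>b. chain 1 (Suc k) N b \<and> (\<forall>J\<subseteq>{Suc k..<r}. \<forall>\<^sub>F n in sequentially. tdiff b J n = c J n)"
    by blast
qed

text \<open>
  For \<open>k = r\<close> only the empty set is left in the Cech complex, and its germs are elements of degree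
  \<open>a\<close>.
\<close>

lemma torsion_cohomology_vanishes:
  assumes "cech_exact N" and x: "x \<in> Gam r (Suc N) a" "d x = 0"
  shows "if N = 0 then x = 0 else \<exists>y\<in>Gam r N a. d y = x"
proof -
  have "k \<le> r \<Longrightarrow> vanishing k N" for k
    by (induction k) (auto intro: vanishing_0 assms vanishing_Suc)
  then have van: "vanishing r N" by simp
  have pw0: "pw n {} = (\<lambda>_. 0)" for n by (simp add: pw_def)
  define c where "c = (\<lambda>(J::nat set) (n::nat). x)"
  have "germ r (Suc N) {} (\<lambda>_. x)"
    using x(1) act_0 [OF Gam_F [OF x(1)]] by (simp add: germ_def pw0 deg_0)
  then have "chain 1 r (Suc N) c" by (simp add: chain_def c_def)
  moreover have "\<forall>J\<subseteq>{r..<r}. \<forall>\<^sub>F n in sequentially. tdiff c J n = 0"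
    using x(2) by (simp add: tdiff_def hdiff_def c_def)
  ultimately obtain b where b: "chain 1 r N b" "\<forall>\<^sub>F n in sequentially. tdiff b {} n = x"
    using van unfolding vanishing_def by (auto simp: c_def)
  show ?thesis
  proof (cases "N = 0")
    case True
    then have "\<forall>\<^sub>F n in sequentially. b {} n = 0" using b(1) by (simp add: chain_def)
    then have "\<forall>\<^sub>F (n::nat) in sequentially. x = 0"
      using b(2) by eventually_elim (simp add: tdiff_def hdiff_def)
    then show ?thesis using True by simp
  next
    case False
    then have "germ r N {} (b {})" using b(1) by (simp add: chain_def)
    then have "\<forall>\<^sub>F n in sequentially. b {} n \<in> Gam r N a"
      unfolding germ_def by (rule eventually_mono) (simp add: pw0 deg_0)
    then have "\<forall>\<^sub>F n in sequentially. b {} n \<in> Gam r N a \<and> d (b {} n) = x"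
      using b(2) by eventually_elim (simp add: tdiff_def hdiff_def)
    then have "\<exists>n. b {} n \<in> Gam r N a \<and> d (b {} n) = x"
      by (rule eventually_happens' [OF sequentially_bot])
    then show ?thesis using False by auto
  qed
qed

end

section \<open>Graded modules and graded injectivity\<close>

lemma module_abelian_group: "Module.module R N \<Longrightarrow> abelian_group N"
  by (simp add: module_def)

lemma additive_map_zero:
  assumes N: "abelian_group N" and P: "abelian_group P"
    and f: "f \<in> carrier N \<rightarrow> carrier P"
    and add: "\<And>x y. x \<in> carrier N \<Longrightarrow> y \<in> carrier N \<Longrightarrow> f (x \<oplus>\<^bsub>N\<^esub> y) = f x \<oplus>\<^bsub>P\<^esub> f y"
  shows "f \<zero>\<^bsub>N\<^esub> = \<zero>\<^bsub>P\<^esub>"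
proof -
  interpret N: abelian_group N by fact
  interpret P: abelian_group P by fact
  have z: "f \<zero>\<^bsub>N\<^esub> \<in> carrier P" using f by auto
  have "f \<zero>\<^bsub>N\<^esub> \<oplus>\<^bsub>P\<^esub> f \<zero>\<^bsub>N\<^esub> = f \<zero>\<^bsub>N\<^esub>"
    using add [of "\<zero>\<^bsub>N\<^esub>" "\<zero>\<^bsub>N\<^esub>"] by simp
  then show ?thesis using z by (metis P.add.l_cancel_one')
qed

lemma additive_map_finsum:
  assumes N: "abelian_group N" and P: "abelian_group P"
    and f: "f \<in> carrier N \<rightarrow> carrier P"
    and add: "\<And>x y. x \<in> carrier N \<Longrightarrow> y \<in> carrier N \<Longrightarrow> f (x \<oplus>\<^bsub>N\<^esub> y) = f x \<oplus>\<^bsub>P\<^esub> f y"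
    and S: "finite S" and c: "c \<in> S \<rightarrow> carrier N"
  shows "f (\<Oplus>\<^bsub>N\<^esub>b\<in>S. c b) = (\<Oplus>\<^bsub>P\<^esub>b\<in>S. f (c b))"
proof -
  interpret N: abelian_group N by fact
  interpret P: abelian_group P by fact
  show ?thesis
    using S c
  proof (induction S rule: finite_induct)
    case empty
    show ?case using additive_map_zero [OF N P f add] by simp
  next
    case (insert b S)
    then have "c \<in> S \<rightarrow> carrier N" "c b \<in> carrier N" by auto
    moreover have "(\<lambda>b. f (c b)) \<in> S \<rightarrow> carrier P" "f (c b) \<in> carrier P"
      using calculation f by auto
    ultimately show ?case
      using insert by (simp add: N.finsum_insert P.finsum_insert add)
  qed
qed

lemma finsum_subcarrier:
  assumes N: "abelian_group N" and N': "abelian_group N'"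
    and sub: "carrier N' \<subseteq> carrier N" and eq: "add N' = add N" "zero N' = zero N"
    and S: "finite S" and c: "c \<in> S \<rightarrow> carrier N'"
  shows "(\<Oplus>\<^bsub>N'\<^esub>b\<in>S. c b) = (\<Oplus>\<^bsub>N\<^esub>b\<in>S. c b)"
proof -
  have "(\<lambda>x. x) (\<Oplus>\<^bsub>N'\<^esub>b\<in>S. c b) = (\<Oplus>\<^bsub>N\<^esub>b\<in>S. (\<lambda>x. x) (c b))"
    by (rule additive_map_finsum [OF N' N _ _ S c]) (use sub eq in auto)
  then show ?thesis by simp
qed

definition decomposition :: "('a, 'b, 'g) graded_module \<Rightarrow> 'b \<Rightarrow> ('g \<Rightarrow> 'b) \<Rightarrow> bool" where
  "decomposition N x c \<longleftrightarrow> (\<forall>b. c b \<in> grade N b) \<and> finite {b. c b \<noteq> \<zero>\<^bsub>N\<^esub>} \<and>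
        x = (\<Oplus>\<^bsub>N\<^esub>b\<in>{b. c b \<noteq> \<zero>\<^bsub>N\<^esub>}. c b)"

lemma graded_moduleD:
  assumes "is_graded_module R A N"
  shows "Module.module R N" "abelian_group N"
    "\<And>b. additive_subgroup (grade N b) N"
    "\<And>b. grade N b \<subseteq> carrier N" "\<And>b. \<zero>\<^bsub>N\<^esub> \<in> grade N b"
    "\<And>b x y. x \<in> grade N b \<Longrightarrow> y \<in> grade N b \<Longrightarrow> x \<oplus>\<^bsub>N\<^esub> y \<in> grade N b"
    "\<And>b x. x \<in> grade N b \<Longrightarrow> \<ominus>\<^bsub>N\<^esub> x \<in> grade N b"
    "\<And>x. x \<in> carrier N \<Longrightarrow> \<exists>c. decomposition N x c"
    "\<And>x c c'. x \<in> carrier N \<Longrightarrow> decomposition N x c \<Longrightarrow> decomposition N x c' \<Longrightarrow> c = c'"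
    "\<And>b b' r x. r \<in> A b \<Longrightarrow> x \<in> grade N b' \<Longrightarrow> r \<odot>\<^bsub>N\<^esub> x \<in> grade N (b + b')"
proof -
  show M: "Module.module R N" and sub: "\<And>b. additive_subgroup (grade N b) N"
    using assms by (simp_all add: is_graded_module_def)
  show ab: "abelian_group N" using M by (rule module_abelian_group)
  show "\<And>b. grade N b \<subseteq> carrier N" using additive_subgroup.a_subset [OF sub] .
  show "\<And>b. \<zero>\<^bsub>N\<^esub> \<in> grade N b" using additive_subgroup.zero_closed [OF sub] .
  show "\<And>b x y. x \<in> grade N b \<Longrightarrow> y \<in> grade N b \<Longrightarrow> x \<oplus>\<^bsub>N\<^esub> y \<in> grade N b"
    using additive_subgroup.a_closed [OF sub] .
  show "\<And>b x. x \<in> grade N b \<Longrightarrow> \<ominus>\<^bsub>N\<^esub> x \<in> grade N b"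
    using additive_subgroup.a_inv_closed [OF sub] .
  have ex1: "\<exists>!c. decomposition N x c" if "x \<in> carrier N" for x
    using assms that unfolding is_graded_module_def decomposition_def by blast
  show "\<And>x. x \<in> carrier N \<Longrightarrow> \<exists>c. decomposition N x c" using ex1 by blast
  show "\<And>x c c'. x \<in> carrier N \<Longrightarrow> decomposition N x c \<Longrightarrow> decomposition N x c' \<Longrightarrow> c = c'"
    using ex1 by blast
  show "\<And>b b' r x. r \<in> A b \<Longrightarrow> x \<in> grade N b' \<Longrightarrow> r \<odot>\<^bsub>N\<^esub> x \<in> grade N (b + b')"
    using assms by (simp add: is_graded_module_def)
qed

lemma decomposition_homogeneous:
  assumes N: "is_graded_module R A N" and x: "x \<in> grade N g"
  shows "decomposition N x (\<lambda>b. if b = g then x else \<zero>\<^bsub>N\<^esub>)"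
proof -
  interpret N: abelian_group N using graded_moduleD(2) [OF N] .
  have xN: "x \<in> carrier N" using x graded_moduleD(4) [OF N] by blast
  have set: "{b. (if b = g then x else \<zero>\<^bsub>N\<^esub>) \<noteq> \<zero>\<^bsub>N\<^esub>} = (if x = \<zero>\<^bsub>N\<^esub> then {} else {g})"
    by auto
  show ?thesis
    unfolding decomposition_def set
    using x xN graded_moduleD(5) [OF N] by (auto simp: N.finsum_insert)
qed

text \<open>
  By uniqueness of decompositions in \<open>P\<close>, the component of degree \<open>g\<close> of a preimage is a preimage
  too.
\<close>

lemma graded_hom_lift:
  assumes N: "is_graded_module R A N" and P: "is_graded_module R A P"
    and f: "graded_hom R N P f" and x: "x \<in> carrier N" "f x \<in> grade P g"
  obtains y where "y \<in> grade N g" "f y = f x"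
proof -
  have abN: "abelian_group N" and abP: "abelian_group P"
    using graded_moduleD(2) N P by blast+
  interpret P: abelian_group P by fact
  have fc: "f \<in> carrier N \<rightarrow> carrier P"
    and fadd: "\<And>x y. x \<in> carrier N \<Longrightarrow> y \<in> carrier N \<Longrightarrow> f (x \<oplus>\<^bsub>N\<^esub> y) = f x \<oplus>\<^bsub>P\<^esub> f y"
    and fgr: "\<And>b x. x \<in> grade N b \<Longrightarrow> f x \<in> grade P b"
    using f unfolding graded_hom_def by blast+
  obtain c where c: "decomposition N x c" using graded_moduleD(8) [OF N x(1)] by blast
  define S where "S = {b. c b \<noteq> \<zero>\<^bsub>N\<^esub>}"
  have S: "finite S" "x = (\<Oplus>\<^bsub>N\<^esub>b\<in>S. c b)" and cg: "\<And>b. c b \<in> grade N b"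
    using c unfolding decomposition_def S_def by auto
  have cN: "c \<in> S \<rightarrow> carrier N" using cg graded_moduleD(4) [OF N] by blast
  have f0: "f \<zero>\<^bsub>N\<^esub> = \<zero>\<^bsub>P\<^esub>" by (rule additive_map_zero [OF abN abP fc fadd])
  have fcP: "f (c b) \<in> carrier P" for b using cg graded_moduleD(4) [OF N] fc by blast
  have sub: "{b. f (c b) \<noteq> \<zero>\<^bsub>P\<^esub>} \<subseteq> S" using f0 by (auto simp: S_def)
  have "f x = (\<Oplus>\<^bsub>P\<^esub>b\<in>S. f (c b))"
    unfolding S(2) by (rule additive_map_finsum [OF abN abP fc fadd S(1) cN])
  also have "\<dots> = (\<Oplus>\<^bsub>P\<^esub>b\<in>{b. f (c b) \<noteq> \<zero>\<^bsub>P\<^esub>}. f (c b))"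
    using sub fcP S(1) by (intro P.add.finprod_mono_neutral_cong_right) auto
  finally have "decomposition P (f x) (\<lambda>b. f (c b))"
    unfolding decomposition_def using fgr cg finite_subset [OF sub S(1)] by auto
  moreover have "decomposition P (f x) (\<lambda>b. if b = g then f x else \<zero>\<^bsub>P\<^esub>)"
    by (rule decomposition_homogeneous [OF P x(2)])
  moreover have "f x \<in> carrier P" using fc x by auto
  ultimately have "(\<lambda>b. f (c b)) = (\<lambda>b. if b = g then f x else \<zero>\<^bsub>P\<^esub>)"
    using graded_moduleD(9) [OF P] by blast
  then have "f (c g) = f x" by (metis (mono_tags))
  then show ?thesis using cg that by blast
qed

text \<open>
  The grading is shifted by \<open>g\<close> because homomorphisms of degree \<open>g\<close> are treated as homomorphisms
  of degree \<open>0\<close> on a shifted module.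
\<close>

lemma graded_submodule:
  fixes N :: "('a, 'b, 'g::ab_group_add) graded_module"
  assumes N: "is_graded_module R A N"
    and U: "U \<subseteq> carrier N" "\<zero>\<^bsub>N\<^esub> \<in> U" "\<And>x y. x \<in> U \<Longrightarrow> y \<in> U \<Longrightarrow> x \<oplus>\<^bsub>N\<^esub> y \<in> U"
      "\<And>x. x \<in> U \<Longrightarrow> \<ominus>\<^bsub>N\<^esub> x \<in> U"
      "\<And>r x. r \<in> carrier R \<Longrightarrow> x \<in> U \<Longrightarrow> r \<odot>\<^bsub>N\<^esub> x \<in> U"
      "\<And>x c b. x \<in> U \<Longrightarrow> decomposition N x c \<Longrightarrow> c b \<in> U"
    and A: "\<And>b. A b \<subseteq> carrier R"
  shows "is_graded_module R A (N\<lparr>carrier := U, grade := \<lambda>b. U \<inter> grade N (b - g)\<rparr>)"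
proof -
  let ?U = "N\<lparr>carrier := U, grade := \<lambda>b. U \<inter> grade N (b - g)\<rparr>"
  interpret N: Module.module R N using graded_moduleD(1) [OF N] .
  have UN: "x \<in> carrier N" if "x \<in> U" for x using U that by auto
  have abU: "abelian_group ?U"
  proof (rule abelian_groupI)
    fix x assume x: "x \<in> carrier ?U"
    show "\<exists>y\<in>carrier ?U. y \<oplus>\<^bsub>?U\<^esub> x = \<zero>\<^bsub>?U\<^esub>"
      using x U(4) UN by (intro bexI [of _ "\<ominus>\<^bsub>N\<^esub> x"]) (auto simp: N.M.l_neg)
  qed (use U UN in \<open>auto simp: N.M.add.m_ac\<close>)
  have modU: "Module.module R ?U"
    by (rule moduleI) (use U UN abU in \<open>auto simp: N.smult_l_distr N.smult_r_distr N.smult_assoc1 N.R.is_cring\<close>)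
  have minus: "\<ominus>\<^bsub>?U\<^esub> x = \<ominus>\<^bsub>N\<^esub> x" if x: "x \<in> U" for x
  proof -
    interpret V: abelian_group ?U by (rule abU)
    have "\<ominus>\<^bsub>N\<^esub> x \<in> carrier ?U" "x \<in> carrier ?U" using U(4) x by auto
    moreover have "\<ominus>\<^bsub>N\<^esub> x \<oplus>\<^bsub>?U\<^esub> x = \<zero>\<^bsub>?U\<^esub>" using UN [OF x] by (simp add: N.M.l_neg)
    ultimately show ?thesis by (simp add: V.minus_equality)
  qed
  have sub: "additive_subgroup (grade ?U b) ?U" for b
  proof (rule additive_subgroupI, rule group.subgroupI)
    show "Group.group (add_monoid ?U)" by (rule abelian_group.a_group [OF abU])
    show "grade ?U b \<subseteq> carrier (add_monoid ?U)" by auto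
    show "grade ?U b \<noteq> {}" using U(2) graded_moduleD(5) [OF N] by auto
    fix x assume x: "x \<in> grade ?U b"
    have "inv\<^bsub>add_monoid ?U\<^esub> x = \<ominus>\<^bsub>N\<^esub> x" using minus x by (simp add: a_inv_def)
    then show "inv\<^bsub>add_monoid ?U\<^esub> x \<in> grade ?U b" using x U(4) graded_moduleD(7) [OF N] by auto
    fix y assume y: "y \<in> grade ?U b"
    show "x \<otimes>\<^bsub>add_monoid ?U\<^esub> y \<in> grade ?U b" using x y U(3) graded_moduleD(6) [OF N] by auto
  qed
  have fin: "(\<Oplus>\<^bsub>?U\<^esub>b\<in>S. c b) = (\<Oplus>\<^bsub>N\<^esub>b\<in>S. c b)" if "finite S" "c \<in> S \<rightarrow> U" for S :: "'g set" and c
    by (rule finsum_subcarrier [OF graded_moduleD(2) [OF N] abU]) (use U that in auto)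
  have shift: "decomposition ?U x c \<longleftrightarrow> (\<forall>b. c b \<in> U) \<and> decomposition N x (\<lambda>b. c (b + g))" for x c
  proof (cases "\<forall>b. c b \<in> U")
    case True
    have set: "{b. c b \<noteq> \<zero>\<^bsub>N\<^esub>} = (\<lambda>b. b + g) ` {b. c (b + g) \<noteq> \<zero>\<^bsub>N\<^esub>}"
      by (auto simp: image_iff intro: exI [of _ "_ - g"]) (metis diff_add_cancel)
    have inj: "inj_on (\<lambda>b. b + g) X" for X by (auto simp: inj_on_def)
    have fins: "finite {b. c b \<noteq> \<zero>\<^bsub>N\<^esub>} \<longleftrightarrow> finite {b. c (b + g) \<noteq> \<zero>\<^bsub>N\<^esub>}"
      unfolding set using inj by (simp add: finite_image_iff)
    have sums: "(\<Oplus>\<^bsub>?U\<^esub>b\<in>{b. c b \<noteq> \<zero>\<^bsub>N\<^esub>}. c b) = (\<Oplus>\<^bsub>N\<^esub>b\<in>{b. c (b + g) \<noteq> \<zero>\<^bsub>N\<^esub>}. c (b + g))"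
      if "finite {b. c b \<noteq> \<zero>\<^bsub>N\<^esub>}"
    proof -
      have "(\<Oplus>\<^bsub>?U\<^esub>b\<in>{b. c b \<noteq> \<zero>\<^bsub>N\<^esub>}. c b) = (\<Oplus>\<^bsub>N\<^esub>b\<in>{b. c b \<noteq> \<zero>\<^bsub>N\<^esub>}. c b)"
        using that True by (intro fin) auto
      also have "\<dots> = (\<Oplus>\<^bsub>N\<^esub>b\<in>{b. c (b + g) \<noteq> \<zero>\<^bsub>N\<^esub>}. c (b + g))"
        unfolding set using True UN by (intro N.M.finsum_reindex inj) auto
      finally show ?thesis .
    qed
    have "(\<forall>b. c b \<in> grade N (b - g)) \<longleftrightarrow> (\<forall>b. c (b + g) \<in> grade N b)"
      by (metis add_diff_cancel diff_add_cancel)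
    then show ?thesis
      unfolding decomposition_def using True fins sums by auto
  qed (auto simp: decomposition_def)
  show ?thesis
    unfolding is_graded_module_def
  proof (intro conjI allI ballI modU sub)
    fix x assume "x \<in> carrier ?U"
    then have x: "x \<in> U" "x \<in> carrier N" using UN by auto
    obtain c where c: "decomposition N x c" using graded_moduleD(8) [OF N x(2)] by blast
    have "\<exists>!c. decomposition ?U x c"
    proof (rule ex1I [of _ "\<lambda>b. c (b - g)"])
      show "decomposition ?U x (\<lambda>b. c (b - g))"
        unfolding shift using c U(6) [OF x(1) c] by simp
      fix c' assume "decomposition ?U x c'"
      then have "(\<lambda>b. c' (b + g)) = c" using graded_moduleD(9) [OF N x(2) _ c] shift by blast
      then show "c' = (\<lambda>b. c (b - g))" by (auto simp: fun_eq_iff) (metis diff_add_cancel)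
    qed
    then show "\<exists>!c. (\<forall>b. c b \<in> grade ?U b) \<and> finite {b. c b \<noteq> \<zero>\<^bsub>?U\<^esub>} \<and>
        x = (\<Oplus>\<^bsub>?U\<^esub>b\<in>{b. c b \<noteq> \<zero>\<^bsub>?U\<^esub>}. c b)"
      unfolding decomposition_def .
  next
    fix b b' r x assume r: "r \<in> A b" and x: "x \<in> grade ?U b'"
    then have "r \<odot>\<^bsub>N\<^esub> x \<in> grade N (b + (b' - g))"
      using graded_moduleD(10) [OF N] by auto
    then show "r \<odot>\<^bsub>?U\<^esub> x \<in> grade ?U (b + b')"
      using x r A U(5) by (auto simp: add_diff_eq)
  qed
qed

section \<open>Linear functionals\<close>

definition linear_functional :: "('a, 'b, 'm) module_scheme \<Rightarrow> ('k::field \<Rightarrow> 'a) \<Rightarrow> ('b \<Rightarrow> 'k) \<Rightarrow> bool" where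
  "linear_functional N \<sigma> f \<longleftrightarrow>
     (\<forall>x\<in>carrier N. \<forall>y\<in>carrier N. f (x \<oplus>\<^bsub>N\<^esub> y) = f x + f y) \<and>
     (\<forall>s. \<forall>x\<in>carrier N. f (\<sigma> s \<odot>\<^bsub>N\<^esub> x) = s * f x)"

text \<open>
  A subspace that is maximal among those without \<open>x\<close> is a complement of the line through \<open>x\<close>; the
  functional is the coordinate on this line. The module is viewed as a vector space through \<open>\<sigma>\<close>.
\<close>

lemma linear_functional_exists:
  fixes N (structure) and \<sigma> :: "'k::field \<Rightarrow> 'a"
  assumes N: "abelian_group N"
    and closed: "\<And>s x. x \<in> carrier N \<Longrightarrow> \<sigma> s \<odot> x \<in> carrier N"
    and distl: "\<And>s t x. x \<in> carrier N \<Longrightarrow> \<sigma> (s + t) \<odot> x = \<sigma> s \<odot> x \<oplus> \<sigma> t \<odot> x"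
    and distr: "\<And>s x y. x \<in> carrier N \<Longrightarrow> y \<in> carrier N \<Longrightarrow> \<sigma> s \<odot> (x \<oplus> y) = \<sigma> s \<odot> x \<oplus> \<sigma> s \<odot> y"
    and assoc: "\<And>s t x. x \<in> carrier N \<Longrightarrow> \<sigma> s \<odot> (\<sigma> t \<odot> x) = \<sigma> (s * t) \<odot> x"
    and one: "\<And>x. x \<in> carrier N \<Longrightarrow> \<sigma> 1 \<odot> x = x"
    and x: "x \<in> carrier N" "x \<noteq> \<zero>"
  obtains f where "linear_functional N \<sigma> f" "f x \<noteq> 0"
proof -
  interpret abelian_group N by fact
  have s0: "\<sigma> 0 \<odot> y = \<zero>" if y: "y \<in> carrier N" for y
    using distl [OF y, of 0 0] closed [OF y, of 0] by (metis add.l_cancel_one' add_0)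
  have sz: "\<sigma> s \<odot> \<zero> = \<zero>" for s
    using distr [of \<zero> \<zero> s] closed [of \<zero> s] by (metis add.l_cancel_one' l_zero zero_closed)
  have sneg: "\<sigma> (- s) \<odot> y = \<ominus> (\<sigma> s \<odot> y)" if y: "y \<in> carrier N" for y s
    using distl [OF y, of "- s" s] s0 [OF y] closed [OF y] by (metis add.left_inverse minus_equality)
  define sub where "sub = (\<lambda>U. U \<subseteq> carrier N \<and> \<zero> \<in> U \<and> (\<forall>y\<in>U. \<forall>z\<in>U. y \<oplus> z \<in> U) \<and> (\<forall>s. \<forall>y\<in>U. \<sigma> s \<odot> y \<in> U))"
  define \<A> where "\<A> = {U. sub U \<and> x \<notin> U}"
  have "\<exists>U\<in>\<A>. \<forall>X\<in>\<A>. U \<subseteq> X \<longrightarrow> X = U"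
  proof (rule subset_Zorn_nonempty)
    have "{\<zero>} \<in> \<A>" using x sz by (auto simp: \<A>_def sub_def)
    then show "\<A> \<noteq> {}" by auto
    fix \<C> assume C: "\<C> \<noteq> {}" "subset.chain \<A> \<C>"
    have CA: "U \<in> \<A>" if "U \<in> \<C>" for U using C that by (auto simp: subset.chain_def)
    have tot: "U \<subseteq> V \<or> V \<subseteq> U" if "U \<in> \<C>" "V \<in> \<C>" for U V
      using C(2) that unfolding subset.chain_def by blast
    have "sub (\<Union>\<C>)"
      unfolding sub_def
    proof (intro conjI ballI allI)
      show "\<Union>\<C> \<subseteq> carrier N" using CA unfolding \<A>_def sub_def by blast
      show "\<zero> \<in> \<Union>\<C>" using C(1) CA by (auto simp: \<A>_def sub_def)
      fix y assume "y \<in> \<Union>\<C>"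
      then obtain U where U: "U \<in> \<C>" "y \<in> U" by auto
      show "\<sigma> s \<odot> y \<in> \<Union>\<C>" for s using U CA [OF U(1)] unfolding \<A>_def sub_def by blast
      fix z assume "z \<in> \<Union>\<C>"
      then obtain V where V: "V \<in> \<C>" "z \<in> V" by auto
      obtain W where W: "W \<in> \<C>" "y \<in> W" "z \<in> W" using tot [OF U(1) V(1)] U V by blast
      show "y \<oplus> z \<in> \<Union>\<C>" using W CA [OF W(1)] unfolding \<A>_def sub_def by blast
    qed
    then show "\<Union>\<C> \<in> \<A>" using CA by (auto simp: \<A>_def)
  qed
  then obtain U where U: "sub U" "x \<notin> U" and max: "\<And>X. sub X \<Longrightarrow> x \<notin> X \<Longrightarrow> U \<subseteq> X \<Longrightarrow> X = U"
    unfolding \<A>_def by blast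
  have Uc: "y \<in> carrier N" if "y \<in> U" for y using U(1) that by (auto simp: sub_def)
  have Uz: "\<zero> \<in> U" and Ua: "y \<in> U \<Longrightarrow> z \<in> U \<Longrightarrow> y \<oplus> z \<in> U" and Us: "y \<in> U \<Longrightarrow> \<sigma> s \<odot> y \<in> U" for y z s
    using U(1) by (auto simp: sub_def)
  have ex: "\<exists>s. \<exists>u\<in>U. y = u \<oplus> \<sigma> s \<odot> x" if y: "y \<in> carrier N" for y
  proof (cases "y \<in> U")
    case True
    then show ?thesis using s0 [OF x(1)] Uc by (intro exI [of _ 0] bexI [of _ y]) auto
  next
    case False
    define X where "X = {u \<oplus> \<sigma> t \<odot> y |u t. u \<in> U}"
    have "sub X"
      unfolding sub_def
    proof (intro conjI ballI allI)
      show "X \<subseteq> carrier N" using Uc closed [OF y] by (auto simp: X_def)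
      have "\<zero> = \<zero> \<oplus> \<sigma> 0 \<odot> y" using s0 [OF y] by simp
      then show "\<zero> \<in> X" using Uz unfolding X_def by blast
      fix z assume "z \<in> X"
      then obtain u t where z: "u \<in> U" "z = u \<oplus> \<sigma> t \<odot> y" by (auto simp: X_def)
      show "\<sigma> s \<odot> z \<in> X" for s
      proof -
        have "\<sigma> s \<odot> z = \<sigma> s \<odot> u \<oplus> \<sigma> (s * t) \<odot> y"
          using z Uc closed y by (simp add: distr assoc)
        then show ?thesis using Us [OF z(1)] unfolding X_def by blast
      qed
      fix z' assume "z' \<in> X"
      then obtain u' t' where z': "u' \<in> U" "z' = u' \<oplus> \<sigma> t' \<odot> y" by (auto simp: X_def)
      have "z \<oplus> z' = (u \<oplus> u') \<oplus> \<sigma> (t + t') \<odot> y"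
        using z z' Uc closed y by (simp add: distl add.m_ac)
      then show "z \<oplus> z' \<in> X" using Ua [OF z(1) z'(1)] unfolding X_def by blast
    qed
    moreover have "U \<subseteq> X"
    proof
      fix u assume u: "u \<in> U"
      then have "u = u \<oplus> \<sigma> 0 \<odot> y" using s0 [OF y] Uc by simp
      then show "u \<in> X" using u unfolding X_def by blast
    qed
    moreover have "X \<noteq> U"
    proof -
      have "y = \<zero> \<oplus> \<sigma> 1 \<odot> y" using one [OF y] y by simp
      then have "y \<in> X" using Uz unfolding X_def by blast
      then show ?thesis using False by auto
    qed
    ultimately have "x \<in> X" using max by blast
    then obtain u t where ut: "u \<in> U" "x = u \<oplus> \<sigma> t \<odot> y" by (auto simp: X_def)
    have t: "t \<noteq> 0"
    proof
      assume "t = 0"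
      then have "x = u" using ut s0 [OF y] Uc by simp
      then show False using ut U(2) by simp
    qed
    have "\<sigma> (1 / t) \<odot> x = \<sigma> (1 / t) \<odot> u \<oplus> y"
      using ut Uc closed y t by (simp add: distr assoc one)
    then have "y = \<ominus> (\<sigma> (1 / t) \<odot> u) \<oplus> \<sigma> (1 / t) \<odot> x"
      using Uc [OF ut(1)] closed y by (simp add: r_neg1)
    also have "\<ominus> (\<sigma> (1 / t) \<odot> u) = \<sigma> (- (1 / t)) \<odot> u"
      using sneg [OF Uc [OF ut(1)]] by simp
    finally show ?thesis using Us [OF ut(1)] by blast
  qed
  have uniq: "s = s'" if "u \<in> U" "u' \<in> U" "u \<oplus> \<sigma> s \<odot> x = u' \<oplus> \<sigma> s' \<odot> x" for s s' u u'
  proof (rule ccontr)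
    assume ne: "s \<noteq> s'"
    have c: "u \<in> carrier N" "u' \<in> carrier N" "\<sigma> s \<odot> x \<in> carrier N" "\<sigma> s' \<odot> x \<in> carrier N" using that Uc closed x by auto
    have "\<sigma> (s - s') \<odot> x = \<sigma> s \<odot> x \<oplus> \<ominus> (\<sigma> s' \<odot> x)"
      using distl [OF x(1), of s "- s'"] sneg [OF x(1)] by simp
    also have "\<dots> = \<ominus> u \<oplus> u'"
    proof -
      have "u' = (u \<oplus> \<sigma> s \<odot> x) \<oplus> \<ominus> (\<sigma> s' \<odot> x)"
        unfolding that(3) using c by (simp add: a_assoc r_neg)
      then show ?thesis using c by (simp add: a_assoc r_neg1)
    qed
    also have "\<dots> = \<sigma> (- 1) \<odot> u \<oplus> u'" using sneg [of u 1] one c by simp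
    finally have "\<sigma> (s - s') \<odot> x \<in> U" using Ua Us that by simp
    then have "\<sigma> (1 / (s - s')) \<odot> (\<sigma> (s - s') \<odot> x) \<in> U" by (rule Us)
    then show False using assoc [OF x(1)] one [OF x(1)] ne U(2) by simp
  qed
  define f where "f = (\<lambda>y. THE s. \<exists>u\<in>U. y = u \<oplus> \<sigma> s \<odot> x)"
  have f: "f (u \<oplus> \<sigma> s \<odot> x) = s" if "u \<in> U" for u s
    unfolding f_def using that uniq by (intro the_equality) blast+
  have "linear_functional N \<sigma> f"
    unfolding linear_functional_def
  proof (intro conjI ballI allI)
    fix y assume y: "y \<in> carrier N"
    then obtain s u where su: "u \<in> U" "y = u \<oplus> \<sigma> s \<odot> x" using ex by blast
    show "f (\<sigma> t \<odot> y) = t * f y" for t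
    proof -
      have "\<sigma> t \<odot> y = \<sigma> t \<odot> u \<oplus> \<sigma> (t * s) \<odot> x"
        using su Uc closed x by (simp add: distr assoc)
      then show ?thesis using f Us su by simp
    qed
    fix z assume z: "z \<in> carrier N"
    then obtain s' u' where su': "u' \<in> U" "z = u' \<oplus> \<sigma> s' \<odot> x" using ex by blast
    have "y \<oplus> z = (u \<oplus> u') \<oplus> \<sigma> (s + s') \<odot> x"
      using su su' Uc closed x by (simp add: distl add.m_ac)
    then show "f (y \<oplus> z) = f y + f z" using f Ua su su' by simp
  qed
  moreover have "f x \<noteq> 0"
    using f [OF Uz, of 1] one [OF x(1)] x by simp
  ultimately show ?thesis using that by blast
qed

section \<open>Toric face rings and the monomial Baer criterion\<close>

lemma poly_mapping_sum_of_monomials: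
  "(\<Sum>b\<in>Poly_Mapping.keys f. Poly_Mapping.single b (Poly_Mapping.lookup f b)) = f"
proof (rule poly_mapping_eqI)
  fix k
  have "Poly_Mapping.lookup (\<Sum>b\<in>Poly_Mapping.keys f. Poly_Mapping.single b (Poly_Mapping.lookup f b)) k =
      (\<Sum>b\<in>Poly_Mapping.keys f. if b = k then Poly_Mapping.lookup f b else 0)"
    by (simp add: lookup_sum lookup_single when_def)
  also have "\<dots> = Poly_Mapping.lookup f k"
    by (simp add: in_keys_iff)
  finally show "Poly_Mapping.lookup (\<Sum>b\<in>Poly_Mapping.keys f. Poly_Mapping.single b (Poly_Mapping.lookup f b)) k =
    Poly_Mapping.lookup f k" .
qed

lemma single_eq_0_iff: "Poly_Mapping.single c s = 0 \<longleftrightarrow> s = 0"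
  by (metis lookup_single_eq lookup_zero single_zero)

lemma keys_single_subset: "c \<in> S \<Longrightarrow> Poly_Mapping.keys (Poly_Mapping.single c t) \<subseteq> S"
  by simp

lemma keys_add_subset:
  "Poly_Mapping.keys f \<subseteq> S \<Longrightarrow> Poly_Mapping.keys g \<subseteq> S \<Longrightarrow> Poly_Mapping.keys (f + g) \<subseteq> S"
  using keys_add [of f g] by blast

lemma poly_mapping_keys_induct:
  fixes f :: "'a \<Rightarrow>\<^sub>0 'b::comm_monoid_add"
  assumes f: "Poly_Mapping.keys f \<subseteq> S"
    and P0: "P 0" and P1: "\<And>c t. c \<in> S \<Longrightarrow> P (Poly_Mapping.single c t)"
    and Padd: "\<And>f g. Poly_Mapping.keys f \<subseteq> S \<Longrightarrow> Poly_Mapping.keys g \<subseteq> S \<Longrightarrow> P f \<Longrightarrow> P g \<Longrightarrow> P (f + g)"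
  shows "P f"
proof -
  have "B \<subseteq> Poly_Mapping.keys f \<Longrightarrow>
      P (\<Sum>b\<in>B. Poly_Mapping.single b (Poly_Mapping.lookup f b)) \<and>
      Poly_Mapping.keys (\<Sum>b\<in>B. Poly_Mapping.single b (Poly_Mapping.lookup f b)) \<subseteq> S"
    if "finite B" for B
    using that
  proof (induction B rule: finite_induct)
    case (insert b B)
    have b: "b \<in> S" using insert.prems f by auto
    have IH: "P (\<Sum>b\<in>B. Poly_Mapping.single b (Poly_Mapping.lookup f b))"
        "Poly_Mapping.keys (\<Sum>b\<in>B. Poly_Mapping.single b (Poly_Mapping.lookup f b)) \<subseteq> S"
      using insert.IH insert.prems by auto
    show ?case
      using Padd [OF keys_single_subset [OF b] IH(2) P1 [OF b] IH(1)]
        keys_add_subset [OF keys_single_subset [OF b] IH(2)] insert.hyps by simp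
  qed (simp add: P0)
  from this [of "Poly_Mapping.keys f"] show ?thesis by (simp add: poly_mapping_sum_of_monomials)
qed

context seminormal_toric
begin

lemma toric_mult_single:
  "toric_mult \<Sigma> M (Poly_Mapping.single a s) (Poly_Mapping.single b t) =
    (if compat a b then Poly_Mapping.single (a + b) (s * t) else 0)"
proof (cases "s = 0 \<or> t = 0")
  case True
  then show ?thesis by (auto simp: toric_mult_def)
next
  case False
  then have "Poly_Mapping.keys (Poly_Mapping.single a s) = {a}" "Poly_Mapping.keys (Poly_Mapping.single b t) = {b}"
    by simp_all
  then show ?thesis unfolding toric_mult_def by (simp only:) (auto simp: compat_def)
qed

lemma keys_toric_mult:
  assumes "c \<in> Poly_Mapping.keys (toric_mult \<Sigma> M f g)"
  obtains a b where "a \<in> Poly_Mapping.keys f" "b \<in> Poly_Mapping.keys g" "compat a b" "c = a + b"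
proof -
  have "Poly_Mapping.lookup (toric_mult \<Sigma> M f g) c \<noteq> 0" using assms by (simp add: in_keys_iff)
  then have "(\<Sum>a\<in>Poly_Mapping.keys f. \<Sum>b\<in>Poly_Mapping.keys g. Poly_Mapping.lookup
        (if \<exists>C\<in>\<Sigma>. a \<in> M C \<and> b \<in> M C
        then Poly_Mapping.single (a + b) (Poly_Mapping.lookup f a * Poly_Mapping.lookup g b) else 0) c) \<noteq> 0"
    by (simp add: toric_mult_def lookup_sum)
  then obtain a where a: "a \<in> Poly_Mapping.keys f" "(\<Sum>b\<in>Poly_Mapping.keys g. Poly_Mapping.lookup
        (if \<exists>C\<in>\<Sigma>. a \<in> M C \<and> b \<in> M C
        then Poly_Mapping.single (a + b) (Poly_Mapping.lookup f a * Poly_Mapping.lookup g b) else 0) c) \<noteq> 0"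
    by (rule sum.not_neutral_contains_not_neutral)
  from a(2) obtain b where b: "b \<in> Poly_Mapping.keys g" "Poly_Mapping.lookup
        (if \<exists>C\<in>\<Sigma>. a \<in> M C \<and> b \<in> M C
        then Poly_Mapping.single (a + b) (Poly_Mapping.lookup f a * Poly_Mapping.lookup g b) else 0) c \<noteq> 0"
    by (rule sum.not_neutral_contains_not_neutral)
  then have "compat a b" "c = a + b"
    by (auto simp: compat_def lookup_single when_def split: if_splits)
  then show ?thesis using a(1) b(1) that by blast
qed

lemma zero_support: "0 \<in> support \<Sigma> M"
  using fan_nonempty zero_mem unfolding support_def by blast

lemma compat_0 [simp]: "a \<in> support \<Sigma> M \<Longrightarrow> compat a 0" "a \<in> support \<Sigma> M \<Longrightarrow> compat 0 a"
  using compat_zero compat_sym by blast+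

end

locale toric_resolution = toric_generators \<Sigma> M r v
  for \<Sigma> :: "(real ^ 'd) set set" and M :: "(real ^ 'd) set \<Rightarrow> (int ^ 'd) set"
    and r :: nat and v :: "nat \<Rightarrow> int ^ 'd" +
  fixes E :: "nat \<Rightarrow> (int ^ 'd \<Rightarrow>\<^sub>0 'k::field, 'e, int ^ 'd) graded_module"
    and \<epsilon> :: "(int ^ 'd \<Rightarrow>\<^sub>0 'k) \<Rightarrow> 'e"
    and \<delta> :: "nat \<Rightarrow> 'e \<Rightarrow> 'e"
  assumes resolution:
    "graded_injective_resolution (toric_face_ring \<Sigma> M) (toric_grade \<Sigma> M) (toric_self_module \<Sigma> M) E \<epsilon> \<delta>"
begin

abbreviation R :: "(int ^ 'd \<Rightarrow>\<^sub>0 'k) ring" where "R \<equiv> toric_face_ring \<Sigma> M"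

abbreviation Self :: "(int ^ 'd \<Rightarrow>\<^sub>0 'k, int ^ 'd \<Rightarrow>\<^sub>0 'k, int ^ 'd) graded_module" where
  "Self \<equiv> toric_self_module \<Sigma> M"

abbreviation X :: "int ^ 'd \<Rightarrow> (int ^ 'd \<Rightarrow>\<^sub>0 'k)" where "X c \<equiv> Poly_Mapping.single c 1"

lemma R_simps [simp]:
  "carrier R = {f. Poly_Mapping.keys f \<subseteq> support \<Sigma> M}" "f \<otimes>\<^bsub>R\<^esub> g = toric_mult \<Sigma> M f g"
  "f \<oplus>\<^bsub>R\<^esub> g = f + g" "\<zero>\<^bsub>R\<^esub> = 0" "\<one>\<^bsub>R\<^esub> = Poly_Mapping.single 0 1"
  by (simp_all add: toric_face_ring_def)

lemma Self_simps [simp]: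
  "carrier Self = {f. Poly_Mapping.keys f \<subseteq> support \<Sigma> M}" "f \<oplus>\<^bsub>Self\<^esub> g = f + g" "\<zero>\<^bsub>Self\<^esub> = 0"
  "f \<odot>\<^bsub>Self\<^esub> g = toric_mult \<Sigma> M f g" "grade Self b = toric_grade \<Sigma> M b"
  by (simp_all add: toric_self_module_def)

lemma Self_graded: "is_graded_module R (toric_grade \<Sigma> M) Self"
  and E_injective: "graded_injective R (toric_grade \<Sigma> M) (E q)"
  and eps_hom: "graded_hom R Self (E 0) \<epsilon>"
  and eps_inj: "inj_on \<epsilon> (carrier Self)"
  and delta_hom: "graded_hom R (E q) (E (Suc q)) (\<delta> q)"
  and exact_eps: "\<epsilon> ` carrier Self = {x \<in> carrier (E 0). \<delta> 0 x = \<zero>\<^bsub>E 1\<^esub>}"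
  and exact_delta: "\<delta> q ` carrier (E q) = {x \<in> carrier (E (Suc q)). \<delta> (Suc q) x = \<zero>\<^bsub>E (Suc (Suc q))\<^esub>}"
  using resolution unfolding graded_injective_resolution_def by blast+

lemma E_graded: "is_graded_module R (toric_grade \<Sigma> M) (E q)"
  using E_injective unfolding graded_injective_def by blast

lemma E_module: "Module.module R (E q)"
  using graded_moduleD(1) [OF E_graded] .

lemma E_group: "abelian_group (E q)"
  using graded_moduleD(2) [OF E_graded] .

lemma grade_carrier: "x \<in> grade (E q) g \<Longrightarrow> x \<in> carrier (E q)"
  using graded_moduleD(4) [OF E_graded] by blast

lemma single_carrier: "c \<in> support \<Sigma> M \<Longrightarrow> Poly_Mapping.single c s \<in> carrier R"
  by simp

lemma single_grade: "c \<in> support \<Sigma> M \<Longrightarrow> Poly_Mapping.single c s \<in> toric_grade \<Sigma> M c"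
  by (simp add: toric_grade_def toric_face_ring_def keys_single)

lemma toric_grade_iff:
  "f \<in> toric_grade \<Sigma> M c \<longleftrightarrow> (\<exists>s. f = Poly_Mapping.single c s \<and> (c \<in> support \<Sigma> M \<or> s = 0))"
proof
  assume f: "f \<in> toric_grade \<Sigma> M c"
  then have keys: "Poly_Mapping.keys f \<subseteq> {c}" "Poly_Mapping.keys f \<subseteq> support \<Sigma> M"
    by (auto simp: toric_grade_def toric_face_ring_def)
  have "f = Poly_Mapping.single c (Poly_Mapping.lookup f c)"
  proof (rule poly_mapping_eqI)
    fix k show "Poly_Mapping.lookup f k = Poly_Mapping.lookup (Poly_Mapping.single c (Poly_Mapping.lookup f c)) k"
      using keys(1) by (cases "k = c") (auto simp: lookup_single when_def in_keys_iff)
  qed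
  moreover have "c \<in> support \<Sigma> M \<or> Poly_Mapping.lookup f c = 0"
    using keys by (auto simp: in_keys_iff)
  ultimately show "\<exists>s. f = Poly_Mapping.single c s \<and> (c \<in> support \<Sigma> M \<or> s = 0)" by blast
qed (auto simp: toric_grade_def toric_face_ring_def split: if_splits)

lemma smult_closed: "f \<in> carrier R \<Longrightarrow> x \<in> carrier (E q) \<Longrightarrow> f \<odot>\<^bsub>E q\<^esub> x \<in> carrier (E q)"
  by (rule module.smult_closed [OF E_module])

lemma smult_zero [simp]: "x \<in> carrier (E q) \<Longrightarrow> 0 \<odot>\<^bsub>E q\<^esub> x = \<zero>\<^bsub>E q\<^esub>"
  using module.smult_l_null [OF E_module] by fastforce

lemma smult_r_zero: "f \<in> carrier R \<Longrightarrow> f \<odot>\<^bsub>E q\<^esub> \<zero>\<^bsub>E q\<^esub> = \<zero>\<^bsub>E q\<^esub>"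
  by (rule module.smult_r_null [OF E_module])

lemma smult_single:
  assumes "a \<in> support \<Sigma> M" "b \<in> support \<Sigma> M" "x \<in> carrier (E q)"
  shows "Poly_Mapping.single a s \<odot>\<^bsub>E q\<^esub> (Poly_Mapping.single b t \<odot>\<^bsub>E q\<^esub> x) =
    (if compat a b then Poly_Mapping.single (a + b) (s * t) \<odot>\<^bsub>E q\<^esub> x else \<zero>\<^bsub>E q\<^esub>)"
  using module.smult_assoc1 [OF E_module single_carrier [OF assms(1)] single_carrier [OF assms(2)] assms(3), of s t]
    assms(3) by (cases "compat a b") (simp_all add: toric_mult_single)

lemma smult_one: "x \<in> carrier (E q) \<Longrightarrow> X 0 \<odot>\<^bsub>E q\<^esub> x = x"
  using module.smult_one [OF E_module] by simp

lemma smult_grade: "c \<in> support \<Sigma> M \<Longrightarrow> x \<in> grade (E q) g \<Longrightarrow> Poly_Mapping.single c s \<odot>\<^bsub>E q\<^esub> x \<in> grade (E q) (c + g)"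
  using graded_moduleD(10) [OF E_graded] single_grade by blast

lemma eps_closed: "f \<in> carrier R \<Longrightarrow> \<epsilon> f \<in> carrier (E 0)"
  and eps_add: "f \<in> carrier R \<Longrightarrow> g \<in> carrier R \<Longrightarrow> \<epsilon> (f + g) = \<epsilon> f \<oplus>\<^bsub>E 0\<^esub> \<epsilon> g"
  and eps_smult: "f \<in> carrier R \<Longrightarrow> g \<in> carrier R \<Longrightarrow> \<epsilon> (toric_mult \<Sigma> M f g) = f \<odot>\<^bsub>E 0\<^esub> \<epsilon> g"
  using eps_hom unfolding graded_hom_def by auto

lemma eps_grade: "f \<in> toric_grade \<Sigma> M b \<Longrightarrow> \<epsilon> f \<in> grade (E 0) b"
proof -
  have "\<epsilon> ` grade Self b \<subseteq> grade (E 0) b" using eps_hom unfolding graded_hom_def by blast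
  then show "f \<in> toric_grade \<Sigma> M b \<Longrightarrow> \<epsilon> f \<in> grade (E 0) b" by auto
qed

lemma eps_zero: "\<epsilon> 0 = \<zero>\<^bsub>E 0\<^esub>"
proof -
  have "\<epsilon> \<zero>\<^bsub>Self\<^esub> = \<zero>\<^bsub>E 0\<^esub>"
    by (rule additive_map_zero [OF graded_moduleD(2) [OF Self_graded] E_group])
      (use eps_hom in \<open>auto simp: graded_hom_def\<close>)
  then show ?thesis by simp
qed

lemma eps_eq_iff: "f \<in> carrier R \<Longrightarrow> g \<in> carrier R \<Longrightarrow> \<epsilon> f = \<epsilon> g \<longleftrightarrow> f = g"
  using eps_inj by (auto simp: inj_on_def)

lemma eps_sum:
  assumes "finite B" "\<And>b. b \<in> B \<Longrightarrow> h b \<in> carrier R"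
  shows "\<epsilon> (\<Sum>b\<in>B. h b) = (\<Oplus>\<^bsub>E 0\<^esub>b\<in>B. \<epsilon> (h b)) \<and> (\<Sum>b\<in>B. h b) \<in> carrier R"
proof -
  interpret E0: abelian_group "E 0" by (rule E_group)
  show ?thesis
    using assms
  proof (induction B rule: finite_induct)
    case (insert b B)
    then have IH: "\<epsilon> (\<Sum>b\<in>B. h b) = (\<Oplus>\<^bsub>E 0\<^esub>b\<in>B. \<epsilon> (h b))" "(\<Sum>b\<in>B. h b) \<in> carrier R" "h b \<in> carrier R"
      by auto
    have "(\<lambda>b. \<epsilon> (h b)) \<in> B \<rightarrow> carrier (E 0)" using insert.prems eps_closed by blast
    then have "(\<Oplus>\<^bsub>E 0\<^esub>b\<in>insert b B. \<epsilon> (h b)) = \<epsilon> (h b) \<oplus>\<^bsub>E 0\<^esub> (\<Oplus>\<^bsub>E 0\<^esub>b\<in>B. \<epsilon> (h b))"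
      using insert.hyps eps_closed [OF IH(3)] by (intro E0.finsum_insert)
    then show ?case
      using insert.hyps IH eps_add [OF IH(3,2)] keys_add_subset [of "h b" "support \<Sigma> M" "sum h B"] by simp
  qed (simp add: eps_zero)
qed

lemma eps_decomposition:
  assumes f: "f \<in> carrier R"
  shows "decomposition (E 0) (\<epsilon> f) (\<lambda>b. \<epsilon> (Poly_Mapping.single b (Poly_Mapping.lookup f b)))"
proof -
  have s: "Poly_Mapping.single b (Poly_Mapping.lookup f b) \<in> toric_grade \<Sigma> M b" for b
    unfolding toric_grade_iff using f by (intro exI conjI refl) (auto simp: in_keys_iff)
  then have sR: "Poly_Mapping.single b (Poly_Mapping.lookup f b) \<in> carrier R" for b
    by (simp add: toric_grade_def)
  have iff: "\<epsilon> (Poly_Mapping.single b (Poly_Mapping.lookup f b)) = \<zero>\<^bsub>E 0\<^esub> \<longleftrightarrow> Poly_Mapping.lookup f b = 0" for b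
    using eps_eq_iff [OF sR [of b], of 0] by (simp add: eps_zero single_eq_0_iff)
  have set: "{b. \<epsilon> (Poly_Mapping.single b (Poly_Mapping.lookup f b)) \<noteq> \<zero>\<^bsub>E 0\<^esub>} = Poly_Mapping.keys f"
    by (simp only: iff set_eq_iff mem_Collect_eq in_keys_iff simp_thms)
  have "\<epsilon> f = (\<Oplus>\<^bsub>E 0\<^esub>b\<in>Poly_Mapping.keys f. \<epsilon> (Poly_Mapping.single b (Poly_Mapping.lookup f b)))"
    using conjunct1 [OF eps_sum [where B = "Poly_Mapping.keys f" and
          h = "\<lambda>b. Poly_Mapping.single b (Poly_Mapping.lookup f b)", OF finite_keys sR]] unfolding poly_mapping_sum_of_monomials .
  then show ?thesis
    unfolding decomposition_def set using eps_grade [OF s] by simp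
qed

text \<open>
  Baer's criterion for a monomial ideal with exponent set \<open>S\<close>: a compatible assignment of values to
  its monomials is multiplication by a homogeneous element. The test modules are the images under
  \<open>\<epsilon>\<close> of the ideal and of the ring inside \<open>E 0\<close>, with shifted grading.
\<close>

lemma monomial_baer:
  assumes S: "S \<subseteq> support \<Sigma> M" "\<And>b c. c \<in> S \<Longrightarrow> compat b c \<Longrightarrow> b + c \<in> S"
    and \<phi>: "\<And>c. c \<in> S \<Longrightarrow> \<phi> c \<in> grade (E q) (c + g)"
    and mult: "\<And>b c. b \<in> support \<Sigma> M \<Longrightarrow> c \<in> S \<Longrightarrow>
        X b \<odot>\<^bsub>E q\<^esub> \<phi> c = (if compat b c then \<phi> (b + c) else \<zero>\<^bsub>E q\<^esub>)"
  obtains e where "e \<in> grade (E q) g" "\<And>c. c \<in> S \<Longrightarrow> X c \<odot>\<^bsub>E q\<^esub> e = \<phi> c"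
proof -
  interpret E0: Module.module R "E 0" by (rule E_module)
  interpret Eq: Module.module R "E q" by (rule E_module)
  define K where "K = {f :: int ^ 'd \<Rightarrow>\<^sub>0 'k. Poly_Mapping.keys f \<subseteq> S}"
  have KR: "f \<in> carrier R" if "f \<in> K" for f using that S(1) by (auto simp: K_def)
  define U where "U = \<epsilon> ` K"
  \<comment> \<open>The test modules are the ideal and the ring, as submodules of \<open>E 0\<close>, with grading shifted by \<open>g\<close>.\<close>
  define N where "N = (E 0)\<lparr>carrier := U, grade := \<lambda>b. U \<inter> grade (E 0) (b - g)\<rparr>"
  define P where "P = (E 0)\<lparr>carrier := carrier (E 0), grade := \<lambda>b. carrier (E 0) \<inter> grade (E 0) (b - g)\<rparr>"
  have Kmult: "toric_mult \<Sigma> M b f \<in> K" if "f \<in> K" for b f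
    using that S(2) unfolding K_def by (auto elim!: keys_toric_mult)
  have Kadd: "f + f' \<in> K" if "f \<in> K" "f' \<in> K" for f f'
    using that keys_add_subset unfolding K_def by blast
  have A: "toric_grade \<Sigma> M b \<subseteq> carrier R" for b by (auto simp: toric_grade_def)
  have N: "is_graded_module R (toric_grade \<Sigma> M) N"
    unfolding N_def
  proof (rule graded_submodule [OF E_graded _ _ _ _ _ _ A])
    show "U \<subseteq> carrier (E 0)" using eps_closed KR unfolding U_def by blast
    have "0 \<in> K" by (simp add: K_def)
    then show "\<zero>\<^bsub>E 0\<^esub> \<in> U" unfolding U_def using eps_zero by (metis imageI)
    show "x \<oplus>\<^bsub>E 0\<^esub> y \<in> U" if xy: "x \<in> U" "y \<in> U" for x y
    proof -
      obtain f f' where f: "f \<in> K" "f' \<in> K" "x = \<epsilon> f" "y = \<epsilon> f'" using xy unfolding U_def by blast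
      have "x \<oplus>\<^bsub>E 0\<^esub> y = \<epsilon> (f + f')" using eps_add [OF KR [OF f(1)] KR [OF f(2)]] f by simp
      then show ?thesis using Kadd [OF f(1,2)] unfolding U_def by blast
    qed
    show "\<ominus>\<^bsub>E 0\<^esub> x \<in> U" if x: "x \<in> U" for x
    proof -
      obtain f where f: "f \<in> K" "x = \<epsilon> f" using x unfolding U_def by blast
      have fm: "- f \<in> K" using f(1) by (auto simp: K_def in_keys_iff)
      have "\<epsilon> (- f) \<oplus>\<^bsub>E 0\<^esub> \<epsilon> f = \<zero>\<^bsub>E 0\<^esub>"
        using eps_add [OF KR [OF fm] KR [OF f(1)]] by (simp add: eps_zero)
      then have "\<ominus>\<^bsub>E 0\<^esub> x = \<epsilon> (- f)"
        using eps_closed [OF KR [OF fm]] eps_closed [OF KR [OF f(1)]] f(2) by (intro E0.M.minus_equality) auto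
      then show ?thesis using fm unfolding U_def by blast
    qed
    show "b \<odot>\<^bsub>E 0\<^esub> x \<in> U" if b: "b \<in> carrier R" and x: "x \<in> U" for b x
    proof -
      obtain f where f: "f \<in> K" "x = \<epsilon> f" using x unfolding U_def by blast
      have "b \<odot>\<^bsub>E 0\<^esub> x = \<epsilon> (toric_mult \<Sigma> M b f)" using eps_smult [OF b KR [OF f(1)]] f by simp
      then show ?thesis using Kmult [OF f(1)] unfolding U_def by blast
    qed
    show "c b \<in> U" if x: "x \<in> U" and c: "decomposition (E 0) x c" for x c b
    proof -
      obtain f where f: "f \<in> K" "x = \<epsilon> f" using x unfolding U_def by blast
      have "c = (\<lambda>b. \<epsilon> (Poly_Mapping.single b (Poly_Mapping.lookup f b)))"
        using graded_moduleD(9) [OF E_graded _ c] eps_decomposition [OF KR [OF f(1)]] f(2)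
          eps_closed [OF KR [OF f(1)]] by blast
      moreover have "Poly_Mapping.single b (Poly_Mapping.lookup f b) \<in> K"
        using f(1) by (auto simp: K_def in_keys_iff)
      ultimately show ?thesis unfolding U_def by blast
    qed
  qed
  have P: "is_graded_module R (toric_grade \<Sigma> M) P"
    unfolding P_def
    by (rule graded_submodule [OF E_graded _ _ _ _ _ _ A])
      (use grade_carrier in \<open>auto simp: decomposition_def\<close>)
  \<comment> \<open>The linear extension of \<open>\<phi>\<close> from the monomials to the ideal.\<close>
  define H where "H = (\<lambda>f. \<Oplus>\<^bsub>E q\<^esub>c\<in>Poly_Mapping.keys f. Poly_Mapping.single 0 (Poly_Mapping.lookup f c) \<odot>\<^bsub>E q\<^esub> \<phi> c)"
  have \<phi>c: "\<phi> c \<in> carrier (E q)" if "c \<in> S" for c using grade_carrier [OF \<phi> [OF that]] .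
  have tmc: "Poly_Mapping.single 0 s \<odot>\<^bsub>E q\<^esub> \<phi> c \<in> carrier (E q)" if "c \<in> S" for c s
    by (rule smult_closed [OF single_carrier [OF zero_support] \<phi>c [OF that]])
  have Hsup: "H f = (\<Oplus>\<^bsub>E q\<^esub>c\<in>B. Poly_Mapping.single 0 (Poly_Mapping.lookup f c) \<odot>\<^bsub>E q\<^esub> \<phi> c)"
    if "finite B" "Poly_Mapping.keys f \<subseteq> B" "B \<subseteq> S" for f B
    unfolding H_def using that tmc \<phi>c
    by (intro Eq.add.finprod_mono_neutral_cong_left) (auto simp: in_keys_iff)
  have Hclosed: "H f \<in> carrier (E q)" if "f \<in> K" for f
    unfolding H_def using that tmc by (intro Eq.finsum_closed) (auto simp: K_def)
  have Hadd: "H (f + f') = H f \<oplus>\<^bsub>E q\<^esub> H f'" if f: "f \<in> K" "f' \<in> K" for f f'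
  proof -
    define B where "B = Poly_Mapping.keys f \<union> Poly_Mapping.keys f'"
    have B: "finite B" "Poly_Mapping.keys f \<subseteq> B" "Poly_Mapping.keys f' \<subseteq> B" "Poly_Mapping.keys (f + f') \<subseteq> B" "B \<subseteq> S"
      using f keys_add [of f f'] by (auto simp: B_def K_def)
    have "H (f + f') = (\<Oplus>\<^bsub>E q\<^esub>c\<in>B. Poly_Mapping.single 0 (Poly_Mapping.lookup f c) \<odot>\<^bsub>E q\<^esub> \<phi> c \<oplus>\<^bsub>E q\<^esub>
        Poly_Mapping.single 0 (Poly_Mapping.lookup f' c) \<odot>\<^bsub>E q\<^esub> \<phi> c)"
      unfolding Hsup [OF B(1,4,5)]
    proof (rule Eq.finsum_cong')
      fix c assume "c \<in> B"
      then have c: "c \<in> S" using B by auto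
      show "Poly_Mapping.single 0 (Poly_Mapping.lookup (f + f') c) \<odot>\<^bsub>E q\<^esub> \<phi> c =
          Poly_Mapping.single 0 (Poly_Mapping.lookup f c) \<odot>\<^bsub>E q\<^esub> \<phi> c \<oplus>\<^bsub>E q\<^esub>
          Poly_Mapping.single 0 (Poly_Mapping.lookup f' c) \<odot>\<^bsub>E q\<^esub> \<phi> c"
        using Eq.smult_l_distr [OF single_carrier [OF zero_support] single_carrier [OF zero_support] \<phi>c [OF c],
            of "Poly_Mapping.lookup f c" "Poly_Mapping.lookup f' c"]
        by (simp add: lookup_add single_add)
    qed (use B tmc in auto)
    also have "\<dots> = H f \<oplus>\<^bsub>E q\<^esub> H f'"
      unfolding Hsup [OF B(1,2,5)] Hsup [OF B(1,3,5)]
      using B tmc by (intro Eq.finsum_addf) auto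
    finally show ?thesis .
  qed
  have H0: "H 0 = \<zero>\<^bsub>E q\<^esub>" by (simp add: H_def)
  have H1: "H (Poly_Mapping.single c t) = Poly_Mapping.single 0 t \<odot>\<^bsub>E q\<^esub> \<phi> c" if c: "c \<in> S" for c t
    using Hsup [of "{c}" "Poly_Mapping.single c t"] c tmc [OF c] by simp
  have K1: "Poly_Mapping.single c t \<in> K" if "c \<in> S" for c t using that by (simp add: K_def)
  have HX: "H (toric_mult \<Sigma> M (Poly_Mapping.single b s) f) = Poly_Mapping.single b s \<odot>\<^bsub>E q\<^esub> H f"
    if f: "f \<in> K" and b: "b \<in> support \<Sigma> M" for b s f
  proof (rule poly_mapping_keys_induct [of f S])
    show "Poly_Mapping.keys f \<subseteq> S" using f by (simp add: K_def)
    show "H (toric_mult \<Sigma> M (Poly_Mapping.single b s) 0) = Poly_Mapping.single b s \<odot>\<^bsub>E q\<^esub> H 0"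
      using smult_r_zero [OF single_carrier [OF b]] by (simp add: toric_mult_def H0)
    fix c t assume c: "c \<in> S"
    have cs: "c \<in> support \<Sigma> M" using S(1) c by auto
    have "Poly_Mapping.single b s \<odot>\<^bsub>E q\<^esub> H (Poly_Mapping.single c t) =
        Poly_Mapping.single b (s * t) \<odot>\<^bsub>E q\<^esub> \<phi> c"
      unfolding H1 [OF c] smult_single [OF b zero_support \<phi>c [OF c]] using b by simp
    also have "\<dots> = Poly_Mapping.single 0 (s * t) \<odot>\<^bsub>E q\<^esub> (X b \<odot>\<^bsub>E q\<^esub> \<phi> c)"
      unfolding smult_single [OF zero_support b \<phi>c [OF c]] using b by simp
    also have "\<dots> = H (toric_mult \<Sigma> M (Poly_Mapping.single b s) (Poly_Mapping.single c t))"
      using mult [OF b c] H1 [of "b + c"] S(2) [OF c] smult_r_zero [OF single_carrier [OF zero_support]]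
      by (simp add: toric_mult_single H0)
    finally show "H (toric_mult \<Sigma> M (Poly_Mapping.single b s) (Poly_Mapping.single c t)) =
        Poly_Mapping.single b s \<odot>\<^bsub>E q\<^esub> H (Poly_Mapping.single c t)" by simp
  next
    fix f f' :: "int ^ 'd \<Rightarrow>\<^sub>0 'k"
    assume "Poly_Mapping.keys f \<subseteq> S" "Poly_Mapping.keys f' \<subseteq> S"
      and eq: "H (toric_mult \<Sigma> M (Poly_Mapping.single b s) f) = Poly_Mapping.single b s \<odot>\<^bsub>E q\<^esub> H f"
        "H (toric_mult \<Sigma> M (Poly_Mapping.single b s) f') = Poly_Mapping.single b s \<odot>\<^bsub>E q\<^esub> H f'"
    then have ff: "f \<in> K" "f' \<in> K" by (auto simp: K_def)
    have "toric_mult \<Sigma> M (Poly_Mapping.single b s) (f + f') =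
        toric_mult \<Sigma> M (Poly_Mapping.single b s) f + toric_mult \<Sigma> M (Poly_Mapping.single b s) f'"
      using E0.R.r_distr [OF KR [OF ff(1)] KR [OF ff(2)] single_carrier [OF b]] by simp
    then show "H (toric_mult \<Sigma> M (Poly_Mapping.single b s) (f + f')) = Poly_Mapping.single b s \<odot>\<^bsub>E q\<^esub> H (f + f')"
      using eq Hadd [OF Kmult [OF ff(1)] Kmult [OF ff(2)]] Hadd [OF ff]
        Eq.smult_r_distr [OF single_carrier [OF b] Hclosed [OF ff(1)] Hclosed [OF ff(2)]] by simp
  qed
  have Hmult: "H (toric_mult \<Sigma> M b f) = b \<odot>\<^bsub>E q\<^esub> H f" if f: "f \<in> K" and b: "b \<in> carrier R" for b f
  proof (rule poly_mapping_keys_induct [of b "support \<Sigma> M"])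
    show "Poly_Mapping.keys b \<subseteq> support \<Sigma> M" using b by simp
    show "H (toric_mult \<Sigma> M 0 f) = 0 \<odot>\<^bsub>E q\<^esub> H f"
      using Hclosed [OF f] by (simp add: toric_mult_def H0)
    fix c t assume "c \<in> support \<Sigma> M"
    then show "H (toric_mult \<Sigma> M (Poly_Mapping.single c t) f) = Poly_Mapping.single c t \<odot>\<^bsub>E q\<^esub> H f"
      by (rule HX [OF f])
  next
    fix b b' :: "int ^ 'd \<Rightarrow>\<^sub>0 'k"
    assume keys: "Poly_Mapping.keys b \<subseteq> support \<Sigma> M" "Poly_Mapping.keys b' \<subseteq> support \<Sigma> M"
      and eq: "H (toric_mult \<Sigma> M b f) = b \<odot>\<^bsub>E q\<^esub> H f" "H (toric_mult \<Sigma> M b' f) = b' \<odot>\<^bsub>E q\<^esub> H f"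
    then have bb: "b \<in> carrier R" "b' \<in> carrier R" by auto
    have "toric_mult \<Sigma> M (b + b') f = toric_mult \<Sigma> M b f + toric_mult \<Sigma> M b' f"
      using E0.R.l_distr [OF bb KR [OF f]] by simp
    then show "H (toric_mult \<Sigma> M (b + b') f) = (b + b') \<odot>\<^bsub>E q\<^esub> H f"
      using eq Hadd [OF Kmult [OF f] Kmult [OF f]] Eq.smult_l_distr [OF bb Hclosed [OF f]] by simp
  qed
  define h where "h = (\<lambda>u. H (inv_into K \<epsilon> u))"
  have injK: "inj_on \<epsilon> K" using eps_eq_iff KR by (auto simp: inj_on_def)
  have h: "h (\<epsilon> f) = H f" if "f \<in> K" for f using that injK by (simp add: h_def)
  have hom: "graded_hom R N (E q) h"
    unfolding graded_hom_def
  proof (intro conjI ballI allI)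
    show "h \<in> carrier N \<rightarrow> carrier (E q)"
      using h Hclosed by (auto simp: N_def U_def)
    fix x assume "x \<in> carrier N"
    then obtain f where f: "f \<in> K" "x = \<epsilon> f" by (auto simp: N_def U_def)
    show "h (b \<odot>\<^bsub>N\<^esub> x) = b \<odot>\<^bsub>E q\<^esub> h x" if b: "b \<in> carrier R" for b
      using h [OF f(1)] h [OF Kmult [OF f(1)], of b] Hmult [OF f(1) b] eps_smult [OF b KR [OF f(1)]] f(2)
      by (simp add: N_def)
    fix y assume "y \<in> carrier N"
    then obtain f' where f': "f' \<in> K" "y = \<epsilon> f'" by (auto simp: N_def U_def)
    show "h (x \<oplus>\<^bsub>N\<^esub> y) = h x \<oplus>\<^bsub>E q\<^esub> h y"
      using h [OF f(1)] h [OF f'(1)] h [OF Kadd [OF f(1) f'(1)]] Hadd [OF f(1) f'(1)]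
        eps_add [OF KR [OF f(1)] KR [OF f'(1)]] f(2) f'(2) by (simp add: N_def)
  next
    fix b
    show "h ` grade N b \<subseteq> grade (E q) b"
    proof
      fix y assume "y \<in> h ` grade N b"
      then obtain f where f: "f \<in> K" "\<epsilon> f \<in> grade (E 0) (b - g)" "y = h (\<epsilon> f)" by (auto simp: N_def U_def)
      have "f \<in> carrier Self" using KR [OF f(1)] by simp
      from graded_hom_lift [OF Self_graded E_graded eps_hom this f(2)]
      obtain f' where f': "f' \<in> grade Self (b - g)" "\<epsilon> f' = \<epsilon> f" by blast
      have "f' \<in> carrier R" using f'(1) by (simp add: toric_grade_def)
      then have "f' = f" using f'(2) eps_eq_iff KR [OF f(1)] by blast
      then have "f \<in> toric_grade \<Sigma> M (b - g)" using f'(1) by simp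
      then obtain s where s: "f = Poly_Mapping.single (b - g) s" unfolding toric_grade_iff by blast
      show "y \<in> grade (E q) b"
      proof (cases "s = 0")
        case True
        then show ?thesis using f(1,3) s h H0 graded_moduleD(5) [OF E_graded] by simp
      next
        case False
        then have c: "b - g \<in> S" using f(1) s by (simp add: K_def)
        have "y = Poly_Mapping.single 0 s \<odot>\<^bsub>E q\<^esub> \<phi> (b - g)"
          using f(1,3) h H1 [OF c] s by simp
        also have "\<dots> \<in> grade (E q) (0 + ((b - g) + g))"
          by (rule smult_grade [OF zero_support \<phi> [OF c]])
        finally show ?thesis by simp
      qed
    qed
  qed
  have inc: "graded_hom R N P (\<lambda>x. x)"
    unfolding graded_hom_def
  proof (intro conjI)
    show "(\<lambda>x. x) \<in> carrier N \<rightarrow> carrier P" using KR eps_closed by (auto simp: N_def P_def U_def)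
    show "\<forall>b. (\<lambda>x. x) ` grade N b \<subseteq> grade P b" using grade_carrier by (auto simp: N_def P_def)
  qed (auto simp: N_def P_def)
  have "\<exists>h'. graded_hom R P (E q) h' \<and> (\<forall>x\<in>carrier N. h' x = h x)"
    using E_injective [of q] N P inc hom unfolding graded_injective_def
    by (elim conjE allE [of _ N] allE [of _ P] allE [of _ "\<lambda>x. x"] allE [of _ h]) auto
  then obtain h' where h': "graded_hom R P (E q) h'" "\<And>x. x \<in> carrier N \<Longrightarrow> h' x = h x" by blast
  \<comment> \<open>The element sought is the image of \<open>1\<close> under the extended homomorphism.\<close>
  have one: "X 0 \<in> carrier R" by (rule single_carrier [OF zero_support])
  have "\<epsilon> (X 0) \<in> grade P g"
    using eps_grade [OF single_grade [OF zero_support, of 1]] eps_closed [OF one] by (simp add: P_def)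
  then have e: "h' (\<epsilon> (X 0)) \<in> grade (E q) g" using h'(1) unfolding graded_hom_def by blast
  have "X c \<odot>\<^bsub>E q\<^esub> h' (\<epsilon> (X 0)) = \<phi> c" if c: "c \<in> S" for c
  proof -
    have cs: "c \<in> support \<Sigma> M" using S(1) c by auto
    have "X c \<odot>\<^bsub>E q\<^esub> h' (\<epsilon> (X 0)) = h' (X c \<odot>\<^bsub>P\<^esub> \<epsilon> (X 0))"
    proof -
      have "\<forall>b\<in>carrier R. \<forall>x\<in>carrier P. h' (b \<odot>\<^bsub>P\<^esub> x) = b \<odot>\<^bsub>E q\<^esub> h' x"
        using h'(1) unfolding graded_hom_def by blast
      moreover have "\<epsilon> (X 0) \<in> carrier P" using eps_closed [OF one] by (simp add: P_def)
      ultimately show ?thesis using single_carrier [OF cs, of 1] by metis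
    qed
    also have "X c \<odot>\<^bsub>P\<^esub> \<epsilon> (X 0) = \<epsilon> (X c)"
    proof -
      have "toric_mult \<Sigma> M (X c) (X 0) = X c" unfolding toric_mult_single using cs by simp
      then show ?thesis
        using eps_smult [OF single_carrier [OF cs, of 1] one] by (simp add: P_def)
    qed
    also have "h' (\<epsilon> (X c)) = h (\<epsilon> (X c))"
      using K1 [OF c] by (intro h'(2)) (auto simp: N_def U_def)
    also have "\<dots> = \<phi> c"
      using h [OF K1 [OF c]] H1 [OF c] smult_one [OF \<phi>c [OF c]] by simp
    finally show ?thesis .
  qed
  then show ?thesis using e that by blast
qed

end

section \<open>Monomials in the generators\<close>

context seminormal_toric
begin

lemma compat_three:
  assumes "compat a c" "compat b (a + c)"
  obtains C where "C \<in> \<Sigma>" "a \<in> M C" "b \<in> M C" "c \<in> M C"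
  using compat_assoc [of a c b] assms compat_sym [of b "a + c"] by blast

end

context toric_generators
begin

definition exp_deg :: "(nat \<Rightarrow> nat) \<Rightarrow> int ^ 'd" where
  "exp_deg \<alpha> = (\<Sum>j<r. int (\<alpha> j) *s v j)"

definition supported :: "(nat \<Rightarrow> nat) \<Rightarrow> (real ^ 'd) set \<Rightarrow> bool" where
  "supported \<alpha> C \<longleftrightarrow> (\<forall>j<r. \<alpha> j > 0 \<longrightarrow> v j \<in> M C)"

text \<open>
  The monomial in the variables with exponent vector \<open>\<alpha>\<close> does not vanish in the toric face ring.
\<close>

definition admissible :: "(nat \<Rightarrow> nat) \<Rightarrow> bool" where
  "admissible \<alpha> \<longleftrightarrow> (\<exists>C\<in>\<Sigma>. supported \<alpha> C)"

lemma exp_deg_add: "exp_deg (\<lambda>j. \<alpha> j + \<beta> j) = exp_deg \<alpha> + exp_deg \<beta>"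
  by (simp add: exp_deg_def sum.distrib [symmetric] vector_sadd_rdistrib)

lemma exp_deg_mem:
  assumes "C \<in> \<Sigma>" "supported \<alpha> C"
  shows "exp_deg \<alpha> \<in> M C"
  unfolding exp_deg_def
proof (rule submonoid_sum [OF submonoid [OF assms(1)]])
  fix j assume "j \<in> {..<r}"
  then show "int (\<alpha> j) *s v j \<in> M C"
    using assms scale_mem [OF assms(1), of "v j" "int (\<alpha> j)"] zero_mem [OF assms(1)]
    by (cases "\<alpha> j = 0") (auto simp: supported_def)
qed

lemma exp_deg_support: "admissible \<alpha> \<Longrightarrow> exp_deg \<alpha> \<in> support \<Sigma> M"
  unfolding admissible_def support_def using exp_deg_mem by blast

lemma exp_deg_pw:
  assumes "J \<subseteq> {0..<r}"
  shows "exp_deg (pw n J) = int n *s vsum J"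
proof -
  have "exp_deg (pw n J) = (\<Sum>j\<in>J. int n *s v j)"
    unfolding exp_deg_def using assms by (intro sum.mono_neutral_cong_right) (auto simp: pw_def)
  then show ?thesis by (simp add: vsum_def vec_eq_iff sum_distrib_left)
qed

lemma exp_deg_pw_single: "j < r \<Longrightarrow> exp_deg (pw n {j}) = int n *s v j"
  using exp_deg_pw [of "{j}" n] by (simp add: vsum_def)

text \<open>
  Every \<open>v j\<close> with positive exponent is a summand of the degree, so \<open>summands_mem\<close> applies.
\<close>

lemma factor_mem:
  assumes C: "C \<in> \<Sigma>" "supported \<alpha> C" and D: "D \<in> \<Sigma>" "exp_deg \<alpha> \<in> M D"
  shows "supported \<alpha> D"
  unfolding supported_def
proof (intro allI impI)
  fix j assume j: "j < r" "0 < \<alpha> j"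
  define \<beta> where "\<beta> = \<alpha>(j := \<alpha> j - 1)"
  have "(\<lambda>i. pw 1 {j} i + \<beta> i) = \<alpha>" using j by (auto simp: pw_def \<beta>_def)
  then have eq: "exp_deg \<alpha> = v j + exp_deg \<beta>" using exp_deg_add [of "pw 1 {j}" \<beta>] exp_deg_pw_single [OF j(1), of 1] by simp
  have "v j \<in> M C" using C j by (auto simp: supported_def)
  moreover have "exp_deg \<beta> \<in> M C"
    using C by (intro exp_deg_mem) (auto simp: supported_def \<beta>_def split: if_splits)
  ultimately show "v j \<in> M D"
    using summands_mem(1) [OF C(1) D(1)] real_vec_in [OF D] unfolding eq by blast
qed

lemma admissible_add_iff: "admissible (\<lambda>j. \<alpha> j + \<beta> j) \<longleftrightarrow> admissible \<alpha> \<and> admissible \<beta> \<and> compat (exp_deg \<alpha>) (exp_deg \<beta>)"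
proof
  assume "admissible (\<lambda>j. \<alpha> j + \<beta> j)"
  then obtain C where C: "C \<in> \<Sigma>" "supported (\<lambda>j. \<alpha> j + \<beta> j) C" unfolding admissible_def by blast
  then have "supported \<alpha> C" "supported \<beta> C" by (auto simp: supported_def)
  then show "admissible \<alpha> \<and> admissible \<beta> \<and> compat (exp_deg \<alpha>) (exp_deg \<beta>)"
    using C(1) exp_deg_mem unfolding admissible_def compat_def by blast
next
  assume "admissible \<alpha> \<and> admissible \<beta> \<and> compat (exp_deg \<alpha>) (exp_deg \<beta>)"
  then obtain C C' D where CD: "C \<in> \<Sigma>" "supported \<alpha> C" "C' \<in> \<Sigma>" "supported \<beta> C'"
      "D \<in> \<Sigma>" "exp_deg \<alpha> \<in> M D" "exp_deg \<beta> \<in> M D"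
    unfolding admissible_def compat_def by blast
  have "supported \<alpha> D" "supported \<beta> D"
    using factor_mem [OF CD(1,2,5,6)] factor_mem [OF CD(3,4,5,7)] .
  then have "supported (\<lambda>j. \<alpha> j + \<beta> j) D" by (auto simp: supported_def)
  then show "admissible (\<lambda>j. \<alpha> j + \<beta> j)" using CD(5) unfolding admissible_def by blast
qed

lemma gen_multiple_support:
  assumes "j < r"
  shows "int n *s v j \<in> support \<Sigma> M"
proof -
  obtain C where C: "C \<in> \<Sigma>" "v j \<in> M C" using gen_support [OF assms] unfolding support_def by blast
  then have "int n *s v j \<in> M C" by (intro scale_mem) auto
  then show ?thesis using C(1) unfolding support_def by blast
qed

lemma gen_multiple_compat:
  assumes "j < r"
  shows "compat (int n *s v j) (int m *s v j)"
proof -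
  obtain C where "C \<in> \<Sigma>" "v j \<in> M C" using gen_support [OF assms] unfolding support_def by blast
  then have "int n *s v j \<in> M C" "int m *s v j \<in> M C" by (auto intro: scale_mem)
  then show ?thesis using \<open>C \<in> \<Sigma>\<close> unfolding compat_def by blast
qed

lemma admissible_pw_single: "j < r \<Longrightarrow> admissible (pw n {j})"
  using gen_support [of j] unfolding admissible_def supported_def support_def by (auto simp: pw_def)

text \<open>
  If the degree \<open>a + n v\<^sub>J\<close> occurs in a cone that contains the \<open>v\<^sub>j\<close> with \<open>j \<in> J\<close>, then \<open>J\<close>
  belongs to the family of the face in which the ray in direction \<open>v\<^sub>J\<close> finally runs.
\<close>

lemma degree_family_exists:
  assumes C: "C \<in> \<Sigma>" and J: "J \<subseteq> G.idx C" and a: "a + int n *s vsum J \<in> M C"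
  obtains D where "D \<in> \<Sigma>" "D \<subseteq> C" "J \<in> degree_family a D"
proof -
  have "real_vec a + real n *\<^sub>R G.vsum J \<in> C"
    using real_vec_in [OF C a] by (simp add: real_vsum)
  then have "J \<in> G.closed_family C (real_vec a)"
    using J unfolding G.closed_family_def by (intro CollectI conjI exI [of _ "real n"]) auto
  then obtain D where D: "D \<in> \<Sigma>" "D \<subseteq> C" "J \<in> G.open_family D (real_vec a)"
    using G.closed_family_eq [OF C] by auto
  then obtain t where t: "J \<subseteq> G.idx D" "t \<ge> 0" "real_vec a + t *\<^sub>R G.vsum J \<in> cone_interior D"
    unfolding G.open_family_def by auto
  obtain m where m: "t \<le> real m" using real_arch_simple by blast
  define k where "k = max n m"
  have "real_vec a + real k *\<^sub>R G.vsum J \<in> cone_interior D"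
    using m by (intro G.interior_mem_mono [OF D(1) t(3) G.vsum_mem [OF D(1) t(1)]]) (auto simp: k_def)
  then have inD: "real_vec (a + int k *s vsum J) \<in> D"
    using cone_interior_subset [of D] by (auto simp: real_vsum)
  have "a + int k *s vsum J = (a + int n *s vsum J) + int (k - n) *s vsum J"
    by (simp add: k_def vec_eq_iff algebra_simps of_nat_diff)
  also have "\<dots> \<in> M C"
    by (rule add_mem [OF C a scale_mem [OF C vsum_mem [OF C J]]]) simp
  finally have "a + int k *s vsum J \<in> M D" using inD by (rule mem_other_cone [OF C D(1)])
  then have "(a + int k *s vsum J) - int k *s vsum J \<in> add_subgroup hull (M D)"
    by (rule subgroup_hull_closed(2) [OF hull_inc subgroup_hull_scale [OF hull_inc [OF vsum_mem [OF D(1) t(1)]]]])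
  then have "a \<in> add_subgroup hull (M D)" by simp
  then have "J \<in> degree_family a D" using D(3) by (simp add: degree_family_def)
  then show ?thesis using D that by blast
qed

end

section \<open>Lifting torsion elements along a localization\<close>

context toric_resolution
begin

lemma power_annihilates_mono:
  assumes j: "j < r" and e: "e \<in> carrier (E q)" "X (int m *s v j) \<odot>\<^bsub>E q\<^esub> e = \<zero>\<^bsub>E q\<^esub>" and "m \<le> n"
  shows "X (int n *s v j) \<odot>\<^bsub>E q\<^esub> e = \<zero>\<^bsub>E q\<^esub>"
proof -
  have eq: "int (n - m) *s v j + int m *s v j = int n *s v j"
    using \<open>m \<le> n\<close> by (simp add: vec_eq_iff algebra_simps of_nat_diff)
  have "X (int (n - m) *s v j) \<odot>\<^bsub>E q\<^esub> (X (int m *s v j) \<odot>\<^bsub>E q\<^esub> e) = X (int n *s v j) \<odot>\<^bsub>E q\<^esub> e"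
    unfolding smult_single [OF gen_multiple_support [OF j] gen_multiple_support [OF j] e(1)]
    using gen_multiple_compat [OF j] by (simp add: eq)
  then show ?thesis
    unfolding e(2) using smult_r_zero [OF single_carrier [OF gen_multiple_support [OF j]]] by simp
qed

text \<open>
  The requirement is that \<open>e'\<close> times the \<open>n\<close>-th power of the variable \<open>k\<close> is \<open>e\<close>, after
  multiplication by one more factor of the variable. It prescribes \<open>e'\<close> on the ideal generated by
  the power \<open>n + 1\<close> of the variable, and \<open>e'\<close> becomes torsion if it is moreover prescribed to be
  zero on high powers of the variables \<open>j < k\<close>. The Artin--Rees lemma shows that the two
  prescriptions agree where they overlap: \<open>e\<close> is killed by some powers of the variables \<open>j < k\<close>.
  Then Baer's criterion gives \<open>e'\<close>.
\<close>

lemma torsion_lift: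
  assumes k: "k < r" and e: "e \<in> grade (E q) (g + int n *s v k)"
    and tors: "\<And>j. j < k \<Longrightarrow> \<exists>m. X (int m *s v j) \<odot>\<^bsub>E q\<^esub> e = \<zero>\<^bsub>E q\<^esub>"
  obtains e' where "e' \<in> grade (E q) g" "\<And>j. j < k \<Longrightarrow> \<exists>m. X (int m *s v j) \<odot>\<^bsub>E q\<^esub> e' = \<zero>\<^bsub>E q\<^esub>"
    "X (int (Suc n) *s v k) \<odot>\<^bsub>E q\<^esub> e' = X (v k) \<odot>\<^bsub>E q\<^esub> e"
proof -
  have eC: "e \<in> carrier (E q)" using grade_carrier [OF e] .
  define y where "y = v k"
  have ys: "y \<in> support \<Sigma> M" unfolding y_def by (rule gen_support [OF k])
  define z where "z = int (Suc n) *s y"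
  define w where "w = X y \<odot>\<^bsub>E q\<^esub> e"
  have w: "w \<in> grade (E q) (y + (g + int n *s y))"
    unfolding w_def using e by (intro smult_grade ys) (simp add: y_def)
  have wC: "w \<in> carrier (E q)" using grade_carrier [OF w] .
  have "\<exists>p. \<forall>j<k. X (int p *s v j) \<odot>\<^bsub>E q\<^esub> e = \<zero>\<^bsub>E q\<^esub>"
  proof -
    obtain m where m: "\<And>j. j < k \<Longrightarrow> X (int (m j) *s v j) \<odot>\<^bsub>E q\<^esub> e = \<zero>\<^bsub>E q\<^esub>"
      using tors by metis
    have "X (int (Max (insert 0 (m ` {..<k}))) *s v j) \<odot>\<^bsub>E q\<^esub> e = \<zero>\<^bsub>E q\<^esub>" if j: "j < k" for j
    proof (rule power_annihilates_mono [OF _ eC m [OF j]])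
      show "j < r" using j k by simp
      show "m j \<le> Max (insert 0 (m ` {..<k}))" using j by (intro Max_ge) auto
    qed
    then show ?thesis by blast
  qed
  then obtain p where p: "\<And>j. j < k \<Longrightarrow> X (int p *s v j) \<odot>\<^bsub>E q\<^esub> e = \<zero>\<^bsub>E q\<^esub>" by blast
  have "\<forall>\<^sub>F p' in sequentially. \<forall>j\<in>{..<k}. \<forall>c s. compat z c \<longrightarrow> compat (int p' *s v j) s \<longrightarrow>
    z + c = int p' *s v j + s \<longrightarrow>
    (\<exists>D\<in>\<Sigma>. \<exists>u\<in>M D. y \<in> M D \<and> c \<in> M D \<and> v j \<in> M D \<and> y + c = int p *s v j + u)"
    unfolding z_def
  proof (intro eventually_ball_finite ballI)
    fix j assume "j \<in> {..<k}"
    then have "j < r" using k by simp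
    from artin_rees [OF gen_support [OF this] ys]
    show "\<forall>\<^sub>F p' in sequentially. \<forall>c s. compat (int (Suc n) *s y) c \<longrightarrow> compat (int p' *s v j) s \<longrightarrow>
      int (Suc n) *s y + c = int p' *s v j + s \<longrightarrow>
      (\<exists>D\<in>\<Sigma>. \<exists>u\<in>M D. y \<in> M D \<and> c \<in> M D \<and> v j \<in> M D \<and> y + c = int p *s v j + u)" .
  qed simp
  from eventually_happens' [OF sequentially_bot this]
  obtain p' where ar: "\<And>j c s. j < k \<Longrightarrow> compat z c \<Longrightarrow> compat (int p' *s v j) s \<Longrightarrow>
    z + c = int p' *s v j + s \<Longrightarrow>
    \<exists>D\<in>\<Sigma>. \<exists>u\<in>M D. y \<in> M D \<and> c \<in> M D \<and> v j \<in> M D \<and> y + c = int p *s v j + u"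
    by blast
  \<comment> \<open>The exponents of the two monomial ideals, generated by powers of the variables \<open>j < k\<close> and by the power \<open>n + 1\<close> of the variable \<open>k\<close>.\<close>
  define Sx where "Sx = {c. \<exists>j<k. \<exists>s. compat (int p' *s v j) s \<and> c = int p' *s v j + s}"
  define Sy where "Sy = {c. \<exists>c'. compat z c' \<and> c = z + c'}"
  define \<phi> where "\<phi> = (\<lambda>c. if c \<in> Sy then X (c - z) \<odot>\<^bsub>E q\<^esub> w else \<zero>\<^bsub>E q\<^esub>)"
  have \<phi>y: "\<phi> (z + c') = X c' \<odot>\<^bsub>E q\<^esub> w" if "compat z c'" for c'
    using that by (auto simp: \<phi>_def Sy_def)
  \<comment> \<open>On the overlap, Artin--Rees exhibits a factor that kills \<open>e\<close>.\<close>
  have \<phi>x: "\<phi> c = \<zero>\<^bsub>E q\<^esub>" if c: "c \<in> Sx" for c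
  proof (cases "c \<in> Sy")
    case True
    then obtain c' where c': "compat z c'" "c = z + c'" by (auto simp: Sy_def)
    obtain j s where js: "j < k" "compat (int p' *s v j) s" "c = int p' *s v j + s"
      using c by (auto simp: Sx_def)
    have "z + c' = int p' *s v j + s" using c'(2) js(3) by simp
    from ar [OF js(1) c'(1) js(2) this]
    obtain D u where D: "D \<in> \<Sigma>" "u \<in> M D" "y \<in> M D" "c' \<in> M D" "v j \<in> M D" "y + c' = int p *s v j + u"
      by blast
    have sup: "x \<in> support \<Sigma> M" if "x \<in> M D" for x using that D(1) unfolding support_def by blast
    have pD: "int p *s v j \<in> M D" by (rule scale_mem [OF D(1,5)]) simp
    have c1: "compat c' y" and c2: "compat u (int p *s v j)"
      using D pD unfolding compat_def by blast+
    have "\<phi> c = X c' \<odot>\<^bsub>E q\<^esub> (X y \<odot>\<^bsub>E q\<^esub> e)" unfolding c'(2) \<phi>y [OF c'(1)] w_def ..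
    also have "\<dots> = X (c' + y) \<odot>\<^bsub>E q\<^esub> e"
      unfolding smult_single [OF sup [OF D(4)] ys eC] using c1 by simp
    also have "c' + y = u + int p *s v j" using D(6) by (simp add: add.commute)
    also have "X (u + int p *s v j) \<odot>\<^bsub>E q\<^esub> e = X u \<odot>\<^bsub>E q\<^esub> (X (int p *s v j) \<odot>\<^bsub>E q\<^esub> e)"
      unfolding smult_single [OF sup [OF D(2)] sup [OF pD] eC] using c2 by simp
    also have "\<dots> = \<zero>\<^bsub>E q\<^esub>"
      unfolding p [OF js(1)] by (rule smult_r_zero [OF single_carrier [OF sup [OF D(2)]]])
    finally show ?thesis .
  qed (simp add: \<phi>_def)
  have Sxc: "b + c \<in> Sx" if c: "c \<in> Sx" and bc: "compat b c" for b c
  proof -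
    obtain j s where js: "j < k" "compat (int p' *s v j) s" "c = int p' *s v j + s"
      using c by (auto simp: Sx_def)
    obtain C where C: "C \<in> \<Sigma>" "int p' *s v j \<in> M C" "b \<in> M C" "s \<in> M C"
      using compat_three [OF js(2)] bc js(3) by blast
    have "compat (int p' *s v j) (b + s)" using C add_mem unfolding compat_def by blast
    moreover have "b + c = int p' *s v j + (b + s)" using js(3) by simp
    ultimately show ?thesis using js(1) unfolding Sx_def by blast
  qed
  have Syc: "compat z (b + c') \<and> compat b c'" if c: "compat z c'" and bc: "compat b (z + c')" for b c'
  proof -
    obtain C where C: "C \<in> \<Sigma>" "z \<in> M C" "b \<in> M C" "c' \<in> M C"
      using compat_three [OF c bc] by blast
    then show ?thesis using add_mem unfolding compat_def by blast
  qed
  obtain e' where e': "e' \<in> grade (E q) g" "\<And>c. c \<in> Sx \<union> Sy \<Longrightarrow> X c \<odot>\<^bsub>E q\<^esub> e' = \<phi> c"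
  proof (rule monomial_baer [of "Sx \<union> Sy" \<phi> q g])
    show "Sx \<union> Sy \<subseteq> support \<Sigma> M" using compat_support unfolding Sx_def Sy_def by auto
    show "b + c \<in> Sx \<union> Sy" if c: "c \<in> Sx \<union> Sy" and bc: "compat b c" for b c
    proof (cases "c \<in> Sx")
      case True then show ?thesis using Sxc bc by blast
    next
      case False
      then obtain c' where c': "compat z c'" "c = z + c'" using c by (auto simp: Sy_def)
      have "b + c = z + (b + c')" using c'(2) by simp
      then show ?thesis using Syc [OF c'(1)] bc c'(2) unfolding Sy_def by blast
    qed
    show "\<phi> c \<in> grade (E q) (c + g)" if "c \<in> Sx \<union> Sy" for c
    proof (cases "c \<in> Sy")
      case True
      then obtain c' where c': "compat z c'" "c = z + c'" by (auto simp: Sy_def)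
      have "X c' \<odot>\<^bsub>E q\<^esub> w \<in> grade (E q) (c' + (y + (g + int n *s y)))"
        using compat_support [OF c'(1)] by (intro smult_grade w) auto
      also have "c' + (y + (g + int n *s y)) = c + g"
        unfolding c'(2) z_def by (simp add: vec_eq_iff algebra_simps)
      finally show ?thesis unfolding c'(2) \<phi>y [OF c'(1)] .
    next
      case False
      then show ?thesis using graded_moduleD(5) [OF E_graded] by (simp add: \<phi>_def)
    qed
    show "X b \<odot>\<^bsub>E q\<^esub> \<phi> c = (if compat b c then \<phi> (b + c) else \<zero>\<^bsub>E q\<^esub>)"
      if b: "b \<in> support \<Sigma> M" and c: "c \<in> Sx \<union> Sy" for b c
    proof (cases "c \<in> Sx")
      case True
      then show ?thesis
        using \<phi>x Sxc smult_r_zero [OF single_carrier [OF b]] by simp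
    next
      case False
      then obtain c' where c': "compat z c'" "c = z + c'" using c by (auto simp: Sy_def)
      have c's: "c' \<in> support \<Sigma> M" using compat_support [OF c'(1)] by blast
      show ?thesis
      proof (cases "compat b c")
        case True
        have *: "compat z (b + c')" "compat b c'" using Syc [OF c'(1)] True c'(2) by auto
        have "\<phi> (b + c) = \<phi> (z + (b + c'))" using c'(2) by (simp add: add.left_commute)
        also have "\<dots> = X (b + c') \<odot>\<^bsub>E q\<^esub> w" by (rule \<phi>y [OF *(1)])
        also have "\<dots> = X b \<odot>\<^bsub>E q\<^esub> (X c' \<odot>\<^bsub>E q\<^esub> w)"
          unfolding smult_single [OF b c's wC] using *(2) by simp
        also have "X c' \<odot>\<^bsub>E q\<^esub> w = \<phi> c" unfolding c'(2) by (rule \<phi>y [OF c'(1), symmetric])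
        finally show ?thesis using True by simp
      next
        case no: False
        have "X b \<odot>\<^bsub>E q\<^esub> (X c' \<odot>\<^bsub>E q\<^esub> w) = \<zero>\<^bsub>E q\<^esub>"
        proof (cases "compat b c'")
          case True
          then have bcs: "b + c' \<in> support \<Sigma> M" using compat_support by blast
          have "\<not> compat (b + c') y"
          proof
            assume "compat (b + c') y"
            then obtain C where C: "C \<in> \<Sigma>" "b \<in> M C" "c' \<in> M C" "y \<in> M C"
              using compat_assoc [of b c' y] True by blast
            have "z \<in> M C" unfolding z_def by (rule scale_mem [OF C(1,4)]) simp
            then have "c \<in> M C" unfolding c'(2) using C by (intro add_mem)
            then show False using no C unfolding compat_def by blast
          qed
          then have "X (b + c') \<odot>\<^bsub>E q\<^esub> w = \<zero>\<^bsub>E q\<^esub>"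
            unfolding w_def smult_single [OF bcs ys eC] by simp
          then show ?thesis
            unfolding smult_single [OF b c's wC] using True by simp
        next
          case False
          then show ?thesis unfolding smult_single [OF b c's wC] by simp
        qed
        then show ?thesis using no unfolding c'(2) \<phi>y [OF c'(1)] by simp
      qed
    qed
  qed (rule that)
  have "\<exists>m. X (int m *s v j) \<odot>\<^bsub>E q\<^esub> e' = \<zero>\<^bsub>E q\<^esub>" if j: "j < k" for j
  proof -
    have jr: "j < r" using j k by simp
    have "compat (int p' *s v j) 0" using gen_multiple_support [OF jr] by simp
    then have "int p' *s v j \<in> Sx" using j unfolding Sx_def by force
    then show ?thesis using e'(2) [of "int p' *s v j"] \<phi>x by (intro exI [of _ p']) auto
  qed
  moreover have "X (int (Suc n) *s v k) \<odot>\<^bsub>E q\<^esub> e' = X (v k) \<odot>\<^bsub>E q\<^esub> e"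
  proof -
    have c0: "compat z 0" unfolding z_def y_def by (rule compat_0(1) [OF gen_multiple_support [OF k]])
    then have "z \<in> Sy" unfolding Sy_def by force
    then have "X z \<odot>\<^bsub>E q\<^esub> e' = \<phi> z" using e'(2) by blast
    also have "\<dots> = w" using \<phi>y [OF c0] smult_one [OF wC] by simp
    finally show ?thesis by (simp only: z_def w_def y_def)
  qed
  ultimately show ?thesis using e'(1) that by blast
qed

end

section \<open>The resolution inside a function space\<close>

context toric_resolution
begin

text \<open>
  In the exact sequence \<open>0 \<rightarrow> R \<rightarrow> E 0 \<rightarrow> E 1 \<rightarrow> \<dots>\<close>, the term with index \<open>l\<close> is realized inside
  \<open>E (aug_index l)\<close>: the ring has index \<open>0\<close> and is identified with its image under \<open>\<epsilon>\<close>, and \<open>E q\<close> has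
  index \<open>q + 1\<close>.
\<close>

primrec aug_index :: "nat \<Rightarrow> nat" where
  "aug_index 0 = 0"
| "aug_index (Suc q) = q"

definition xmon :: "(nat \<Rightarrow> nat) \<Rightarrow> (int ^ 'd \<Rightarrow>\<^sub>0 'k)" where
  "xmon \<alpha> = (if admissible \<alpha> then X (exp_deg \<alpha>) else 0)"

abbreviation lin :: "nat \<Rightarrow> ('e \<Rightarrow> 'k) \<Rightarrow> bool" where
  "lin q f \<equiv> linear_functional (E q) (\<lambda>s. Poly_Mapping.single 0 s) f"

definition aug_diff :: "nat \<Rightarrow> 'e \<Rightarrow> 'e" where
  "aug_diff l = (if l = 0 then id else \<delta> (aug_index l))"

definition aug_grade :: "nat \<Rightarrow> int ^ 'd \<Rightarrow> 'e set" where
  "aug_grade l g = (if l = 0 then \<epsilon> ` toric_grade \<Sigma> M g else grade (E (aug_index l)) g)"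

text \<open>
  The terms of the sequence are embedded into a single space of functions, by evaluation at the
  linear functionals. In this space the monomials act, and the differential is given, by
  transposition, that is, by composing functionals; so all these maps are additive on the whole
  space.
\<close>

definition evals :: "nat \<Rightarrow> 'e \<Rightarrow> nat \<times> ('e \<Rightarrow> 'k) \<Rightarrow> 'k" where
  "evals l x = (\<lambda>(l', f). if l' = l \<and> lin (aug_index l) f then f x else 0)"

definition val_space :: "nat \<Rightarrow> int ^ 'd \<Rightarrow> (nat \<times> ('e \<Rightarrow> 'k) \<Rightarrow> 'k) set" where
  "val_space l g = evals l ` aug_grade l g"

definition val_act :: "(nat \<Rightarrow> nat) \<Rightarrow> (nat \<times> ('e \<Rightarrow> 'k) \<Rightarrow> 'k) \<Rightarrow> (nat \<times> ('e \<Rightarrow> 'k) \<Rightarrow> 'k)" where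
  "val_act \<alpha> t = (\<lambda>(l, f). if lin (aug_index l) f then t (l, \<lambda>x. f (xmon \<alpha> \<odot>\<^bsub>E (aug_index l)\<^esub> x)) else 0)"

definition val_diff :: "(nat \<times> ('e \<Rightarrow> 'k) \<Rightarrow> 'k) \<Rightarrow> (nat \<times> ('e \<Rightarrow> 'k) \<Rightarrow> 'k)" where
  "val_diff t = (\<lambda>(l, f). case l of 0 \<Rightarrow> 0 | Suc m \<Rightarrow> if lin m f then t (m, \<lambda>x. f (aug_diff m x)) else 0)"

lemma xmon_closed: "xmon \<alpha> \<in> carrier R"
  using single_carrier [OF exp_deg_support, of \<alpha> 1] by (simp add: xmon_def)

lemma xmon_mult: "toric_mult \<Sigma> M (xmon \<alpha>) (xmon \<beta>) = xmon (\<lambda>j. \<alpha> j + \<beta> j)"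
proof -
  have zero: "toric_mult \<Sigma> M 0 f = 0" "toric_mult \<Sigma> M f 0 = 0" for f :: "int ^ 'd \<Rightarrow>\<^sub>0 'k"
    by (simp_all add: toric_mult_def)
  show ?thesis
    unfolding xmon_def admissible_add_iff exp_deg_add by (simp add: zero toric_mult_single)
qed

lemma xmon_zero: "xmon (\<lambda>_. 0) = X 0"
proof -
  have "admissible (\<lambda>_. 0)" using fan_nonempty by (auto simp: admissible_def supported_def)
  then show ?thesis by (simp add: xmon_def exp_deg_def)
qed

lemma xmon_pw_single: "j < r \<Longrightarrow> xmon (pw n {j}) = X (int n *s v j)"
  by (simp add: xmon_def admissible_pw_single exp_deg_pw_single)

lemma smult_xmon: "x \<in> carrier (E q) \<Longrightarrow> xmon \<alpha> \<odot>\<^bsub>E q\<^esub> (xmon \<beta> \<odot>\<^bsub>E q\<^esub> x) = xmon (\<lambda>j. \<alpha> j + \<beta> j) \<odot>\<^bsub>E q\<^esub> x"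
  using module.smult_assoc1 [OF E_module xmon_closed xmon_closed, of x q \<alpha> \<beta>] by (simp add: xmon_mult)

lemma lin_add: "lin q f \<Longrightarrow> x \<in> carrier (E q) \<Longrightarrow> y \<in> carrier (E q) \<Longrightarrow> f (x \<oplus>\<^bsub>E q\<^esub> y) = f x + f y"
  unfolding linear_functional_def by blast

lemma lin_zero:
  assumes "lin q f"
  shows "f \<zero>\<^bsub>E q\<^esub> = 0"
proof -
  interpret A: abelian_group "E q" by (rule E_group)
  have "f \<zero>\<^bsub>E q\<^esub> + f \<zero>\<^bsub>E q\<^esub> = f \<zero>\<^bsub>E q\<^esub>"
    using lin_add [OF assms A.zero_closed A.zero_closed] by simp
  then show ?thesis by (metis add_cancel_right_right)
qed

lemma lin_smult:
  assumes f: "lin q f" and c: "c \<in> carrier R"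
  shows "lin q (\<lambda>x. f (c \<odot>\<^bsub>E q\<^esub> x))"
  unfolding linear_functional_def
proof (intro conjI ballI allI)
  interpret A: Module.module R "E q" by (rule E_module)
  fix x assume x: "x \<in> carrier (E q)"
  have cx: "c \<odot>\<^bsub>E q\<^esub> x \<in> carrier (E q)" by (rule smult_closed [OF c x])
  fix s
  have s: "Poly_Mapping.single 0 s \<in> carrier R" by (rule single_carrier [OF zero_support])
  have "c \<odot>\<^bsub>E q\<^esub> (Poly_Mapping.single 0 s \<odot>\<^bsub>E q\<^esub> x) = (c \<otimes>\<^bsub>R\<^esub> Poly_Mapping.single 0 s) \<odot>\<^bsub>E q\<^esub> x"
    by (rule A.smult_assoc1 [OF c s x, symmetric])
  also have "c \<otimes>\<^bsub>R\<^esub> Poly_Mapping.single 0 s = Poly_Mapping.single 0 s \<otimes>\<^bsub>R\<^esub> c"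
    by (rule A.R.m_comm [OF c s])
  also have "\<dots> \<odot>\<^bsub>E q\<^esub> x = Poly_Mapping.single 0 s \<odot>\<^bsub>E q\<^esub> (c \<odot>\<^bsub>E q\<^esub> x)"
    by (rule A.smult_assoc1 [OF s c x])
  finally show "f (c \<odot>\<^bsub>E q\<^esub> (Poly_Mapping.single 0 s \<odot>\<^bsub>E q\<^esub> x)) = s * f (c \<odot>\<^bsub>E q\<^esub> x)"
    using f cx unfolding linear_functional_def by simp
  fix y assume y: "y \<in> carrier (E q)"
  show "f (c \<odot>\<^bsub>E q\<^esub> (x \<oplus>\<^bsub>E q\<^esub> y)) = f (c \<odot>\<^bsub>E q\<^esub> x) + f (c \<odot>\<^bsub>E q\<^esub> y)"
    using lin_add [OF f cx smult_closed [OF c y]] A.smult_r_distr [OF c x y] by simp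
qed

lemma delta_closed: "x \<in> carrier (E q) \<Longrightarrow> \<delta> q x \<in> carrier (E (Suc q))"
  and delta_add: "x \<in> carrier (E q) \<Longrightarrow> y \<in> carrier (E q) \<Longrightarrow> \<delta> q (x \<oplus>\<^bsub>E q\<^esub> y) = \<delta> q x \<oplus>\<^bsub>E (Suc q)\<^esub> \<delta> q y"
  and delta_smult: "c \<in> carrier R \<Longrightarrow> x \<in> carrier (E q) \<Longrightarrow> \<delta> q (c \<odot>\<^bsub>E q\<^esub> x) = c \<odot>\<^bsub>E (Suc q)\<^esub> \<delta> q x"
  using delta_hom [of q] unfolding graded_hom_def by blast+

lemma delta_grade:
  assumes "x \<in> grade (E q) g"
  shows "\<delta> q x \<in> grade (E (Suc q)) g"
proof -
  have "\<delta> q ` grade (E q) g \<subseteq> grade (E (Suc q)) g" using delta_hom [of q] unfolding graded_hom_def by blast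
  then show ?thesis using assms by auto
qed

lemma aug_diff_Suc [simp]: "aug_diff (Suc q) = \<delta> q" and aug_diff_0 [simp]: "aug_diff 0 x = x"
  by (simp_all add: aug_diff_def)

lemma lin_aug_diff:
  assumes "lin l f"
  shows "lin (aug_index l) (\<lambda>x. f (aug_diff l x))"
proof (cases l)
  case 0
  then show ?thesis using assms by simp
next
  case (Suc q)
  then have f: "lin (Suc q) f" using assms by simp
  have "lin q (\<lambda>x. f (\<delta> q x))"
    unfolding linear_functional_def
  proof (intro conjI ballI allI)
    fix x assume x: "x \<in> carrier (E q)"
    show "f (\<delta> q (Poly_Mapping.single 0 s \<odot>\<^bsub>E q\<^esub> x)) = s * f (\<delta> q x)" for s
      using f delta_closed [OF x] delta_smult [OF single_carrier [OF zero_support] x, of s]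
      unfolding linear_functional_def by simp
    fix y assume y: "y \<in> carrier (E q)"
    show "f (\<delta> q (x \<oplus>\<^bsub>E q\<^esub> y)) = f (\<delta> q x) + f (\<delta> q y)"
      using lin_add [OF f delta_closed [OF x] delta_closed [OF y]] delta_add [OF x y] by simp
  qed
  then show ?thesis using Suc by simp
qed

lemma evals_add:
  assumes "x \<in> carrier (E (aug_index l))" "y \<in> carrier (E (aug_index l))"
  shows "evals l (x \<oplus>\<^bsub>E (aug_index l)\<^esub> y) = evals l x + evals l y"
  unfolding evals_def fun_eq_iff using lin_add [OF _ assms] by (simp add: split_paired_all)

lemma evals_zero: "evals l \<zero>\<^bsub>E (aug_index l)\<^esub> = 0"
  unfolding evals_def fun_eq_iff using lin_zero by (simp add: split_paired_all)

lemma evals_minus: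
  assumes x: "x \<in> carrier (E (aug_index l))"
  shows "evals l (\<ominus>\<^bsub>E (aug_index l)\<^esub> x) = - evals l x"
proof -
  interpret A: abelian_group "E (aug_index l)" by (rule E_group)
  have "evals l (\<ominus>\<^bsub>E (aug_index l)\<^esub> x) + evals l x = 0"
    using evals_add [OF A.a_inv_closed [OF x] x] by (simp add: A.l_neg [OF x] evals_zero)
  then show ?thesis by (simp add: eq_neg_iff_add_eq_0)
qed

text \<open>Linear functionals separate points.\<close>

lemma evals_eq_0:
  assumes x: "x \<in> carrier (E (aug_index l))" and 0: "evals l x = 0"
  shows "x = \<zero>\<^bsub>E (aug_index l)\<^esub>"
proof (rule ccontr)
  assume ne: "x \<noteq> \<zero>\<^bsub>E (aug_index l)\<^esub>"
  interpret A: Module.module R "E (aug_index l)" by (rule E_module)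
  have s: "Poly_Mapping.single 0 s \<in> carrier R" for s :: 'k by (rule single_carrier [OF zero_support])
  obtain f where f: "lin (aug_index l) f" "f x \<noteq> 0"
  proof (rule linear_functional_exists [of "E (aug_index l)" "\<lambda>s. Poly_Mapping.single 0 s" x])
    show "abelian_group (E (aug_index l))" by (rule E_group)
    fix y assume y: "y \<in> carrier (E (aug_index l))"
    show "Poly_Mapping.single 0 s \<odot>\<^bsub>E (aug_index l)\<^esub> y \<in> carrier (E (aug_index l))" for s by (rule smult_closed [OF s y])
    show "Poly_Mapping.single 0 (s + t) \<odot>\<^bsub>E (aug_index l)\<^esub> y =
        Poly_Mapping.single 0 s \<odot>\<^bsub>E (aug_index l)\<^esub> y \<oplus>\<^bsub>E (aug_index l)\<^esub> Poly_Mapping.single 0 t \<odot>\<^bsub>E (aug_index l)\<^esub> y" for s t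
      using A.smult_l_distr [OF s s y, of s t] by (simp add: single_add)
    show "Poly_Mapping.single 0 s \<odot>\<^bsub>E (aug_index l)\<^esub> (Poly_Mapping.single 0 t \<odot>\<^bsub>E (aug_index l)\<^esub> y) =
        Poly_Mapping.single 0 (s * t) \<odot>\<^bsub>E (aug_index l)\<^esub> y" for s t
      using smult_single [OF zero_support zero_support y, of s t] zero_support by simp
    show "Poly_Mapping.single 0 1 \<odot>\<^bsub>E (aug_index l)\<^esub> y = y" by (rule smult_one [OF y])
    fix z assume z: "z \<in> carrier (E (aug_index l))"
    show "Poly_Mapping.single 0 s \<odot>\<^bsub>E (aug_index l)\<^esub> (y \<oplus>\<^bsub>E (aug_index l)\<^esub> z) =
        Poly_Mapping.single 0 s \<odot>\<^bsub>E (aug_index l)\<^esub> y \<oplus>\<^bsub>E (aug_index l)\<^esub> Poly_Mapping.single 0 s \<odot>\<^bsub>E (aug_index l)\<^esub> z" for s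
      by (rule A.smult_r_distr [OF s y z])
  qed (use x ne that in auto)
  have "evals l x (l, f) = 0" using 0 by simp
  then show False using f by (simp add: evals_def)
qed

lemma evals_eq_iff:
  assumes "x \<in> carrier (E (aug_index l))" "y \<in> carrier (E (aug_index l))"
  shows "evals l x = evals l y \<longleftrightarrow> x = y"
proof
  interpret A: abelian_group "E (aug_index l)" by (rule E_group)
  assume "evals l x = evals l y"
  then have "evals l (x \<oplus>\<^bsub>E (aug_index l)\<^esub> \<ominus>\<^bsub>E (aug_index l)\<^esub> y) = 0"
    using assms by (simp add: evals_add evals_minus)
  then have "x \<oplus>\<^bsub>E (aug_index l)\<^esub> \<ominus>\<^bsub>E (aug_index l)\<^esub> y = \<zero>\<^bsub>E (aug_index l)\<^esub>"
    using assms by (intro evals_eq_0) auto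
  then show "x = y" using assms A.minus_equality A.minus_minus
    by (metis A.a_inv_closed A.minus_equality A.minus_minus)
qed simp

lemma val_act_add: "val_act \<alpha> (s + t) = val_act \<alpha> s + val_act \<alpha> t"
  by (simp add: val_act_def fun_eq_iff split_paired_all)

lemma val_diff_add: "val_diff (s + t) = val_diff s + val_diff t"
  by (simp add: val_diff_def fun_eq_iff split_paired_all split: nat.split)

lemma val_act_evals:
  assumes x: "x \<in> carrier (E (aug_index l))"
  shows "val_act \<alpha> (evals l x) = evals l (xmon \<alpha> \<odot>\<^bsub>E (aug_index l)\<^esub> x)"
  unfolding val_act_def evals_def fun_eq_iff
  using lin_smult [OF _ xmon_closed] by (simp add: split_paired_all)

lemma val_diff_evals: "val_diff (evals l x) = evals (Suc l) (aug_diff l x)"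
  unfolding val_diff_def evals_def fun_eq_iff
  using lin_aug_diff by (auto simp: split_paired_all split: nat.split)

lemma aug_grade_carrier: "x \<in> aug_grade l g \<Longrightarrow> x \<in> carrier (E (aug_index l))"
  using eps_closed grade_carrier by (cases l) (auto simp: aug_grade_def toric_grade_def)

lemma aug_grade_0E:
  assumes "x \<in> aug_grade 0 g"
  obtains s where "x = \<epsilon> (Poly_Mapping.single g s)" "g \<in> support \<Sigma> M \<or> s = 0"
    "Poly_Mapping.single g s \<in> toric_grade \<Sigma> M g" "Poly_Mapping.single g s \<in> carrier R"
proof -
  obtain f where f: "f \<in> toric_grade \<Sigma> M g" "x = \<epsilon> f" using assms by (auto simp: aug_grade_def)
  obtain s where s: "f = Poly_Mapping.single g s" "g \<in> support \<Sigma> M \<or> s = 0"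
    using f(1) unfolding toric_grade_iff by blast
  have "f \<in> carrier R" using f(1) by (simp add: toric_grade_def)
  then show ?thesis using that f s by blast
qed

lemma aug_grade_zero: "\<zero>\<^bsub>E (aug_index l)\<^esub> \<in> aug_grade l g"
proof (cases l)
  case 0
  have "0 \<in> toric_grade \<Sigma> M g" unfolding toric_grade_iff by (rule exI [of _ 0]) simp
  then have "\<epsilon> 0 \<in> \<epsilon> ` toric_grade \<Sigma> M g" by blast
  then show ?thesis using 0 eps_zero by (simp add: aug_grade_def)
qed (use graded_moduleD(5) [OF E_graded] in \<open>simp add: aug_grade_def\<close>)

lemma aug_grade_diff:
  assumes x: "x \<in> aug_grade l g" and y: "y \<in> aug_grade l g"
  shows "x \<oplus>\<^bsub>E (aug_index l)\<^esub> \<ominus>\<^bsub>E (aug_index l)\<^esub> y \<in> aug_grade l g"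
proof (cases l)
  case 0
  interpret A: abelian_group "E 0" by (rule E_group)
  obtain s where s: "x = \<epsilon> (Poly_Mapping.single g s)" "g \<in> support \<Sigma> M \<or> s = 0"
    using x unfolding 0 by (rule aug_grade_0E)
  obtain t where t: "y = \<epsilon> (Poly_Mapping.single g t)" "g \<in> support \<Sigma> M \<or> t = 0"
    using y unfolding 0 by (rule aug_grade_0E)
  note st = s(1) t(1)
  have sup: "g \<in> support \<Sigma> M \<or> s = 0 \<and> t = 0" using s(2) t(2) by blast
  then have c: "Poly_Mapping.single g u \<in> carrier R" if "u \<in> {s, t, - t, s - t}" for u
    using that by auto
  have "\<epsilon> (Poly_Mapping.single g (- t)) \<oplus>\<^bsub>E 0\<^esub> y = \<zero>\<^bsub>E 0\<^esub>"
    unfolding st(2) using eps_add [OF c [of "- t"] c [of t]] by (simp add: eps_zero flip: single_add)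
  then have m: "\<ominus>\<^bsub>E 0\<^esub> y = \<epsilon> (Poly_Mapping.single g (- t))"
    using eps_closed [OF c [of "- t"]] eps_closed [OF c [of t]] st(2) by (intro A.minus_equality) auto
  have "x \<oplus>\<^bsub>E 0\<^esub> \<ominus>\<^bsub>E 0\<^esub> y = \<epsilon> (Poly_Mapping.single g (s - t))"
    unfolding m st(1) using eps_add [OF c [of s] c [of "- t"]] by (simp flip: single_add)
  moreover have "Poly_Mapping.single g (s - t) \<in> toric_grade \<Sigma> M g"
    using sup by (auto simp: toric_grade_iff)
  ultimately show ?thesis using 0 by (simp add: aug_grade_def)
next
  case (Suc q)
  then show ?thesis
    using x y graded_moduleD(6,7) [OF E_graded] by (simp add: aug_grade_def)
qed

lemma aug_grade_act:
  assumes x: "x \<in> aug_grade l g"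
  shows "xmon \<alpha> \<odot>\<^bsub>E (aug_index l)\<^esub> x \<in> aug_grade l (g + exp_deg \<alpha>)"
proof (cases "admissible \<alpha>")
  case False
  then show ?thesis using aug_grade_zero aug_grade_carrier [OF x] by (simp add: xmon_def)
next
  case True
  have d: "exp_deg \<alpha> \<in> support \<Sigma> M" by (rule exp_deg_support [OF True])
  show ?thesis
  proof (cases l)
    case 0
    obtain s where s: "x = \<epsilon> (Poly_Mapping.single g s)" and gs: "Poly_Mapping.single g s \<in> carrier R"
      using x unfolding 0 by (rule aug_grade_0E)
    have "xmon \<alpha> \<odot>\<^bsub>E 0\<^esub> x = \<epsilon> (toric_mult \<Sigma> M (X (exp_deg \<alpha>)) (Poly_Mapping.single g s))"
      using eps_smult [OF single_carrier [OF d, of 1] gs] True s by (simp add: xmon_def)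
    moreover have "toric_mult \<Sigma> M (X (exp_deg \<alpha>)) (Poly_Mapping.single g s) \<in> toric_grade \<Sigma> M (g + exp_deg \<alpha>)"
      unfolding toric_mult_single toric_grade_iff using compat_support [of "exp_deg \<alpha>" g]
      by (cases "compat (exp_deg \<alpha>) g") (auto simp: add.commute intro: exI [of _ 0])
    ultimately show ?thesis using 0 by (simp add: aug_grade_def)
  next
    case (Suc q)
    then have "xmon \<alpha> \<odot>\<^bsub>E q\<^esub> x \<in> grade (E q) (exp_deg \<alpha> + g)"
      using True x smult_grade [OF d] by (simp add: xmon_def aug_grade_def)
    then show ?thesis using Suc by (simp add: aug_grade_def add.commute)
  qed
qed

lemma aug_grade_aug_diff: "x \<in> aug_grade l g \<Longrightarrow> aug_diff l x \<in> aug_grade (Suc l) g"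
  using eps_grade delta_grade by (cases l) (auto simp: aug_grade_def)

lemma aug_diff_aug_diff:
  assumes "x \<in> aug_grade l g"
  shows "aug_diff (Suc l) (aug_diff l x) = \<zero>\<^bsub>E (Suc l)\<^esub>"
proof (cases l)
  case 0
  then obtain f where f: "f \<in> carrier Self" "x = \<epsilon> f" using assms by (auto simp: aug_grade_def toric_grade_def)
  have "\<epsilon> f \<in> {x \<in> carrier (E 0). \<delta> 0 x = \<zero>\<^bsub>E 1\<^esub>}" using f(1) exact_eps by blast
  then show ?thesis using 0 f(2) by simp
next
  case (Suc q)
  then have x: "x \<in> carrier (E q)" using aug_grade_carrier [OF assms] by simp
  have "\<delta> q x \<in> {x \<in> carrier (E (Suc q)). \<delta> (Suc q) x = \<zero>\<^bsub>E (Suc (Suc q))\<^esub>}"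
    using x exact_delta [of q] by blast
  then show ?thesis using Suc by simp
qed

lemma aug_grade_exact:
  assumes x: "x \<in> aug_grade (Suc l) g" and 0: "aug_diff (Suc l) x = \<zero>\<^bsub>E (Suc l)\<^esub>"
  obtains y where "y \<in> aug_grade l g" "aug_diff l y = x"
proof (cases l)
  case 0
  have xg: "x \<in> grade (E 0) g" using x 0 by (simp add: aug_grade_def)
  have "x \<in> {x \<in> carrier (E 0). \<delta> 0 x = \<zero>\<^bsub>E 1\<^esub>}" using grade_carrier [OF xg] assms(2) 0 by simp
  then obtain f where f: "f \<in> carrier Self" "x = \<epsilon> f" using exact_eps by blast
  obtain f' where f': "f' \<in> grade Self g" "\<epsilon> f' = \<epsilon> f"
    using xg f(2) by (rule_tac graded_hom_lift [OF Self_graded E_graded eps_hom f(1)]) auto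
  have "x = \<epsilon> f'" using f'(2) f(2) by simp
  then have "x \<in> \<epsilon> ` toric_grade \<Sigma> M g" using f'(1) by simp
  then show ?thesis using that [of x] 0 by (simp add: aug_grade_def)
next
  case (Suc q)
  have xg: "x \<in> grade (E (Suc q)) g" using x Suc by (simp add: aug_grade_def)
  have "x \<in> {x \<in> carrier (E (Suc q)). \<delta> (Suc q) x = \<zero>\<^bsub>E (Suc (Suc q))\<^esub>}"
    using grade_carrier [OF xg] assms(2) Suc by simp
  then obtain y where y: "y \<in> carrier (E q)" "x = \<delta> q y" using exact_delta [of q] by blast
  obtain y' where "y' \<in> grade (E q) g" "\<delta> q y' = \<delta> q y"
    using xg y(2) by (rule_tac graded_hom_lift [OF E_graded E_graded delta_hom y(1)]) auto
  then show ?thesis using that [of y'] Suc y(2) by (auto simp: aug_grade_def)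
qed

lemma val_act_pw_evals:
  assumes "x \<in> carrier (E q)" "j < r"
  shows "val_act (pw m {j}) (evals (Suc q) x) = evals (Suc q) (X (int m *s v j) \<odot>\<^bsub>E q\<^esub> x)"
  using val_act_evals [of x "Suc q"] assms by (simp add: xmon_pw_single)

lemma val_act_pw_evals_eq_0:
  assumes "x \<in> carrier (E q)" "j < r"
  shows "val_act (pw m {j}) (evals (Suc q) x) = 0 \<longleftrightarrow> X (int m *s v j) \<odot>\<^bsub>E q\<^esub> x = \<zero>\<^bsub>E q\<^esub>"
  unfolding val_act_pw_evals [OF assms]
  using evals_eq_0 [of _ "Suc q"] evals_zero [of "Suc q"]
    smult_closed [OF single_carrier [OF gen_multiple_support [OF assms(2)]] assms(1)] by auto

text \<open>The lifting assumption is \<open>torsion_lift\<close>; all other ones are transported along \<open>evals\<close>.\<close>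

lemma germ_resolution: "germ_resolution r exp_deg val_act val_diff val_space"
proof
  fix q g \<alpha> \<beta> and s t :: "nat \<times> ('e \<Rightarrow> 'k) \<Rightarrow> 'k"
  show "0 \<in> val_space q g" using evals_zero [of q] aug_grade_zero [of q g] unfolding val_space_def by (metis imageI)
  show "s - t \<in> val_space q g" if st: "s \<in> val_space q g" "t \<in> val_space q g"
  proof -
    interpret A: abelian_group "E (aug_index q)" by (rule E_group)
    obtain x y where xy: "x \<in> aug_grade q g" "y \<in> aug_grade q g" "s = evals q x" "t = evals q y"
      using st unfolding val_space_def by blast
    have "evals q (x \<oplus>\<^bsub>E (aug_index q)\<^esub> \<ominus>\<^bsub>E (aug_index q)\<^esub> y) = s - t"
      using xy aug_grade_carrier [OF xy(1)] aug_grade_carrier [OF xy(2)] by (simp add: evals_add evals_minus)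
    then show ?thesis using aug_grade_diff [OF xy(1,2)] unfolding val_space_def by (metis imageI)
  qed
  show "val_act \<alpha> (s + t) = val_act \<alpha> s + val_act \<alpha> t" by (rule val_act_add)
  show "val_diff (s + t) = val_diff s + val_diff t" by (rule val_diff_add)
  show "exp_deg (\<lambda>j. \<alpha> j + \<beta> j) = exp_deg \<alpha> + exp_deg \<beta>" by (rule exp_deg_add)
next
  fix s q g assume "s \<in> val_space q g"
  then obtain x where x: "x \<in> aug_grade q g" "s = evals q x" unfolding val_space_def by blast
  have xc: "x \<in> carrier (E (aug_index q))" by (rule aug_grade_carrier [OF x(1)])
  have ac: "val_act \<alpha> s = evals q (xmon \<alpha> \<odot>\<^bsub>E (aug_index q)\<^esub> x)" for \<alpha> unfolding x(2) by (rule val_act_evals [OF xc])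
  have xa: "xmon \<alpha> \<odot>\<^bsub>E (aug_index q)\<^esub> x \<in> aug_grade q (g + exp_deg \<alpha>)" for \<alpha> by (rule aug_grade_act [OF x(1)])
  show "val_act \<alpha> s \<in> val_space q (g + exp_deg \<alpha>)" for \<alpha> unfolding ac val_space_def using xa by blast
  show "val_diff s \<in> val_space (Suc q) g" unfolding x(2) val_diff_evals val_space_def using aug_grade_aug_diff [OF x(1)] by blast
  show "val_act \<alpha> (val_act \<beta> s) = val_act (\<lambda>j. \<alpha> j + \<beta> j) s" for \<alpha> \<beta>
    unfolding ac val_act_evals [OF aug_grade_carrier [OF xa]] smult_xmon [OF xc] ..
  show "val_act (\<lambda>_. 0) s = s"
    using ac [of "\<lambda>_. 0"] unfolding xmon_zero smult_one [OF xc] by (simp only: x(2))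
  show "val_diff (val_act \<alpha> s) = val_act \<alpha> (val_diff s)" for \<alpha>
  proof -
    have c: "aug_diff q x \<in> carrier (E (aug_index (Suc q)))" by (rule aug_grade_carrier [OF aug_grade_aug_diff [OF x(1)]])
    have "aug_diff q (xmon \<alpha> \<odot>\<^bsub>E (aug_index q)\<^esub> x) = xmon \<alpha> \<odot>\<^bsub>E q\<^esub> aug_diff q x"
      using delta_smult [OF xmon_closed] xc by (cases q) auto
    then have "val_diff (val_act \<alpha> s) = evals (Suc q) (xmon \<alpha> \<odot>\<^bsub>E q\<^esub> aug_diff q x)"
      by (simp only: ac val_diff_evals)
    also have "\<dots> = val_act \<alpha> (val_diff s)"
      using val_act_evals [OF c, of \<alpha>] by (simp only: x(2) val_diff_evals aug_index.simps)
    finally show ?thesis .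
  qed
  show "val_diff (val_diff s) = 0"
    unfolding x(2) val_diff_evals aug_diff_aug_diff [OF x(1)] using evals_zero [of "Suc (Suc q)"] by simp
next
  fix s g assume s: "s \<in> val_space 0 g" "val_diff s = 0"
  then obtain x where x: "x \<in> aug_grade 0 g" "s = evals 0 x" unfolding val_space_def by blast
  have "evals 1 x = 0" using s(2) unfolding x(2) val_diff_evals by simp
  then have "x = \<zero>\<^bsub>E (aug_index 1)\<^esub>" using aug_grade_carrier [OF x(1)] by (intro evals_eq_0) auto
  then show "s = 0" using evals_zero [of 0] x(2) by simp
next
  fix s q g assume s: "s \<in> val_space (Suc q) g" "val_diff s = 0"
  then obtain x where x: "x \<in> aug_grade (Suc q) g" "s = evals (Suc q) x" unfolding val_space_def by blast
  have "evals (Suc (Suc q)) (aug_diff (Suc q) x) = 0" using s(2) unfolding x(2) val_diff_evals .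
  then have "aug_diff (Suc q) x = \<zero>\<^bsub>E (aug_index (Suc (Suc q)))\<^esub>"
    by (rule evals_eq_0 [OF aug_grade_carrier [OF aug_grade_aug_diff [OF x(1)]]])
  then have "aug_diff (Suc q) x = \<zero>\<^bsub>E (Suc q)\<^esub>" by simp
  then obtain y where y: "y \<in> aug_grade q g" "aug_diff q y = x" by (rule aug_grade_exact [OF x(1)])
  then have "val_diff (evals q y) = s" unfolding val_diff_evals x(2) by simp
  then show "\<exists>y\<in>val_space q g. val_diff y = s" using y(1) unfolding val_space_def by blast
next
  fix k s q g n
  assume k: "k < r" and s: "s \<in> val_space (Suc q) (g + exp_deg (pw n {k}))"
    and tors: "\<And>j. j < k \<Longrightarrow> \<exists>m. val_act (pw m {j}) s = 0"
  obtain e where e: "e \<in> grade (E q) (g + int n *s v k)" "s = evals (Suc q) e"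
    using s k unfolding val_space_def by (auto simp: aug_grade_def exp_deg_pw_single)
  have eC: "e \<in> carrier (E q)" by (rule grade_carrier [OF e(1)])
  have te: "\<exists>m. X (int m *s v j) \<odot>\<^bsub>E q\<^esub> e = \<zero>\<^bsub>E q\<^esub>" if j: "j < k" for j
    using tors [OF j] val_act_pw_evals_eq_0 [OF eC, of j] j k unfolding e(2) by auto
  obtain e' where e': "e' \<in> grade (E q) g" "\<And>j. j < k \<Longrightarrow> \<exists>m. X (int m *s v j) \<odot>\<^bsub>E q\<^esub> e' = \<zero>\<^bsub>E q\<^esub>"
    "X (int (Suc n) *s v k) \<odot>\<^bsub>E q\<^esub> e' = X (v k) \<odot>\<^bsub>E q\<^esub> e"
    by (rule torsion_lift [OF k e(1) te], assumption, rule that)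
  have e'C: "e' \<in> carrier (E q)" by (rule grade_carrier [OF e'(1)])
  have "evals (Suc q) e' \<in> val_space (Suc q) g" using e'(1) by (simp add: val_space_def aug_grade_def)
  moreover have "\<exists>m. val_act (pw m {j}) (evals (Suc q) e') = 0" if "j < k" for j
    using e'(2) [OF that] val_act_pw_evals_eq_0 [OF e'C, of j] that k by auto
  moreover have "val_act (pw (n + 1) {k}) (evals (Suc q) e') = val_act (pw 1 {k}) s"
    unfolding e(2) val_act_pw_evals [OF e'C k] val_act_pw_evals [OF eC k] using e'(3) by simp
  ultimately show "\<exists>y m. y \<in> val_space (Suc q) g \<and> (\<forall>j<k. \<exists>m. val_act (pw m {j}) y = 0) \<and>
      val_act (pw (n + m) {k}) y = val_act (pw m {k}) s"
    by blast
qed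

end

section \<open>The Cech complex of a toric face ring in a fixed degree\<close>

context toric_resolution
begin

lemma degree_family_idx: "D \<in> \<Sigma> \<Longrightarrow> J \<in> degree_family a D \<Longrightarrow> J \<subseteq> G.idx D"
  by (rule conjunct1 [OF iffD1 [OF degree_family_iff]])

lemma degree_family_eventually:
  "D \<in> \<Sigma> \<Longrightarrow> J \<in> degree_family a D \<Longrightarrow>
    \<forall>\<^sub>F n in sequentially. a + int n *s vsum J \<in> M D \<and> real_vec (a + int n *s vsum J) \<in> cone_interior D"
  by (rule conjunct2 [OF iffD1 [OF degree_family_iff]])

text \<open>The image of the term \<open>s X\<^sup>g\<close>, read as zero if the ring has no component of degree \<open>g\<close>.\<close>

definition theta :: "int ^ 'd \<Rightarrow> 'k \<Rightarrow> nat \<times> ('e \<Rightarrow> 'k) \<Rightarrow> 'k" where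
  "theta g s = (if g \<in> support \<Sigma> M then evals 0 (\<epsilon> (Poly_Mapping.single g s)) else 0)"

lemma val_space_0_iff: "t \<in> val_space 0 g \<longleftrightarrow> (\<exists>s. t = theta g s)"
proof
  assume "t \<in> val_space 0 g"
  then obtain x where x: "x \<in> aug_grade 0 g" "t = evals 0 x" unfolding val_space_def by blast
  obtain s where s: "x = \<epsilon> (Poly_Mapping.single g s)" "g \<in> support \<Sigma> M \<or> s = 0"
    using x(1) by (rule aug_grade_0E)
  show "\<exists>s. t = theta g s"
  proof (cases "g \<in> support \<Sigma> M")
    case True
    then show ?thesis using s x(2) by (auto simp: theta_def)
  next
    case False
    then have "t = 0" using s x(2) eps_zero evals_zero [of 0] by simp
    then show ?thesis using False by (simp add: theta_def)
  qed
next
  assume "\<exists>s. t = theta g s"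
  then obtain s where s: "t = theta g s" by blast
  show "t \<in> val_space 0 g"
  proof (cases "g \<in> support \<Sigma> M")
    case True
    then show ?thesis
      using single_grade [OF True, of s] by (simp add: s theta_def val_space_def aug_grade_def)
  next
    case False
    then show ?thesis using germ_resolution.F_zero [OF germ_resolution] by (simp add: s theta_def)
  qed
qed

lemma theta_add: "theta g (s + t) = theta g s + theta g t"
proof (cases "g \<in> support \<Sigma> M")
  case True
  then show ?thesis
    using evals_add [of "\<epsilon> (Poly_Mapping.single g s)" 0 "\<epsilon> (Poly_Mapping.single g t)"]
      eps_add [OF single_carrier [OF True, of s] single_carrier [OF True, of t]]
      eps_closed [OF single_carrier [OF True, of s]] eps_closed [OF single_carrier [OF True, of t]]
    by (simp add: theta_def single_add)
qed (simp add: theta_def)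

lemma theta_zero [simp]: "theta g 0 = 0"
  using theta_add [of g 0 0] by simp

lemma theta_uminus: "theta g (- s) = - theta g s"
  using theta_add [of g "- s" s] by (simp add: eq_neg_iff_add_eq_0)

lemma theta_sign: "theta g (inc_sign j J * s) = inc_sign j J * theta g s"
proof -
  have "theta g ((-1) ^ n * s) = (-1) ^ n * theta g s" for n
    by (induction n) (auto simp: theta_uminus)
  then show ?thesis unfolding inc_sign_def .
qed

lemma theta_sum: "theta g (sum f A) = (\<Sum>x\<in>A. theta g (f x))"
  by (induction A rule: infinite_finite_induct) (auto simp: theta_add)

lemma theta_eq_0:
  assumes g: "g \<in> support \<Sigma> M" and 0: "theta g s = 0"
  shows "s = 0"
proof -
  have c: "Poly_Mapping.single g s \<in> carrier R" by (rule single_carrier [OF g])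
  have "\<epsilon> (Poly_Mapping.single g s) = \<zero>\<^bsub>E (aug_index 0)\<^esub>"
    using 0 g eps_closed [OF c] by (intro evals_eq_0) (auto simp: theta_def)
  then have "\<epsilon> (Poly_Mapping.single g s) = \<epsilon> 0" by (simp add: eps_zero)
  then show ?thesis using eps_eq_iff [OF c, of 0] by (simp add: single_eq_0_iff)
qed

lemma val_act_theta:
  assumes g: "g \<in> support \<Sigma> M"
  shows "val_act \<alpha> (theta g s) = (if admissible \<alpha> \<and> compat (exp_deg \<alpha>) g then theta (exp_deg \<alpha> + g) s else 0)"
proof -
  have c: "Poly_Mapping.single g s \<in> carrier R" by (rule single_carrier [OF g])
  have "val_act \<alpha> (theta g s) = evals 0 (xmon \<alpha> \<odot>\<^bsub>E 0\<^esub> \<epsilon> (Poly_Mapping.single g s))"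
    using val_act_evals [of "\<epsilon> (Poly_Mapping.single g s)" 0 \<alpha>] eps_closed [OF c] g by (simp add: theta_def)
  also have "xmon \<alpha> \<odot>\<^bsub>E 0\<^esub> \<epsilon> (Poly_Mapping.single g s) = \<epsilon> (toric_mult \<Sigma> M (xmon \<alpha>) (Poly_Mapping.single g s))"
    by (rule eps_smult [OF xmon_closed c, symmetric])
  also have "toric_mult \<Sigma> M (xmon \<alpha>) (Poly_Mapping.single g s) =
      (if admissible \<alpha> \<and> compat (exp_deg \<alpha>) g then Poly_Mapping.single (exp_deg \<alpha> + g) s else 0)"
    by (simp add: xmon_def toric_mult_single) (simp add: toric_mult_def)
  finally show ?thesis
    using compat_support [of "exp_deg \<alpha>" g] evals_zero [of 0] by (auto simp: theta_def eps_zero)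
qed

lemma val_act_zero: "val_act \<alpha> 0 = 0"
  by (rule germ_resolution.act_simps(1) [OF germ_resolution])

context
  fixes a :: "int ^ 'd"
begin

interpretation GR: germ_resolution r exp_deg val_act val_diff val_space a
  by (rule germ_resolution)

definition degree_complex :: "nat set set" where
  "degree_complex = (\<Union>D\<in>\<Sigma>. degree_family a D)"

text \<open>In each degree the ring is at most one-dimensional, so a germ is given by a scalar.\<close>

lemma germ_in_family:
  assumes J: "J \<subseteq> {0..<r}" and c: "GR.germ 0 0 J c" and "J \<in> degree_complex"
  obtains s where "\<forall>\<^sub>F n in sequentially. c n = theta (a + exp_deg (pw n J)) s"
proof -
  obtain D where D: "D \<in> \<Sigma>" "J \<in> degree_family a D" using assms(3) unfolding degree_complex_def by blast
  have JD: "J \<subseteq> G.idx D" by (rule degree_family_idx [OF D])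
  obtain N where N: "\<And>n. n \<ge> N \<Longrightarrow> c n \<in> GR.Gam 0 0 (a + exp_deg (pw n J))"
      "\<And>n0 n. N \<le> n0 \<Longrightarrow> n0 \<le> n \<Longrightarrow> c n = val_act (pw (n - n0) J) (c n0)"
    by (rule GR.germ_iterate [OF c]) (rule that)
  obtain N' where N': "\<And>n. n \<ge> N' \<Longrightarrow> a + int n *s vsum J \<in> M D"
    using degree_family_eventually [OF D] unfolding eventually_sequentially by (elim exE) (auto intro: that)
  define m where "m = max N N'"
  obtain s where s: "c m = theta (a + exp_deg (pw m J)) s"
    using N(1) [of m] GR.Gam_F val_space_0_iff unfolding m_def by (metis max.cobounded1)
  have gm: "a + exp_deg (pw m J) \<in> M D" using N' [of m] exp_deg_pw [OF J] by (simp add: m_def)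
  have "c n = theta (a + exp_deg (pw n J)) s" if n: "n \<ge> m" for n
  proof -
    have sup: "supported (pw (n - m) J) D"
      using JD idx_iff [OF D(1)] by (auto simp: supported_def pw_def split: if_splits)
    then have "admissible (pw (n - m) J)" "exp_deg (pw (n - m) J) \<in> M D"
      using D(1) exp_deg_mem unfolding admissible_def by blast+
    then have ok: "admissible (pw (n - m) J) \<and> compat (exp_deg (pw (n - m) J)) (a + exp_deg (pw m J))"
      using D(1) gm unfolding compat_def by blast
    have gs: "a + exp_deg (pw m J) \<in> support \<Sigma> M" using D(1) gm unfolding support_def by blast
    have "(\<lambda>i. pw (n - m) J i + pw m J i) = pw n J" using n by (auto simp: pw_def fun_eq_iff)
    then have eq: "exp_deg (pw (n - m) J) + (a + exp_deg (pw m J)) = a + exp_deg (pw n J)"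
      using exp_deg_add [of "pw (n - m) J" "pw m J"] by (simp add: algebra_simps)
    have "c n = val_act (pw (n - m) J) (c m)" using N(2) [of m n] n by (simp add: m_def)
    also have "\<dots> = theta (a + exp_deg (pw n J)) s"
      unfolding s val_act_theta [OF gs] eq using ok by simp
    finally show ?thesis .
  qed
  then show ?thesis using that unfolding eventually_sequentially by blast
qed

lemma compat_label:
  assumes C: "C \<in> \<Sigma>" "J \<subseteq> G.idx C" and g: "a + int n *s vsum J \<in> M C"
  shows "J \<in> degree_complex"
  using degree_family_exists [OF C g] unfolding degree_complex_def by blast

lemma germ_not_in_family:
  assumes J: "J \<subseteq> {0..<r}" and c: "GR.germ 0 0 J c" and not: "J \<notin> degree_complex"
  shows "\<forall>\<^sub>F n in sequentially. c n = 0"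
proof -
  obtain N where N: "\<And>n. n \<ge> N \<Longrightarrow> c n \<in> GR.Gam 0 0 (a + exp_deg (pw n J))"
      "\<And>n0 n. N \<le> n0 \<Longrightarrow> n0 \<le> n \<Longrightarrow> c n = val_act (pw (n - n0) J) (c n0)"
    by (rule GR.germ_iterate [OF c]) (rule that)
  have "c (Suc n) = 0" if n: "n \<ge> N" for n
  proof -
    obtain s where s: "c n = theta (a + exp_deg (pw n J)) s"
      using N(1) [OF n] GR.Gam_F val_space_0_iff by metis
    have eq: "c (Suc n) = val_act (pw 1 J) (c n)" using N(2) [of n "Suc n"] n by simp
    show ?thesis
    proof (cases "a + exp_deg (pw n J) \<in> support \<Sigma> M \<and> admissible (pw 1 J) \<and> compat (exp_deg (pw 1 J)) (a + exp_deg (pw n J))")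
      case True
      then obtain C B where CB: "C \<in> \<Sigma>" "exp_deg (pw 1 J) \<in> M C" "a + exp_deg (pw n J) \<in> M C"
          "B \<in> \<Sigma>" "supported (pw 1 J) B"
        unfolding compat_def admissible_def by blast
      have "supported (pw 1 J) C" by (rule factor_mem [OF CB(4,5,1,2)])
      then have "J \<subseteq> G.idx C"
        using J idx_iff [OF CB(1)] by (auto simp: supported_def pw_def)
      then have "J \<in> degree_complex" using CB(3) exp_deg_pw [OF J] compat_label [OF CB(1)] by simp
      then show ?thesis using not by blast
    next
      case False
      then show ?thesis
        unfolding eq s using val_act_theta [of "a + exp_deg (pw n J)"] val_act_zero
        by (cases "a + exp_deg (pw n J) \<in> support \<Sigma> M") (auto simp: theta_def)
    qed
  qed
  then have "\<forall>\<^sub>F n in sequentially. c (Suc n) = 0" unfolding eventually_sequentially by blast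
  then show ?thesis by (subst (asm) eventually_sequentially_Suc [of "\<lambda>n. c n = 0"])
qed

text \<open>
  The product of the monomials of degree \<open>n v\<^sub>j\<close> and \<open>a + n v\<close>, where \<open>v\<close> is the sum over
  \<open>J - {j}\<close>, is not zero if and only if their degrees lie in a common cone. In this case \<open>J\<close> has a
  label, and it contains the label of \<open>J - {j}\<close>.
\<close>

lemma val_act_incidence:
  assumes J: "J \<subseteq> {0..<r}" and j: "j \<in> J" and "J - {j} \<in> degree_complex"
  shows "\<forall>\<^sub>F n in sequentially. \<forall>s. val_act (pw n {j}) (theta (a + exp_deg (pw n (J - {j}))) s) =
    (if degree_inc a (J - {j}) J then theta (a + exp_deg (pw n J)) s else 0)"
proof -
  obtain D' where D': "D' \<in> \<Sigma>" "J - {j} \<in> degree_family a D'" using assms(3) unfolding degree_complex_def by blast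
  have jr: "j < r" using J j by auto
  have Jj: "J - {j} \<subseteq> {0..<r}" using J by auto
  have ev: "\<forall>\<^sub>F n in sequentially. a + int n *s vsum (J - {j}) \<in> M D' \<and>
      real_vec (a + int n *s vsum (J - {j})) \<in> cone_interior D'"
    by (rule degree_family_eventually [OF D'])
  have JD': "J - {j} \<subseteq> G.idx D'" by (rule degree_family_idx [OF D'])
  show ?thesis
    using ev eventually_gt_at_top [of "0::nat"]
  proof eventually_elim
    case (elim n)
    define g where "g = a + exp_deg (pw n (J - {j}))"
    have g: "g = a + int n *s vsum (J - {j})" using exp_deg_pw [OF Jj] by (simp add: g_def)
    have gD': "g \<in> M D'" "real_vec g \<in> cone_interior D'" using elim(1) unfolding g by auto
    have gs: "g \<in> support \<Sigma> M" using D'(1) gD'(1) unfolding support_def by blast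
    have "(\<lambda>i. pw n {j} i + pw n (J - {j}) i) = pw n J" using j by (auto simp: pw_def fun_eq_iff)
    then have eq: "exp_deg (pw n {j}) + g = a + exp_deg (pw n J)"
      using exp_deg_add [of "pw n {j}" "pw n (J - {j})"] by (simp add: g_def algebra_simps)
    have "compat (exp_deg (pw n {j})) g \<longleftrightarrow> degree_inc a (J - {j}) J"
    proof
      assume "compat (exp_deg (pw n {j})) g"
      then obtain C where C: "C \<in> \<Sigma>" "exp_deg (pw n {j}) \<in> M C" "g \<in> M C" unfolding compat_def by blast
      have vj: "v j \<in> M C"
        using root_mem [OF C(1) gen_support [OF jr], of n] C(2) elim(2) exp_deg_pw_single [OF jr] by simp
      have D'C: "D' \<subseteq> C" by (rule interior_le [OF C(1) D'(1) gD'(2) real_vec_in [OF C(1,3)]])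
      have JC: "J \<subseteq> G.idx C"
        using vj jr JD' G.idx_mono [OF D'C] gen_mem_iff [OF jr C(1)] by (auto simp: G.idx_def)
      have "a + int n *s vsum J \<in> M C"
        using add_mem [OF C(1,2,3)] unfolding eq exp_deg_pw [OF J] .
      then obtain D where D: "D \<in> \<Sigma>" "D \<subseteq> C" "J \<in> degree_family a D"
        by (rule degree_family_exists [OF C(1) JC])
      have "D' \<subseteq> D"
        using D(3) D'(2) unfolding degree_family_def
        by (intro G.open_family_label_mono [OF C(1) D(1) D'(1) D(2) D'C, of J "real_vec a" "J - {j}"])
          (auto split: if_splits)
      then show "degree_inc a (J - {j}) J" unfolding degree_inc_def using D D' by blast
    next
      assume "degree_inc a (J - {j}) J"
      then obtain D D2 where D: "D \<in> \<Sigma>" "D2 \<in> \<Sigma>" "J \<in> degree_family a D" "J - {j} \<in> degree_family a D2" "D2 \<subseteq> D"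
        unfolding degree_inc_def by blast
      have "D2 = D'" by (rule degree_family_disjoint [OF D(2) D'(1) D(4) D'(2)])
      then have gD: "g \<in> M D" using mem_mono [OF D'(1) D(1)] D(5) gD'(1) by blast
      have "J \<subseteq> G.idx D" by (rule degree_family_idx [OF D(1,3)])
      then have "v j \<in> M D" using j idx_iff [OF D(1)] by blast
      then have "exp_deg (pw n {j}) \<in> M D" unfolding exp_deg_pw_single [OF jr] by (intro scale_mem [OF D(1)]) auto
      then show "compat (exp_deg (pw n {j})) g" using gD D(1) unfolding compat_def by blast
    qed
    then show ?case
      unfolding g_def [symmetric] val_act_theta [OF gs] eq using admissible_pw_single [OF jr] by simp
  qed
qed

text \<open>In terms of scalars, the Cech differential is the coboundary of the labelled family.\<close>

lemma hdiff_theta: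
  assumes J: "J \<subseteq> {0..<r}"
    and c1: "\<And>j. j \<in> J \<Longrightarrow> J - {j} \<in> degree_complex \<Longrightarrow>
      \<forall>\<^sub>F n in sequentially. c (J - {j}) n = theta (a + exp_deg (pw n (J - {j}))) (f (J - {j}))"
    and c2: "\<And>j. j \<in> J \<Longrightarrow> J - {j} \<notin> degree_complex \<Longrightarrow> \<forall>\<^sub>F n in sequentially. c (J - {j}) n = 0"
  shows "\<forall>\<^sub>F n in sequentially. GR.hdiff c J n = theta (a + exp_deg (pw n J)) (cobd degree_complex (degree_inc a) f J)"
proof -
  have fin: "finite J" using J finite_subset by blast
  have "\<forall>\<^sub>F n in sequentially. \<forall>j\<in>J. val_act (pw n {j}) (c (J - {j}) n) =
      theta (a + exp_deg (pw n J)) (if J - {j} \<in> degree_complex \<and> degree_inc a (J - {j}) J then f (J - {j}) else 0)"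
  proof (intro eventually_ball_finite fin ballI)
    fix j assume j: "j \<in> J"
    show "\<forall>\<^sub>F n in sequentially. val_act (pw n {j}) (c (J - {j}) n) =
      theta (a + exp_deg (pw n J)) (if J - {j} \<in> degree_complex \<and> degree_inc a (J - {j}) J then f (J - {j}) else 0)"
    proof (cases "J - {j} \<in> degree_complex")
      case True
      show ?thesis
        using c1 [OF j True] val_act_incidence [OF J j True] by eventually_elim (simp add: True)
    next
      case False
      show ?thesis
        using c2 [OF j False] by eventually_elim (simp add: False val_act_zero)
    qed
  qed
  then show ?thesis
  proof eventually_elim
    case (elim n)
    have "GR.hdiff c J n = (\<Sum>j\<in>J. inc_sign j J * theta (a + exp_deg (pw n J))
        (if J - {j} \<in> degree_complex \<and> degree_inc a (J - {j}) J then f (J - {j}) else 0))"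
      unfolding GR.hdiff_def using elim by simp
    also have "\<dots> = theta (a + exp_deg (pw n J)) (cobd degree_complex (degree_inc a) f J)"
      unfolding cobd_def theta_sum by (intro sum.cong refl) (simp add: theta_sign flip: theta_sign)
    finally show ?case .
  qed
qed

text \<open>
  Cochains of germs are cochains of scalars on the labelled family, where exactness is known.
\<close>

lemma cech_exact:
  assumes "\<And>D. D \<in> \<Sigma> \<Longrightarrow> dim D \<le> i \<Longrightarrow> a \<notin> uminus ` normalization (M D)"
  shows "GR.cech_exact i"
  unfolding GR.cech_exact_def
proof (intro allI impI)
  fix c assume c: "\<forall>J\<subseteq>{0..<r}. card J = i \<longrightarrow> GR.germ 0 0 J (c J)"
    and dc: "\<forall>J\<subseteq>{0..<r}. card J = Suc i \<longrightarrow> (\<forall>\<^sub>F n in sequentially. GR.hdiff c J n = 0)"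
  have ex: "exact_at TYPE('k) degree_complex (degree_inc a) i"
    unfolding degree_complex_def by (rule exact_at_degree [OF assms])
  have famJ: "J \<subseteq> {0..<r}" if "J \<in> degree_complex" for J
    using that degree_family_idx unfolding degree_complex_def by (fastforce simp: G.idx_def)
  have "\<exists>s. J \<in> degree_complex \<and> card J = i \<longrightarrow> (\<forall>\<^sub>F n in sequentially. c J n = theta (a + exp_deg (pw n J)) s)" for J
  proof (cases "J \<in> degree_complex \<and> card J = i")
    case True
    then have "GR.germ 0 0 J (c J)" using c famJ by blast
    then obtain s where "\<forall>\<^sub>F n in sequentially. c J n = theta (a + exp_deg (pw n J)) s"
      using True famJ by (rule_tac germ_in_family) auto
    then show ?thesis by blast
  qed auto
  then have "\<forall>J. \<exists>s. J \<in> degree_complex \<and> card J = i \<longrightarrow> (\<forall>\<^sub>F n in sequentially. c J n = theta (a + exp_deg (pw n J)) s)"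
    by blast
  from choice [OF this] obtain f where f0: "\<forall>J. J \<in> degree_complex \<and> card J = i \<longrightarrow>
      (\<forall>\<^sub>F n in sequentially. c J n = theta (a + exp_deg (pw n J)) (f J))"
    by (elim exE)
  have f: "\<forall>\<^sub>F n in sequentially. c J n = theta (a + exp_deg (pw n J)) (f J)" if "J \<in> degree_complex" "card J = i" for J
    using f0 that by blast
  have z: "\<forall>\<^sub>F n in sequentially. c J n = 0" if "J \<subseteq> {0..<r}" "J \<notin> degree_complex" "card J = i" for J
    using germ_not_in_family c that by blast
  have gsup: "\<forall>\<^sub>F n in sequentially. a + exp_deg (pw n J) \<in> support \<Sigma> M" if J: "J \<in> degree_complex" for J
  proof -
    obtain D where D: "D \<in> \<Sigma>" "J \<in> degree_family a D" using J unfolding degree_complex_def by blast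
    have "\<forall>\<^sub>F n in sequentially. a + int n *s vsum J \<in> M D \<and> real_vec (a + int n *s vsum J) \<in> cone_interior D"
      by (rule degree_family_eventually [OF D])
    then show ?thesis
    proof eventually_elim
      case (elim n)
      then show ?case unfolding exp_deg_pw [OF famJ [OF J]] support_def using D(1) by blast
    qed
  qed
  have "cobd degree_complex (degree_inc a) f J = 0" if J: "J \<in> degree_complex" "card J = Suc i" for J
  proof -
    have Jr: "J \<subseteq> {0..<r}" by (rule famJ [OF J(1)])
    have fin: "finite J" using Jr finite_subset by blast
    have cj: "card (J - {j}) = i" "J - {j} \<subseteq> {0..<r}" if "j \<in> J" for j
      using card_Suc_Diff1 [OF fin that] J(2) Jr by auto
    have "\<forall>\<^sub>F n in sequentially. GR.hdiff c J n = theta (a + exp_deg (pw n J)) (cobd degree_complex (degree_inc a) f J)"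
      using f z cj by (intro hdiff_theta Jr) blast+
    then have "\<forall>\<^sub>F n in sequentially. theta (a + exp_deg (pw n J)) (cobd degree_complex (degree_inc a) f J) = 0 \<and>
        a + exp_deg (pw n J) \<in> support \<Sigma> M"
      using dc [rule_format, OF Jr J(2)] gsup [OF J(1)] by eventually_elim simp
    then have "\<exists>n. theta (a + exp_deg (pw n J)) (cobd degree_complex (degree_inc a) f J) = 0 \<and> a + exp_deg (pw n J) \<in> support \<Sigma> M"
      by (rule eventually_happens' [OF sequentially_bot])
    then show ?thesis using theta_eq_0 by blast
  qed
  then obtain h where h: "\<And>J. J \<in> degree_complex \<Longrightarrow> card J = i \<Longrightarrow> f J = cobd degree_complex (degree_inc a) h J"
    using ex unfolding exact_at_def by blast
  define b where "b = (\<lambda>J n. if J \<in> degree_complex then theta (a + exp_deg (pw n J)) (h J) else 0)"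
  have "GR.germ 0 0 J (b J)" if J: "J \<subseteq> {0..<r}" for J
  proof (cases "J \<in> degree_complex")
    case False
    then have "b J = (\<lambda>_. 0)" by (simp add: b_def)
    then show ?thesis using GR.germ_zero by simp
  next
    case True
    then obtain D where D: "D \<in> \<Sigma>" "J \<in> degree_family a D" unfolding degree_complex_def by blast
    have JD: "J \<subseteq> G.idx D" by (rule degree_family_idx [OF D])
    have sup: "supported (pw 1 J) D"
      using JD idx_iff [OF D(1)] by (auto simp: supported_def pw_def split: if_splits)
    then have ok: "admissible (pw 1 J)" "exp_deg (pw 1 J) \<in> M D"
      using D(1) exp_deg_mem unfolding admissible_def by blast+
    have "\<forall>\<^sub>F n in sequentially. a + int n *s vsum J \<in> M D \<and> real_vec (a + int n *s vsum J) \<in> cone_interior D"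
      by (rule degree_family_eventually [OF D])
    then show ?thesis
      unfolding GR.germ_def
    proof eventually_elim
      case (elim n)
      have gD: "a + exp_deg (pw n J) \<in> M D" using elim exp_deg_pw [OF J] by simp
      then have gs: "a + exp_deg (pw n J) \<in> support \<Sigma> M" and cm: "compat (exp_deg (pw 1 J)) (a + exp_deg (pw n J))"
        using D(1) ok(2) unfolding support_def compat_def by blast+
      have "(\<lambda>i. pw 1 J i + pw n J i) = pw (Suc n) J" by (auto simp: pw_def fun_eq_iff)
      then have eq: "exp_deg (pw 1 J) + (a + exp_deg (pw n J)) = a + exp_deg (pw (Suc n) J)"
        using exp_deg_add [of "pw 1 J" "pw n J"] by (simp add: algebra_simps)
      have "val_act (pw 1 J) (theta (a + exp_deg (pw n J)) (h J)) = theta (a + exp_deg (pw (Suc n) J)) (h J)"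
        unfolding val_act_theta [OF gs] eq using ok(1) cm by simp
      then have "b J (Suc n) = val_act (pw 1 J) (b J n)"
        using True by (simp add: b_def)
      moreover have "b J n \<in> GR.Gam 0 0 (a + exp_deg (pw n J))"
        using True val_space_0_iff by (auto simp: b_def GR.Gam_def)
      ultimately show ?case by blast
    qed
  qed
  moreover have "\<forall>\<^sub>F n in sequentially. c J n = GR.hdiff b J n" if J: "J \<subseteq> {0..<r}" "card J = i" for J
  proof -
    have hb: "\<forall>\<^sub>F n in sequentially. GR.hdiff b J n = theta (a + exp_deg (pw n J)) (cobd degree_complex (degree_inc a) h J)"
      by (intro hdiff_theta J(1)) (simp_all add: b_def)
    show ?thesis
    proof (cases "J \<in> degree_complex")
      case True
      show ?thesis using hb f [OF True J(2)] by eventually_elim (simp add: h [OF True J(2)])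
    next
      case False
      then have "\<not> degree_inc a (J - {j}) J" for j unfolding degree_inc_def degree_complex_def by blast
      then have z0: "cobd degree_complex (degree_inc a) h J = 0" by (intro cobd_eq_0) blast
      show ?thesis using hb z [OF J(1) False J(2)] by eventually_elim (simp add: z0)
    qed
  qed
  ultimately show "\<exists>b. (\<forall>J\<subseteq>{0..<r}. Suc (card J) = i \<longrightarrow> GR.germ 0 0 J (b J)) \<and>
      (\<forall>J\<subseteq>{0..<r}. card J = i \<longrightarrow> (\<forall>\<^sub>F n in sequentially. c J n = GR.hdiff b J n))"
    by blast
qed

end

end

section \<open>Local cohomology\<close>

context toric_resolution
begin

abbreviation max_ideal :: "(int ^ 'd \<Rightarrow>\<^sub>0 'k) set" where
  "max_ideal \<equiv> toric_max_ideal \<Sigma> M"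

lemma generator_power_in_ideal_pow:
  assumes j: "j < r"
  shows "X (int n *s v j) \<in> ideal_pow R max_ideal n"
proof (induction n)
  case 0
  show ?case using zero_support by simp
next
  case (Suc n)
  have "X (v j) \<in> max_ideal" using gen_support [OF j] gen_nonzero [OF j] by (simp add: toric_max_ideal_def)
  from ideal_prod.prod [OF this Suc, of R]
  have "toric_mult \<Sigma> M (X (v j)) (X (int n *s v j)) \<in> ideal_pow R max_ideal (Suc n)" by simp
  moreover have c: "compat (v j) (int n *s v j)" using gen_multiple_compat [OF j, of 1 n] by simp
  have "toric_mult \<Sigma> M (X (v j)) (X (int n *s v j)) = X (v j + int n *s v j)"
    using c by (simp add: toric_mult_single)
  moreover have "v j + int n *s v j = int (Suc n) *s v j" by (simp add: vec_eq_iff algebra_simps)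
  ultimately show ?case by (simp only:)
qed

lemma support_exponent:
  assumes "c \<in> support \<Sigma> M"
  obtains \<alpha> where "admissible \<alpha>" "c = exp_deg \<alpha>"
proof -
  obtain C where C: "C \<in> \<Sigma>" "c \<in> M C" using assms unfolding support_def by blast
  obtain \<alpha> :: "nat \<Rightarrow> nat" where "\<forall>j<r. \<alpha> j > 0 \<longrightarrow> v j \<in> M C" "c = (\<Sum>j<r. int (\<alpha> j) *s v j)"
    using gen_combination [OF C] by blast
  then show ?thesis using that [of \<alpha>] C(1) unfolding admissible_def supported_def exp_deg_def by blast
qed

lemma keys_ideal_pow:
  assumes "f \<in> ideal_pow R max_ideal n"
  shows "Poly_Mapping.keys f \<subseteq> {c. \<exists>\<alpha>. admissible \<alpha> \<and> n \<le> (\<Sum>j<r. \<alpha> j) \<and> c = exp_deg \<alpha>}"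
  using assms
proof (induction n arbitrary: f)
  case 0
  show ?case
  proof
    fix c assume "c \<in> Poly_Mapping.keys f"
    then have "c \<in> support \<Sigma> M" using 0 by auto
    then obtain \<alpha> where "admissible \<alpha>" "c = exp_deg \<alpha>" by (rule support_exponent)
    then show "c \<in> {c. \<exists>\<alpha>. admissible \<alpha> \<and> 0 \<le> (\<Sum>j<r. \<alpha> j) \<and> c = exp_deg \<alpha>}" by auto
  qed
next
  case (Suc n)
  have "f \<in> ideal_prod R max_ideal (ideal_pow R max_ideal n)" using Suc.prems by simp
  then show ?case
  proof (induction f rule: ideal_prod.induct)
    case (prod f h)
    show ?case
    proof
      fix c assume "c \<in> Poly_Mapping.keys (f \<otimes>\<^bsub>R\<^esub> h)"
      then have "c \<in> Poly_Mapping.keys (toric_mult \<Sigma> M f h)" by simp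
      then obtain a b where ab: "a \<in> Poly_Mapping.keys f" "b \<in> Poly_Mapping.keys h" "compat a b" "c = a + b"
        by (rule keys_toric_mult)
      have "a \<in> support \<Sigma> M" and a0: "a \<noteq> 0" using ab(1) prod(1) by (auto simp: toric_max_ideal_def)
      then obtain \<alpha> where \<alpha>: "admissible \<alpha>" "a = exp_deg \<alpha>" by (elim support_exponent)
      have "\<exists>j<r. 0 < \<alpha> j"
      proof (rule ccontr)
        assume "\<not> ?thesis"
        then have "a = 0" unfolding \<alpha>(2) exp_deg_def by simp
        then show False using a0 by simp
      qed
      then have pos: "0 < (\<Sum>j<r. \<alpha> j)" by (auto intro: sum_pos2)
      obtain \<beta> where \<beta>: "admissible \<beta>" "n \<le> (\<Sum>j<r. \<beta> j)" "b = exp_deg \<beta>"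
        using Suc.IH [OF prod(2)] ab(2) by auto
      have "Suc n \<le> (\<Sum>j<r. \<alpha> j) + (\<Sum>j<r. \<beta> j)" using pos \<beta>(2) by linarith
      then have "Suc n \<le> (\<Sum>j<r. \<alpha> j + \<beta> j)" by (simp only: sum.distrib)
      moreover have "admissible (\<lambda>j. \<alpha> j + \<beta> j)" using \<alpha> \<beta> ab(3) by (simp add: admissible_add_iff)
      ultimately show "c \<in> {c. \<exists>\<alpha>. admissible \<alpha> \<and> Suc n \<le> (\<Sum>j<r. \<alpha> j) \<and> c = exp_deg \<alpha>}"
        using \<alpha>(2) \<beta>(3) ab(4) by (intro CollectI exI [of _ "\<lambda>j. \<alpha> j + \<beta> j"]) (simp add: exp_deg_add)
    qed
  next
    case (sum f h)
    then show ?case using keys_add_subset by simp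
  qed
qed

text \<open>
  A high power of the maximal ideal is spanned by monomials with a high exponent at one of the finitely
  many generators (pigeonhole), so torsion can be tested on powers of the single generators.
\<close>

lemma torsion_iff:
  "x \<in> torsion R max_ideal (E q) \<longleftrightarrow>
    x \<in> carrier (E q) \<and> (\<forall>j<r. \<exists>n. X (int n *s v j) \<odot>\<^bsub>E q\<^esub> x = \<zero>\<^bsub>E q\<^esub>)"
proof
  assume "x \<in> torsion R max_ideal (E q)"
  then obtain n where x: "x \<in> carrier (E q)" "\<forall>s\<in>ideal_pow R max_ideal n. s \<odot>\<^bsub>E q\<^esub> x = \<zero>\<^bsub>E q\<^esub>"
    unfolding torsion_def by blast
  then show "x \<in> carrier (E q) \<and> (\<forall>j<r. \<exists>n. X (int n *s v j) \<odot>\<^bsub>E q\<^esub> x = \<zero>\<^bsub>E q\<^esub>)"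
    using generator_power_in_ideal_pow by blast
next
  assume asm: "x \<in> carrier (E q) \<and> (\<forall>j<r. \<exists>n. X (int n *s v j) \<odot>\<^bsub>E q\<^esub> x = \<zero>\<^bsub>E q\<^esub>)"
  then have x: "x \<in> carrier (E q)" by blast
  obtain m where m: "\<And>j. j < r \<Longrightarrow> X (int (m j) *s v j) \<odot>\<^bsub>E q\<^esub> x = \<zero>\<^bsub>E q\<^esub>"
    using asm by metis
  define p where "p = Max (insert 0 (m ` {..<r}))"
  have p: "X (int p *s v j) \<odot>\<^bsub>E q\<^esub> x = \<zero>\<^bsub>E q\<^esub>" if j: "j < r" for j
    using j by (intro power_annihilates_mono [OF j x m [OF j]]) (auto simp: p_def intro: Max_ge)
  interpret A: Module.module R "E q" by (rule E_module)
  have "s \<odot>\<^bsub>E q\<^esub> x = \<zero>\<^bsub>E q\<^esub>" if s: "s \<in> ideal_pow R max_ideal (r * p + 1)" for s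
  proof (rule poly_mapping_keys_induct [OF keys_ideal_pow [OF s]])
    show "0 \<odot>\<^bsub>E q\<^esub> x = \<zero>\<^bsub>E q\<^esub>" by (rule smult_zero [OF x])
  next
    fix c t assume "c \<in> {c. \<exists>\<alpha>. admissible \<alpha> \<and> r * p + 1 \<le> (\<Sum>j<r. \<alpha> j) \<and> c = exp_deg \<alpha>}"
    then obtain \<alpha> where \<alpha>: "admissible \<alpha>" "r * p + 1 \<le> (\<Sum>j<r. \<alpha> j)" "c = exp_deg \<alpha>" by blast
    \<comment> \<open>Pigeonhole: the sum of the exponents exceeds \<open>r p\<close>.\<close>
    have "\<exists>j<r. p \<le> \<alpha> j"
    proof (rule ccontr)
      assume "\<not> ?thesis"
      then have "(\<Sum>j<r. \<alpha> j) \<le> (\<Sum>j<r. p)" by (intro sum_mono) auto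
      then show False using \<alpha>(2) by simp
    qed
    then obtain j where j: "j < r" "p \<le> \<alpha> j" by blast
    define \<beta> where "\<beta> = (\<lambda>i. \<alpha> i - pw p {j} i)"
    have eq: "\<alpha> = (\<lambda>i. \<beta> i + pw p {j} i)" using j(2) by (auto simp: \<beta>_def pw_def fun_eq_iff)
    have "admissible (\<lambda>i. \<beta> i + pw p {j} i)" using \<alpha>(1) eq by simp
    then have \<beta>: "admissible \<beta>" "compat (exp_deg \<beta>) (int p *s v j)"
      using admissible_add_iff [of \<beta> "pw p {j}"] exp_deg_pw_single [OF j(1)] by auto
    have c: "c = exp_deg \<beta> + int p *s v j"
      unfolding \<alpha>(3) using exp_deg_add [of \<beta> "pw p {j}"] exp_deg_pw_single [OF j(1)] eq by simp
    have "Poly_Mapping.single c t \<odot>\<^bsub>E q\<^esub> x = Poly_Mapping.single (exp_deg \<beta>) t \<odot>\<^bsub>E q\<^esub> (X (int p *s v j) \<odot>\<^bsub>E q\<^esub> x)"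
      unfolding smult_single [OF exp_deg_support [OF \<beta>(1)] gen_multiple_support [OF j(1)] x] c using \<beta>(2) by simp
    also have "\<dots> = \<zero>\<^bsub>E q\<^esub>"
      unfolding p [OF j(1)] by (rule smult_r_zero [OF single_carrier [OF exp_deg_support [OF \<beta>(1)]]])
    finally show "Poly_Mapping.single c t \<odot>\<^bsub>E q\<^esub> x = \<zero>\<^bsub>E q\<^esub>" .
  next
    fix f h :: "int ^ 'd \<Rightarrow>\<^sub>0 'k"
    assume keys: "Poly_Mapping.keys f \<subseteq> {c. \<exists>\<alpha>. admissible \<alpha> \<and> r * p + 1 \<le> (\<Sum>j<r. \<alpha> j) \<and> c = exp_deg \<alpha>}"
        "Poly_Mapping.keys h \<subseteq> {c. \<exists>\<alpha>. admissible \<alpha> \<and> r * p + 1 \<le> (\<Sum>j<r. \<alpha> j) \<and> c = exp_deg \<alpha>}"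
      and 0: "f \<odot>\<^bsub>E q\<^esub> x = \<zero>\<^bsub>E q\<^esub>" "h \<odot>\<^bsub>E q\<^esub> x = \<zero>\<^bsub>E q\<^esub>"
    have "f \<in> carrier R" "h \<in> carrier R"
      using keys exp_deg_support by auto
    from A.smult_l_distr [OF this x] show "(f + h) \<odot>\<^bsub>E q\<^esub> x = \<zero>\<^bsub>E q\<^esub>" by (simp add: 0)
  qed
  then show "x \<in> torsion R max_ideal (E q)" using x unfolding torsion_def by blast
qed

lemma torsion_subgroup: "subgroup (torsion R max_ideal (E q)) (add_monoid (E q))"
proof -
  interpret A: Module.module R "E q" by (rule E_module)
  have s: "X (int n *s v j) \<in> carrier R" if "j < r" for n j
    by (rule single_carrier [OF gen_multiple_support [OF that]])
  show ?thesis
  proof (rule A.add.subgroupI)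
    show "torsion R max_ideal (E q) \<subseteq> carrier (E q)" by (auto simp: torsion_def)
    have "\<zero>\<^bsub>E q\<^esub> \<in> torsion R max_ideal (E q)"
      unfolding torsion_iff using smult_r_zero [OF s] A.M.zero_closed by blast
    then show "torsion R max_ideal (E q) \<noteq> {}" by blast
  next
    fix x assume x: "x \<in> torsion R max_ideal (E q)"
    then have xc: "x \<in> carrier (E q)" by (auto simp: torsion_def)
    have "\<exists>n. X (int n *s v j) \<odot>\<^bsub>E q\<^esub> (\<ominus>\<^bsub>E q\<^esub> x) = \<zero>\<^bsub>E q\<^esub>" if j: "j < r" for j
    proof -
      obtain n where "X (int n *s v j) \<odot>\<^bsub>E q\<^esub> x = \<zero>\<^bsub>E q\<^esub>" using x j unfolding torsion_iff by blast
      then show ?thesis using A.smult_r_minus [OF s [OF j] xc, of n] by (intro exI [of _ n]) simp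
    qed
    then show "\<ominus>\<^bsub>E q\<^esub> x \<in> torsion R max_ideal (E q)" using xc unfolding torsion_iff by blast
    fix y assume y: "y \<in> torsion R max_ideal (E q)"
    then have yc: "y \<in> carrier (E q)" by (auto simp: torsion_def)
    have "\<exists>n. X (int n *s v j) \<odot>\<^bsub>E q\<^esub> (x \<oplus>\<^bsub>E q\<^esub> y) = \<zero>\<^bsub>E q\<^esub>" if j: "j < r" for j
    proof -
      obtain n m where "X (int n *s v j) \<odot>\<^bsub>E q\<^esub> x = \<zero>\<^bsub>E q\<^esub>" "X (int m *s v j) \<odot>\<^bsub>E q\<^esub> y = \<zero>\<^bsub>E q\<^esub>"
        using x y j unfolding torsion_iff by blast
      then have "X (int (max n m) *s v j) \<odot>\<^bsub>E q\<^esub> x = \<zero>\<^bsub>E q\<^esub>" "X (int (max n m) *s v j) \<odot>\<^bsub>E q\<^esub> y = \<zero>\<^bsub>E q\<^esub>"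
        using power_annihilates_mono [OF j xc, of n "max n m"] power_annihilates_mono [OF j yc, of m "max n m"]
        by auto
      then show ?thesis
        using A.smult_r_distr [OF s [OF j] xc yc, of "max n m"] by (intro exI [of _ "max n m"]) simp
    qed
    then show "x \<oplus>\<^bsub>E q\<^esub> y \<in> torsion R max_ideal (E q)" using xc yc unfolding torsion_iff by blast
  qed
qed

lemma coboundaries_subgroup: "subgroup (coboundaries R max_ideal E \<delta> i) (add_monoid (E i))"
proof (cases i)
  case 0
  interpret A: abelian_group "E 0" by (rule E_group)
  show ?thesis using A.add.triv_subgroup 0 by (simp add: coboundaries_def)
next
  case (Suc q)
  interpret A: abelian_group "E q" by (rule E_group)
  interpret B: abelian_group "E (Suc q)" by (rule E_group)
  interpret group_hom "add_monoid (E q)" "add_monoid (E (Suc q))" "\<delta> q"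
    by unfold_locales (simp add: hom_def delta_closed delta_add)
  show ?thesis using subgroup_img_is_subgroup [OF torsion_subgroup] Suc by (simp add: coboundaries_def)
qed

lemma delta_zero: "\<delta> q \<zero>\<^bsub>E q\<^esub> = \<zero>\<^bsub>E (Suc q)\<^esub>"
  by (rule additive_map_zero [OF E_group E_group]) (simp_all add: delta_closed delta_add)

lemma cocycle_is_coboundary:
  assumes van: "\<And>D. D \<in> \<Sigma> \<Longrightarrow> dim D \<le> i \<Longrightarrow> a \<notin> uminus ` normalization (M D)"
    and z: "z \<in> cocycles R max_ideal E \<delta> i" "z \<in> grade (E i) a"
  shows "z \<in> coboundaries R max_ideal E \<delta> i"
proof -
  interpret GR: germ_resolution r exp_deg val_act val_diff val_space a by (rule germ_resolution)
  have Gam_iff: "evals (Suc q) x \<in> GR.Gam r (Suc q) a \<longleftrightarrow> x \<in> torsion R max_ideal (E q)"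
    if x: "x \<in> grade (E q) a" for x q
  proof -
    have xc: "x \<in> carrier (E q)" by (rule grade_carrier [OF x])
    have "evals (Suc q) x \<in> val_space (Suc q) a" using x by (simp add: val_space_def aug_grade_def)
    then show ?thesis
      unfolding GR.Gam_def torsion_iff using xc val_act_pw_evals_eq_0 [OF xc] by auto
  qed
  have zc: "z \<in> carrier (E i)" by (rule grade_carrier [OF z(2)])
  have zG: "evals (Suc i) z \<in> GR.Gam r (Suc i) a"
    unfolding Gam_iff [OF z(2)] using z(1) by (simp add: cocycles_def)
  have z0: "val_diff (evals (Suc i) z) = 0"
    unfolding val_diff_evals using z(1) evals_zero [of "Suc (Suc i)"] by (simp add: cocycles_def)
  have *: "if i = 0 then evals (Suc i) z = 0 else \<exists>y\<in>GR.Gam r i a. val_diff y = evals (Suc i) z"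
    by (rule GR.torsion_cohomology_vanishes [OF cech_exact [OF van] zG z0])
  show ?thesis
  proof (cases i)
    case 0
    then have "evals 1 z = 0" using * by simp
    then have "z = \<zero>\<^bsub>E 0\<^esub>" using evals_eq_0 [of z 1] zc 0 by simp
    then show ?thesis using 0 by (simp add: coboundaries_def)
  next
    case (Suc q)
    then obtain y where y: "y \<in> GR.Gam r (Suc q) a" "val_diff y = evals (Suc (Suc q)) z" using * by auto
    obtain w where w: "w \<in> grade (E q) a" "y = evals (Suc q) w"
      using GR.Gam_F [OF y(1)] by (auto simp: val_space_def aug_grade_def)
    have wc: "w \<in> carrier (E q)" by (rule grade_carrier [OF w(1)])
    have "evals (Suc (Suc q)) (\<delta> q w) = evals (Suc (Suc q)) z"
      using y(2) unfolding w(2) val_diff_evals by simp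
    then have "\<delta> q w = z"
      using evals_eq_iff [of "\<delta> q w" "Suc (Suc q)" z] delta_closed [OF wc] zc Suc by simp
    moreover have "w \<in> torsion R max_ideal (E q)" using y(1) Gam_iff [OF w(1)] w(2) by simp
    ultimately show ?thesis using Suc by (auto simp: coboundaries_def)
  qed
qed

lemma local_cohomology_degree_vanishes:
  assumes van: "\<And>D. D \<in> \<Sigma> \<Longrightarrow> dim D \<le> i \<Longrightarrow> a \<notin> uminus ` normalization (M D)"
  shows "local_cohomology_vanishes R max_ideal E \<delta> i a"
proof -
  interpret A: abelian_group "E i" by (rule E_group)
  have coset: "coboundaries R max_ideal E \<delta> i +>\<^bsub>E i\<^esub> z = coboundaries R max_ideal E \<delta> i"
    if "z \<in> cocycles R max_ideal E \<delta> i \<inter> grade (E i) a" for z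
    using that cocycle_is_coboundary [OF van] grade_carrier
    by (intro A.a_coset_join2 coboundaries_subgroup) auto
  have "\<zero>\<^bsub>E i\<^esub> \<in> torsion R max_ideal (E i)"
    using subgroup.one_closed [OF torsion_subgroup [of i]] by simp
  then have "\<zero>\<^bsub>E i\<^esub> \<in> cocycles R max_ideal E \<delta> i \<inter> grade (E i) a"
    using delta_zero graded_moduleD(5) [OF E_graded] by (simp add: cocycles_def)
  then have "local_cohomology_component R max_ideal E \<delta> i a = {coboundaries R max_ideal E \<delta> i}"
    using coset unfolding local_cohomology_component_def by force
  then show ?thesis by (simp add: local_cohomology_vanishes_def local_cohomology_def FactGroup_def)
qed

end

theorem theorem4p3:
  fixes \<Sigma> :: "(real ^ 'd) set set"
    and M :: "(real ^ 'd) set \<Rightarrow> (int ^ 'd) set"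
    and R :: "(int ^ 'd \<Rightarrow>\<^sub>0 'k::field) ring"
    and \<mm> :: "(int ^ 'd \<Rightarrow>\<^sub>0 'k) set"
    and E :: "nat \<Rightarrow> (int ^ 'd \<Rightarrow>\<^sub>0 'k, 'e, int ^ 'd) graded_module"
    and \<epsilon> :: "(int ^ 'd \<Rightarrow>\<^sub>0 'k) \<Rightarrow> 'e"
    and \<delta> :: "nat \<Rightarrow> 'e \<Rightarrow> 'e"
    and i :: nat
    and a :: "int ^ 'd"
  assumes "rational_pointed_fan \<Sigma>"
    and "monoidal_complex \<Sigma> M"
    and "seminormal_complex \<Sigma> M"
    and "R = toric_face_ring \<Sigma> M"
    and "\<mm> = toric_max_ideal \<Sigma> M"
    and "graded_injective_resolution R (toric_grade \<Sigma> M) (toric_self_module \<Sigma> M) E \<epsilon> \<delta>"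
  shows "(\<not> local_cohomology_vanishes R \<mm> E \<delta> i a \<longrightarrow>
            (\<exists>C\<in>\<Sigma>. dim C \<le> i \<and> a \<in> uminus ` normalization (M C))) \<and>
         (a \<notin> uminus ` support \<Sigma> (normalization_complex M) \<longrightarrow>
            local_cohomology_vanishes R \<mm> E \<delta> i a)"
proof -
  interpret seminormal_toric \<Sigma> M
    using assms(1-3) by unfold_locales
  obtain r v where rv: "toric_generators_axioms \<Sigma> M r v"
  proof (rule generators_exist)
    fix r :: nat and v :: "nat \<Rightarrow> int ^ 'd"
    assume "\<And>j. j < r \<Longrightarrow> v j \<in> support \<Sigma> M" "\<And>j. j < r \<Longrightarrow> v j \<noteq> 0"
      "\<And>C c. C \<in> \<Sigma> \<Longrightarrow> c \<in> M C \<Longrightarrow>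
         \<exists>\<alpha>::nat \<Rightarrow> nat. (\<forall>j<r. \<alpha> j > 0 \<longrightarrow> v j \<in> M C) \<and> c = (\<Sum>j<r. int (\<alpha> j) *s v j)"
    then have "toric_generators_axioms \<Sigma> M r v" by unfold_locales
    then show ?thesis by (rule that)
  qed
  interpret toric_generators \<Sigma> M r v
    by (intro toric_generators.intro rv) unfold_locales
  interpret toric_resolution \<Sigma> M r v E \<epsilon> \<delta>
    using assms(4,6) by unfold_locales simp
  have van: "local_cohomology_vanishes R \<mm> E \<delta> i a"
    if "\<And>C. C \<in> \<Sigma> \<Longrightarrow> dim C \<le> i \<Longrightarrow> a \<notin> uminus ` normalization (M C)"
    unfolding assms(4,5) using that by (rule local_cohomology_degree_vanishes)
  have sup: "support \<Sigma> (normalization_complex M) = (\<Union>C\<in>\<Sigma>. normalization (M C))"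
    by (simp add: support_def normalization_complex_def)
  have "local_cohomology_vanishes R \<mm> E \<delta> i a"
    if "a \<notin> uminus ` support \<Sigma> (normalization_complex M)"
  proof (rule van)
    fix C assume "C \<in> \<Sigma>" "dim C \<le> i"
    then show "a \<notin> uminus ` normalization (M C)" using that unfolding sup by blast
  qed
  then show ?thesis using van by blast
qed

end
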